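(* The optimal horoball packing density for noncompact Coxeter simplex tilings in $\overline{\mathbb{H}}^3$ (that is, the largest value of $\delta_{opt}(\Gamma)$ among the $23$ noncompact Coxeter simplex groups $\Gamma$) is $$d_3(\infty)=\frac{\sqrt{3}}{2}\,G^{-1}=\frac{2}{3}\,L(2,\chi_{-3})^{-1},$$ and it is realized in the tilings by eight simplex groups in the commensurability class of $[3,3,6]$.
   Context: $\mathbb{H}^3$ is hyperbolic $3$-space of curvature $-1$ and $\overline{\mathbb{H}}^3=\mathbb{H}^3\cup\partial\mathbb{H}^3$. $\Lambda(\theta)=-\int_0^\theta\ln|2\sin t|\,dt$ is the Lobachevsky function; $d_3(\infty)=\left(2\sqrt3\,\Lambda(\pi/3)\right)^{-1}$ is the simplicial horoball density; $G=3\Lambda(\pi/3)$ is Gieseking's constant; $L(s,\chi_{-3})$ is the Dirichlet $L$-function of the nontrivial character mod $3$. A Coxeter simplex in $\overline{\mathbb{H}}^3$ is a finite-volume tetrahedron, possibly with ideal vertices (on $\partial\mathbb{H}^3$), whose dihedral angles are integer submultiples of $\pi$; it is noncompact if it has at least one ideal vertex. It is determined up to isometry by its Coxeter diagram: one node per facet; facets orthogonal if nodes are not joined, dihedral angle $\pi/k$ if joined by an edge labeled $k\ge 3$. $\Gamma$ is the group generated by reflections in the facets, $\mathcal{F}_\Gamma$ the simplex, and $\mathcal{T}_\Gamma$ the tiling by images of $\mathcal{F}_\Gamma$ under $\Gamma$. The $23$ noncompact Coxeter simplex groups have these four-node diagrams: Commensurability class of $[3,3,6]$ (11 groups): paths with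 consecutive labels $(3,3,6)$ [$\overline V_3$], $(3,6,3)$ [$\overline Y_3$], $(6,3,6)$ [$\overline Z_3$], $(4,3,6)$ [$\overline{BV}_3$]; a triangle with all labels $3$ plus a node joined to one triangle node by an edge labeled $3$ [$\overline P_3$], $4$ [$\overline{BP}_3$] or $6$ [$\overline{VP}_3$]; complete graph with all labels $3$ [$\widehat{PP}_3$]; star with labels $6,3,3$ [$\overline{DV}_3$]; complete graph minus one edge with all labels $3$ [$\overline{DP}_3$]; $4$-cycle with labels $3,6,3,6$ [$\widehat{VV}_3$]. Commensurability class of $[3,4,4]$ (6 groups): path $(3,4,4)$ [$\overline R_3$]; star $3,4,4$ [$\overline O_3$]; $4$-cycle $3,3,4,4$ [$\widehat{BR}_3$]; path $(4,4,4)$ [$\overline N_3$]; star $4,4,4$ [$\overline M_3$]; $4$-cycle $4,4,4,4$ [$\widehat{RR}_3$]. Nonarithmetic (6 groups): path $(5,3,6)$ [$\overline{HV}_3$]; triangle with all labels $3$ plus a node joined to one triangle node by an edge labeled $5$ [$\overline{HP}_3$]; $4$-cycles $3,3,3,6$ [$\widehat{AV}_3$], $3,4,3,6$ [$\widehat{BV}_3$], $3,5,3,6$ [$\widehat{HV}_3$], $3,4,4,4$ [$\widehat{CR}_3$]. Horoball packing associated to $\mathcal{T}_\Gamma$: let $v_1,\dots,v_m$ be the ideal vertices of $\mathcal{F}_\Gamma$. It is a $\Gamma$-invariant collection $\mathcal{B}$ of horoballs which restricts on $\mathcal{F}_\Gamma$ to a set $\{B_1,\dots,B_m\}$ such that (1)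 $B_i$ is centered at $v_i$; (2) horoballs have pairwise disjoint interiors; (3) each $B_i$ is contained in the half-space (containing $\mathcal{F}_\Gamma$) bounded by the plane of the facet of $\mathcal{F}_\Gamma$ opposite $v_i$. The sizes of horoballs at different ideal vertices may be chosen differently. Its density is $$\delta(\mathcal{B})=\frac{\sum_{i=1}^m \mathrm{vol}_{\mathbb{H}^3}(B_i\cap\mathcal{F}_\Gamma)}{\mathrm{vol}_{\mathbb{H}^3}(\mathcal{F}_\Gamma)},$$ and $\delta_{opt}(\Gamma)$ is the supremum of $\delta(\mathcal{B})$ over all such packings. "Realized" by $\Gamma$ means $\delta_{opt}(\Gamma)=d_3(\infty)$.
   Formalization: The count "eight" is stated as: at least eight groups realize the density, and all groups realizing it lie in the class of [3,3,6]; exactly eight would be false, since with the given definitions nine of the eleven groups of that class realize it. *)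

theory Defs
  imports "HOL-Analysis.Analysis"
begin

section \<open>Special functions and constants\<close>

definition lobachevsky :: "real \<Rightarrow> real" where
  "lobachevsky \<theta> = - (LBINT t=ereal 0..ereal \<theta>. ln \<bar>2 * sin t\<bar>)"

definition simplicial_density3 :: real where
  "simplicial_density3 = inverse (2 * sqrt 3 * lobachevsky (pi / 3))"

definition gieseking :: real where
  "gieseking = 3 * lobachevsky (pi / 3)"

definition chi_minus3 :: "nat \<Rightarrow> real" where
  "chi_minus3 n = (if n mod 3 = 1 then 1 else if n mod 3 = 2 then - 1 else 0)"

text \<open>The Dirichlet series; for a bounded character it is only used where it converges
  absolutely (\<open>s > 1\<close>).\<close>

definition dirichlet_L :: "(nat \<Rightarrow> real) \<Rightarrow> real \<Rightarrow> real" where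
  "dirichlet_L c s = (\<Sum>n. c (Suc n) / real (Suc n) powr s)"


section \<open>Hyperbolic 3-space: the hyperboloid model\<close>

text \<open>Minkowski space of signature (3,1), with the time coordinate first.\<close>

type_synonym minkowski = "real \<times> (real ^ 3)"

definition lorentz :: "minkowski \<Rightarrow> minkowski \<Rightarrow> real" where
  "lorentz x y = snd x \<bullet> snd y - fst x * fst y"

definition hyp3 :: "minkowski set" where
  "hyp3 = {x. lorentz x x = - 1 \<and> fst x > 0}"

text \<open>The Riemannian volume of the hyperboloid, written in the chart
  \<open>y \<mapsto> (sqrt (1 + |y|\<^sup>2), y)\<close>, where its density is \<open>1 / sqrt (1 + |y|\<^sup>2)\<close>.\<close>

definition hyp_vol :: "minkowski set \<Rightarrow> real" where
  "hyp_vol A =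
     measure (density lborel (\<lambda>y :: real ^ 3. ennreal (1 / sqrt (1 + (norm y)\<^sup>2))))
       {y. (sqrt (1 + (norm y)\<^sup>2), y) \<in> A}"

definition hyp_interior :: "minkowski set \<Rightarrow> minkowski set" where
  "hyp_interior A = top_of_set hyp3 interior_of A"

text \<open>For a spacelike vector \<open>u\<close>: the half-space with outward normal \<open>u\<close>, and the reflection
  (for \<open>lorentz u u = 1\<close>) in its bounding plane.\<close>

definition half_space :: "minkowski \<Rightarrow> minkowski set" where
  "half_space u = {x \<in> hyp3. lorentz x u \<le> 0}"

definition hyp_reflection :: "minkowski \<Rightarrow> minkowski \<Rightarrow> minkowski" where
  "hyp_reflection u x = x - (2 * lorentz x u) *\<^sub>R u"

text \<open>A point of the boundary at infinity is a ray of future null vectors. The horoballs centered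
  at the point represented by \<open>l\<close> are exactly the sets \<open>horoball (c *\<^sub>R l)\<close> with \<open>c > 0\<close>.\<close>

definition future_null :: "minkowski set" where
  "future_null = {l. lorentz l l = 0 \<and> fst l > 0}"

definition horoball :: "minkowski \<Rightarrow> minkowski set" where
  "horoball l = {x \<in> hyp3. lorentz x l \<ge> - 1}"


section \<open>Coxeter simplices\<close>

text \<open>A diagram on the nodes \<open>0, 1, 2, 3\<close> is the list of its edges \<open>(i, j, k)\<close> with labels
  \<open>k \<ge> 3\<close>.\<close>

type_synonym diagram = "(nat \<times> nat \<times> nat) list"

definition coxeter_matrix :: "diagram \<Rightarrow> nat \<Rightarrow> nat \<Rightarrow> nat" where
  "coxeter_matrix D i j =
     (if i = j then 1
      else case find (\<lambda>(a, b, k). {a, b} = {i, j}) D of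
             Some (a, b, k) \<Rightarrow> k
           | None \<Rightarrow> 2)"

text \<open>A simplex is given by the outward unit normals \<open>e 0, ..., e 3\<close> of its facets.\<close>

definition hyp_simplex :: "(nat \<Rightarrow> minkowski) \<Rightarrow> minkowski set" where
  "hyp_simplex e = (\<Inter>i<4. half_space (e i))"

text \<open>\<open>w\<close> represents, up to positive scaling, the vertex opposite to facet \<open>i\<close>: a point of
  hyperbolic space if \<open>w\<close> is timelike, an ideal point if \<open>w\<close> is null.\<close>

definition represents_vertex :: "(nat \<Rightarrow> minkowski) \<Rightarrow> nat \<Rightarrow> minkowski \<Rightarrow> bool" where
  "represents_vertex e i w \<longleftrightarrow>
     lorentz w w \<le> 0 \<and> fst w > 0 \<and>
     lorentz w (e i) < 0 \<and> (\<forall>j<4. j \<noteq> i \<longrightarrow> lorentz w (e j) = 0)"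

text \<open>Outward unit normals of facets meeting at the dihedral angle \<open>\<theta>\<close> have product
  \<open>- cos \<theta>\<close>; the diagonal entry \<open>1\<close> of the Coxeter matrix makes the normals unit vectors.
  The second clause says that the four facets bound a tetrahedron, all of whose vertices lie in
  hyperbolic space or on its boundary.\<close>

definition coxeter_simplex :: "diagram \<Rightarrow> (nat \<Rightarrow> minkowski) \<Rightarrow> bool" where
  "coxeter_simplex D e \<longleftrightarrow>
     (\<forall>i<4. \<forall>j<4. lorentz (e i) (e j) = - cos (pi / real (coxeter_matrix D i j))) \<and>
     (\<forall>i<4. \<exists>w. represents_vertex e i w)"

definition ideal_vertices :: "(nat \<Rightarrow> minkowski) \<Rightarrow> nat set" where
  "ideal_vertices e = {i. i < 4 \<and> (\<exists>w \<in> future_null. represents_vertex e i w)}"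

inductive_set reflection_group :: "(nat \<Rightarrow> minkowski) \<Rightarrow> (minkowski \<Rightarrow> minkowski) set"
  for e :: "nat \<Rightarrow> minkowski" where
  one: "id \<in> reflection_group e"
| step: "i < 4 \<Longrightarrow> g \<in> reflection_group e \<Longrightarrow> hyp_reflection (e i) \<circ> g \<in> reflection_group e"


section \<open>Horoball packings\<close>

text \<open>\<open>B\<close> is the invariant collection of horoballs; its members whose interiors meet the
  simplex are the \<open>b i\<close>, one for each ideal vertex, with independently chosen sizes.\<close>

definition horoball_packing ::
  "(nat \<Rightarrow> minkowski) \<Rightarrow> minkowski set set \<Rightarrow> (nat \<Rightarrow> minkowski set) \<Rightarrow> bool" where
  "horoball_packing e B b \<longleftrightarrow>
     B \<subseteq> horoball ` future_null \<and>
     (\<forall>g \<in> reflection_group e. \<forall>H \<in> B. g ` H \<in> B) \<and>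
     {H \<in> B. hyp_interior H \<inter> hyp_simplex e \<noteq> {}} = b ` ideal_vertices e \<and>
     (\<forall>i \<in> ideal_vertices e. \<exists>l \<in> future_null. represents_vertex e i l \<and> b i = horoball l) \<and>
     pairwise (\<lambda>H K. disjnt (hyp_interior H) (hyp_interior K)) B \<and>
     (\<forall>i \<in> ideal_vertices e. b i \<subseteq> half_space (e i))"

definition packing_density :: "(nat \<Rightarrow> minkowski) \<Rightarrow> (nat \<Rightarrow> minkowski set) \<Rightarrow> real" where
  "packing_density e b =
     (\<Sum>i \<in> ideal_vertices e. hyp_vol (b i \<inter> hyp_simplex e)) / hyp_vol (hyp_simplex e)"

definition delta_opt :: "(nat \<Rightarrow> minkowski) \<Rightarrow> real" where
  "delta_opt e = Sup {packing_density e b | B b. horoball_packing e B b}"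


section \<open>The noncompact Coxeter simplex groups\<close>

datatype simplex_group =
    V_bar | Y_bar | Z_bar | BV_bar | P_bar | BP_bar | VP_bar | PP_hat | DV_bar | DP_bar | VV_hat
  | R_bar | O_bar | BR_hat | N_bar | M_bar | RR_hat
  | HV_bar | HP_bar | AV_hat | BV_hat | HV_hat | CR_hat

definition path_diagram :: "nat \<Rightarrow> nat \<Rightarrow> nat \<Rightarrow> diagram" where
  "path_diagram p q r = [(0, 1, p), (1, 2, q), (2, 3, r)]"

definition star_diagram :: "nat \<Rightarrow> nat \<Rightarrow> nat \<Rightarrow> diagram" where
  "star_diagram p q r = [(0, 1, p), (0, 2, q), (0, 3, r)]"

definition cycle_diagram :: "nat \<Rightarrow> nat \<Rightarrow> nat \<Rightarrow> nat \<Rightarrow> diagram" where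
  "cycle_diagram p q r s = [(0, 1, p), (1, 2, q), (2, 3, r), (3, 0, s)]"

definition tailed_triangle_diagram :: "nat \<Rightarrow> diagram" where
  "tailed_triangle_diagram p = [(0, 1, 3), (1, 2, 3), (2, 0, 3), (0, 3, p)]"

fun diagram :: "simplex_group \<Rightarrow> diagram" where
  "diagram V_bar = path_diagram 3 3 6"
| "diagram Y_bar = path_diagram 3 6 3"
| "diagram Z_bar = path_diagram 6 3 6"
| "diagram BV_bar = path_diagram 4 3 6"
| "diagram P_bar = tailed_triangle_diagram 3"
| "diagram BP_bar = tailed_triangle_diagram 4"
| "diagram VP_bar = tailed_triangle_diagram 6"
| "diagram PP_hat = [(0, 1, 3), (0, 2, 3), (0, 3, 3), (1, 2, 3), (1, 3, 3), (2, 3, 3)]"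
| "diagram DV_bar = star_diagram 6 3 3"
| "diagram DP_bar = [(0, 1, 3), (0, 2, 3), (0, 3, 3), (1, 2, 3), (1, 3, 3)]"
| "diagram VV_hat = cycle_diagram 3 6 3 6"
| "diagram R_bar = path_diagram 3 4 4"
| "diagram O_bar = star_diagram 3 4 4"
| "diagram BR_hat = cycle_diagram 3 3 4 4"
| "diagram N_bar = path_diagram 4 4 4"
| "diagram M_bar = star_diagram 4 4 4"
| "diagram RR_hat = cycle_diagram 4 4 4 4"
| "diagram HV_bar = path_diagram 5 3 6"
| "diagram HP_bar = tailed_triangle_diagram 5"
| "diagram AV_hat = cycle_diagram 3 3 3 6"
| "diagram BV_hat = cycle_diagram 3 4 3 6"
| "diagram HV_hat = cycle_diagram 3 5 3 6"
| "diagram CR_hat = cycle_diagram 3 4 4 4"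

text \<open>The groups of the list that are commensurable with \<open>[3,3,6]\<close>.\<close>

definition commensurability_class_336 :: "simplex_group set" where
  "commensurability_class_336 =
     {V_bar, Y_bar, Z_bar, BV_bar, P_bar, BP_bar, VP_bar, PP_hat, DV_bar, DP_bar, VV_hat}"

end

theory Submission
  imports Defs "HOL-Real_Asymp.Real_Asymp"
begin

text \<open>A horoball is a future null vector, so a packing is a choice of scales \<open>r i \<ge> 1\<close> of the null vectors
  \<open>v i\<close> of the ideal vertices, normalized by \<open>lorentz (v i) (e i) = - 1\<close>: condition (3) is \<open>r i \<ge> 1\<close>, and
  disjointness of the horoballs at vertices \<open>i, j\<close> is \<open>r i * r j * \<kappa> \<ge> 2\<close> with \<open>\<kappa> = - lorentz (v i) (v j)\<close>.
  Conversely these finitely many inequalities suffice for the whole orbit, because by Tits' theorem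
  the image of a normal under a group element is a nonnegative or a nonpositive combination of the
  normals. With \<open>s i = 1 / (r i)\<^sup>2\<close> the covered volume is linear in \<open>s\<close>, and the constraints are
  \<open>s i \<le> 1\<close> and \<open>s i * s j \<le> \<kappa>\<^sup>2 / 4\<close>, so the optimum is an elementary computation.

  The volume of the simplex is computed in upper half-space coordinates at an ideal vertex, as an
  integral over a Euclidean triangle that splits into six right triangles, expressed by the
  Lobachevsky function or estimated by the first terms of a power series. In nine groups the volume is
  a rational multiple \<open>x\<close> of \<open>lobachevsky (pi / 3)\<close> and the covered volume is \<open>x * sqrt 3 / 6\<close>; in the
  others the rational estimates suffice for strict inequality.\<close>

section \<open>Lorentz transformations and Lebesgue measure\<close>

text \<open>\<open>hyp_vol\<close> is defined in one chart, while every computation wants upper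
  half-space coordinates at an ideal vertex. No change of variables is made on the hyperboloid
  itself: the hyperbolic volume of \<open>A\<close> is four times the Lebesgue volume of the solid
  cone over \<open>A\<close>, cut off at the hyperboloid. On cones, isometries are linear maps of
  determinant 1 or -1, and half-space coordinates are a linear frame followed by Fubini.

  The half-space picture is normalized so that the facet opposite the ideal vertex is the unit
  hemisphere. The distances of its centre from the three vertical facets and the angles between
  these facets can then be read off the Gram matrix, so that each group becomes a list of polynomial
  identities and inequalities in sqrt 2, sqrt 3 and cos (pi / 5).

  Equality of densities cannot come from estimates. The Fourier series of the Lobachevsky function
  is developed because it relates the values at pi / 6, pi / 3 and 2 pi / 3, and because at pi / 3
  it is the L-series up to a factor.\<close>

lemma lborel_distr_linear_basis:
  fixes f :: "'a::euclidean_space \<Rightarrow> 'b::euclidean_space"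
  assumes f: "linear f" and bij: "bij_betw f Basis Basis"
  shows "distr lborel borel f = lborel"
proof (rule lborel_eqI[symmetric])
  have meas: "f \<in> borel_measurable borel"
    using f by (simp add: borel_measurable_continuous_onI linear_continuous_on linear_conv_bounded_linear)
  have inner_f: "f x \<bullet> f b = x \<bullet> b" if "b \<in> Basis" for x b
  proof -
    have inj: "inj_on f Basis"
      using bij by (auto simp: bij_betw_def)
    have fB: "f a \<in> Basis" if "a \<in> Basis" for a using that bij by (auto simp: bij_betw_def)
    have "f x = (\<Sum>a\<in>Basis. (x \<bullet> a) *\<^sub>R f a)"
    proof -
      have "f (\<Sum>a\<in>Basis. (x \<bullet> a) *\<^sub>R a) = (\<Sum>a\<in>Basis. (x \<bullet> a) *\<^sub>R f a)"
        by (simp add: linear_sum[OF f] linear_scale[OF f])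
      then show ?thesis by (simp add: euclidean_representation)
    qed
    then have "f x \<bullet> f b = (\<Sum>a\<in>Basis. (x \<bullet> a) * (f a \<bullet> f b))"
      by (simp add: inner_sum_left)
    also have "\<dots> = (\<Sum>a\<in>Basis. if a = b then x \<bullet> a else 0)"
      using that fB by (intro sum.cong) (auto simp: inner_Basis inj_on_eq_iff[OF inj])
    finally show ?thesis using that by simp
  qed
  fix l u :: 'b assume lu: "\<And>b. b \<in> Basis \<Longrightarrow> l \<bullet> b \<le> u \<bullet> b"
  define l' where "l' = (\<Sum>a\<in>Basis. (l \<bullet> f a) *\<^sub>R a)"
  define u' where "u' = (\<Sum>a\<in>Basis. (u \<bullet> f a) *\<^sub>R a)"
  have l': "l' \<bullet> a = l \<bullet> f a" and u': "u' \<bullet> a = u \<bullet> f a" if "a \<in> Basis" for a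
    using that by (simp_all add: l'_def u'_def)
  have fB: "f a \<in> Basis" if "a \<in> Basis" for a using that bij by (auto simp: bij_betw_def)
  have "f -` box l u = box l' u'"
  proof -
    have "(\<forall>i\<in>Basis. l \<bullet> i < f x \<bullet> i \<and> f x \<bullet> i < u \<bullet> i) \<longleftrightarrow>
          (\<forall>i\<in>Basis. l' \<bullet> i < x \<bullet> i \<and> x \<bullet> i < u' \<bullet> i)" for x
    proof -
      have "(\<forall>i\<in>Basis. l \<bullet> i < f x \<bullet> i \<and> f x \<bullet> i < u \<bullet> i) \<longleftrightarrow>
          (\<forall>i\<in>f ` Basis. l \<bullet> i < f x \<bullet> i \<and> f x \<bullet> i < u \<bullet> i)"
        using bij by (simp add: bij_betw_def)
      also have "\<dots> \<longleftrightarrow> (\<forall>i\<in>Basis. l' \<bullet> i < x \<bullet> i \<and> x \<bullet> i < u' \<bullet> i)"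
        by (simp add: l' u' inner_f)
      finally show ?thesis .
    qed
    then show ?thesis by (auto simp: box_def)
  qed
  then have "emeasure (distr lborel borel f) (box l u) = emeasure lborel (box l' u')"
    using meas by (simp add: emeasure_distr)
  also have "\<dots> = ennreal (\<Prod>b\<in>Basis. (u' - l') \<bullet> b)"
    using lu fB by (intro emeasure_lborel_box) (simp add: l' u')
  also have "(\<Prod>b\<in>Basis. (u' - l') \<bullet> b) = (\<Prod>b\<in>Basis. (u - l) \<bullet> f b)"
    by (intro prod.cong) (auto simp: l' u' inner_diff_left)
  also have "\<dots> = prod ((\<bullet>) (u - l)) Basis"
    by (rule prod.reindex_bij_betw[OF bij])
  finally show "emeasure (distr lborel borel f) (box l u) = ennreal (prod ((\<bullet>) (u - l)) Basis)" .
qed simp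

lemma linear_measurable:
  fixes f :: "'a::euclidean_space \<Rightarrow> 'b::euclidean_space"
  assumes "linear f" shows "f \<in> borel_measurable borel"
  using assms by (simp add: borel_measurable_continuous_onI linear_continuous_on linear_conv_bounded_linear)

text \<open>The preimage of a box is its image under the inverse \<open>B\<close>, to which the
  determinant formula for linear images applies; boxes determine the measure.\<close>

lemma lborel_distr_unimodular:
  fixes A :: "real^'n::{finite,wellorder}^'n::_"
  assumes det: "\<bar>det A\<bar> = 1"
  shows "distr lborel borel ((*v) A) = lborel"
proof (rule lborel_eqI[symmetric])
  have meas: "(*v) A \<in> borel_measurable borel"
    by (rule linear_measurable) (rule matrix_vector_mul_linear)
  from det have "invertible A" by (auto simp: invertible_det_nz)
  then obtain B where AB: "A ** B = mat 1" "B ** A = mat 1" by (auto simp: invertible_def)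
  have "det A * det B = 1" using det_mul[of A B] by (simp add: AB det_I)
  then have detB: "\<bar>det B\<bar> = 1" using det by (metis abs_mult abs_one mult_1)
  fix l u :: "real^'n::_" assume lu: "\<And>b. b \<in> Basis \<Longrightarrow> l \<bullet> b \<le> u \<bullet> b"
  have pre: "(*v) A -` box l u = (*v) B ` box l u"
  proof (intro set_eqI iffI)
    fix x assume "x \<in> (*v) A -` box l u"
    moreover have "x = B *v (A *v x)" by (simp add: matrix_vector_mul_assoc AB)
    ultimately show "x \<in> (*v) B ` box l u" by auto
  next
    fix x assume "x \<in> (*v) B ` box l u"
    then show "x \<in> (*v) A -` box l u" by (auto simp: matrix_vector_mul_assoc AB)
  qed
  have bor: "(*v) A -` box l u \<in> sets borel"
    using measurable_sets[OF meas, of "box l u"] by simp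
  have lm: "(*v) B ` box l u \<in> lmeasurable"
    by (rule measurable_linear_image) simp_all
  have "emeasure (distr lborel borel ((*v) A)) (box l u) = emeasure lborel ((*v) A -` box l u)"
    using meas by (simp add: emeasure_distr)
  also have "\<dots> = emeasure lebesgue ((*v) B ` box l u)" unfolding pre[symmetric] using bor by simp
  also have "\<dots> = ennreal (measure lebesgue ((*v) B ` box l u))"
    by (rule emeasure_eq_measure2[OF lm])
  also have "measure lebesgue ((*v) B ` box l u) = measure lebesgue (box l u)"
    by (subst measure_linear_image) (simp_all add: detB)
  also have "ennreal (measure lebesgue (box l u)) = ennreal (prod ((\<bullet>) (u - l)) Basis)"
    using lu by (simp add: measure_lborel_box_eq)
  finally show "emeasure (distr lborel borel ((*v) A)) (box l u)
    = ennreal (prod ((\<bullet>) (u - l)) Basis)" .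
qed simp

text \<open>Identifies \<open>minkowski\<close> with \<open>real^4\<close>, where a linear map has a
  matrix and a determinant.\<close>

definition of_vec4 :: "real^4 \<Rightarrow> minkowski" where
  "of_vec4 v = (v$1, vector [v$2, v$3, v$4])"

definition to_vec4 :: "minkowski \<Rightarrow> real^4" where
  "to_vec4 x = (\<chi> i. if i = 1 then fst x else if i = 2 then snd x $ 1 else if i = 3 then snd x $ 2 else snd x $ 3)"

lemma of_to_vec4 [simp]: "of_vec4 (to_vec4 x) = x"
  by (auto simp: of_vec4_def to_vec4_def prod_eq_iff vec_eq_iff forall_3)

lemma to_of_vec4 [simp]: "to_vec4 (of_vec4 x) = x"
  by (auto simp: of_vec4_def to_vec4_def vec_eq_iff forall_4)

lemma linear_of_vec4: "linear of_vec4"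
  by (auto intro!: linearI simp: of_vec4_def vec_eq_iff forall_3)

lemma linear_to_vec4: "linear to_vec4"
  by (auto intro!: linearI simp: to_vec4_def vec_eq_iff forall_4)

lemma bij_of_vec4: "bij_betw of_vec4 Basis Basis"
proof (rule bij_betwI[where g = to_vec4])
  have *: "of_vec4 (axis i 1) \<in> Basis" for i :: 4
  proof -
    have "of_vec4 (axis 1 1) = (1, 0)" "of_vec4 (axis 2 1) = (0, axis 1 1)"
      "of_vec4 (axis 3 1) = (0, axis 2 1)" "of_vec4 (axis 4 1) = (0, axis 3 1)"
      by (auto simp: of_vec4_def axis_def vec_eq_iff forall_3)
    then show ?thesis using exhaust_4[of i] by (auto simp: Basis_prod_def Basis_vec_def)
  qed
  show "of_vec4 \<in> Basis \<rightarrow> Basis"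
    using * by (auto simp: Basis_vec_def[where 'b=4])
  have 1: "to_vec4 (1, 0) = axis 1 1"
    by (auto simp: to_vec4_def axis_def vec_eq_iff)
  have 2: "to_vec4 (0, axis i 1) \<in> range (\<lambda>i. axis i 1)" for i :: 3
    using exhaust_3[of i]
  proof (elim disjE)
    assume "i = 1" then have "to_vec4 (0, axis i 1) = axis 2 1"
      by (auto simp: to_vec4_def axis_def vec_eq_iff forall_4)
    then show ?thesis by simp
  next
    assume "i = 2" then have "to_vec4 (0, axis i 1) = axis 3 1"
      by (auto simp: to_vec4_def axis_def vec_eq_iff forall_4)
    then show ?thesis by simp
  next
    assume "i = 3" then have "to_vec4 (0, axis i 1) = axis 4 1"
      by (auto simp: to_vec4_def axis_def vec_eq_iff forall_4)
    then show ?thesis by simp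
  qed
  show "to_vec4 \<in> Basis \<rightarrow> Basis"
    using 1 2 by (auto simp: Basis_prod_def Basis_vec_def)
qed auto

lemma distr_of_vec4: "distr lborel borel of_vec4 = lborel"
  by (rule lborel_distr_linear_basis[OF linear_of_vec4 bij_of_vec4])

lemma lorentz_alt: "lorentz x y = snd x $ 1 * snd y $ 1 + snd x $ 2 * snd y $ 2 + snd x $ 3 * snd y $ 3 - fst x * fst y"
  by (simp add: lorentz_def inner_vec_def sum_3)

text \<open>With \<open>J\<close> the matrix of the form, invariance reads
  \<open>transpose A ** J ** A = J\<close>, and taking determinants gives (det A)^2 = 1.\<close>

theorem lborel_distr_lorentz:
  fixes S :: "minkowski \<Rightarrow> minkowski"
  assumes lin: "linear S" and S: "\<And>x y. lorentz (S x) (S y) = lorentz x y"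
  shows "distr lborel borel S = lborel"
proof -
  define A where "A = matrix (to_vec4 \<circ> S \<circ> of_vec4)"
  have lin': "linear (to_vec4 \<circ> S \<circ> of_vec4)"
    by (intro linear_compose linear_of_vec4 lin linear_to_vec4)
  have Av: "A *v v = to_vec4 (S (of_vec4 v))" for v
    unfolding A_def using matrix_vector_mul(2)[OF lin'] by (simp add: fun_eq_iff)
  define J :: "real^4^4" where "J = (\<chi> i j. if i = j then (if i = 1 then - 1 else 1) else 0)"
  have J: "v \<bullet> (J *v w) = lorentz (of_vec4 v) (of_vec4 w)" for v w
  proof -
    have "(J *v w) $ i = (if i = 1 then - w $ i else w $ i)" for i
      by (cases "i = 1") (simp_all add: J_def matrix_vector_mult_def if_distribR if_distrib[of "\<lambda>t. t * _"] cong: if_cong)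
    then show ?thesis
      by (simp add: lorentz_alt of_vec4_def inner_vec_def sum_4)
  qed
  have "v \<bullet> ((transpose A ** J ** A) *v w) = v \<bullet> (J *v w)" for v w
  proof -
    have "v \<bullet> ((transpose A ** J ** A) *v w) = (A *v v) \<bullet> (J *v (A *v w))"
      by (simp only: matrix_vector_mul_assoc[symmetric] transpose_matrix_vector inner_commute[of v]
          dot_lmul_matrix) (rule inner_commute)
    then show ?thesis by (simp add: J Av S)
  qed
  then have "transpose A ** J ** A = J"
    unfolding matrix_eq using vector_eq_ldot by blast
  then have "det A * det J * det A = det J" using det_mul[of "transpose A ** J" A] det_mul[of "transpose A" J] by simp
  moreover have "det J \<noteq> 0"
    by (subst det_diagonal) (auto simp: J_def)
  ultimately have "(det A)\<^sup>2 = 1" by (simp add: power2_eq_square)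
  then have "\<bar>det A\<bar> = 1" by (auto simp: power2_eq_1_iff)
  then have A: "distr lborel borel ((*v) A) = lborel" by (rule lborel_distr_unimodular)
  have "distr lborel borel S = distr (distr lborel borel of_vec4) borel S"
    by (simp add: distr_of_vec4)
  also have "\<dots> = distr lborel borel (S \<circ> of_vec4)"
    by (subst distr_distr) (auto intro: linear_measurable lin linear_of_vec4)
  also have "S \<circ> of_vec4 = of_vec4 \<circ> (*v) A" by (auto simp: Av)
  also have "distr lborel borel \<dots> = distr (distr lborel borel ((*v) A)) borel of_vec4"
    by (subst distr_distr) (auto intro!: linear_measurable linear_of_vec4 simp: matrix_vector_mul_linear)
  also have "\<dots> = lborel" by (simp add: A distr_of_vec4)
  finally show ?thesis .
qed

text \<open>The coordinates are ordered so that the first two span the plane of \<open>f\<close> and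
  \<open>g\<close>, where \<open>p + q\<close> and \<open>p - q\<close> are light-cone coordinates,
  and the last two form a pair, the horizontal direction of the half-space.\<close>

definition frame_map :: "minkowski \<Rightarrow> minkowski \<Rightarrow> minkowski \<Rightarrow> minkowski \<Rightarrow> real \<times> real \<times> real \<times> real \<Rightarrow> minkowski"
  where "frame_map f u v g = (\<lambda>(p, q, y, z). p *\<^sub>R f + q *\<^sub>R g + y *\<^sub>R u + z *\<^sub>R v)"

lemma lorentz_add_left: "lorentz (x + y) z = lorentz x z + lorentz y z"
  and lorentz_add_right: "lorentz z (x + y) = lorentz z x + lorentz z y"
  and lorentz_diff_left: "lorentz (x - y) z = lorentz x z - lorentz y z"
  and lorentz_diff_right: "lorentz z (x - y) = lorentz z x - lorentz z y"
  and lorentz_scale_left: "lorentz (a *\<^sub>R x) z = a * lorentz x z"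
  and lorentz_scale_right: "lorentz z (a *\<^sub>R x) = a * lorentz z x"
  and lorentz_minus_left: "lorentz (- x) z = - lorentz x z"
  and lorentz_minus_right: "lorentz z (- x) = - lorentz z x"
  and lorentz_zero_left: "lorentz 0 z = 0"
  and lorentz_zero_right: "lorentz z 0 = 0"
  by (simp_all add: lorentz_def inner_simps algebra_simps)

lemmas lorentz_simps = lorentz_add_left lorentz_add_right lorentz_diff_left lorentz_diff_right
  lorentz_scale_left lorentz_scale_right lorentz_minus_left lorentz_minus_right
  lorentz_zero_left lorentz_zero_right

lemma lorentz_commute: "lorentz x y = lorentz y x"
  by (simp add: lorentz_def inner_commute mult.commute)

text \<open>The frame map is a relabelling \<open>E\<close> of the coordinates followed by the
  Lorentz map \<open>S\<close> that sends the standard frame to the given one.\<close>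

lemma distr_frame_map:
  assumes "lorentz f f = - 1" "lorentz u u = 1" "lorentz v v = 1" "lorentz g g = 1"
    and "lorentz f u = 0" "lorentz f v = 0" "lorentz f g = 0"
    and "lorentz u v = 0" "lorentz u g = 0" "lorentz v g = 0"
  shows "distr lborel borel (frame_map f u v g) = lborel"
proof -
  define E where "E = (\<lambda>(p, q, y, z). (p, vector [q, y, z]) :: minkowski)"
  define S where "S = (\<lambda>x :: minkowski. fst x *\<^sub>R f + (snd x $ 1) *\<^sub>R g + (snd x $ 2) *\<^sub>R u + (snd x $ 3) *\<^sub>R v)"
  have linS: "linear S" by (rule linearI) (auto simp: S_def algebra_simps)
  have "lorentz (S x) (S y) = lorentz x y" for x y
    using assms by (simp add: S_def lorentz_simps lorentz_commute lorentz_alt[of x y] algebra_simps)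
  then have S: "distr lborel borel S = lborel" by (rule lborel_distr_lorentz[OF linS])
  have linE: "linear E" by (rule linearI) (auto simp: E_def vec_eq_iff forall_3)
  have bij: "bij_betw E Basis Basis"
  proof (rule bij_betwI[where g = "\<lambda>x. (fst x, snd x $ 1, snd x $ 2, snd x $ 3)"])
    have "E (1, 0) = (1, 0)" "E (0, 1, 0) = (0, axis 1 1)"
      "E (0, 0, 1, 0) = (0, axis 2 1)" "E (0, 0, 0, 1) = (0, axis 3 1)"
      by (auto simp: E_def axis_def vec_eq_iff forall_3 zero_prod_def)
    then show "E \<in> Basis \<rightarrow> Basis"
      by (auto simp: Basis_prod_def Basis_vec_def)
    have that_axis: "(0, axis i 1 $ 1, axis i 1 $ 2, axis i 1 $ 3) \<in> (Basis :: (real \<times> real \<times> real \<times> real) set)" for i :: 3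
      using exhaust_3[of i] by (auto simp: Basis_prod_def axis_def zero_prod_def)
    have that_one: "(1, 0, 0, 0) \<in> (Basis :: (real \<times> real \<times> real \<times> real) set)"
      by (auto simp: Basis_prod_def zero_prod_def)
    have that_basis: "x = (1, 0) \<or> (\<exists>i. x = (0, axis i 1))" if "x \<in> Basis" for x :: minkowski
      using that by (auto simp: Basis_prod_def Basis_vec_def)
    show "(\<lambda>x. (fst x, snd x $ 1, snd x $ 2, snd x $ 3)) \<in> (Basis :: minkowski set) \<rightarrow> Basis"
    proof (intro Pi_I)
      fix x :: minkowski assume "x \<in> Basis"
      then consider "x = (1, 0)" | i where "x = (0, axis i 1)"
        using that_basis by blast
      then show "(fst x, snd x $ 1, snd x $ 2, snd x $ 3) \<in> Basis"
        using that_axis that_one by cases simp_all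
    qed
  qed (auto simp: E_def vec_eq_iff forall_3)
  have E: "distr lborel borel E = lborel" by (rule lborel_distr_linear_basis[OF linE bij])
  have "frame_map f u v g = S \<circ> E"
    by (auto simp: frame_map_def S_def E_def)
  then have "distr lborel borel (frame_map f u v g) = distr (distr lborel borel E) borel S"
    by (subst distr_distr) (auto intro!: linear_measurable linS linE)
  then show ?thesis by (simp add: E S)
qed

section \<open>Hyperbolic volume as a cone volume\<close>

lemma nn_integral_lborel_scale:
  fixes f :: "'a::euclidean_space \<Rightarrow> ennreal"
  assumes [measurable]: "f \<in> borel_measurable borel" and c: "c > 0"
  shows "(\<integral>\<^sup>+x. f x \<partial>lborel) = ennreal (c ^ DIM('a)) * (\<integral>\<^sup>+x. f (c *\<^sub>R x) \<partial>lborel)"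
proof -
  have "(\<integral>\<^sup>+x. f x \<partial>lborel) =
      (\<integral>\<^sup>+x. f x \<partial>density (distr lborel borel (\<lambda>x. 0 + c *\<^sub>R x)) (\<lambda>_. ennreal (\<bar>c\<bar> ^ DIM('a))))"
    using lborel_affine[of c "0::'a"] c by simp
  also have "\<dots> = (\<integral>\<^sup>+x. ennreal (c ^ DIM('a)) * f (c *\<^sub>R x) \<partial>lborel)"
    using c by (subst nn_integral_density) (simp_all add: nn_integral_distr)
  finally show ?thesis by (simp add: nn_integral_cmult)
qed

lemma nn_integral_lborel_pair:
  fixes f :: "'a::euclidean_space \<times> 'b::euclidean_space \<Rightarrow> ennreal"
  assumes "f \<in> borel_measurable (borel \<Otimes>\<^sub>M borel)"
  shows "(\<integral>\<^sup>+w. f w \<partial>lborel) = (\<integral>\<^sup>+x. \<integral>\<^sup>+y. f (x, y) \<partial>lborel \<partial>lborel)"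
proof -
  have "f \<in> borel_measurable (lborel \<Otimes>\<^sub>M lborel)"
    using assms by (simp add: lborel_prod borel_prod)
  from lborel.nn_integral_fst[OF this] show ?thesis by (simp add: lborel_prod)
qed

text \<open>The solid cone over \<open>A\<close> from the origin up to the hyperboloid: a timelike
  \<open>X\<close> has Lorentz length \<open>sqrt (- lorentz X X)\<close>, which is restricted to at
  most 1.\<close>

definition hyp_cone :: "minkowski set \<Rightarrow> minkowski set" where
  "hyp_cone A = {X. fst X > 0 \<and> lorentz X X < 0 \<and> - 1 \<le> lorentz X X \<and>
     (1 / sqrt (- lorentz X X)) *\<^sub>R X \<in> A}"

lemma lorentz_continuous [continuous_intros]:
  "continuous_on S f \<Longrightarrow> continuous_on S g \<Longrightarrow> continuous_on S (\<lambda>x. lorentz (f x) (g x))"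
  unfolding lorentz_def by (intro continuous_intros)

lemma lorentz_measurable [measurable]:
  assumes [measurable]: "f \<in> borel_measurable M" "g \<in> borel_measurable M"
  shows "(\<lambda>x. lorentz (f x) (g x)) \<in> borel_measurable M"
  by (rule borel_measurable_continuous_Pair[OF assms]) (intro continuous_intros)

lemma borel_measurable_fst [measurable]: "(fst :: 'a::topological_space \<times> 'b::topological_space \<Rightarrow> 'a) \<in> borel_measurable borel"
  and borel_measurable_snd [measurable]: "(snd :: 'a \<times> 'b \<Rightarrow> 'b) \<in> borel_measurable borel"
  by (intro borel_measurable_continuous_onI continuous_intros)+

lemma hyp_cone_borel [measurable]:
  assumes [measurable]: "A \<in> sets borel" shows "hyp_cone A \<in> sets borel"
  unfolding hyp_cone_def by measurable

abbreviation hyp_measure :: "(real^3) measure" where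
  "hyp_measure \<equiv> density lborel (\<lambda>y. ennreal (1 / sqrt (1 + (norm y)\<^sup>2)))"

text \<open>On the vertical line over \<open>Y\<close> the height t is replaced by the Lorentz
  length s, where t^2 = s^2 + |Y|^2 and dt = (s / t) ds. For \<open>Y \<noteq> 0\<close> the
  substitution is smooth up to the endpoint s = 0.\<close>

lemma hyp_cone_slice:
  fixes Y :: "real^3"
  assumes [measurable]: "A \<in> sets borel" and Y: "Y \<noteq> 0"
  shows "(\<integral>\<^sup>+t. indicator (hyp_cone A) (t, Y) \<partial>lborel) =
    (\<integral>\<^sup>+s. indicator A ((1 / s) *\<^sub>R (sqrt (s\<^sup>2 + (norm Y)\<^sup>2), Y)) *
       ennreal (s / sqrt (s\<^sup>2 + (norm Y)\<^sup>2)) * indicator {0<..1} s \<partial>lborel)"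
proof -
  define n where "n = norm Y"
  have n: "n > 0" using Y by (simp add: n_def)
  define f where "f t = indicat_real (hyp_cone A) (t, Y)" for t
  define g where "g s = sqrt (s\<^sup>2 + n\<^sup>2)" for s
  have pos: "s\<^sup>2 + n\<^sup>2 > 0" for s using n by (simp add: add_nonneg_pos)
  have lor: "lorentz (t, Y) (t, Y) = n\<^sup>2 - t\<^sup>2" for t
    by (simp add: lorentz_def n_def power2_norm_eq_inner) (simp add: power2_eq_square)
  have f_meas [measurable]: "f \<in> borel_measurable borel"
  proof -
    have [measurable]: "(\<lambda>t. (t, Y)) \<in> borel_measurable borel"
      by (intro borel_measurable_continuous_onI continuous_intros)
    show ?thesis unfolding f_def by measurable
  qed
  have f_supp: "f t * indicator {g 0..g 1} t = f t" for t
  proof (cases "(t, Y) \<in> hyp_cone A")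
    case True
    then have "t > 0" "n\<^sup>2 < t\<^sup>2" "t\<^sup>2 \<le> 1 + n\<^sup>2" by (auto simp: hyp_cone_def lor)
    then have "g 0 \<le> t" "t \<le> g 1"
      using n by (auto simp: g_def abs_le_square_iff[symmetric] intro: real_le_rsqrt power_less_imp_less_base less_imp_le)
    then show ?thesis by simp
  qed (simp add: f_def)
  have "(\<integral>\<^sup>+t. indicator (hyp_cone A) (t, Y) \<partial>lborel) = (\<integral>\<^sup>+t. ennreal (f t * indicator {g 0..g 1} t) \<partial>lborel)"
    unfolding f_supp by (simp add: f_def ennreal_indicator)
  also have "\<dots> = (\<integral>\<^sup>+s. ennreal (f (g s) * (s / g s) * indicator {0..1} s) \<partial>lborel)"
  proof (rule nn_integral_substitution)
    show "set_borel_measurable borel {g 0..g 1} f"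
      unfolding set_borel_measurable_def by measurable
    show "(g has_real_derivative s / g s) (at s)" if "s \<in> {0..1}" for s
      unfolding g_def using pos[of s] by (auto intro!: derivative_eq_intros simp: field_simps)
    show "continuous_on {0..1} (\<lambda>s. s / g s)"
      unfolding g_def using pos by (intro continuous_intros) (auto simp: less_imp_neq[symmetric])
  qed (use pos in \<open>auto simp: g_def intro!: divide_nonneg_nonneg\<close>)
  also have "\<dots> = (\<integral>\<^sup>+s. indicator A ((1 / s) *\<^sub>R (g s, Y)) * ennreal (s / g s) * indicator {0<..1} s \<partial>lborel)"
  proof (rule nn_integral_cong)
    fix s :: real
    show "ennreal (f (g s) * (s / g s) * indicator {0..1} s) =
      indicator A ((1 / s) *\<^sub>R (g s, Y)) * ennreal (s / g s) * indicator {0<..1} s"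
    proof (cases "s \<in> {0<..1}")
      case True
      then have s: "0 < s" "s \<le> 1" by auto
      have g: "(g s)\<^sup>2 = s\<^sup>2 + n\<^sup>2" "g s > 0" using pos[of s] by (auto simp: g_def)
      have "(g s, Y) \<in> hyp_cone A \<longleftrightarrow> (1 / s) *\<^sub>R (g s, Y) \<in> A"
        using s g by (auto simp: hyp_cone_def lor power_le_one real_sqrt_unique)
      then show ?thesis using s by (simp add: f_def indicator_def)
    next
      case False
      then show ?thesis by (auto simp: indicator_def not_le)
    qed
  qed
  finally show ?thesis by (simp add: g_def n_def)
qed

text \<open>After exchanging the integrals, rescaling \<open>Y\<close> by the Lorentz length s turns
  the slice at s into s^3 times the hyperbolic volume. The factor 4 is the inverse of the integral
  of s^3 over [0, 1].\<close>

theorem emeasure_hyp_measure_eq_cone: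
  assumes [measurable]: "A \<in> sets borel"
  shows "emeasure hyp_measure {y. (sqrt (1 + (norm y)\<^sup>2), y) \<in> A} = 4 * emeasure lborel (hyp_cone A)"
proof -
  define N where "N = emeasure hyp_measure {y. (sqrt (1 + (norm y)\<^sup>2), y) \<in> A}"
  have [measurable]: "(\<lambda>y::real^3. (sqrt (1 + (norm y)\<^sup>2), y)) \<in> borel_measurable borel"
    by (intro borel_measurable_continuous_onI continuous_intros)
  have N: "N = (\<integral>\<^sup>+y. indicator A (sqrt (1 + (norm y)\<^sup>2), y) * ennreal (1 / sqrt (1 + (norm y)\<^sup>2)) \<partial>lborel)"
    unfolding N_def by (subst emeasure_density)
      (auto intro!: nn_integral_cong simp: indicator_def mult.commute)
  define F :: "real \<Rightarrow> real^3 \<Rightarrow> ennreal" where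
    "F s Y = indicator A ((1 / s) *\<^sub>R (sqrt (s\<^sup>2 + (norm Y)\<^sup>2), Y)) *
       ennreal (s / sqrt (s\<^sup>2 + (norm Y)\<^sup>2)) * indicator {0<..1} s" for s Y
  have Pm: "(\<lambda>x::real \<times> (real^3). (1 / fst x) *\<^sub>R (sqrt ((fst x)\<^sup>2 + (norm (snd x))\<^sup>2), snd x)) \<in> borel_measurable (borel \<Otimes>\<^sub>M borel)"
    by measurable
  have [measurable]: "case_prod F \<in> borel_measurable (borel \<Otimes>\<^sub>M borel)"
    unfolding F_def using Pm by (simp add: split_beta') measurable
  have "emeasure lborel (hyp_cone A) = (\<integral>\<^sup>+X. indicator (hyp_cone A) X \<partial>(lborel \<Otimes>\<^sub>M lborel))"
    by (simp add: lborel_prod)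
  also have "\<dots> = (\<integral>\<^sup>+Y. \<integral>\<^sup>+t. indicator (hyp_cone A) (t, Y) \<partial>lborel \<partial>lborel)"
    by (rule lborel_pair.nn_integral_snd[symmetric]) (simp add: lborel_prod)
  also have "\<dots> = (\<integral>\<^sup>+Y. \<integral>\<^sup>+s. F s Y \<partial>lborel \<partial>lborel)"
  proof (rule nn_integral_cong_AE, rule eventually_mono[OF AE_lborel_singleton[of "0 :: real^3"]])
    fix Y :: "real^3" assume "Y \<noteq> 0"
    then show "(\<integral>\<^sup>+t. indicator (hyp_cone A) (t, Y) \<partial>lborel) = (\<integral>\<^sup>+s. F s Y \<partial>lborel)"
      unfolding F_def by (rule hyp_cone_slice[OF assms])
  qed
  also have "\<dots> = (\<integral>\<^sup>+s. \<integral>\<^sup>+Y. F s Y \<partial>lborel \<partial>lborel)"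
    by (rule lborel_pair.Fubini') measurable
  also have "\<dots> = (\<integral>\<^sup>+s. N * ennreal (s ^ 3 * indicator {0..1} s) \<partial>lborel)"
  proof (rule nn_integral_cong)
    fix s :: real
    show "(\<integral>\<^sup>+Y. F s Y \<partial>lborel) = N * ennreal (s ^ 3 * indicator {0..1} s)"
    proof (cases "s \<in> {0<..1}")
      case True
      then have s: "0 < s" "s \<le> 1" by auto
      have [measurable]: "F s \<in> borel_measurable borel"
      proof -
        have "(\<lambda>Y. case_prod F (s, Y)) \<in> borel_measurable borel" by measurable
        then show ?thesis by simp
      qed
      have sq: "sqrt (s\<^sup>2 + (norm (s *\<^sub>R y))\<^sup>2) = s * sqrt (1 + (norm y)\<^sup>2)" for y :: "real^3"
      proof -
        have "s\<^sup>2 + (norm (s *\<^sub>R y))\<^sup>2 = s\<^sup>2 * (1 + (norm y)\<^sup>2)"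
          by (simp add: power_mult_distrib algebra_simps)
        then show ?thesis using s by (simp add: real_sqrt_mult)
      qed
      have "(\<integral>\<^sup>+Y. F s Y \<partial>lborel) = ennreal (s ^ 3) * (\<integral>\<^sup>+y. F s (s *\<^sub>R y) \<partial>lborel)"
        using nn_integral_lborel_scale[of "F s" s] s by simp
      also have "(\<integral>\<^sup>+y. F s (s *\<^sub>R y) \<partial>lborel) = N"
        unfolding N F_def sq using s by (intro nn_integral_cong) (simp add: field_simps)
      finally show ?thesis using s by (simp add: mult.commute)
    next
      case False
      then have "F s Y = 0" for Y by (simp add: F_def)
      moreover have "s ^ 3 * indicator {0..1} s = (0 :: real)" using False by (auto simp: indicator_def)
      ultimately show ?thesis unfolding \<open>s ^ 3 * indicator {0..1} s = (0 :: real)\<close> by simp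
    qed
  qed
  also have "\<dots> = N * (\<integral>\<^sup>+s. ennreal (s ^ 3 * indicator {0..1} s) \<partial>lborel)"
    by (intro nn_integral_cmult) simp
  also have "(\<integral>\<^sup>+s. ennreal (s ^ 3 * indicator {0..1} s) \<partial>lborel) = ennreal (1 / 4)"
  proof -
    have "(\<integral>\<^sup>+s. ennreal (s ^ 3) * indicator {0..1} s \<partial>lborel) = ennreal (1 ^ 4 / 4 - 0 ^ 4 / 4)"
      by (rule nn_integral_FTC_Icc) (auto intro!: derivative_eq_intros)
    moreover have "(\<integral>\<^sup>+s. ennreal (s ^ 3 * indicator {0..1} s) \<partial>lborel) = (\<integral>\<^sup>+s. ennreal (s ^ 3) * indicator {0..1} s \<partial>lborel)"
      by (intro nn_integral_cong) (auto simp: indicator_def)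
    ultimately show ?thesis by simp
  qed
  finally have "4 * emeasure lborel (hyp_cone A) = N * (4 * ennreal (1 / 4))"
    by (simp add: mult.left_commute mult.assoc)
  also have "4 * ennreal (1 / 4) = 1"
    by (simp add: ennreal_mult[symmetric] flip: ennreal_numeral ennreal_1)
  finally show ?thesis by (simp add: N_def)
qed

text \<open>With \<beta> = p + q and \<alpha> = p - q, minus the Lorentz form is \<alpha> \<beta> -
  |\<zeta>|^2, and \<xi> = \<zeta> / \<beta> is the horizontal half-space coordinate. For fixed
  \<beta> and \<xi> the last three conditions confine \<alpha> to an interval of length 1 / \<beta>
  - \<beta> h. With the Jacobian \<beta>^2 of \<zeta> = \<beta> \<xi>, integration over \<beta>
  gives 1 / (4 h), and the change from (p, q) to (\<alpha>, \<beta>) halves this.\<close>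

lemma region_measure:
  fixes D :: "(real \<times> real) set" and h :: "real \<times> real \<Rightarrow> real"
  assumes [measurable]: "D \<in> sets borel" "h \<in> borel_measurable borel"
    and h: "AE \<xi> in lborel. \<xi> \<in> D \<longrightarrow> h \<xi> > 0"
  shows "emeasure lborel {(p, q, \<zeta>). p + q > 0 \<and> (1 / (p + q)) *\<^sub>R \<zeta> \<in> D \<and>
      0 < (p - q) * (p + q) - (norm \<zeta>)\<^sup>2 \<and>
      (p + q)\<^sup>2 * h ((1 / (p + q)) *\<^sub>R \<zeta>) \<le> (p - q) * (p + q) - (norm \<zeta>)\<^sup>2 \<and>
      (p - q) * (p + q) - (norm \<zeta>)\<^sup>2 \<le> 1} = ennreal (1 / 8) * (\<integral>\<^sup>+\<xi>\<in>D. ennreal (1 / h \<xi>) \<partial>lborel)"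
    (is "emeasure lborel ?S = _")
proof -
  define I :: "real \<Rightarrow> real \<Rightarrow> real \<times> real \<Rightarrow> ennreal" where
    "I \<alpha> \<beta> \<zeta> = indicator {(\<alpha>, \<beta>, \<zeta>). \<beta> > 0 \<and> (1 / \<beta>) *\<^sub>R \<zeta> \<in> D \<and> 0 < \<alpha> * \<beta> - (norm \<zeta>)\<^sup>2 \<and> \<beta>\<^sup>2 * h ((1 / \<beta>) *\<^sub>R \<zeta>) \<le> \<alpha> * \<beta> - (norm \<zeta>)\<^sup>2 \<and>
       \<alpha> * \<beta> - (norm \<zeta>)\<^sup>2 \<le> 1} (\<alpha>, \<beta>, \<zeta>)" for \<alpha> \<beta> \<zeta>
  have I_measurable [measurable (raw)]: "(\<lambda>x. I (a x) (b x) (c x)) \<in> borel_measurable M"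
    if [measurable]: "a \<in> borel_measurable M" "b \<in> borel_measurable M" "c \<in> borel_measurable M" for a b c and M :: "'m measure"
    unfolding I_def indicator_def mem_Collect_eq prod.case by measurable
  have S_sets [measurable]: "?S \<in> sets (borel \<Otimes>\<^sub>M (borel \<Otimes>\<^sub>M borel))"
  proof -
    have "Measurable.pred (borel \<Otimes>\<^sub>M (borel \<Otimes>\<^sub>M borel)) (\<lambda>w. I (fst w - fst (snd w)) (fst w + fst (snd w)) (snd (snd w)) \<ge> 1)"
      by measurable
    moreover have "{w. I (fst w - fst (snd w)) (fst w + fst (snd w)) (snd (snd w)) \<ge> 1} = ?S"
      by (auto simp: I_def indicator_def split: if_splits)
    ultimately show ?thesis by (simp add: pred_def space_pair_measure)
  qed
  define G where "G \<alpha> \<beta> = (\<integral>\<^sup>+\<zeta>. I \<alpha> \<beta> \<zeta> \<partial>lborel)" for \<alpha> \<beta>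
  have [measurable]: "case_prod G \<in> borel_measurable (borel \<Otimes>\<^sub>M borel)"
    unfolding G_def by measurable
  have G_measurable [measurable (raw)]: "(\<lambda>x. G (a x) (b x)) \<in> borel_measurable M"
    if [measurable]: "a \<in> borel_measurable M" "b \<in> borel_measurable M" for a b and M :: "'m measure"
  proof -
    have "(\<lambda>x. case_prod G (a x, b x)) \<in> borel_measurable M" by measurable
    then show ?thesis by simp
  qed
  have "emeasure lborel ?S = (\<integral>\<^sup>+w. indicator ?S w \<partial>lborel)"
    by (rule nn_integral_indicator[symmetric]) (use S_sets in \<open>simp only: borel_prod sets_lborel\<close>)
  also have "\<dots> = (\<integral>\<^sup>+p. \<integral>\<^sup>+r. indicator ?S (p, r) \<partial>lborel \<partial>lborel)"
    by (rule nn_integral_lborel_pair, rule borel_measurable_indicator) (use S_sets in \<open>simp only: borel_prod\<close>)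
  also have "\<dots> = (\<integral>\<^sup>+p. \<integral>\<^sup>+q. \<integral>\<^sup>+\<zeta>. indicator ?S (p, q, \<zeta>) \<partial>lborel \<partial>lborel \<partial>lborel)"
  proof (rule nn_integral_cong)
    fix p
    have "(\<lambda>r. indicator ?S (p, r) :: ennreal) \<in> borel_measurable (borel \<Otimes>\<^sub>M borel)" by measurable
    then show "(\<integral>\<^sup>+r. indicator ?S (p, r) \<partial>lborel) = (\<integral>\<^sup>+q. \<integral>\<^sup>+\<zeta>. indicator ?S (p, q, \<zeta>) \<partial>lborel \<partial>lborel)"
      by (rule nn_integral_lborel_pair)
  qed
  also have "\<dots> = (\<integral>\<^sup>+p. \<integral>\<^sup>+q. G (p - q) (p + q) \<partial>lborel \<partial>lborel)"
    unfolding G_def I_def by (intro nn_integral_cong) (simp add: indicator_def)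
  also have "\<dots> = (\<integral>\<^sup>+q. \<integral>\<^sup>+p. G (p - q) (p + q) \<partial>lborel \<partial>lborel)"
    by (rule lborel_pair.Fubini') measurable
  also have "\<dots> = (\<integral>\<^sup>+q. \<integral>\<^sup>+\<beta>. G (\<beta> - 2 * q) \<beta> \<partial>lborel \<partial>lborel)"
  proof (rule nn_integral_cong)
    fix q :: real
    show "(\<integral>\<^sup>+p. G (p - q) (p + q) \<partial>lborel) = (\<integral>\<^sup>+\<beta>. G (\<beta> - 2 * q) \<beta> \<partial>lborel)"
    proof -
      have "(\<lambda>p. G (p - q) (p + q)) \<in> borel_measurable borel" by measurable
      from nn_integral_real_affine[OF this, of 1 "- q"] show ?thesis by (simp add: algebra_simps)
    qed
  qed
  also have "\<dots> = (\<integral>\<^sup>+\<beta>. \<integral>\<^sup>+q. G (\<beta> - 2 * q) \<beta> \<partial>lborel \<partial>lborel)"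
    by (rule lborel_pair.Fubini') measurable
  also have "\<dots> = (\<integral>\<^sup>+\<beta>. ennreal (1 / 2) * (\<integral>\<^sup>+\<alpha>. G \<alpha> \<beta> \<partial>lborel) \<partial>lborel)"
  proof (rule nn_integral_cong)
    fix \<beta> :: real
    have "(\<integral>\<^sup>+q. G (\<beta> - 2 * q) \<beta> \<partial>lborel) = ennreal \<bar>- 1 / 2\<bar> * (\<integral>\<^sup>+\<alpha>. G (\<beta> - 2 * (\<beta> / 2 + (- 1 / 2) * \<alpha>)) \<beta> \<partial>lborel)"
    proof (rule nn_integral_real_affine)
      show "(\<lambda>q. G (\<beta> - 2 * q) \<beta>) \<in> borel_measurable borel" by measurable
    qed simp
    then show "(\<integral>\<^sup>+q. G (\<beta> - 2 * q) \<beta> \<partial>lborel) = ennreal (1 / 2) * (\<integral>\<^sup>+\<alpha>. G \<alpha> \<beta> \<partial>lborel)"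
      by simp
  qed
  also have "\<dots> = ennreal (1 / 2) * (\<integral>\<^sup>+\<beta>. (\<integral>\<^sup>+\<alpha>. G \<alpha> \<beta> \<partial>lborel) \<partial>lborel)"
    by (rule nn_integral_cmult) measurable
  also have "(\<integral>\<^sup>+\<beta>. (\<integral>\<^sup>+\<alpha>. G \<alpha> \<beta> \<partial>lborel) \<partial>lborel) =
    (\<integral>\<^sup>+\<beta>. \<integral>\<^sup>+\<xi>. indicator D \<xi> * indicator {0<..} \<beta> * ennreal (\<beta> - \<beta> ^ 3 * h \<xi>) \<partial>lborel \<partial>lborel)"
  proof (rule nn_integral_cong)
    fix \<beta> :: real
    show "(\<integral>\<^sup>+\<alpha>. G \<alpha> \<beta> \<partial>lborel) = (\<integral>\<^sup>+\<xi>. indicator D \<xi> * indicator {0<..} \<beta> * ennreal (\<beta> - \<beta> ^ 3 * h \<xi>) \<partial>lborel)"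
    proof (cases "\<beta> > 0")
      case \<beta>: True
      have "(\<integral>\<^sup>+\<alpha>. G \<alpha> \<beta> \<partial>lborel) = (\<integral>\<^sup>+\<zeta>. (\<integral>\<^sup>+\<alpha>. I \<alpha> \<beta> \<zeta> \<partial>lborel) \<partial>lborel)"
        unfolding G_def by (rule lborel_pair.Fubini') measurable
      also have "\<dots> = ennreal (\<beta> ^ DIM(real \<times> real)) * (\<integral>\<^sup>+\<xi>. (\<integral>\<^sup>+\<alpha>. I \<alpha> \<beta> (\<beta> *\<^sub>R \<xi>) \<partial>lborel) \<partial>lborel)"
        by (rule nn_integral_lborel_scale[OF _ \<beta>]) measurable
      also have "\<dots> = (\<integral>\<^sup>+\<xi>. ennreal (\<beta>\<^sup>2) * (\<integral>\<^sup>+\<alpha>. I \<alpha> \<beta> (\<beta> *\<^sub>R \<xi>) \<partial>lborel) \<partial>lborel)"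
        by (subst nn_integral_cmult) (simp_all add: power2_eq_square)
      also have "\<dots> = (\<integral>\<^sup>+\<xi>. indicator D \<xi> * indicator {0<..} \<beta> * ennreal (\<beta> - \<beta> ^ 3 * h \<xi>) \<partial>lborel)"
      proof (rule nn_integral_cong_AE, rule eventually_mono[OF h])
        fix \<xi> :: "real \<times> real" assume h\<xi>: "\<xi> \<in> D \<longrightarrow> h \<xi> > 0"
        have *: "I \<alpha> \<beta> (\<beta> *\<^sub>R \<xi>) = indicator D \<xi> * indicator {\<beta> * h \<xi> + \<beta> * (norm \<xi>)\<^sup>2 .. 1 / \<beta> + \<beta> * (norm \<xi>)\<^sup>2} \<alpha>" for \<alpha>
        proof -
          have "\<beta>\<^sup>2 * h \<xi> \<le> \<alpha> * \<beta> - (norm (\<beta> *\<^sub>R \<xi>))\<^sup>2 \<longleftrightarrow> \<beta> * h \<xi> + \<beta> * (norm \<xi>)\<^sup>2 \<le> \<alpha>"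
          proof -
            have "\<beta>\<^sup>2 * h \<xi> \<le> \<alpha> * \<beta> - (norm (\<beta> *\<^sub>R \<xi>))\<^sup>2 \<longleftrightarrow> \<beta> * (\<beta> * h \<xi> + \<beta> * (norm \<xi>)\<^sup>2) \<le> \<beta> * \<alpha>"
              using \<beta> by (simp add: power_mult_distrib algebra_simps power2_eq_square)
            then show ?thesis using \<beta> by simp
          qed
          moreover have "\<alpha> * \<beta> - (norm (\<beta> *\<^sub>R \<xi>))\<^sup>2 \<le> 1 \<longleftrightarrow> \<alpha> \<le> 1 / \<beta> + \<beta> * (norm \<xi>)\<^sup>2"
          proof -
            have "\<alpha> \<le> 1 / \<beta> + \<beta> * (norm \<xi>)\<^sup>2 \<longleftrightarrow> \<beta> * \<alpha> \<le> \<beta> * (1 / \<beta> + \<beta> * (norm \<xi>)\<^sup>2)"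
              using \<beta> by simp
            also have "\<dots> \<longleftrightarrow> \<alpha> * \<beta> - (norm (\<beta> *\<^sub>R \<xi>))\<^sup>2 \<le> 1"
              using \<beta> by (simp add: power_mult_distrib algebra_simps power2_eq_square)
            finally show ?thesis by simp
          qed
          moreover have "0 < \<alpha> * \<beta> - (norm (\<beta> *\<^sub>R \<xi>))\<^sup>2"
            if "\<xi> \<in> D" "\<beta>\<^sup>2 * h \<xi> \<le> \<alpha> * \<beta> - (norm (\<beta> *\<^sub>R \<xi>))\<^sup>2"
          proof -
            have "0 < \<beta>\<^sup>2 * h \<xi>" using h\<xi> that \<beta> by simp
            then show ?thesis using that by linarith
          qed
          moreover have "(1 / \<beta>) *\<^sub>R \<beta> *\<^sub>R \<xi> = \<xi>" using \<beta> by simp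
          ultimately show ?thesis using \<beta> unfolding I_def indicator_def mem_Collect_eq prod.case atLeastAtMost_iff by auto
        qed
        have "(\<integral>\<^sup>+\<alpha>. I \<alpha> \<beta> (\<beta> *\<^sub>R \<xi>) \<partial>lborel) = indicator D \<xi> * emeasure lborel {\<beta> * h \<xi> + \<beta> * (norm \<xi>)\<^sup>2 .. 1 / \<beta> + \<beta> * (norm \<xi>)\<^sup>2}"
          unfolding * by (subst nn_integral_cmult) auto
        also have "\<dots> = indicator D \<xi> * ennreal (1 / \<beta> - \<beta> * h \<xi>)"
          by (simp add: emeasure_lborel_Icc_eq ennreal_neg)
        finally have "ennreal (\<beta>\<^sup>2) * (\<integral>\<^sup>+\<alpha>. I \<alpha> \<beta> (\<beta> *\<^sub>R \<xi>) \<partial>lborel) = indicator D \<xi> * (ennreal (\<beta>\<^sup>2) * ennreal (1 / \<beta> - \<beta> * h \<xi>))"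
          by (simp add: mult.left_commute)
        also have "ennreal (\<beta>\<^sup>2) * ennreal (1 / \<beta> - \<beta> * h \<xi>) = ennreal (\<beta> - \<beta> ^ 3 * h \<xi>)"
        proof -
          have "\<beta>\<^sup>2 * (1 / \<beta> - \<beta> * h \<xi>) = \<beta> - \<beta> ^ 3 * h \<xi>"
            using \<beta> by (simp add: right_diff_distrib power2_eq_square power3_eq_cube)
          then show ?thesis by (subst ennreal_mult'[symmetric]) simp_all
        qed
        finally show "ennreal (\<beta>\<^sup>2) * (\<integral>\<^sup>+\<alpha>. I \<alpha> \<beta> (\<beta> *\<^sub>R \<xi>) \<partial>lborel) = indicator D \<xi> * indicator {0<..} \<beta> * ennreal (\<beta> - \<beta> ^ 3 * h \<xi>)"
          using \<beta> by simp
      qed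
      finally show ?thesis .
    next
      case False
      then have "I \<alpha> \<beta> \<zeta> = 0" for \<alpha> \<zeta> by (simp add: I_def)
      then show ?thesis using False by (simp add: G_def)
    qed
  qed
  also have "\<dots> = (\<integral>\<^sup>+\<xi>. \<integral>\<^sup>+\<beta>. indicator D \<xi> * indicator {0<..} \<beta> * ennreal (\<beta> - \<beta> ^ 3 * h \<xi>) \<partial>lborel \<partial>lborel)"
    by (rule lborel_pair.Fubini') measurable
  also have "\<dots> = (\<integral>\<^sup>+\<xi>. ennreal (1 / 4) * (ennreal (1 / h \<xi>) * indicator D \<xi>) \<partial>lborel)"
  proof (rule nn_integral_cong_AE, rule eventually_mono[OF h])
    fix \<xi> :: "real \<times> real" assume h\<xi>: "\<xi> \<in> D \<longrightarrow> h \<xi> > 0"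
    show "(\<integral>\<^sup>+\<beta>. indicator D \<xi> * indicator {0<..} \<beta> * ennreal (\<beta> - \<beta> ^ 3 * h \<xi>) \<partial>lborel) = ennreal (1 / 4) * (ennreal (1 / h \<xi>) * indicator D \<xi>)"
    proof (cases "\<xi> \<in> D")
      case True
      define k where "k = h \<xi>"
      have k: "k > 0" using True h\<xi> by (simp add: k_def)
      \<comment> \<open>At this value of \<beta> the interval for \<alpha> shrinks to a point, so
        the positive part of the integrand lives on \<open>{0..b}\<close>.\<close>
      define b where "b = 1 / sqrt k"
      have b: "b > 0" "b\<^sup>2 * k = 1" using k by (auto simp: b_def power_divide)
      have fac: "\<beta> - \<beta> ^ 3 * k = k * \<beta> * (b\<^sup>2 - \<beta>\<^sup>2)" for \<beta>
        using b(2) by (simp add: algebra_simps power2_eq_square power3_eq_cube)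
      have "indicator D \<xi> * indicator {0<..} \<beta> * ennreal (\<beta> - \<beta> ^ 3 * h \<xi>) = ennreal (\<beta> - \<beta> ^ 3 * k) * indicator {0..b} \<beta>" for \<beta>
      proof (cases "\<beta> \<le> 0")
        case True then show ?thesis by (auto simp: indicator_def)
      next
        case False
        have "\<beta> - \<beta> ^ 3 * k \<le> 0" if "b < \<beta>"
          unfolding fac using False k b that by (auto intro!: mult_nonneg_nonpos power_mono)
        then show ?thesis using False \<open>\<xi> \<in> D\<close> by (auto simp: indicator_def k_def ennreal_neg not_le)
      qed
      then have "(\<integral>\<^sup>+\<beta>. indicator D \<xi> * indicator {0<..} \<beta> * ennreal (\<beta> - \<beta> ^ 3 * h \<xi>) \<partial>lborel) =
        (\<integral>\<^sup>+\<beta>. ennreal (\<beta> - \<beta> ^ 3 * k) * indicator {0..b} \<beta> \<partial>lborel)" by simp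
      also have "\<dots> = ennreal ((b\<^sup>2 / 2 - b ^ 4 * k / 4) - (0\<^sup>2 / 2 - 0 ^ 4 * k / 4))"
      proof -
        have nn: "0 \<le> \<beta> - \<beta> ^ 3 * k" if "0 \<le> \<beta>" "\<beta> \<le> b" for \<beta>
          unfolding fac using k that by (auto intro!: mult_nonneg_nonneg power_mono)
        show ?thesis
          by (rule nn_integral_FTC_Icc) (use b nn in \<open>auto intro!: derivative_eq_intros\<close>)
      qed
      also have "b ^ 4 * k = b\<^sup>2" using b(2) by (simp add: power4_eq_xxxx power2_eq_square)
      also have "b\<^sup>2 = 1 / k" using b(2) k by (simp add: field_simps)
      finally show ?thesis using True k by (simp add: k_def ennreal_mult[symmetric] field_simps)
    qed simp
  qed
  also have "\<dots> = ennreal (1 / 4) * (\<integral>\<^sup>+\<xi>\<in>D. ennreal (1 / h \<xi>) \<partial>lborel)"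
    by (rule nn_integral_cmult) measurable
  finally have "emeasure lborel ?S = ennreal (1 / 2) * ennreal (1 / 4) * (\<integral>\<^sup>+\<xi>\<in>D. ennreal (1 / h \<xi>) \<partial>lborel)"
    by (simp only: mult.assoc)
  also have "ennreal (1 / 2) * ennreal (1 / 4) = ennreal (1 / 8)"
    by (subst ennreal_mult[symmetric]) simp_all
  finally show ?thesis .
qed

text \<open>Orthogonality turns the Cauchy-Schwarz inequality for the space parts into a bound on
  the time part of \<open>y\<close>: the form is nonnegative on the complement of a timelike
  vector.\<close>

lemma lorentz_square_pos_orth:
  fixes x y :: minkowski
  assumes "lorentz x x < 0" "lorentz x y = 0"
  shows "lorentz y y \<ge> 0"
proof -
  have 1: "snd x \<bullet> snd x < (fst x)\<^sup>2" using assms(1) by (simp add: lorentz_def power2_eq_square)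
  have "(fst x * fst y)\<^sup>2 = (snd x \<bullet> snd y)\<^sup>2" using assms(2) by (simp add: lorentz_def)
  also have "\<dots> \<le> (snd x \<bullet> snd x) * (snd y \<bullet> snd y)" by (rule Cauchy_Schwarz_ineq)
  also have "\<dots> \<le> (fst x)\<^sup>2 * (snd y \<bullet> snd y)"
    using 1 by (intro mult_right_mono) auto
  finally have "(fst x)\<^sup>2 * (fst y)\<^sup>2 \<le> (fst x)\<^sup>2 * (snd y \<bullet> snd y)" by (simp add: power_mult_distrib)
  moreover have "(fst x)\<^sup>2 > 0" using 1 inner_ge_zero[of "snd x"] by linarith
  ultimately have "(fst y)\<^sup>2 \<le> snd y \<bullet> snd y" by simp
  then show ?thesis by (simp add: lorentz_def power2_eq_square)
qed

lemma lorentz_causal_norm: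
  "lorentz x x \<le> 0 \<Longrightarrow> norm (snd x) \<le> \<bar>fst x\<bar>"
  by (simp add: lorentz_def norm_eq_sqrt_inner real_sqrt_le_iff flip: real_sqrt_abs)
     (simp add: power2_eq_square)

lemma lorentz_timelike_norm:
  "lorentz x x < 0 \<Longrightarrow> norm (snd x) < \<bar>fst x\<bar>"
  by (simp add: lorentz_def norm_eq_sqrt_inner flip: real_sqrt_abs)
     (simp add: power2_eq_square)

lemma lorentz_future_neg:
  assumes "lorentz x x < 0" "fst x > 0" "lorentz l l \<le> 0" "fst l > 0"
  shows "lorentz x l < 0"
proof -
  have "snd x \<bullet> snd l \<le> norm (snd x) * norm (snd l)" by (rule norm_cauchy_schwarz)
  also have "\<dots> \<le> norm (snd x) * fst l"
    using lorentz_causal_norm[of l] assms by (intro mult_left_mono) auto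
  also have "\<dots> < fst x * fst l"
    using lorentz_timelike_norm[of x] assms by (intro mult_strict_right_mono) auto
  finally show ?thesis by (simp add: lorentz_def)
qed

lemma lorentz_future_nonpos:
  assumes "lorentz x x \<le> 0" "fst x \<ge> 0" "lorentz l l \<le> 0" "fst l \<ge> 0"
  shows "lorentz x l \<le> 0"
proof -
  have "snd x \<bullet> snd l \<le> norm (snd x) * norm (snd l)" by (rule norm_cauchy_schwarz)
  also have "\<dots> \<le> fst x * fst l"
    using lorentz_causal_norm[of l] lorentz_causal_norm[of x] assms by (intro mult_mono) auto
  finally show ?thesis by (simp add: lorentz_def)
qed

text \<open>The pairing with one future causal vector separates the two time cones, so the time
  orientation can be tested in any Lorentz frame. This expresses membership in
  \<open>hyp_cone\<close> through \<open>p + q\<close>.\<close>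

lemma timelike_future_iff:
  assumes "lorentz x x < 0" "lorentz l l \<le> 0" "fst l > 0"
  shows "fst x > 0 \<longleftrightarrow> lorentz x l < 0"
proof -
  have "fst x \<noteq> 0" using lorentz_timelike_norm[OF assms(1)] by auto
  moreover have "lorentz (- x) l < 0" if "fst x < 0"
    using lorentz_future_neg[of "- x" l] assms that by (simp add: lorentz_simps)
  ultimately show ?thesis using lorentz_future_neg[of x l] assms
    by (cases "fst x > 0") (auto simp: lorentz_simps)
qed

lemma half_space_borel [measurable]: "half_space u \<in> sets borel"
  and horoball_borel [measurable]: "horoball u \<in> sets borel"
  and hyp3_borel [measurable]: "hyp3 \<in> sets borel"
  unfolding half_space_def horoball_def hyp3_def by measurable

lemma hyp_simplex_borel [measurable]: "hyp_simplex e \<in> sets borel"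
  unfolding hyp_simplex_def by (intro sets.finite_INT) (auto simp: lessThan_empty_iff)

text \<open>In the upper half-space coordinates \<open>(\<xi>, t)\<close> attached to the null vectors \<open>f - g\<close> (at
  infinity) and \<open>f + g\<close>, the set \<open>A\<close> is \<open>{(\<xi>, t). \<xi> \<in> D \<and> h \<xi> \<le> t\<^sup>2}\<close>.\<close>

theorem hyp_vol_region:
  fixes A :: "minkowski set" and D :: "(real \<times> real) set" and h :: "real \<times> real \<Rightarrow> real"
  assumes frame: "lorentz f f = - 1" "lorentz u u = 1" "lorentz v v = 1" "lorentz g g = 1"
     "lorentz f u = 0" "lorentz f v = 0" "lorentz f g = 0"
     "lorentz u v = 0" "lorentz u g = 0" "lorentz v g = 0"
    and future: "fst (f - g) > 0"
    and meas [measurable]: "A \<in> sets borel" "D \<in> sets borel" "h \<in> borel_measurable borel"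
    and h: "AE \<xi> in lborel. \<xi> \<in> D \<longrightarrow> h \<xi> > 0"
    and A: "\<And>x b. x \<in> hyp3 \<Longrightarrow> b = - lorentz x (f - g) \<Longrightarrow> b > 0 \<Longrightarrow>
       x \<in> A \<longleftrightarrow> (lorentz x u / b, lorentz x v / b) \<in> D \<and>
         b\<^sup>2 * h (lorentz x u / b, lorentz x v / b) \<le> 1"
  shows "hyp_vol A = enn2real (ennreal (1 / 2) * (\<integral>\<^sup>+\<xi>\<in>D. ennreal (1 / h \<xi>) \<partial>lborel))"
proof -
  define T where "T = frame_map f u v g"
  have T: "distr lborel borel T = lborel" unfolding T_def by (rule distr_frame_map[OF frame])
  have T_eq: "T (p, q, y, z) = p *\<^sub>R f + q *\<^sub>R g + y *\<^sub>R u + z *\<^sub>R v" for p q y z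
    by (simp add: T_def frame_map_def)
  have T_meas [measurable]: "T \<in> borel_measurable borel"
    unfolding T_def frame_map_def
    by (intro borel_measurable_continuous_onI) (simp add: split_beta', intro continuous_intros)
  have null: "lorentz (f - g) (f - g) = 0"
    using frame by (simp add: lorentz_simps lorentz_commute[of g f])
  have lor: "lorentz (T (p, q, y, z)) (T (p, q, y, z)) = (norm (y, z))\<^sup>2 - (p - q) * (p + q)"
    "lorentz (T (p, q, y, z)) (f - g) = - (p + q)"
    "lorentz (T (p, q, y, z)) u = y" "lorentz (T (p, q, y, z)) v = z" for p q y z
    using frame by (simp_all add: T_eq lorentz_simps lorentz_commute[of u f] lorentz_commute[of v f]
      lorentz_commute[of g f] lorentz_commute[of v u] lorentz_commute[of g u] lorentz_commute[of g v]
      norm_prod_def algebra_simps power2_eq_square)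
  have "T -` hyp_cone A = {(p, q, \<zeta>). p + q > 0 \<and> (1 / (p + q)) *\<^sub>R \<zeta> \<in> D \<and>
      0 < (p - q) * (p + q) - (norm \<zeta>)\<^sup>2 \<and>
      (p + q)\<^sup>2 * h ((1 / (p + q)) *\<^sub>R \<zeta>) \<le> (p - q) * (p + q) - (norm \<zeta>)\<^sup>2 \<and>
      (p - q) * (p + q) - (norm \<zeta>)\<^sup>2 \<le> 1}" (is "_ = ?S")
  proof (intro set_eqI, clarify)
    fix p q y z :: real
    define X where "X = T (p, q, y, z)"
    define n where "n = (p - q) * (p + q) - (norm (y, z))\<^sup>2"
    have n: "lorentz X X = - n" by (simp add: X_def lor n_def)
    show "(p, q, y, z) \<in> T -` hyp_cone A \<longleftrightarrow> (p, q, y, z) \<in> ?S"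
    proof (cases "0 < n \<and> p + q > 0")
      case True
      then have n0: "n > 0" and pq: "p + q > 0" by auto
      have fX: "fst X > 0"
        using timelike_future_iff[of X "f - g"] null future n n0 pq by (simp add: X_def lor)
      define s where "s = sqrt n"
      have s: "s > 0" "s\<^sup>2 = n" using n0 by (simp_all add: s_def)
      \<comment> \<open>The point of the hyperboloid on the ray of \<open>X\<close>; its height in
        the half-space is \<open>1 / b\<close>.\<close>
      define x where "x = (1 / s) *\<^sub>R X"
      define b where "b = (p + q) / s"
      have "lorentz x (f - g) = (1 / s) * lorentz X (f - g)" by (simp only: x_def lorentz_scale_left)
      then have b: "b > 0" "b = - lorentz x (f - g)" using pq s by (simp_all only: b_def X_def lor) (simp_all add: field_simps)
      have x: "x \<in> hyp3"
        using fX s n0 by (simp add: hyp3_def x_def lorentz_simps n field_simps power2_eq_square)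
      have coord: "(lorentz x u / b, lorentz x v / b) = (1 / (p + q)) *\<^sub>R (y, z)"
        using s pq by (simp add: x_def b_def lorentz_simps X_def lor)
      have "X \<in> hyp_cone A \<longleftrightarrow> n \<le> 1 \<and> x \<in> A"
        using fX n0 by (auto simp: hyp_cone_def n x_def s_def)
      also have "x \<in> A \<longleftrightarrow> (1 / (p + q)) *\<^sub>R (y, z) \<in> D \<and> b\<^sup>2 * h ((1 / (p + q)) *\<^sub>R (y, z)) \<le> 1"
        using A[OF x b(2,1)] unfolding coord .
      also have "b\<^sup>2 * h ((1 / (p + q)) *\<^sub>R (y, z)) \<le> 1 \<longleftrightarrow> (p + q)\<^sup>2 * h ((1 / (p + q)) *\<^sub>R (y, z)) \<le> n"
        unfolding b_def power_divide s(2) using n0 by (simp add: field_simps)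
      finally show ?thesis using pq n0 by (auto simp: X_def n_def)
    next
      case False
      then have "(p, q, y, z) \<notin> ?S" by (auto simp: n_def)
      moreover have "X \<notin> hyp_cone A"
      proof
        assume "X \<in> hyp_cone A"
        then have "n > 0" "fst X > 0" by (auto simp: hyp_cone_def n)
        then have "lorentz X (f - g) < 0"
          using timelike_future_iff[of X "f - g"] null future n by simp
        then show False using False \<open>n > 0\<close> by (simp add: X_def lor)
      qed
      ultimately show ?thesis by (simp add: X_def)
    qed
  qed
  then have "emeasure lborel (hyp_cone A) = emeasure lborel ?S"
    by (subst T[symmetric], subst emeasure_distr) simp_all
  also have "\<dots> = ennreal (1 / 8) * (\<integral>\<^sup>+\<xi>\<in>D. ennreal (1 / h \<xi>) \<partial>lborel)"
    by (rule region_measure) (use h in auto)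
  \<comment> \<open>The factors 4 and 1 / 8 combine to 1 / 2, in agreement with the half-space
    volume element: the integral of t^(-3) over t \<ge> sqrt h is 1 / (2 h).\<close>
  finally have "emeasure hyp_measure {y. (sqrt (1 + (norm y)\<^sup>2), y) \<in> A} =
      ennreal 4 * (ennreal (1 / 8) * (\<integral>\<^sup>+\<xi>\<in>D. ennreal (1 / h \<xi>) \<partial>lborel))"
    using emeasure_hyp_measure_eq_cone[of A] by simp
  also have "\<dots> = ennreal (1 / 2) * (\<integral>\<^sup>+\<xi>\<in>D. ennreal (1 / h \<xi>) \<partial>lborel)"
  proof -
    have "ennreal 4 * ennreal (1 / 8) = ennreal (1 / 2)"
      by (subst ennreal_mult[symmetric]) (simp_all del: ennreal_numeral)
    then show ?thesis by (simp only: mult.assoc[symmetric])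
  qed
  finally show ?thesis by (simp add: hyp_vol_def measure_def)
qed

section \<open>Integrals over right triangles\<close>

lemma distr_plane_linear:
  assumes det: "\<bar>a * d - b * c\<bar> = (1 :: real)"
  shows "distr lborel borel (\<lambda>(x, y). (a * x + b * y, c * x + d * y)) = (lborel :: (real \<times> real) measure)"
proof -
  define E :: "real^2 \<Rightarrow> real \<times> real" where "E v = (v $ 1, v $ 2)" for v
  define E' :: "real \<times> real \<Rightarrow> real^2" where "E' p = vector [fst p, snd p]" for p
  define A :: "real^2^2" where "A = vector [vector [a, b], vector [c, d]]"
  have linE: "linear E" and linE': "linear E'"
    by (auto intro!: linearI simp: E_def E'_def vec_eq_iff forall_2)
  have inv: "E (E' p) = p" "E' (E v) = v" for p v
    by (auto simp: E_def E'_def vec_eq_iff forall_2)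
  have "E (axis 1 1) = (1, 0)" "E (axis 2 1) = (0, 1)" "E' (1, 0) = axis 1 1" "E' (0, 1) = axis 2 1"
    by (auto simp: E_def E'_def axis_def vec_eq_iff forall_2)
  then have "E (axis i 1) \<in> Basis" for i
    using exhaust_2[of i] by (auto simp: Basis_prod_def)
  then have B: "E v \<in> Basis" if "v \<in> Basis" for v
    using that by (auto simp: Basis_vec_def)
  have B': "E' p \<in> Basis" if "p \<in> Basis" for p
    using that \<open>E' (1, 0) = axis 1 1\<close> \<open>E' (0, 1) = axis 2 1\<close> by (auto simp: Basis_vec_def Basis_prod_def)
  have "bij_betw E Basis Basis" "bij_betw E' Basis Basis"
    using B B' by (auto intro!: bij_betwI[where g = E'] bij_betwI[where g = E] simp: inv)
  note E = lborel_distr_linear_basis[OF linE this(1)] and E' = lborel_distr_linear_basis[OF linE' this(2)]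
  have "\<bar>det A\<bar> = 1" using det by (simp add: A_def det_2 mult.commute)
  then have A: "distr lborel borel ((*v) A) = lborel" by (rule lborel_distr_unimodular)
  have eq: "(\<lambda>(x, y). (a * x + b * y, c * x + d * y)) = E \<circ> ((*v) A \<circ> E')"
    by (auto simp: E_def E'_def A_def matrix_vector_mult_def sum_2)
  have "E \<in> borel_measurable borel" "E' \<in> borel_measurable borel" "(*v) A \<in> borel_measurable borel"
    by (auto intro!: linear_measurable linE linE' matrix_vector_mul_linear)
  then have "distr lborel borel (E \<circ> ((*v) A \<circ> E')) = distr (distr (distr lborel borel E') borel ((*v) A)) borel E"
    by (simp add: distr_distr comp_def)
  then show ?thesis by (simp add: eq E' A E)
qed

text \<open>Integral of a radial function over a right triangle: the origin is a vertex, \<open>d\<close> is the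
  length of the adjacent leg and \<open>t\<close> is the tangent of the angle at the origin.\<close>

definition wedge :: "(real \<Rightarrow> ennreal) \<Rightarrow> real \<Rightarrow> real \<Rightarrow> ennreal" where
  "wedge f d t = (\<integral>\<^sup>+z\<in>{z. 0 < fst z \<and> fst z \<le> d \<and> 0 \<le> snd z \<and> snd z \<le> t * fst z}. f ((norm z)\<^sup>2) \<partial>lborel)"

lemma AE_plane_line:
  fixes a b :: real
  assumes "(a, b) \<noteq> 0"
  shows "AE z in (lborel :: (real \<times> real) measure). a * fst z + b * snd z \<noteq> 0"
proof -
  have "negligible {z. (a, b) \<bullet> z = 0}" using assms by (rule negligible_hyperplane[OF disjI1])
  then have "{z. (a, b) \<bullet> z = 0} \<in> null_sets lebesgue" by (simp add: negligible_iff_null_sets)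
  moreover have "{z. (a, b) \<bullet> z = 0} \<in> sets borel" by (intro borel_closed closed_hyperplane)
  ultimately have "{z. (a, b) \<bullet> z = 0} \<in> null_sets lborel"
    by (simp add: null_sets_def)
  then show ?thesis by (rule AE_I') (auto simp: inner_prod_def)
qed

lemma norm_plane: "(norm z)\<^sup>2 = (fst z)\<^sup>2 + (snd z)\<^sup>2" for z :: "real \<times> real"
  by (simp add: norm_prod_def)

text \<open>The region is the triangle spanned by the origin and one side of a larger triangle;
  \<open>(n1, n2)\<close> is the outward unit normal of that side and \<open>d\<close> its distance.
  The last two conditions say that the distance quotient of this side dominates those of the two
  others. After rotating the normal to the first axis, the perpendicular from the origin splits the
  region into two right triangles; \<open>c\<close> and \<open>c'\<close> being nonnegative keeps
  its foot on the side.\<close>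

lemma cone_integral:
  fixes f :: "real \<Rightarrow> ennreal" and n1 n2 :: real
  assumes [measurable]: "f \<in> borel_measurable borel" and n: "n1\<^sup>2 + n2\<^sup>2 = 1"
    and s: "s > 0" "s' > 0" and d: "d \<ge> 0" "c \<ge> 0" "c' \<ge> 0" "dq \<ge> 0" "dq' \<ge> 0"
  shows "(\<integral>\<^sup>+z\<in>{z. 0 < n1 * fst z + n2 * snd z \<and> n1 * fst z + n2 * snd z \<le> d \<and>
      d * (- c * (n1 * fst z + n2 * snd z) + s * (- n2 * fst z + n1 * snd z)) \<le> dq * (n1 * fst z + n2 * snd z) \<and>
      d * (- c' * (n1 * fst z + n2 * snd z) - s' * (- n2 * fst z + n1 * snd z)) \<le> dq' * (n1 * fst z + n2 * snd z)}.
      f ((norm z)\<^sup>2) \<partial>lborel) = wedge f d ((dq + c * d) / (s * d)) + wedge f d ((dq' + c' * d) / (s' * d))"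
    (is "(\<integral>\<^sup>+z\<in>?C. _ \<partial>lborel) = _")
proof (cases "d = 0")
  case True
  then have "?C = {}" by auto
  then show ?thesis using True by (simp add: wedge_def not_le[symmetric])
next
  case False
  with d have d0: "d > 0" by simp
  define t where "t = (dq + c * d) / (s * d)"
  define t' where "t' = (dq' + c' * d) / (s' * d)"
  have tt: "t \<ge> 0" "t' \<ge> 0" using s d d0 by (auto simp: t_def t'_def)
  define R where "R = (\<lambda>(x, y). (n1 * x + (- n2) * y, n2 * x + n1 * y))"
  have R: "distr lborel borel R = lborel"
    unfolding R_def by (rule distr_plane_linear) (use n in \<open>simp add: power2_eq_square\<close>)
  have [measurable]: "R \<in> borel_measurable borel"
    unfolding R_def by (intro borel_measurable_continuous_onI) (simp add: split_beta', intro continuous_intros)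
  have R1: "n1 * fst (R z) + n2 * snd (R z) = fst z" and R2: "- n2 * fst (R z) + n1 * snd (R z) = snd z" for z
    using n unfolding R_def split_beta' fst_conv snd_conv by algebra+
  have Rn: "(norm (R z))\<^sup>2 = (norm z)\<^sup>2" for z
  proof -
    have "(norm (R z))\<^sup>2 = (n1\<^sup>2 + n2\<^sup>2) * (norm z)\<^sup>2"
      unfolding norm_plane R_def split_beta' fst_conv snd_conv by algebra
    then show ?thesis by (simp add: n)
  qed
  define C where "C = ?C"
  have C_meas [measurable]: "C \<in> sets borel"
  proof -
    define p q where "p z = n1 * fst z + n2 * snd z" and "q z = - n2 * fst z + n1 * snd z" for z :: "real \<times> real"
    have pq: "continuous_on UNIV p" "continuous_on UNIV q"
      unfolding p_def q_def by (intro continuous_intros)+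
    have "C = {z. 0 < p z} \<inter> {z. p z \<le> d} \<inter> {z. d * (- c * p z + s * q z) \<le> dq * p z} \<inter> {z. d * (- c' * p z - s' * q z) \<le> dq' * p z}"
      unfolding p_def q_def C_def by auto
    also have "\<dots> \<in> sets borel"
      by (intro sets.Int borel_open borel_closed open_Collect_less closed_Collect_le continuous_intros pq)
    finally show ?thesis .
  qed
  have mem: "R z \<in> C \<longleftrightarrow> 0 < fst z \<and> fst z \<le> d \<and> - t' * fst z \<le> snd z \<and> snd z \<le> t * fst z" for z
  proof -
    have "d * (- c * fst z + s * snd z) \<le> dq * fst z \<longleftrightarrow> (s * d) * snd z \<le> (dq + c * d) * fst z"
      by (simp add: algebra_simps)
    also have "\<dots> \<longleftrightarrow> snd z \<le> t * fst z"
      unfolding t_def using s d0 by (simp add: pos_le_divide_eq mult.commute)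
    finally have 1: "d * (- c * fst z + s * snd z) \<le> dq * fst z \<longleftrightarrow> snd z \<le> t * fst z" .
    have "d * (- c' * fst z - s' * snd z) \<le> dq' * fst z \<longleftrightarrow> (s' * d) * (- snd z) \<le> (dq' + c' * d) * fst z"
    proof -
      have e: "d * (- c' * fst z - s' * snd z) = - (c' * d * fst z) - s' * d * snd z"
        "(dq' + c' * d) * fst z = dq' * fst z + c' * d * fst z" "s' * d * - snd z = - (s' * d * snd z)"
        by (simp_all add: algebra_simps)
      show ?thesis unfolding e by (rule iffI; linarith)
    qed
    also have "\<dots> \<longleftrightarrow> - snd z \<le> t' * fst z"
      unfolding t'_def using s d0 by (simp add: pos_le_divide_eq mult.commute)
    finally show ?thesis unfolding C_def mem_Collect_eq R1 R2 1 by auto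
  qed
  define W where "W = {z :: real \<times> real. 0 < fst z \<and> fst z \<le> d \<and> 0 \<le> snd z \<and> snd z \<le> t * fst z}"
  define W' where "W' = {z :: real \<times> real. 0 < fst z \<and> fst z \<le> d \<and> 0 \<le> snd z \<and> snd z \<le> t' * fst z}"
  \<comment> \<open>The reflection that folds the lower right triangle onto the shape used by
    \<open>wedge\<close>.\<close>
  define M where "M = (\<lambda>(x, y). (1 * x + 0 * y, 0 * x + (- 1) * y) :: real \<times> real)"
  have M: "distr lborel borel M = lborel" unfolding M_def by (rule distr_plane_linear) simp
  have [measurable]: "M \<in> borel_measurable borel"
    unfolding M_def by (intro borel_measurable_continuous_onI) (simp add: split_beta', intro continuous_intros)
  have [measurable]: "W \<in> sets borel" "W' \<in> sets borel" unfolding W_def W'_def by measurable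
  have "(\<integral>\<^sup>+z\<in>C. f ((norm z)\<^sup>2) \<partial>lborel) = (\<integral>\<^sup>+z. f ((norm (R z))\<^sup>2) * indicator C (R z) \<partial>lborel)"
  proof -
    have "(\<integral>\<^sup>+z\<in>C. f ((norm z)\<^sup>2) \<partial>distr lborel borel R) = (\<integral>\<^sup>+z. f ((norm (R z))\<^sup>2) * indicator C (R z) \<partial>lborel)"
      by (rule nn_integral_distr) measurable
    then show ?thesis unfolding R .
  qed
  also have "\<dots> = (\<integral>\<^sup>+z. f ((norm z)\<^sup>2) * indicator W z + f ((norm z)\<^sup>2) * indicator W' (M z) \<partial>lborel)"
  proof (rule nn_integral_cong_AE, rule eventually_mono[OF AE_plane_line[of 0 1]])
    fix z :: "real \<times> real" assume "0 * fst z + 1 * snd z \<noteq> 0"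
    then have z: "snd z \<noteq> 0" by simp
    have "snd z \<le> t * fst z" if "0 < fst z" "snd z < 0"
      using mult_nonneg_nonneg[OF tt(1), of "fst z"] that by linarith
    moreover have "- (t' * fst z) \<le> snd z" if "0 < fst z" "snd z > 0"
      using mult_nonneg_nonneg[OF tt(2), of "fst z"] that by linarith
    ultimately have "indicator C (R z) = (indicator W z + indicator W' (M z) :: ennreal)"
      using z by (cases "snd z > 0")
        (auto simp: indicator_def mem W_def W'_def M_def split_beta')
    then show "f ((norm (R z))\<^sup>2) * indicator C (R z) = f ((norm z)\<^sup>2) * indicator W z + f ((norm z)\<^sup>2) * indicator W' (M z)"
      by (simp add: Rn distrib_left)
  qed (simp add: zero_prod_def)
  also have "\<dots> = (\<integral>\<^sup>+z. f ((norm z)\<^sup>2) * indicator W z \<partial>lborel) + (\<integral>\<^sup>+z. f ((norm z)\<^sup>2) * indicator W' (M z) \<partial>lborel)"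
    by (rule nn_integral_add) measurable
  also have "(\<integral>\<^sup>+z. f ((norm z)\<^sup>2) * indicator W' (M z) \<partial>lborel) = (\<integral>\<^sup>+z. f ((norm (M z))\<^sup>2) * indicator W' (M z) \<partial>lborel)"
    by (intro nn_integral_cong) (simp add: M_def split_beta' norm_prod_def)
  also have "\<dots> = (\<integral>\<^sup>+z. f ((norm z)\<^sup>2) * indicator W' z \<partial>distr lborel borel M)"
    by (rule nn_integral_distr[symmetric]) measurable
  finally show ?thesis unfolding M wedge_def C_def[symmetric] W_def W'_def t_def t'_def .
qed

text \<open>The three linear forms measure the distance along the outward unit normals of the sides,
  and \<open>c12\<close>, \<open>s12\<close>, \<open>c13\<close>, ... are the cosines and sines of
  the angles of the triangle. A point is assigned to the side whose form divided by its distance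
  \<open>d1\<close>, \<open>d2\<close>, \<open>d3\<close> is largest; this cuts the triangle from
  the origin into three pieces for \<open>cone_integral\<close>.\<close>

theorem triangle_integral:
  fixes f :: "real \<Rightarrow> ennreal"
  assumes [measurable]: "f \<in> borel_measurable borel"
    and cs: "c12\<^sup>2 + s12\<^sup>2 = 1" "c13\<^sup>2 + s13\<^sup>2 = 1" "c23 = s12 * s13 - c12 * c13" "s23 = s12 * c13 + c12 * s13"
    and s: "s12 > 0" "s13 > 0" "s23 > 0" and c: "c12 \<ge> 0" "c13 \<ge> 0" "c23 \<ge> 0"
    and d: "d1 \<ge> 0" "d2 \<ge> 0" "d3 \<ge> 0"
  shows "(\<integral>\<^sup>+z\<in>{z. fst z \<le> d1 \<and> - c12 * fst z + s12 * snd z \<le> d2 \<and> - c13 * fst z - s13 * snd z \<le> d3}. f ((norm z)\<^sup>2) \<partial>lborel) =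
    wedge f d1 ((d2 + c12 * d1) / (s12 * d1)) + wedge f d1 ((d3 + c13 * d1) / (s13 * d1)) +
    wedge f d2 ((d3 + c23 * d2) / (s23 * d2)) + wedge f d2 ((d1 + c12 * d2) / (s12 * d2)) +
    wedge f d3 ((d1 + c13 * d3) / (s13 * d3)) + wedge f d3 ((d2 + c23 * d3) / (s23 * d3))"
    (is "(\<integral>\<^sup>+z\<in>?T. _ \<partial>lborel) = _")
proof -
  define a1 a2 a3 where "a1 z = fst z" and "a2 z = - c12 * fst z + s12 * snd z" and "a3 z = - c13 * fst z - s13 * snd z"
    for z :: "real \<times> real"
  note a_def = a1_def a2_def a3_def
  define C1 where "C1 = {z. 0 < a1 z \<and> a1 z \<le> d1 \<and> d1 * a2 z \<le> d2 * a1 z \<and> d1 * a3 z \<le> d3 * a1 z}"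
  define C2 where "C2 = {z. 0 < a2 z \<and> a2 z \<le> d2 \<and> d2 * a3 z \<le> d3 * a2 z \<and> d2 * a1 z \<le> d1 * a2 z}"
  define C3 where "C3 = {z. 0 < a3 z \<and> a3 z \<le> d3 \<and> d3 * a1 z \<le> d1 * a3 z \<and> d3 * a2 z \<le> d2 * a3 z}"
  have [measurable]: "C1 \<in> sets borel" "C2 \<in> sets borel" "C3 \<in> sets borel"
    unfolding C1_def C2_def C3_def a_def by measurable
  have I1: "(\<integral>\<^sup>+z\<in>C1. f ((norm z)\<^sup>2) \<partial>lborel) = wedge f d1 ((d2 + c12 * d1) / (s12 * d1)) + wedge f d1 ((d3 + c13 * d1) / (s13 * d1))"
    using cone_integral[OF assms(1), of 1 0 s12 s13 d1 c12 c13 d2 d3] s c d by (simp add: C1_def a_def)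
  have I2: "(\<integral>\<^sup>+z\<in>C2. f ((norm z)\<^sup>2) \<partial>lborel) = wedge f d2 ((d3 + c23 * d2) / (s23 * d2)) + wedge f d2 ((d1 + c12 * d2) / (s12 * d2))"
  proof -
    have e: "- c23 * (- c12 * fst z + s12 * snd z) + s23 * (- s12 * fst z + - c12 * snd z) = a3 z"
      "- c12 * (- c12 * fst z + s12 * snd z) - s12 * (- s12 * fst z + - c12 * snd z) = a1 z" for z
      using cs unfolding a_def by algebra+
    show ?thesis
      using cone_integral[OF assms(1), of "- c12" s12 s23 s12 d2 c23 c12 d3 d1, unfolded e] s c d cs(1)
      by (simp add: C2_def a_def)
  qed
  have I3: "(\<integral>\<^sup>+z\<in>C3. f ((norm z)\<^sup>2) \<partial>lborel) = wedge f d3 ((d1 + c13 * d3) / (s13 * d3)) + wedge f d3 ((d2 + c23 * d3) / (s23 * d3))"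
  proof -
    have e: "- c13 * (- c13 * fst z + - s13 * snd z) + s13 * (- (- s13) * fst z + - c13 * snd z) = a1 z"
      "- c23 * (- c13 * fst z + - s13 * snd z) - s23 * (- (- s13) * fst z + - c13 * snd z) = a2 z" for z
      using cs unfolding a_def by algebra+
    show ?thesis
      using cone_integral[OF assms(1), of "- c13" "- s13" s13 s23 d3 c13 c23 d1 d2, unfolded e] s c d cs(2)
      by (simp add: C3_def a_def)
  qed
  \<comment> \<open>Outward unit normals weighted by the side lengths sum to zero, and by the sine
    rule the side lengths are proportional to the sines of the opposite angles. Hence some form is
    positive wherever \<open>a1 z \<noteq> 0\<close>.\<close>
  have zero: "s23 * a1 z + s13 * a2 z + s12 * a3 z = 0" for z
    using cs unfolding a_def by algebra
  have AE: "AE z in lborel. indicator ?T z = (indicator C1 z + indicator C2 z + indicator C3 z :: ennreal)"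
  proof -
    \<comment> \<open>Points where two quotients tie lie on lines through the origin, which are null
      sets.\<close>
    have A12: "AE z in lborel. d1 > 0 \<longrightarrow> d1 * a2 z \<noteq> d2 * a1 z"
      using AE_plane_line[of "- d1 * c12 - d2" "d1 * s12"] s
      by (cases "d1 > 0") (auto simp: a_def zero_prod_def algebra_simps elim!: eventually_mono)
    have A13: "AE z in lborel. d1 > 0 \<longrightarrow> d1 * a3 z \<noteq> d3 * a1 z"
      using AE_plane_line[of "- d1 * c13 - d3" "- d1 * s13"] s
      by (cases "d1 > 0") (auto simp: a_def zero_prod_def algebra_simps elim!: eventually_mono)
    have A23: "AE z in lborel. d2 > 0 \<longrightarrow> d2 * a3 z \<noteq> d3 * a2 z"
    proof (cases "d2 > 0")
      case True
      have "(- d2 * c13 + d3 * c12, - d2 * s13 - d3 * s12) \<noteq> 0"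
      proof -
        have "d2 * s13 + d3 * s12 > 0"
          using True s d by (intro add_pos_nonneg mult_pos_pos mult_nonneg_nonneg) auto
        then show ?thesis by (auto simp: zero_prod_def)
      qed
      from AE_plane_line[OF this] show ?thesis by (auto simp: a_def algebra_simps elim!: eventually_mono)
    qed simp
    have A0: "AE z in lborel. a1 z \<noteq> 0" using AE_plane_line[of 1 0] by (simp add: a_def zero_prod_def)
    show ?thesis
      using A12 A13 A23 A0
    proof eventually_elim
      case (elim z)
      have sub: "z \<in> ?T" if "z \<in> C1 \<or> z \<in> C2 \<or> z \<in> C3"
      proof -
        have *: "b \<le> q" if "0 < x" "x \<le> p" "p * b \<le> q * x" "q \<ge> 0" for b x p q :: real
        proof -
          have "q * x \<le> q * p" using that by (intro mult_left_mono) auto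
          then have "p * b \<le> p * q" using that(3) mult.commute[of q p] by linarith
          moreover have "p > 0" using that by linarith
          ultimately show ?thesis by (simp only: mult_le_cancel_left_pos)
        qed
        have "z \<in> ?T \<longleftrightarrow> a1 z \<le> d1 \<and> a2 z \<le> d2 \<and> a3 z \<le> d3" by (simp add: a_def)
        then show ?thesis using that d
          by (auto simp: C1_def C2_def C3_def intro: *)
      qed
      have dis: "\<not> (z \<in> C1 \<and> z \<in> C2)" "\<not> (z \<in> C1 \<and> z \<in> C3)" "\<not> (z \<in> C2 \<and> z \<in> C3)"
        using elim by (force simp: C1_def C2_def C3_def)+
      have ex: "z \<in> C1 \<or> z \<in> C2 \<or> z \<in> C3" if "z \<in> ?T"
      proof -
        have le: "a1 z \<le> d1" "a2 z \<le> d2" "a3 z \<le> d3" using that by (auto simp: a_def)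
        define a where "a k = (if k = 0 then a1 z else if k = 1 then a2 z else a3 z)" for k :: nat
        define e where "e k = (if k = 0 then d1 else if k = 1 then d2 else d3)" for k :: nat
        \<comment> \<open>Only indices with a positive form compete: on the triangle these have
          \<open>e k > 0\<close>, so the quotient is meaningful even when the origin lies on some
          side.\<close>
        define P where "P = {k. k < 3 \<and> a k > 0}"
        have "P \<noteq> {}"
        proof
          assume "P = {}"
          then have "\<not> a 0 > 0" "\<not> a 1 > 0" "\<not> a 2 > 0" by (auto simp: P_def)
          then have "a1 z \<le> 0" "a2 z \<le> 0" "a3 z \<le> 0" by (simp_all add: a_def)
          then have "s23 * a1 z \<le> 0" "s13 * a2 z \<le> 0" "s12 * a3 z \<le> 0" using s by (simp_all add: mult_le_0_iff)
          then have "s23 * a1 z = 0" using zero[of z] by linarith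
          then show False using s elim by simp
        qed
        moreover have "finite P" by (simp add: P_def)
        ultimately have "Max ((\<lambda>k. a k / e k) ` P) \<in> (\<lambda>k. a k / e k) ` P" by (intro Max_in) auto
        then obtain k where k: "k \<in> P" and kmax: "Max ((\<lambda>k. a k / e k) ` P) = a k / e k" by auto
        have max: "a q / e q \<le> a k / e k" if "q \<in> P" for q
          unfolding kmax[symmetric] using that \<open>finite P\<close> by (intro Max_ge) auto
        have ae: "a k \<le> e k" if "k < 3" for k using le that by (auto simp: a_def e_def)
        have e0: "e k \<ge> 0" for k using d by (simp add: e_def)
        have k': "k < 3" "0 < a k" "e k > 0" using k ae[of k] by (auto simp: P_def)
        have all: "e k * a q \<le> e q * a k" if "q < 3" for q
        proof (cases "a q > 0")
          case True
          then have "e q > 0" using ae[of q] that by auto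
          then show ?thesis using max[of q] True that k' by (simp add: P_def field_simps)
        next
          case False
          then have "e k * a q \<le> 0" using e0[of k] by (simp add: mult_nonneg_nonpos)
          also have "0 \<le> e q * a k" using e0[of q] k' by simp
          finally show ?thesis .
        qed
        from k'(1) consider "k = 0" | "k = 1" | "k = 2" by linarith
        then show ?thesis
        proof cases
          case 1 then have "z \<in> C1" using k' all[of 1] all[of 2] ae[of 0] by (simp add: C1_def a_def e_def)
          then show ?thesis by simp
        next
          case 2 then have "z \<in> C2" using k' all[of 0] all[of 2] ae[of 1] by (simp add: C2_def a_def e_def)
          then show ?thesis by simp
        next
          case 3 then have "z \<in> C3" using k' all[of 0] all[of 1] ae[of 2] by (simp add: C3_def a_def e_def)
          then show ?thesis by simp
        qed
      qed
      have T: "z \<in> ?T \<longleftrightarrow> z \<in> C1 \<or> z \<in> C2 \<or> z \<in> C3" using sub ex by blast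
      show ?case unfolding indicator_def T using dis
        by (cases "z \<in> C1"; cases "z \<in> C2"; cases "z \<in> C3") simp_all
    qed
  qed
  have "(\<integral>\<^sup>+z\<in>?T. f ((norm z)\<^sup>2) \<partial>lborel) =
    (\<integral>\<^sup>+z. f ((norm z)\<^sup>2) * indicator C1 z + f ((norm z)\<^sup>2) * indicator C2 z + f ((norm z)\<^sup>2) * indicator C3 z \<partial>lborel)"
    by (rule nn_integral_cong_AE, use AE in eventually_elim) (simp add: distrib_left)
  also have "\<dots> = (\<integral>\<^sup>+z\<in>C1. f ((norm z)\<^sup>2) \<partial>lborel) + (\<integral>\<^sup>+z\<in>C2. f ((norm z)\<^sup>2) \<partial>lborel) + (\<integral>\<^sup>+z\<in>C3. f ((norm z)\<^sup>2) \<partial>lborel)"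
    by (subst nn_integral_add, measurable)+
  finally show ?thesis unfolding I1 I2 I3 by (simp add: add.assoc)
qed

section \<open>The Lobachevsky function\<close>

definition log_sin :: "real \<Rightarrow> real" where "log_sin t = ln \<bar>2 * sin t\<bar>"

text \<open>A linear minorant makes \<open>log_sin\<close> integrable at 0. The interval reaches 2
  pi / 3 because sums \<gamma> + \<alpha> of two angles up to pi / 3 occur later. Up to pi / 3 the
  derivative is at least 1 / 2; beyond, the sine is at least sqrt 3 / 2 while t / 4 stays below 2 /
  3.\<close>

lemma sin_ge_quarter:
  assumes "0 \<le> t" "t \<le> 2 * pi / 3"
  shows "t / 4 \<le> sin t"
proof (cases "t \<le> pi / 3")
  case True
  have "0 / 2 - sin 0 \<ge> t / 2 - sin t"
  proof (rule DERIV_nonpos_imp_nonincreasing[OF assms(1)])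
    fix x assume x: "0 \<le> x" "x \<le> t"
    have "cos (pi / 3) \<le> cos x" using x True by (intro cos_monotone_0_pi_le) auto
    then show "\<exists>y. ((\<lambda>t. t / 2 - sin t) has_real_derivative y) (at x) \<and> y \<le> 0"
      by (intro exI[of _ "1 / 2 - cos x"]) (auto intro!: derivative_eq_intros simp: cos_60)
  qed
  then show ?thesis using assms by simp
next
  case False
  have "\<bar>t - pi / 2\<bar> \<le> pi / 6" using assms False by linarith
  then have "cos (pi / 6) \<le> cos \<bar>t - pi / 2\<bar>" by (intro cos_monotone_0_pi_le) auto
  then have "sqrt 3 / 2 \<le> sin t" by (simp add: cos_30 sin_cos_eq abs_minus_commute flip: cos_minus[of "t - pi/2"])
  moreover have "sqrt 3 \<ge> 17 / 10" by (rule real_le_rsqrt) (simp add: power2_eq_square)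
  moreover have "t \<le> 8 / 3" using assms pi_less_4 by linarith
  ultimately show ?thesis by linarith
qed

lemma log_sin_integrable:
  assumes "0 \<le> a" "b \<le> 2 * pi / 3"
  shows "set_integrable lborel {a..b} log_sin"
proof -
  have "(\<lambda>x. x powr (- 1 / 2)) absolutely_integrable_on {0..2 * pi / 3 :: real}"
    using has_integral_powr_from_0[of "- 1 / 2" "2 * pi / 3"]
    by (intro nonnegative_absolutely_integrable_1) (auto simp: integrable_on_def)
  then have "set_integrable lborel {0..2 * pi / 3} (\<lambda>x. x powr (- 1 / 2))"
    by (simp add: set_integrable_def integrable_completion)
  \<comment> \<open>The majorant comes from ln y \<le> y - 1 at y = x^(-1/2), which bounds the
    logarithmic singularity by an integrable power.\<close>
  then have int: "set_integrable lborel {0..2 * pi / 3} (\<lambda>x. 4 * x powr (- 1 / 2) + 1)"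
    by (intro set_integral_add set_integrable_mult_right) (simp_all add: set_integrable_def)
  have [measurable]: "log_sin \<in> borel_measurable borel" unfolding log_sin_def by measurable
  have "set_integrable lborel {0..2 * pi / 3} log_sin"
  proof (rule set_integrable_bound[OF int])
    show "set_borel_measurable lborel {0..2 * pi / 3} log_sin" unfolding set_borel_measurable_def by measurable
    have "norm (log_sin x) \<le> norm (4 * x powr (- 1 / 2) + 1)" if x: "0 \<le> x" "x \<le> 2 * pi / 3" for x
    proof (cases "x = 0")
      case False
      then have x0: "x > 0" using x by simp
      have s: "x / 4 \<le> sin x" by (rule sin_ge_quarter[OF x])
      have "ln (2 * sin x) \<le> ln 2" using s x0 sin_le_one[of x] by (subst ln_le_cancel_iff) auto
      also have "ln 2 \<le> (1 :: real)" using ln_le_minus_one[of 2] by simp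
      finally have 1: "ln (2 * sin x) \<le> 1" .
      have "ln (x / 2) \<le> ln (2 * sin x)" using s x0 by (subst ln_le_cancel_iff) auto
      moreover have "- ln (x / 2) \<le> 4 * x powr (- 1 / 2) + 1"
      proof -
        have "- ln (x / 2) = 2 * ln (x powr (- 1 / 2)) + ln 2" using x0 by (simp add: ln_div ln_powr)
        also have "\<dots> \<le> 2 * (x powr (- 1 / 2) - 1) + 1"
          using ln_le_minus_one[of "x powr (- 1 / 2)"] ln_le_minus_one[of "2::real"] x0 by simp
        also have "\<dots> \<le> 4 * x powr (- 1 / 2) + 1" by simp
        finally show ?thesis .
      qed
      ultimately have "\<bar>ln (2 * sin x)\<bar> \<le> 4 * x powr (- 1 / 2) + 1" using 1 by (simp add: abs_le_iff) (use powr_ge_zero[of x "- (1 / 2)"] in linarith)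
      then show ?thesis using s x0 by (simp add: log_sin_def)
    qed (simp add: log_sin_def)
    then show "AE x\<in>{0..2 * pi / 3} in lborel. norm (log_sin x) \<le> norm (4 * x powr (- 1 / 2) + 1)" by auto
  qed
  then show ?thesis by (rule set_integrable_subset) (use assms in auto)
qed

abbreviation log_sin_integral :: "real \<Rightarrow> real \<Rightarrow> real" where
  "log_sin_integral a b \<equiv> (LINT t:{a..b}|lborel. log_sin t)"

lemma lobachevsky_log_sin: "0 \<le> \<theta> \<Longrightarrow> lobachevsky \<theta> = - log_sin_integral 0 \<theta>"
  by (simp add: lobachevsky_def interval_integral_Icc log_sin_def[abs_def])

lemma log_sin_integral_lobachevsky:
  assumes "0 \<le> a" "a \<le> b" "b \<le> 2 * pi / 3"
  shows "log_sin_integral a b = lobachevsky a - lobachevsky b"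
proof -
  have i: "set_integrable lborel {0..a} log_sin" "set_integrable lborel {a..b} log_sin" "set_integrable lborel {0..b} log_sin"
    using assms by (auto intro!: log_sin_integrable)
  note HK = this[THEN set_borel_integral_eq_integral(2)] and HKi = this(3)[THEN set_borel_integral_eq_integral(1)]
  have "log_sin_integral 0 a + log_sin_integral a b = log_sin_integral 0 b"
    unfolding HK using assms HKi by (intro Henstock_Kurzweil_Integration.integral_combine) auto
  then show ?thesis using assms by (simp add: lobachevsky_log_sin)
qed

text \<open>Real part of the logarithm series at z = r e^(2 i t). The term with \<open>n = 0\<close>
  is 0, as division by zero yields 0.\<close>

lemma cos_series:
  assumes r: "0 \<le> r" "r < 1"
  shows "(\<lambda>n. r ^ n * cos (2 * real n * t) / real n) sums (- ln (1 - 2 * r * cos (2 * t) + r\<^sup>2) / 2)"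
proof -
  define z where "z = complex_of_real r * cis (2 * t)"
  have nz: "cmod z < 1" using r by (simp add: z_def norm_mult)
  have "(\<lambda>n. - (z ^ n) / of_nat n) sums ln (1 - z)"
    using Ln_series'[of "- z"] nz by simp
  from sums_minus[OF sums_Re[OF this]]
  have "(\<lambda>n. Re (z ^ n / of_nat n)) sums - Re (ln (1 - z))" by simp
  moreover have "Re (z ^ n / of_nat n) = r ^ n * cos (2 * real n * t) / real n" for n
    by (simp add: z_def power_mult_distrib Complex.DeMoivre mult_ac Re_divide_of_nat flip: of_real_power)
  moreover have "Re (ln (1 - z)) = ln (1 - 2 * r * cos (2 * t) + r\<^sup>2) / 2"
  proof -
    have ne: "1 - z \<noteq> 0" using nz by auto
    have "(cmod (1 - z))\<^sup>2 = 1 - 2 * r * cos (2 * t) + r\<^sup>2 * ((cos (2 * t))\<^sup>2 + (sin (2 * t))\<^sup>2)"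
      by (simp add: cmod_power2 z_def power_mult_distrib sin_squared_eq power2_diff) (simp add: algebra_simps)
    then have "(cmod (1 - z))\<^sup>2 = 1 - 2 * r * cos (2 * t) + r\<^sup>2" by simp
    moreover have "ln ((cmod (1 - z))\<^sup>2) = 2 * ln (cmod (1 - z))" using ne by (simp add: ln_realpow)
    ultimately show ?thesis using ne by simp
  qed
  ultimately show ?thesis by (simp only: minus_divide_left)
qed

text \<open>The quantity is |1 - r e^(2 i t)|^2 = (1 - r)^2 + 4 r (sin t)^2. The bounds are uniform
  in \<open>r\<close> and so provide an integrable majorant for the limit r to 1.\<close>

lemma poisson_bounds:
  assumes r: "0 \<le> r" "r \<le> (1::real)"
  shows "(sin t)\<^sup>2 \<le> 1 - 2 * r * cos (2 * t) + r\<^sup>2" "1 - 2 * r * cos (2 * t) + r\<^sup>2 \<le> 4"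
proof -
  define s where "s = (sin t)\<^sup>2"
  have c: "cos (2 * t) = 1 - 2 * s" by (simp add: s_def cos_double_sin)
  have s: "0 \<le> s" "s \<le> 1" unfolding s_def by (simp_all add: abs_square_le_1)
  have e: "1 - 2 * r * cos (2 * t) + r\<^sup>2 = (1 - r)\<^sup>2 + 4 * r * s"
    unfolding c by (simp add: power2_eq_square algebra_simps)
  have "(1 - r)\<^sup>2 + 4 * r * s - s = (1 - r)\<^sup>2 * (1 - s) + s * (r * (2 + r))"
    by (simp add: power2_eq_square algebra_simps)
  also have "\<dots> \<ge> 0" using r s by (intro add_nonneg_nonneg mult_nonneg_nonneg) auto
  finally show "(sin t)\<^sup>2 \<le> 1 - 2 * r * cos (2 * t) + r\<^sup>2" by (simp add: e s_def)
  have "r * s \<le> r * 1" using r s by (intro mult_left_mono) auto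
  moreover have "r * r \<le> 1 * 1" using r by (intro mult_mono) auto
  ultimately show "1 - 2 * r * cos (2 * t) + r\<^sup>2 \<le> 4"
    unfolding e using r by (simp add: power2_eq_square algebra_simps)
qed

text \<open>Abel summation: at r = 1 the cosine series of the integrand does not converge absolutely
  in general, so it is integrated term by term for r < 1. The limit r to 1 is taken by Tannery's
  theorem in the series and by dominated convergence in the integral.\<close>

theorem lobachevsky_fourier:
  assumes \<theta>: "0 \<le> \<theta>" "\<theta> \<le> 2 * pi / 3"
  shows "lobachevsky \<theta> = (\<Sum>n. sin (2 * real n * \<theta>) / (real n)\<^sup>2) / 2"
proof -
  define A where "A r t = - ln (1 - 2 * r * cos (2 * t) + r\<^sup>2) / 2" for r t :: real
  define a where "a r n = r ^ n * sin (2 * real n * \<theta>) / (2 * (real n)\<^sup>2)" for r n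
  define R where "R k = real (Suc k) / real (Suc (Suc k))" for k
  have R: "0 \<le> R k" "R k < 1" for k by (simp_all add: R_def)
  have R_lim: "R \<longlonglongrightarrow> 1" unfolding R_def by real_asymp
  have int: "(\<Sum>n. a r n) = (LINT t|lborel. indicator {0..\<theta>} t * A r t)" if r: "0 \<le> r" "r < 1" for r
  proof -
    let ?f = "\<lambda>n t. (r ^ n * cos (2 * real n * t) / real n) * indicator {0..\<theta>} t"
    have bI: "has_bochner_integral lborel (?f n) (a r n)" for n
    proof (cases "n = 0")
      case False
      have "has_bochner_integral lborel (?f n) (r ^ n * sin (2 * real n * \<theta>) / (2 * (real n)\<^sup>2) - r ^ n * sin (2 * real n * 0) / (2 * (real n)\<^sup>2))"
        by (rule has_bochner_integral_FTC_Icc_real)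
           (use \<theta> False in \<open>auto intro!: derivative_eq_intros continuous_intros simp: power2_eq_square\<close>)
      then show ?thesis by (simp add: a_def)
    qed (simp add: a_def has_bochner_integral_zero)
    have bnd: "norm (?f n t) \<le> r ^ n * indicator {0..\<theta>} t" for n t
    proof (cases "n = 0")
      case False
      have "\<bar>r ^ n * cos (2 * real n * t) / real n\<bar> \<le> r ^ n * 1 / 1"
        unfolding abs_mult abs_divide using r False by (intro frac_le mult_left_mono mult_mono) auto
      then show ?thesis by (auto simp: indicator_def)
    qed (use r in simp)
    have I: "integrable lborel (?f n)" for n using bI[of n] by (simp add: has_bochner_integral_iff)
    have "(\<lambda>n. \<integral>t. ?f n t \<partial>lborel) sums (\<integral>t. (\<Sum>n. ?f n t) \<partial>lborel)"
    proof (rule sums_integral[OF I])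
      have geo: "summable (\<lambda>n. r ^ n * c)" for c using r by (intro summable_mult2 summable_geometric) simp
      show "AE t in lborel. summable (\<lambda>n. norm (?f n t))"
      proof (rule AE_I2)
        show "summable (\<lambda>n. norm (?f n t))" for t
          by (rule summable_comparison_test'[OF geo[of "indicator {0..\<theta>} t"], of 0]) (use bnd[of _ t] in simp)
      qed
      have "(\<integral>t. norm (?f n t) \<partial>lborel) \<le> r ^ n * \<theta>" for n
      proof -
        have "(\<integral>t. norm (?f n t) \<partial>lborel) \<le> (\<integral>t. r ^ n * indicator {0..\<theta>} t \<partial>lborel)"
          by (intro integral_mono bnd integrable_norm I integrable_mult_right) (simp add: integrable_indicator_iff emeasure_lborel_Icc_eq)
        then show ?thesis using \<theta> by simp
      qed
      then show "summable (\<lambda>n. \<integral>t. norm (?f n t) \<partial>lborel)"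
        by (intro summable_comparison_test'[OF geo[of \<theta>], of 0]) (simp add: integral_nonneg_AE)
    qed
    moreover have "(\<integral>t. ?f n t \<partial>lborel) = a r n" for n using bI[of n] by (simp add: has_bochner_integral_iff)
    moreover have "(\<Sum>n. ?f n t) = indicator {0..\<theta>} t * A r t" for t
      using sums_mult2[OF cos_series[OF r, of t], of "indicator {0..\<theta>} t"] by (simp add: sums_iff A_def mult.commute)
    ultimately show ?thesis by (simp add: sums_iff)
  qed
  have lhs: "(\<lambda>k. \<Sum>n. a (R k) n) \<longlonglongrightarrow> (\<Sum>n. a 1 n)"
  proof -
    have sum: "summable (\<lambda>n. 1 / (real n)\<^sup>2)" using inverse_power_summable[of 2, where 'a=real] by (simp add: inverse_eq_divide)
    have bound: "norm (a (R k) n) \<le> 1 / (real n)\<^sup>2" for n k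
    proof (cases "n = 0")
      case False
      have "R k ^ n \<le> 1" using R[of k] by (intro power_le_one) auto
      then have "\<bar>R k ^ n * sin (2 * real n * \<theta>)\<bar> \<le> 1 * 1" unfolding abs_mult using R[of k] by (intro mult_mono) auto
      then have "\<bar>R k ^ n * sin (2 * real n * \<theta>)\<bar> / (2 * (real n)\<^sup>2) \<le> 1 / (real n)\<^sup>2"
        by (intro frac_le) (use False in auto)
      then show ?thesis by (simp add: a_def abs_mult)
    qed (simp add: a_def)
    have lim: "(\<lambda>k. a (R k) n) \<longlonglongrightarrow> a 1 n" for n
    proof (cases "n = 0")
      case False
      then show ?thesis unfolding a_def by (intro tendsto_intros R_lim) auto
    qed (simp add: a_def)
    have "eventually (\<lambda>(n, k). norm (a (R k) n) \<le> 1 / (real n)\<^sup>2) (at_top \<times>\<^sub>F sequentially)"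
      using bound by (intro always_eventually) auto
    from tannerys_theorem[OF lim this sum] show ?thesis by simp
  qed
  have rhs: "(\<lambda>k. LINT t|lborel. indicator {0..\<theta>} t * A (R k) t) \<longlonglongrightarrow> (LINT t|lborel. indicator {0..\<theta>} t * (- log_sin t))"
  proof (rule integral_dominated_convergence[where w = "\<lambda>t. indicator {0..\<theta>} t * (3 + \<bar>log_sin t\<bar>)"])
    have [measurable]: "log_sin \<in> borel_measurable borel" unfolding log_sin_def by measurable
    show "(\<lambda>t. indicator {0..\<theta>} t * (- log_sin t)) \<in> borel_measurable lborel" by measurable
    show "(\<lambda>t. indicator {0..\<theta>} t * A (R k) t) \<in> borel_measurable lborel" for k unfolding A_def by measurable
    have "set_integrable lborel {0..\<theta>} (\<lambda>t. 3 + \<bar>log_sin t\<bar>)"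
      using set_integrable_abs[OF log_sin_integrable[of 0 \<theta>]] \<theta>
      by (intro set_integral_add) (auto simp: set_integrable_def integrable_indicator_iff emeasure_lborel_Icc_eq)
    then show "integrable lborel (\<lambda>t. indicator {0..\<theta>} t * (3 + \<bar>log_sin t\<bar>))" by (simp add: set_integrable_def)
    have pos: "sin t > 0" if "0 < t" "t \<le> \<theta>" for t using that \<theta> sin_ge_quarter[of t] by auto
    have nz: "AE t in lborel. t \<noteq> (0::real)" by (rule AE_lborel_singleton)
    show "AE t in lborel. (\<lambda>k. indicator {0..\<theta>} t * A (R k) t) \<longlonglongrightarrow> indicator {0..\<theta>} t * (- log_sin t)"
      using nz
    proof eventually_elim
      case (elim t)
      show ?case
      proof (cases "t \<in> {0..\<theta>}")
        case True
        then have s: "sin t > 0" using elim pos by auto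
        have e: "1 - 2 * 1 * cos (2 * t) + 1\<^sup>2 = (2 * sin t)\<^sup>2"
          by (simp add: cos_double_sin power2_eq_square)
        have "(\<lambda>k. A (R k) t) \<longlonglongrightarrow> A 1 t"
          unfolding A_def by (intro tendsto_intros R_lim) (use s e in auto)
        moreover have "A 1 t = - log_sin t"
          unfolding A_def e log_sin_def using s by (subst ln_realpow) simp_all
        ultimately show ?thesis by (intro tendsto_mult) auto
      qed simp
    qed
    show "AE t in lborel. norm (indicator {0..\<theta>} t * A (R k) t) \<le> indicator {0..\<theta>} t * (3 + \<bar>log_sin t\<bar>)" for k
      using nz
    proof eventually_elim
      case (elim t)
      show ?case
      proof (cases "t \<in> {0..\<theta>}")
        case True
        then have s: "sin t > 0" using elim pos by auto
        let ?E = "1 - 2 * R k * cos (2 * t) + (R k)\<^sup>2"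
        have b: "(sin t)\<^sup>2 \<le> ?E" "?E \<le> 4" using poisson_bounds[of "R k" t] R[of k] by auto
        have "0 < (sin t)\<^sup>2" using s by simp
        moreover from this have "0 < ?E" using b(1) by linarith
        ultimately have "ln ((sin t)\<^sup>2) \<le> ln ?E" "ln ?E \<le> ln 4"
          using b by (simp_all only: ln_le_cancel_iff zero_less_numeral)
        moreover have "ln ((sin t)\<^sup>2) = 2 * log_sin t - 2 * ln 2"
          using s by (subst ln_realpow) (simp_all add: log_sin_def ln_mult)
        moreover have "ln 2 \<le> (1 :: real)" "ln 4 \<le> (3 :: real)" using ln_le_minus_one[of 2] ln_le_minus_one[of "4::real"] by auto
        ultimately have "\<bar>ln ?E\<bar> \<le> 2 * (3 + \<bar>log_sin t\<bar>)" by (auto simp: abs_le_iff)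
        then show ?thesis using True by (simp add: A_def)
      qed simp
    qed
  qed
  have "(\<Sum>n. a 1 n) = (LINT t|lborel. indicator {0..\<theta>} t * (- log_sin t))"
    using LIMSEQ_unique[OF lhs] rhs int[OF R] by simp
  also have "\<dots> = lobachevsky \<theta>" using \<theta> by (simp add: lobachevsky_log_sin set_lebesgue_integral_def)
  also have "(\<Sum>n. a 1 n) = (\<Sum>n. sin (2 * real n * \<theta>) / (real n)\<^sup>2) / 2"
  proof -
    have "summable (\<lambda>n. sin (2 * real n * \<theta>) / (real n)\<^sup>2)"
    proof (rule summable_comparison_test')
      show "summable (\<lambda>n. 1 / (real n)\<^sup>2)" using inverse_power_summable[of 2, where 'a=real] by (simp add: inverse_eq_divide)
    qed (auto simp: divide_right_mono)
    from suminf_divide[OF this, of 2] show ?thesis by (simp add: a_def mult.commute)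
  qed
  finally show ?thesis by simp
qed

section \<open>Evaluation and estimation of the integrals over right triangles\<close>

lemma wedge_slices:
  assumes [measurable]: "f \<in> borel_measurable borel"
  shows "wedge f d t = (\<integral>\<^sup>+s\<in>{0..t}. (\<integral>\<^sup>+x\<in>{0<..d}. ennreal x * f (x\<^sup>2 * (1 + s\<^sup>2)) \<partial>lborel) \<partial>lborel)"
proof -
  define I where "I x y = f (x\<^sup>2 + y\<^sup>2) * indicator {0<..d} x * indicator {0..} y * indicator {0..} (t * x - y)" for x y :: real
  have I_meas [measurable (raw)]: "(\<lambda>x. I (a x) (b x)) \<in> borel_measurable M"
    if [measurable]: "a \<in> borel_measurable M" "b \<in> borel_measurable M" for a b and M :: "'m measure"
    unfolding I_def by measurable
  have "wedge f d t = (\<integral>\<^sup>+z. I (fst z) (snd z) \<partial>lborel)"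
    unfolding wedge_def by (intro nn_integral_cong) (auto simp: I_def norm_plane indicator_def)
  also have "\<dots> = (\<integral>\<^sup>+x. \<integral>\<^sup>+y. I x y \<partial>lborel \<partial>lborel)"
  proof -
    have "(\<lambda>z. I (fst z) (snd z)) \<in> borel_measurable (borel \<Otimes>\<^sub>M borel)" by measurable
    from nn_integral_lborel_pair[OF this] show ?thesis by simp
  qed
  also have "\<dots> = (\<integral>\<^sup>+x. \<integral>\<^sup>+s. indicator {0<..d} x * indicator {0..t} s * (ennreal x * f (x\<^sup>2 * (1 + s\<^sup>2))) \<partial>lborel \<partial>lborel)"
  proof (rule nn_integral_cong)
    fix x :: real
    show "(\<integral>\<^sup>+y. I x y \<partial>lborel) = (\<integral>\<^sup>+s. indicator {0<..d} x * indicator {0..t} s * (ennreal x * f (x\<^sup>2 * (1 + s\<^sup>2))) \<partial>lborel)"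
    proof (cases "x > 0")
      \<comment> \<open>The substitution y = x s makes the slope \<open>s\<close> a coordinate: the
        area element becomes x dx ds and the squared radius x^2 (1 + s^2).\<close>
      case True
      have "(\<integral>\<^sup>+y. I x y \<partial>lborel) = ennreal \<bar>x\<bar> * (\<integral>\<^sup>+s. I x (0 + x * s) \<partial>lborel)"
      proof -
        have "(\<lambda>y. I x y) \<in> borel_measurable borel" by measurable
        from nn_integral_real_affine[OF this, of x 0] True show ?thesis by simp
      qed
      also have "\<dots> = (\<integral>\<^sup>+s. ennreal x * I x (x * s) \<partial>lborel)"
        using True by (subst nn_integral_cmult) simp_all
      also have "\<dots> = (\<integral>\<^sup>+s. indicator {0<..d} x * indicator {0..t} s * (ennreal x * f (x\<^sup>2 * (1 + s\<^sup>2))) \<partial>lborel)"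
      proof (rule nn_integral_cong)
        fix s
        have "indicator {0..} (x * s) * indicator {0..} (t * x - x * s) = (indicator {0..t} s :: ennreal)"
          using True by (auto simp: indicator_def zero_le_mult_iff algebra_simps)
        moreover have "x\<^sup>2 + (x * s)\<^sup>2 = x\<^sup>2 * (1 + s\<^sup>2)" by (simp add: algebra_simps power_mult_distrib)
        ultimately have "I x (x * s) = f (x\<^sup>2 * (1 + s\<^sup>2)) * indicator {0<..d} x * indicator {0..t} s"
          unfolding I_def by (simp only: mult.assoc)
        then show "ennreal x * I x (x * s) = indicator {0<..d} x * indicator {0..t} s * (ennreal x * f (x\<^sup>2 * (1 + s\<^sup>2)))"
          by (simp only: mult_ac)
      qed
      finally show ?thesis .
    qed (simp add: I_def)
  qed
  also have "\<dots> = (\<integral>\<^sup>+s. \<integral>\<^sup>+x. indicator {0<..d} x * indicator {0..t} s * (ennreal x * f (x\<^sup>2 * (1 + s\<^sup>2))) \<partial>lborel \<partial>lborel)"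
    by (rule lborel_pair.Fubini') measurable
  also have "\<dots> = (\<integral>\<^sup>+s\<in>{0..t}. (\<integral>\<^sup>+x\<in>{0<..d}. ennreal x * f (x\<^sup>2 * (1 + s\<^sup>2)) \<partial>lborel) \<partial>lborel)"
  proof (rule nn_integral_cong)
    fix s
    show "(\<integral>\<^sup>+x. indicator {0<..d} x * indicator {0..t} s * (ennreal x * f (x\<^sup>2 * (1 + s\<^sup>2))) \<partial>lborel) =
      (\<integral>\<^sup>+x\<in>{0<..d}. ennreal x * f (x\<^sup>2 * (1 + s\<^sup>2)) \<partial>lborel) * indicator {0..t} s"
      by (subst nn_integral_multc[symmetric]) (auto intro!: nn_integral_cong simp: mult_ac)
  qed
  finally show ?thesis .
qed

lemma wedge_const:
  assumes "d \<ge> 0" "t \<ge> 0" "c \<ge> 0"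
  shows "wedge (\<lambda>_. ennreal c) d t = ennreal (c * (d\<^sup>2 * t / 2))"
proof -
  have "(\<integral>\<^sup>+x\<in>{0<..d}. ennreal x * ennreal c \<partial>lborel) = (\<integral>\<^sup>+x\<in>{0..d}. ennreal (x * c) \<partial>lborel)"
    using assms by (intro nn_integral_cong) (auto simp: indicator_def ennreal_mult)
  also have "\<dots> = ennreal (d\<^sup>2 / 2 * c - 0\<^sup>2 / 2 * c)"
    by (rule nn_integral_FTC_Icc) (use assms in \<open>auto intro!: derivative_eq_intros\<close>)
  finally have inner: "(\<integral>\<^sup>+x\<in>{0<..d}. ennreal x * ennreal c \<partial>lborel) = ennreal (d\<^sup>2 / 2 * c)" by simp
  have "wedge (\<lambda>_. ennreal c) d t = (\<integral>\<^sup>+s\<in>{0..t}. ennreal (d\<^sup>2 / 2 * c) \<partial>lborel)"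
    by (subst wedge_slices) (simp_all add: inner)
  also have "\<dots> = ennreal (d\<^sup>2 / 2 * c) * ennreal t"
    using assms by (subst nn_integral_cmult_indicator) auto
  also have "\<dots> = ennreal (c * (d\<^sup>2 * t / 2))"
    using assms by (subst ennreal_mult[symmetric]) (auto simp: mult_ac)
  finally show ?thesis .
qed

text \<open>\<open>1 - r\<close> is the squared height of the unit hemisphere over a point at
  squared distance \<open>r\<close> from its centre, so this is the integrand \<open>1 / h\<close>
  of \<open>hyp_vol_region\<close>, cut off at the unit circle.\<close>

definition hyp_density :: "real \<Rightarrow> ennreal" where
  "hyp_density r = (if r < 1 then ennreal (1 / (1 - r)) else 0)"

lemma hyp_density_measurable [measurable]: "hyp_density \<in> borel_measurable borel"
  unfolding hyp_density_def by measurable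

text \<open>The second condition places the triangle in the closed unit disc. Equality puts its far
  corner on the circle, where the logarithm is singular; the single slice \<open>s = t\<close> is
  therefore dropped as a null set.\<close>

lemma wedge_hyp_density:
  assumes d: "0 \<le> d" "d\<^sup>2 * (1 + t\<^sup>2) \<le> 1"
  shows "wedge hyp_density d t = (\<integral>\<^sup>+s\<in>{0..t}. ennreal (- ln (1 - d\<^sup>2 * (1 + s\<^sup>2)) / (2 * (1 + s\<^sup>2))) \<partial>lborel)"
  unfolding wedge_slices[OF hyp_density_measurable]
proof (rule nn_integral_cong_AE, rule eventually_mono[OF AE_lborel_singleton[of t]])
  fix s :: real assume "s \<noteq> t"
  show "(\<integral>\<^sup>+x\<in>{0<..d}. ennreal x * hyp_density (x\<^sup>2 * (1 + s\<^sup>2)) \<partial>lborel) * indicator {0..t} s =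
    ennreal (- ln (1 - d\<^sup>2 * (1 + s\<^sup>2)) / (2 * (1 + s\<^sup>2))) * indicator {0..t} s"
  proof (cases "s \<in> {0..t}")
    case True
    define k where "k = 1 + s\<^sup>2"
    have k: "k > 0" by (simp add: k_def add_pos_nonneg)
    have lt: "d\<^sup>2 * k < 1"
    proof (cases "d = 0")
      case False
      have "s\<^sup>2 < t\<^sup>2" using True \<open>s \<noteq> t\<close> by (intro power_strict_mono) auto
      then have "d\<^sup>2 * k < d\<^sup>2 * (1 + t\<^sup>2)" using False by (simp add: k_def)
      then show ?thesis using d by simp
    qed simp
    have xk: "x\<^sup>2 * k < 1" if "0 \<le> x" "x \<le> d" for x
    proof -
      have "x\<^sup>2 * k \<le> d\<^sup>2 * k" using that k by (intro mult_right_mono power_mono) auto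
      then show ?thesis using lt by simp
    qed
    have "(\<integral>\<^sup>+x\<in>{0<..d}. ennreal x * hyp_density (x\<^sup>2 * k) \<partial>lborel) = (\<integral>\<^sup>+x\<in>{0..d}. ennreal (x / (1 - x\<^sup>2 * k)) \<partial>lborel)"
    proof (rule nn_integral_cong)
      fix x
      show "ennreal x * hyp_density (x\<^sup>2 * k) * indicator {0<..d} x = ennreal (x / (1 - x\<^sup>2 * k)) * indicator {0..d} x"
        using xk[of x] by (cases "x > 0 \<and> x \<le> d") (auto simp: hyp_density_def ennreal_mult[symmetric] indicator_def)
    qed
    also have "\<dots> = ennreal (- ln (1 - d\<^sup>2 * k) / (2 * k) - (- ln (1 - 0\<^sup>2 * k) / (2 * k)))"
    proof -
      have der: "((\<lambda>x. - ln (1 - x\<^sup>2 * k) / (2 * k)) has_real_derivative x / (1 - x\<^sup>2 * k)) (at x)"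
        if "0 \<le> x" "x \<le> d" for x
      proof -
        have "((\<lambda>x. 1 - x\<^sup>2 * k) has_real_derivative - (2 * x * k)) (at x)"
          by (auto intro!: derivative_eq_intros)
        from DERIV_chain2[OF DERIV_ln_divide this]
        have "((\<lambda>x. ln (1 - x\<^sup>2 * k)) has_real_derivative 1 / (1 - x\<^sup>2 * k) * - (2 * x * k)) (at x)"
          using xk[OF that] by simp
        from DERIV_cmult[OF this, of "- 1 / (2 * k)"] show ?thesis
          using k by (simp add: field_simps)
      qed
      show ?thesis by (rule nn_integral_FTC_Icc) (use der xk d in \<open>simp_all add: less_imp_le\<close>)
    qed
    finally show ?thesis by (simp add: k_def)
  qed simp
qed

text \<open>Integrates the first three terms of - ln (1 - w) = w + w^2 / 2 + w^3 / 3 + ... with w =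
  d^2 (1 + s^2); all further terms are nonnegative.\<close>

lemma wedge_hyp_density_lower:
  assumes d: "0 \<le> d" "0 \<le> t" "d\<^sup>2 * (1 + t\<^sup>2) \<le> 1"
  shows "wedge hyp_density d t \<ge> ennreal (d\<^sup>2 * t / 2 + d ^ 4 * (t + t ^ 3 / 3) / 4 + d ^ 6 * (t + 2 * t ^ 3 / 3 + t ^ 5 / 5) / 6)"
proof -
  let ?p = "\<lambda>s. d\<^sup>2 / 2 + d ^ 4 * (1 + s\<^sup>2) / 4 + d ^ 6 * (1 + s\<^sup>2)\<^sup>2 / 6"
  have eq: "(\<integral>\<^sup>+s\<in>{0..t}. ennreal (?p s) \<partial>lborel) =
    ennreal ((d\<^sup>2 * t / 2 + d ^ 4 * (t + t ^ 3 / 3) / 4 + d ^ 6 * (t + 2 * t ^ 3 / 3 + t ^ 5 / 5) / 6) -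
       (d\<^sup>2 * 0 / 2 + d ^ 4 * (0 + 0 ^ 3 / 3) / 4 + d ^ 6 * (0 + 2 * 0 ^ 3 / 3 + 0 ^ 5 / 5) / 6))"
  proof (rule nn_integral_FTC_Icc)
    fix s
    show "((\<lambda>t. d\<^sup>2 * t / 2 + d ^ 4 * (t + t ^ 3 / 3) / 4 + d ^ 6 * (t + 2 * t ^ 3 / 3 + t ^ 5 / 5) / 6) has_real_derivative ?p s) (at s)"
      by (auto intro!: derivative_eq_intros simp: power2_eq_square field_simps) (simp add: algebra_simps eval_nat_numeral)
  qed (use d in auto)
  have le: "(\<integral>\<^sup>+s\<in>{0..t}. ennreal (?p s) \<partial>lborel) \<le> (\<integral>\<^sup>+s\<in>{0..t}. ennreal (- ln (1 - d\<^sup>2 * (1 + s\<^sup>2)) / (2 * (1 + s\<^sup>2))) \<partial>lborel)"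
  proof (rule nn_integral_mono_AE, rule eventually_mono[OF AE_lborel_singleton[of t]])
    fix s :: real assume "s \<noteq> t"
    show "ennreal (?p s) * indicator {0..t} s \<le> ennreal (- ln (1 - d\<^sup>2 * (1 + s\<^sup>2)) / (2 * (1 + s\<^sup>2))) * indicator {0..t} s"
    proof (cases "s \<in> {0..t}")
      case True
      define k where "k = 1 + s\<^sup>2"
      define w where "w = d\<^sup>2 * k"
      have k: "k > 0" by (simp add: k_def add_pos_nonneg)
      have w0: "0 \<le> w" using k by (simp add: w_def)
      have w1: "w < 1"
      proof (cases "d = 0")
        case False
        have "s\<^sup>2 < t\<^sup>2" using True \<open>s \<noteq> t\<close> by (intro power_strict_mono) auto
        then have "d\<^sup>2 * k < d\<^sup>2 * (1 + t\<^sup>2)" using False by (simp add: k_def)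
        then show ?thesis using d by (simp add: w_def)
      qed (simp add: w_def)
      have "- ln (1 - 0) - (0 + 0\<^sup>2 / 2 + 0 ^ 3 / 3) \<le> - ln (1 - w) - (w + w\<^sup>2 / 2 + w ^ 3 / 3)"
      proof (rule DERIV_nonneg_imp_nondecreasing[OF w0])
        fix x assume x: "0 \<le> x" "x \<le> w"
        have "1 / (1 - x) - (1 + x + x\<^sup>2) = x ^ 3 / (1 - x)"
          using x w1 by (simp add: field_simps eval_nat_numeral)
        also have "\<dots> \<ge> 0" using x w1 by (intro divide_nonneg_nonneg) auto
        finally have "1 / (1 - x) - (1 + x + x\<^sup>2) \<ge> 0" .
        moreover have "((\<lambda>w. - ln (1 - w) - (w + w\<^sup>2 / 2 + w ^ 3 / 3)) has_real_derivative 1 / (1 - x) - (1 + x + x\<^sup>2)) (at x)"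
          using x w1 by (auto intro!: derivative_eq_intros)
        ultimately show "\<exists>y. ((\<lambda>w. - ln (1 - w) - (w + w\<^sup>2 / 2 + w ^ 3 / 3)) has_real_derivative y) (at x) \<and> 0 \<le> y" by blast
      qed
      then have "(w + w\<^sup>2 / 2 + w ^ 3 / 3) / (2 * k) \<le> - ln (1 - w) / (2 * k)"
        using k by (intro divide_right_mono) auto
      moreover have "(w + w\<^sup>2 / 2 + w ^ 3 / 3) / (2 * k) = ?p s"
        using k unfolding w_def k_def[symmetric] by (simp add: field_simps eval_nat_numeral)
      ultimately show ?thesis by (intro mult_right_mono ennreal_leI) (simp_all add: w_def k_def)
    qed simp
  qed
  show ?thesis using le unfolding eq wedge_hyp_density[OF d(1,3)] by simp
qed

lemma log_sin_minus [simp]: "log_sin (- t) = log_sin t" by (simp add: log_sin_def)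

lemma set_integral_affine:
  fixes f :: "real \<Rightarrow> real"
  assumes "set_integrable lborel {a..b} f"
  shows "set_integrable lborel {a - t..b - t} (\<lambda>x. f (t + x))"
    and "(LINT x:{a - t..b - t}|lborel. f (t + x)) = (LINT x:{a..b}|lborel. f x)"
    and "set_integrable lborel {t - b..t - a} (\<lambda>x. f (t - x))"
    and "(LINT x:{t - b..t - a}|lborel. f (t - x)) = (LINT x:{a..b}|lborel. f x)"
proof -
  let ?g = "\<lambda>x. indicator {a..b} x * f x"
  have i1: "indicator {a..b} (t + x) = (indicator {a - t..b - t} x :: real)" for x by (auto simp: indicator_def)
  have i2: "indicator {a..b} (t - x) = (indicator {t - b..t - a} x :: real)" for x by (auto simp: indicator_def)
  have g: "integrable lborel ?g" using assms by (simp add: set_integrable_def)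
  show "set_integrable lborel {a - t..b - t} (\<lambda>x. f (t + x))"
    using lborel_integrable_real_affine[OF g, of 1 t] by (simp add: set_integrable_def i1)
  show "(LINT x:{a - t..b - t}|lborel. f (t + x)) = (LINT x:{a..b}|lborel. f x)"
    using lborel_integral_real_affine[of 1 ?g t] by (simp add: set_lebesgue_integral_def i1)
  show "set_integrable lborel {t - b..t - a} (\<lambda>x. f (t - x))"
    using lborel_integrable_real_affine[OF g, of "- 1" t] by (simp add: set_integrable_def i2)
  show "(LINT x:{t - b..t - a}|lborel. f (t - x)) = (LINT x:{a..b}|lborel. f x)"
    using lborel_integral_real_affine[of "- 1" ?g t] by (simp add: set_lebesgue_integral_def i2)
qed

text \<open>With s = tan x the argument of the logarithm factors as sin (\<gamma> + x) sin (\<gamma>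
  - x) / (cos x)^2, so the integrand becomes a combination of three \<open>log_sin\<close> terms.
  Half of \<open>v\<close> is the classical volume of an orthoscheme with a vertex at infinity. The
  bound \<gamma> \<le> pi / 3 keeps \<gamma> + \<alpha> in the interval of
  \<open>log_sin_integrable\<close>.\<close>

theorem wedge_hyp_density_lobachevsky:
  assumes \<gamma>: "0 < \<gamma>" "\<gamma> \<le> pi / 3" and \<alpha>: "0 \<le> \<alpha>" "\<alpha> \<le> \<gamma>"
  defines "v \<equiv> (2 * lobachevsky (pi / 2 - \<alpha>) - 2 * lobachevsky (pi / 2) + lobachevsky (\<gamma> + \<alpha>) - lobachevsky (\<gamma> - \<alpha>)) / 2"
  shows "wedge hyp_density (cos \<gamma>) (tan \<alpha>) = ennreal v"
proof -
  have cpos: "cos x > 0" if "0 \<le> x" "x \<le> \<alpha>" for x using that \<alpha> \<gamma> by (intro cos_gt_zero_pi) auto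
  have cg: "cos \<gamma> > 0" using \<gamma> by (intro cos_gt_zero_pi) auto
  have tan1: "1 + (tan x)\<^sup>2 = 1 / (cos x)\<^sup>2" if "0 \<le> x" "x \<le> \<alpha>" for x
    using cpos[OF that] by (simp add: tan_def field_simps sin_squared_eq)
  have ta: "tan x \<ge> 0" if "0 \<le> x" "x \<le> \<alpha>" for x
    unfolding tan_def using that \<alpha> \<gamma> cpos[OF that] by (intro divide_nonneg_pos sin_ge_zero) auto
  have "cos \<gamma> \<le> cos \<alpha>" using \<alpha> \<gamma> by (intro cos_monotone_0_pi_le) auto
  then have "(cos \<gamma>)\<^sup>2 \<le> (cos \<alpha>)\<^sup>2" using cg by (intro power_mono) auto
  moreover have "(cos \<gamma>)\<^sup>2 * (1 + (tan \<alpha>)\<^sup>2) = (cos \<gamma>)\<^sup>2 / (cos \<alpha>)\<^sup>2"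
    using tan1[of \<alpha>] \<alpha> by (simp only: order_refl) simp
  ultimately have le1: "(cos \<gamma>)\<^sup>2 * (1 + (tan \<alpha>)\<^sup>2) \<le> 1" using cpos[of \<alpha>] \<alpha> by (simp only:) simp
  define F where "F s = - ln (1 - (cos \<gamma>)\<^sup>2 * (1 + s\<^sup>2)) / (2 * (1 + s\<^sup>2))" for s
  define h where "h x = (2 * log_sin (pi / 2 - x) - log_sin (\<gamma> + x) - log_sin (\<gamma> - x)) / 2" for x
  have [measurable]: "F \<in> borel_measurable borel" unfolding F_def by measurable
  have [measurable]: "log_sin \<in> borel_measurable borel" unfolding log_sin_def by measurable
  \<comment> \<open>The endpoint \<open>x = \<alpha>\<close> is excluded because sin (\<gamma> - x)
    vanishes there when \<alpha> = \<gamma>, the case of an ideal corner.\<close>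
  have Fh: "F (tan x) * (1 / (cos x)\<^sup>2) = h x" if x: "0 \<le> x" "x < \<alpha>" for x
  proof -
    have c: "cos x > 0" using cpos x by simp
    have s1: "sin (\<gamma> + x) > 0" "sin (\<gamma> - x) > 0" using x \<alpha> \<gamma> by (auto intro!: sin_gt_zero)
    have prod: "sin (\<gamma> + x) * sin (\<gamma> - x) = (cos x)\<^sup>2 - (cos \<gamma>)\<^sup>2"
      by (simp add: sin_add sin_diff algebra_simps power2_eq_square)
         (use sin_cos_squared_add[of x] sin_cos_squared_add[of \<gamma>] in algebra)
    have "1 - (cos \<gamma>)\<^sup>2 * (1 + (tan x)\<^sup>2) = sin (\<gamma> + x) * sin (\<gamma> - x) / (cos x)\<^sup>2"
      unfolding prod using tan1[of x] x c by (simp add: diff_divide_distrib)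
    then have "ln (1 - (cos \<gamma>)\<^sup>2 * (1 + (tan x)\<^sup>2)) = ln (sin (\<gamma> + x)) + ln (sin (\<gamma> - x)) - 2 * ln (cos x)"
      using s1 c by (simp add: ln_mult ln_div ln_realpow)
    moreover have "log_sin (pi / 2 - x) = ln 2 + ln (cos x)"
      using c by (simp add: log_sin_def ln_mult sin_diff)
    moreover have "log_sin (\<gamma> + x) = ln 2 + ln (sin (\<gamma> + x))" "log_sin (\<gamma> - x) = ln 2 + ln (sin (\<gamma> - x))"
      using s1 by (simp_all add: log_sin_def ln_mult)
    ultimately have "- ln (1 - (cos \<gamma>)\<^sup>2 * (1 + (tan x)\<^sup>2)) / 2 = h x" by (simp add: h_def)
    moreover have "- A / (2 * T) * T = - A / 2" if "T > 0" for A T :: real using that by simp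
    moreover have "1 + (tan x)\<^sup>2 > 0" by (simp add: add_pos_nonneg)
    moreover have "1 / (cos x)\<^sup>2 = 1 + (tan x)\<^sup>2" using tan1[of x] x by (simp only: order.strict_implies_order)
    ultimately show ?thesis unfolding F_def by (simp only:)
  qed
  have i: "set_integrable lborel {pi / 2 - \<alpha>..pi / 2} log_sin" "set_integrable lborel {\<gamma>..\<gamma> + \<alpha>} log_sin" "set_integrable lborel {\<gamma> - \<alpha>..\<gamma>} log_sin"
    using \<gamma> \<alpha> by (auto intro!: log_sin_integrable)
  note a1 = set_integral_affine(3,4)[OF i(1), of "pi / 2", simplified]
  note a2 = set_integral_affine(1,2)[OF i(2), of \<gamma>, simplified]
  note a3 = set_integral_affine(3,4)[OF i(3), of \<gamma>, simplified]
  have hI: "set_integrable lborel {0..\<alpha>} h"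
    unfolding h_def by (intro set_integrable_divide set_integral_diff set_integrable_mult_right a1 a2 a3)
  have hL: "(LINT x:{0..\<alpha>}|lborel. h x) = v"
  proof -
    have "(LINT x:{0..\<alpha>}|lborel. h x) = (2 * log_sin_integral (pi / 2 - \<alpha>) (pi / 2) - log_sin_integral \<gamma> (\<gamma> + \<alpha>) - log_sin_integral (\<gamma> - \<alpha>) \<gamma>) / 2"
      unfolding h_def a1(2)[symmetric] a2(2)[symmetric] a3(2)[symmetric]
      by (simp add: set_integral_diff a1(1) a2(1) a3(1) set_integrable_mult_right)
    also have "\<dots> = v" unfolding v_def using \<gamma> \<alpha> by (simp add: log_sin_integral_lobachevsky)
    finally show ?thesis .
  qed
  have Fn: "F (tan x) \<ge> 0" if "0 \<le> x" "x \<le> \<alpha>" for x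
  proof -
    have "tan x \<le> tan \<alpha>" by (rule tan_mono_le) (use that \<alpha> \<gamma> in auto)
    then have "(tan x)\<^sup>2 \<le> (tan \<alpha>)\<^sup>2" using ta[OF that] by (intro power_mono) auto
    then have "(cos \<gamma>)\<^sup>2 * (1 + (tan x)\<^sup>2) \<le> (cos \<gamma>)\<^sup>2 * (1 + (tan \<alpha>)\<^sup>2)" by (intro mult_left_mono) auto
    then have "0 \<le> 1 - (cos \<gamma>)\<^sup>2 * (1 + (tan x)\<^sup>2)" "1 - (cos \<gamma>)\<^sup>2 * (1 + (tan x)\<^sup>2) \<le> 1" using le1 by auto
    then have "ln (1 - (cos \<gamma>)\<^sup>2 * (1 + (tan x)\<^sup>2)) \<le> 0" by (cases "1 - (cos \<gamma>)\<^sup>2 * (1 + (tan x)\<^sup>2) = 0") auto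
    then show ?thesis unfolding F_def by (intro divide_nonneg_nonneg) (auto simp: add_nonneg_nonneg)
  qed
  have hn: "AE x in lborel. 0 \<le> indicator {0..\<alpha>} x * h x"
  proof (rule eventually_mono[OF AE_lborel_singleton[of \<alpha>]])
    fix x assume "x \<noteq> \<alpha>"
    then show "0 \<le> indicator {0..\<alpha>} x * h x"
      using Fn[of x] Fh[of x] by (auto simp: indicator_def less_le simp flip: Fh)
  qed
  have "wedge hyp_density (cos \<gamma>) (tan \<alpha>) = (\<integral>\<^sup>+s. ennreal (F s * indicator {tan 0..tan \<alpha>} s) \<partial>lborel)"
    unfolding F_def using wedge_hyp_density[OF less_imp_le[OF cg] le1]
    by (simp add: indicator_def if_distrib cong: if_cong nn_integral_cong) (intro nn_integral_cong; simp)
  also have "\<dots> = (\<integral>\<^sup>+x. ennreal (F (tan x) * (1 / (cos x)\<^sup>2) * indicator {0..\<alpha>} x) \<partial>lborel)"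
  proof (rule nn_integral_substitution)
    show "set_borel_measurable borel {tan 0..tan \<alpha>} F" unfolding set_borel_measurable_def by measurable
    show "(tan has_real_derivative 1 / (cos x)\<^sup>2) (at x)" if "x \<in> {0..\<alpha>}" for x
      using cpos[of x] that by (auto intro!: derivative_eq_intros simp: field_simps)
    show "continuous_on {0..\<alpha>} (\<lambda>x. 1 / (cos x)\<^sup>2)" using cpos by (intro continuous_intros) (auto simp: less_imp_neq[symmetric])
  qed (use \<alpha> in auto)
  also have "\<dots> = (\<integral>\<^sup>+x. ennreal (indicator {0..\<alpha>} x * h x) \<partial>lborel)"
  proof (rule nn_integral_cong_AE, rule eventually_mono[OF AE_lborel_singleton[of \<alpha>]])
    fix x assume "x \<noteq> \<alpha>"
    then show "ennreal (F (tan x) * (1 / (cos x)\<^sup>2) * indicator {0..\<alpha>} x) = ennreal (indicator {0..\<alpha>} x * h x)"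
      using Fh[of x] by (auto simp: indicator_def)
  qed
  also have "\<dots> = ennreal (LINT x|lborel. indicator {0..\<alpha>} x * h x)"
    using hI hn by (intro nn_integral_eq_integral) (auto simp: set_integrable_def)
  finally show ?thesis using hL by (simp add: set_lebesgue_integral_def)
qed

section \<open>Special values of the Lobachevsky function and of the L-series\<close>

lemma summable_sin_over_square: "summable (\<lambda>n. sin (x n) / (real n)\<^sup>2)"
proof (rule summable_comparison_test')
  show "summable (\<lambda>n. 1 / (real n)\<^sup>2)" using inverse_power_summable[of 2, where 'a=real] by (simp add: inverse_eq_divide)
  show "norm (sin (x n) / (real n)\<^sup>2) \<le> 1 / (real n)\<^sup>2" for n
    by (simp add: divide_right_mono)
qed

lemma lobachevsky_sums:
  assumes "0 \<le> \<theta>" "\<theta> \<le> 2 * pi / 3"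
  shows "(\<lambda>n. sin (2 * real n * \<theta>) / (real n)\<^sup>2) sums (2 * lobachevsky \<theta>)"
  using summable_sums[OF summable_sin_over_square[of "\<lambda>n. 2 * real n * \<theta>"]]
  unfolding lobachevsky_fourier[OF assms] by simp

lemma lobachevsky_zero [simp]: "lobachevsky 0 = 0"
  using lobachevsky_fourier[of 0] by simp

lemma lobachevsky_half_pi [simp]: "lobachevsky (pi / 2) = 0"
proof -
  have "sin (2 * real n * (pi / 2)) = 0" for n using sin_npi[of n] by (simp add: mult.commute)
  then show ?thesis using lobachevsky_fourier[of "pi / 2"] by simp
qed

lemma lobachevsky_two_thirds_pi: "lobachevsky (2 * pi / 3) = - lobachevsky (pi / 3)"
proof -
  have "sin (2 * real n * (2 * pi / 3)) = - sin (2 * real n * (pi / 3))" for n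
  proof -
    have "2 * real n * (2 * pi / 3) = 2 * real n * pi - 2 * real n * (pi / 3)" by (simp add: field_simps)
    then show ?thesis by (simp only: sin_diff sin_2npi cos_2npi mult_zero_left mult_zero_right mult_1_left mult_1_right diff_0)
  qed
  then have "(\<lambda>n. - (sin (2 * real n * (pi / 3)) / (real n)\<^sup>2)) sums (2 * lobachevsky (2 * pi / 3))"
    using lobachevsky_sums[of "2 * pi / 3"] by simp
  from sums_unique2[OF this sums_minus[OF lobachevsky_sums[of "pi / 3"]]] show ?thesis by simp
qed

text \<open>The shift by pi / 2 multiplies the n-th sine by (-1)^n. Odd terms cancel; even terms
  double and, with (2 n)^2 in the denominator, give half the terms of the series at 2
  \<theta>.\<close>

lemma lobachevsky_duplication:
  assumes "0 \<le> \<theta>" "\<theta> \<le> pi / 6"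
  shows "lobachevsky \<theta> + lobachevsky (\<theta> + pi / 2) = lobachevsky (2 * \<theta>) / 2"
proof -
  define a where "a n = sin (2 * real n * \<theta>) / (real n)\<^sup>2 + sin (2 * real n * (\<theta> + pi / 2)) / (real n)\<^sup>2" for n
  have sums: "a sums (2 * lobachevsky \<theta> + 2 * lobachevsky (\<theta> + pi / 2))"
    unfolding a_def by (intro sums_add lobachevsky_sums) (use assms in auto)
  have sh: "sin (2 * real n * (\<theta> + pi / 2)) = (- 1) ^ n * sin (2 * real n * \<theta>)" for n
    by (simp add: distrib_left sin_add mult.commute[of "real n" pi] cos_npi sin_npi mult.assoc)
  have "(\<lambda>n. sum a {n * 2..<n * 2 + 2}) sums (2 * lobachevsky \<theta> + 2 * lobachevsky (\<theta> + pi / 2))"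
    by (rule sums_group[OF sums]) simp
  moreover have "sum a {n * 2..<n * 2 + 2} = (1 / 2) * (sin (2 * real n * (2 * \<theta>)) / (real n)\<^sup>2)" for n
  proof -
    have "sum a {n * 2..<n * 2 + 2} = a (2 * n) + a (2 * n + 1)" by (simp add: mult.commute)
    also have "a (2 * n + 1) = 0" unfolding a_def sh by simp
    also have "a (2 * n) = (1 / 2) * (sin (2 * real n * (2 * \<theta>)) / (real n)\<^sup>2)"
      unfolding a_def sh by (simp add: power2_eq_square mult_ac)
    finally show ?thesis by simp
  qed
  moreover have "(\<lambda>n. (1 / 2) * (sin (2 * real n * (2 * \<theta>)) / (real n)\<^sup>2)) sums ((1 / 2) * (2 * lobachevsky (2 * \<theta>)))"
    by (intro sums_mult lobachevsky_sums) (use assms in auto)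
  ultimately have "2 * lobachevsky \<theta> + 2 * lobachevsky (\<theta> + pi / 2) = (1 / 2) * (2 * lobachevsky (2 * \<theta>))"
    by (simp add: sums_unique2)
  then show ?thesis by simp
qed

text \<open>Duplication at pi / 6 involves pi / 6 + pi / 2 = 2 pi / 3, where the value is minus the
  one at pi / 3.\<close>

lemma lobachevsky_sixth_pi: "lobachevsky (pi / 6) = 3 / 2 * lobachevsky (pi / 3)"
proof -
  have "pi / 6 + pi / 2 = 2 * pi / 3" "2 * (pi / 6) = pi / 3" by simp_all
  then show ?thesis using lobachevsky_duplication[of "pi / 6"] lobachevsky_two_thirds_pi by simp
qed

text \<open>These sines are odd in n with period 3, hence a multiple of the odd character mod 3;
  this ties the Fourier series to the L-series.\<close>

lemma sin_third_pi: "sin (2 * real n * (pi / 3)) = sqrt 3 / 2 * chi_minus3 n"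
proof -
  define q r where "q = n div 3" and "r = n mod 3"
  have n: "n = 3 * q + r" "r < 3" by (simp_all add: q_def r_def)
  have "2 * real n * (pi / 3) = 2 * real q * pi + 2 * real r * (pi / 3)" by (simp add: n(1) field_simps)
  then have "sin (2 * real n * (pi / 3)) = sin (2 * real r * (pi / 3))"
    by (simp only: sin_add sin_2npi cos_2npi mult_zero_left mult_zero_right mult_1_left mult_1_right add_0_left)
  also have "\<dots> = sqrt 3 / 2 * chi_minus3 r"
  proof -
    consider "r = 0" | "r = 1" | "r = 2" using n(2) by linarith
    then show ?thesis
    proof cases
      case 3
      have e: "2 * real r * (pi / 3) = pi + pi / 3" using 3 by (simp add: field_simps)
      show ?thesis unfolding e sin_add using 3 by (simp add: chi_minus3_def sin_60)
    qed (simp_all add: chi_minus3_def sin_120)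
  qed
  also have "chi_minus3 r = chi_minus3 n" by (simp add: chi_minus3_def r_def)
  finally show ?thesis .
qed

lemma chi_sums: "(\<lambda>n. chi_minus3 n / (real n)\<^sup>2) sums (dirichlet_L chi_minus3 2)"
  and lobachevsky_third_pi_eq: "lobachevsky (pi / 3) = sqrt 3 / 4 * dirichlet_L chi_minus3 2"
proof -
  have s: "(\<lambda>n. sqrt 3 / 2 * (chi_minus3 n / (real n)\<^sup>2)) sums (2 * lobachevsky (pi / 3))"
    using lobachevsky_sums[of "pi / 3"] unfolding sin_third_pi by simp
  from sums_mult[OF this, of "2 / sqrt 3"]
  have s2: "(\<lambda>n. chi_minus3 n / (real n)\<^sup>2) sums (2 / sqrt 3 * (2 * lobachevsky (pi / 3)))" by simp
  then have "(\<lambda>n. chi_minus3 (Suc n) / (real (Suc n))\<^sup>2) sums (2 / sqrt 3 * (2 * lobachevsky (pi / 3)))"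
    using sums_Suc_iff[of "\<lambda>n. chi_minus3 n / (real n)\<^sup>2"] by simp
  then have L: "dirichlet_L chi_minus3 2 = 2 / sqrt 3 * (2 * lobachevsky (pi / 3))"
    by (simp add: dirichlet_L_def sums_iff del: of_nat_Suc)
  then show "(\<lambda>n. chi_minus3 n / (real n)\<^sup>2) sums (dirichlet_L chi_minus3 2)" using s2 by simp
  have "sqrt 3 * sqrt 3 = (3 :: real)" by simp
  then show "lobachevsky (pi / 3) = sqrt 3 / 4 * dirichlet_L chi_minus3 2"
    unfolding L by (simp add: field_simps)
qed

text \<open>The terms are grouped into pairs of constant sign, so that each partial sum is a bound:
  pairs at 3 n + 1, 3 n + 2 from below, and pairs at 3 n + 2, 3 n + 4 subtracted from the leading 1
  from above. Two and three pairs give about 0.7725 and 0.7873.\<close>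

lemma dirichlet_L_bounds: "dirichlet_L chi_minus3 2 > 3 / 4" "dirichlet_L chi_minus3 2 < 79 / 100"
proof -
  let ?a = "\<lambda>n. chi_minus3 n / (real n)\<^sup>2"
  have chi: "chi_minus3 (3 * k) = 0" "chi_minus3 (3 * k + 1) = 1" "chi_minus3 (3 * k + 2) = - 1" for k
    by (simp_all add: chi_minus3_def) presburger+
  have "(\<lambda>n. sum ?a {n * 3..<n * 3 + 3}) sums (dirichlet_L chi_minus3 2)"
    by (rule sums_group[OF chi_sums]) simp
  moreover have "sum ?a {n * 3..<n * 3 + 3} = 1 / (3 * real n + 1)\<^sup>2 - 1 / (3 * real n + 2)\<^sup>2" for n
  proof -
    have "{n * 3..<n * 3 + 3} = {3 * n, 3 * n + 1, 3 * n + 2}" by auto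
    then show ?thesis using chi[of n] by (simp add: add.commute)
  qed
  ultimately have s: "(\<lambda>n. 1 / (3 * real n + 1)\<^sup>2 - 1 / (3 * real n + 2)\<^sup>2) sums (dirichlet_L chi_minus3 2)" by simp
  have nn: "1 / (3 * real n + 1)\<^sup>2 - 1 / (3 * real n + 2)\<^sup>2 \<ge> 0" for n
    by (simp add: frac_le power_mono)
  have "(\<Sum>n<2. 1 / (3 * real n + 1)\<^sup>2 - 1 / (3 * real n + 2)\<^sup>2) \<le> (\<Sum>n. 1 / (3 * real n + 1)\<^sup>2 - 1 / (3 * real n + 2)\<^sup>2)"
    using s nn by (intro sum_le_suminf) (auto simp: sums_iff)
  then show "dirichlet_L chi_minus3 2 > 3 / 4" using s by (simp add: sums_iff lessThan_nat_numeral power2_eq_square)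
  have "(\<Sum>n<2. ?a n) = 1" by (simp add: lessThan_nat_numeral chi_minus3_def)
  then have "(\<lambda>n. ?a (n + 2)) sums (dirichlet_L chi_minus3 2 - 1)"
    using sums_split_initial_segment[OF chi_sums, of 2] by (simp only:)
  from sums_group[OF this, of 3]
  have "(\<lambda>n. sum (\<lambda>n. ?a (n + 2)) {n * 3..<n * 3 + 3}) sums (dirichlet_L chi_minus3 2 - 1)" by simp
  moreover have "sum (\<lambda>n. ?a (n + 2)) {n * 3..<n * 3 + 3} = - (1 / (3 * real n + 2)\<^sup>2 - 1 / (3 * real n + 4)\<^sup>2)" for n
  proof -
    have e: "{n * 3..<n * 3 + 3} = {3 * n, 3 * n + 1, 3 * n + 2}" by auto
    have "3 * n + 1 + 2 = 3 * (n + 1)" "3 * n + 2 + 2 = 3 * (n + 1) + 1" by simp_all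
    then show ?thesis 
    proof -
      have "sum (\<lambda>n. ?a (n + 2)) {3 * n, 3 * n + 1, 3 * n + 2} = ?a (3 * n + 2) + ?a (3 * n + 1 + 2) + ?a (3 * n + 2 + 2)"
        by simp
      also have "\<dots> = - 1 / (real (3 * n + 2))\<^sup>2 + 0 + 1 / (real (3 * (n + 1) + 1))\<^sup>2"
        unfolding \<open>3 * n + 1 + 2 = 3 * (n + 1)\<close> \<open>3 * n + 2 + 2 = 3 * (n + 1) + 1\<close> chi by simp
      also have "real (3 * (n + 1) + 1) = 3 * real n + 4" by simp
      finally show ?thesis unfolding e by (simp add: add.commute)
    qed
  qed
  ultimately have "(\<lambda>n. - (1 / (3 * real n + 2)\<^sup>2 - 1 / (3 * real n + 4)\<^sup>2)) sums (dirichlet_L chi_minus3 2 - 1)" by simp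
  from sums_minus[OF this] have s': "(\<lambda>n. 1 / (3 * real n + 2)\<^sup>2 - 1 / (3 * real n + 4)\<^sup>2) sums (1 - dirichlet_L chi_minus3 2)" by simp
  have nn': "1 / (3 * real n + 2)\<^sup>2 - 1 / (3 * real n + 4)\<^sup>2 \<ge> 0" for n
    by (simp add: frac_le power_mono)
  have "(\<Sum>n<3. 1 / (3 * real n + 2)\<^sup>2 - 1 / (3 * real n + 4)\<^sup>2) \<le> (\<Sum>n. 1 / (3 * real n + 2)\<^sup>2 - 1 / (3 * real n + 4)\<^sup>2)"
    using s' nn' by (intro sum_le_suminf) (auto simp: sums_iff)
  then show "dirichlet_L chi_minus3 2 < 79 / 100" using s' by (simp add: sums_iff lessThan_nat_numeral power2_eq_square)
qed

text \<open>The Fourier series at pi / 4 alternates over the odd squares, so twice the value is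
  Catalan's constant; two pairs of terms give more than 0.908.\<close>

lemma lobachevsky_quarter_pi_lower: "lobachevsky (pi / 4) > 9 / 20"
proof -
  let ?a = "\<lambda>n. sin (2 * real n * (pi / 4)) / (real n)\<^sup>2"
  have p: "sin (2 * real (4 * k + r) * (pi / 4)) = sin (real r * (pi / 2))" for k r
  proof -
    have "2 * real (4 * k + r) * (pi / 4) = 2 * real k * pi + real r * (pi / 2)" by (simp add: field_simps)
    then show ?thesis by (simp only: sin_add sin_2npi cos_2npi mult_zero_left mult_zero_right mult_1_left mult_1_right add_0_left)
  qed
  have "sin (3 * pi / 2) = - 1" using sin_3over2_pi by simp
  then have v: "sin (2 * real (4 * k) * (pi / 4)) = 0" "sin (2 * real (4 * k + 1) * (pi / 4)) = 1"
     "sin (2 * real (4 * k + 2) * (pi / 4)) = 0" "sin (2 * real (4 * k + 3) * (pi / 4)) = - 1" for k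
    using p[of k 0] p[of k 1] p[of k 2] p[of k 3] by simp_all
  have "(\<lambda>n. sum ?a {n * 4..<n * 4 + 4}) sums (2 * lobachevsky (pi / 4))"
    by (rule sums_group[OF lobachevsky_sums]) auto
  moreover have "sum ?a {n * 4..<n * 4 + 4} = 1 / (4 * real n + 1)\<^sup>2 - 1 / (4 * real n + 3)\<^sup>2" for n
  proof -
    have e: "{n * 4..<n * 4 + 4} = {4 * n, 4 * n + 1, 4 * n + 2, 4 * n + 3}" by auto
    have four: "sum f {4 * n, 4 * n + 1, 4 * n + 2, 4 * n + 3} = f (4 * n) + f (4 * n + 1) + f (4 * n + 2) + f (4 * n + 3)"
      for f :: "nat \<Rightarrow> real" by simp
    show ?thesis unfolding e four[of ?a] v
      by (simp only: of_nat_add of_nat_mult of_nat_numeral of_nat_1 div_0 add_0_left add_0_right minus_divide_left[symmetric] diff_conv_add_uminus)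
  qed
  ultimately have s: "(\<lambda>n. 1 / (4 * real n + 1)\<^sup>2 - 1 / (4 * real n + 3)\<^sup>2) sums (2 * lobachevsky (pi / 4))" by simp
  have nn: "1 / (4 * real n + 1)\<^sup>2 - 1 / (4 * real n + 3)\<^sup>2 \<ge> 0" for n
    by (simp add: frac_le power_mono)
  have "(\<Sum>n<2. 1 / (4 * real n + 1)\<^sup>2 - 1 / (4 * real n + 3)\<^sup>2) \<le> (\<Sum>n. 1 / (4 * real n + 1)\<^sup>2 - 1 / (4 * real n + 3)\<^sup>2)"
    using s nn by (intro sum_le_suminf) (auto simp: sums_iff)
  then show ?thesis using s by (simp add: sums_iff lessThan_nat_numeral power2_eq_square)
qed

text \<open>The pairs (\<gamma>, \<alpha>) are (pi / 3, pi / 6), (pi / 3, pi / 3), (pi / 6, pi / 6)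
  and (pi / 4, pi / 4). The first three values make up the volumes in all cases of equality.\<close>

lemma wedge_values:
  "wedge hyp_density (1 / 2) (1 / sqrt 3) = ennreal (lobachevsky (pi / 3) / 4)"
  "wedge hyp_density (1 / 2) (sqrt 3) = ennreal (lobachevsky (pi / 3))"
  "wedge hyp_density (sqrt 3 / 2) (1 / sqrt 3) = ennreal (3 / 2 * lobachevsky (pi / 3))"
  "wedge hyp_density (sqrt 2 / 2) 1 = ennreal (lobachevsky (pi / 4))"
proof -
  have a: "pi / 3 + pi / 6 = pi / 2" "pi / 3 - pi / 6 = pi / 6" "pi / 2 - pi / 6 = pi / 3" "pi / 2 - pi / 3 = pi / 6"
    "pi / 3 + pi / 3 = 2 * pi / 3" "pi / 6 + pi / 6 = pi / 3" "pi / 2 - pi / 4 = pi / 4" "pi / 4 + pi / 4 = pi / 2"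
    by (simp_all add: field_simps)
  show "wedge hyp_density (1 / 2) (1 / sqrt 3) = ennreal (lobachevsky (pi / 3) / 4)"
    using wedge_hyp_density_lobachevsky[of "pi / 3" "pi / 6"] by (simp add: a cos_60 tan_30 lobachevsky_sixth_pi)
  show "wedge hyp_density (1 / 2) (sqrt 3) = ennreal (lobachevsky (pi / 3))"
    using wedge_hyp_density_lobachevsky[of "pi / 3" "pi / 3"] by (simp add: a cos_60 tan_60 lobachevsky_sixth_pi lobachevsky_two_thirds_pi)
  show "wedge hyp_density (sqrt 3 / 2) (1 / sqrt 3) = ennreal (3 / 2 * lobachevsky (pi / 3))"
    using wedge_hyp_density_lobachevsky[of "pi / 6" "pi / 6"] by (simp add: a cos_30 tan_30)
  show "wedge hyp_density (sqrt 2 / 2) 1 = ennreal (lobachevsky (pi / 4))"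
    using wedge_hyp_density_lobachevsky[of "pi / 4" "pi / 4"] by (simp add: a cos_45 tan_45)
qed

text \<open>Guards against \<open>enn2real\<close> sending infinity to 0. The distances that occur
  are cosines of pi / k, so they are 0 or at least 1 / 2, and \<open>1 / 2 \<le> d\<close> is the
  condition \<gamma> \<le> pi / 3 for d = cos \<gamma>.\<close>

lemma wedge_hyp_density_finite:
  assumes "d = 0 \<or> 1 / 2 \<le> d" "t \<ge> 0" "d\<^sup>2 * (1 + t\<^sup>2) \<le> 1" "d < 1"
  shows "wedge hyp_density d t < \<infinity>"
proof (cases "d = 0")
  case True
  then show ?thesis by (simp add: wedge_def not_le[symmetric])
next
  case False
  then have d: "1 / 2 \<le> d" using assms by simp
  define \<gamma> where "\<gamma> = arccos d"
  define \<alpha> where "\<alpha> = arctan t"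
  have g: "cos \<gamma> = d" using d assms by (simp add: \<gamma>_def)
  have "arccos d \<le> arccos (1 / 2)" using d assms by (intro arccos_le_arccos) auto
  moreover have "arccos (1 / 2) = pi / 3" using arccos_cos[of "pi / 3"] by (simp add: cos_60)
  ultimately have "\<gamma> \<le> pi / 3" by (simp add: \<gamma>_def)
  moreover have "\<gamma> > 0" using arccos_lt_bounded[of d] d assms by (simp add: \<gamma>_def)
  moreover have a: "0 \<le> \<alpha>" "\<alpha> < pi / 2" using assms arctan_ubound by (auto simp: \<alpha>_def)
  moreover have "\<alpha> \<le> \<gamma>"
  proof -
    have c: "cos \<alpha> > 0" using a by (intro cos_gt_zero_pi) auto
    have "cos \<alpha> = 1 / sqrt (1 + t\<^sup>2)" by (simp add: \<alpha>_def cos_arctan)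
    moreover have "d \<le> 1 / sqrt (1 + t\<^sup>2)"
    proof -
      have "sqrt (d\<^sup>2 * (1 + t\<^sup>2)) \<le> sqrt 1" using assms(3) by (rule real_sqrt_le_mono)
      then have "d * sqrt (1 + t\<^sup>2) \<le> 1" using d by (simp add: real_sqrt_mult)
      moreover have "sqrt (1 + t\<^sup>2) > 0" by (simp add: add_pos_nonneg)
      ultimately show ?thesis by (simp only: pos_le_divide_eq)
    qed
    ultimately have "cos \<gamma> \<le> cos \<alpha>" by (simp only: g)
    then show ?thesis using a \<open>\<gamma> \<le> pi / 3\<close> \<open>\<gamma> > 0\<close> by (subst cos_mono_le_eq[symmetric]) auto
  qed
  ultimately have "wedge hyp_density (cos \<gamma>) (tan \<alpha>) < \<infinity>"
    by (subst wedge_hyp_density_lobachevsky) auto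
  then show ?thesis by (simp add: g \<alpha>_def tan_arctan)
qed

section \<open>The geometric representation of a Coxeter group\<close>

lemma hyp_reflection_linear: "hyp_reflection u (x + y) = hyp_reflection u x + hyp_reflection u y"
  "hyp_reflection u (a *\<^sub>R x) = a *\<^sub>R hyp_reflection u x"
  by (simp_all add: hyp_reflection_def lorentz_simps algebra_simps)

lemma lorentz_hyp_reflection:
  assumes "lorentz u u = 1"
  shows "lorentz (hyp_reflection u x) (hyp_reflection u y) = lorentz x y"
  using assms lorentz_commute[of u x] lorentz_commute[of u y]
  by (simp add: hyp_reflection_def lorentz_simps algebra_simps)

lemma hyp_reflection_involution: "lorentz u u = 1 \<Longrightarrow> hyp_reflection u (hyp_reflection u x) = x"
  by (simp add: hyp_reflection_def lorentz_simps algebra_simps)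

locale coxeter_vectors =
  fixes e :: "nat \<Rightarrow> minkowski" and m :: "nat \<Rightarrow> nat \<Rightarrow> nat"
  assumes gram: "i < 4 \<Longrightarrow> j < 4 \<Longrightarrow> lorentz (e i) (e j) = - cos (pi / real (m i j))"
    and m_diag: "i < 4 \<Longrightarrow> m i i = 1"
    and m_offdiag: "i < 4 \<Longrightarrow> j < 4 \<Longrightarrow> i \<noteq> j \<Longrightarrow> 2 \<le> m i j"
    and m_sym: "m i j = m j i"
begin

definition act :: "nat list \<Rightarrow> minkowski \<Rightarrow> minkowski" where
  "act w = foldr (\<lambda>i g. hyp_reflection (e i) \<circ> g) w id"

lemma act_simps [simp]: "act [] = id" "act (i # w) = hyp_reflection (e i) \<circ> act w"
  by (simp_all add: act_def)

lemma act_append: "act (u @ v) = act u \<circ> act v"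
  by (induction u) (simp_all add: comp_assoc)

abbreviation word :: "nat list \<Rightarrow> bool" where "word w \<equiv> set w \<subseteq> {..<4}"

lemma unit: "i < 4 \<Longrightarrow> lorentz (e i) (e i) = 1"
  by (simp add: gram m_diag)

lemma act_linear: "act w (x + y) = act w x + act w y" "act w (a *\<^sub>R x) = a *\<^sub>R act w x"
  by (induction w) (simp_all add: hyp_reflection_linear)

lemma act_lorentz: "word w \<Longrightarrow> lorentz (act w x) (act w y) = lorentz x y"
  by (induction w) (simp_all add: lorentz_hyp_reflection unit)

lemma act_rev: "word w \<Longrightarrow> act (rev w) (act w x) = x"
  by (induction w arbitrary: x) (simp_all add: act_append hyp_reflection_involution unit)

lemma act_rev': "word w \<Longrightarrow> act w (act (rev w) x) = x"
  using act_rev[of "rev w" x] by simp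

lemma act_cancel: "i < 4 \<Longrightarrow> act (u @ i # i # v) = act (u @ v)"
  by (auto simp: act_append hyp_reflection_involution unit fun_eq_iff)

lemma reflection_group_word: "g \<in> reflection_group e \<longleftrightarrow> (\<exists>w. word w \<and> g = act w)"
proof
  show "\<exists>w. word w \<and> g = act w" if "g \<in> reflection_group e"
    using that
  proof induction
    case one then show ?case by (intro exI[of _ "[]"]) simp
  next
    case (step i g)
    then obtain w where "word w" "g = act w" by blast
    then show ?case using step.hyps by (intro exI[of _ "i # w"]) simp
  qed
  have "act w \<in> reflection_group e" if "word w" for w
    using that by (induction w) (auto simp: reflection_group.one intro: reflection_group.step)
  then show "\<exists>w. word w \<and> g = act w \<Longrightarrow> g \<in> reflection_group e" by blast
qed

text \<open>The length belongs to the map and not to the word: group elements are compared as maps,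
  and no presentation of the group enters.\<close>

definition len :: "(minkowski \<Rightarrow> minkowski) \<Rightarrow> nat" where
  "len g = (LEAST n. \<exists>w. word w \<and> length w = n \<and> act w = g)"

lemma len_le: "word w \<Longrightarrow> len (act w) \<le> length w"
  unfolding len_def by (rule Least_le) blast

lemma reduced_word: "word w \<Longrightarrow> \<exists>u. word u \<and> length u = len (act w) \<and> act u = act w"
  unfolding len_def by (rule LeastI[of _ "length w"]) blast

lemma len_append: "word u \<Longrightarrow> word v \<Longrightarrow> len (act (u @ v)) \<le> len (act u) + length v"
proof -
  assume u: "word u" and v: "word v"
  obtain u' where u': "word u'" "length u' = len (act u)" "act u' = act u" using reduced_word[OF u] by blast
  have "act (u @ v) = act (u' @ v)" by (simp add: act_append u')
  then show ?thesis using len_le[of "u' @ v"] u' v by simp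
qed

lemma len_rev: "word w \<Longrightarrow> len (act (rev w)) = len (act w)"
proof -
  have le: "len (act (rev w)) \<le> len (act w)" if w: "word w" for w
  proof -
    obtain u where u: "word u" "length u = len (act w)" "act u = act w" using reduced_word[OF w] by blast
    have "act (rev u) x = act (rev w) x" for x
      using act_rev[OF u(1), of "act (rev w) x"] act_rev'[OF w, of x] u(3) by simp
    then have "act (rev u) = act (rev w)" by (rule ext)
    then show ?thesis using len_le[of "rev u"] u by simp
  qed
  show "word w \<Longrightarrow> ?thesis" using le[of w] le[of "rev w"] by simp
qed

text \<open>Only the existence of coefficients is asked; independence of the \<open>e i\<close>
  becomes available with the vertices of the tetrahedron.\<close>

definition nonneg_comb :: "minkowski \<Rightarrow> bool" where
  "nonneg_comb v \<longleftrightarrow> (\<exists>c. (\<forall>i<4. c i \<ge> 0) \<and> v = (\<Sum>i<4. c i *\<^sub>R e i))"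

lemma nonneg_comb_base: "i < 4 \<Longrightarrow> nonneg_comb (e i)"
  unfolding nonneg_comb_def by (intro exI[of _ "\<lambda>j. if j = i then 1 else 0"]) (simp add: if_distrib[of "\<lambda>a. a *\<^sub>R _"] cong: if_cong)

lemma nonneg_comb_add: "nonneg_comb u \<Longrightarrow> nonneg_comb v \<Longrightarrow> nonneg_comb (u + v)"
proof -
  assume "nonneg_comb u" "nonneg_comb v"
  then obtain c d where "\<forall>i<4. c i \<ge> 0" "u = (\<Sum>i<4. c i *\<^sub>R e i)" "\<forall>i<4. d i \<ge> 0" "v = (\<Sum>i<4. d i *\<^sub>R e i)"
    unfolding nonneg_comb_def by blast
  then show ?thesis unfolding nonneg_comb_def
    by (intro exI[of _ "\<lambda>i. c i + d i"]) (simp add: scaleR_add_left sum.distrib)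
qed

lemma nonneg_comb_scale: "nonneg_comb u \<Longrightarrow> a \<ge> 0 \<Longrightarrow> nonneg_comb (a *\<^sub>R u)"
proof -
  assume "nonneg_comb u" "a \<ge> 0"
  then obtain c where "\<forall>i<4. c i \<ge> 0" "u = (\<Sum>i<4. c i *\<^sub>R e i)" unfolding nonneg_comb_def by blast
  then show ?thesis unfolding nonneg_comb_def using \<open>a \<ge> 0\<close>
    by (intro exI[of _ "\<lambda>i. a * c i"]) (simp add: scaleR_sum_right)
qed

text \<open>The alternating word of length \<open>k\<close> in \<open>a\<close> and \<open>b\<close> whose last letter is \<open>b\<close>.\<close>

primrec alt :: "nat \<Rightarrow> nat \<Rightarrow> nat \<Rightarrow> nat list" where
  "alt b a 0 = []"
| "alt b a (Suc k) = (if even k then b else a) # alt b a k"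

lemma length_alt [simp]: "length (alt b a k) = k" by (induction k) auto
lemma set_alt: "set (alt b a k) \<subseteq> {a, b}" by (induction k) auto
lemma alt_snoc: "alt a b (Suc k) = alt b a k @ [a]" by (induction k) auto

section \<open>Rank two: alternating words in a dihedral group\<close>

lemma alternating_word:
  assumes "set u \<subseteq> {a, b}" "\<And>xs c ys. u \<noteq> xs @ c # c # ys" "u \<noteq> [] \<Longrightarrow> last u = b" "a \<noteq> b"
  shows "u = alt b a (length u)"
  using assms
proof (induction u)
  case (Cons x u)
  have u: "u = alt b a (length u)"
  proof (rule Cons.IH)
    show "u \<noteq> xs @ c # c # ys" for xs c ys using Cons.prems(2)[of "x # xs"] by auto
  qed (use Cons.prems in auto)
  show ?case
  proof (cases u)
    case Nil then show ?thesis using Cons.prems by simp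
  next
    case (Cons y v)
    have "x \<noteq> y" using Cons.prems(2)[of "[]" x v] Cons by auto
    moreover have "y = (if even (length v) then b else a)" using u Cons by simp
    ultimately have "x = (if even (length u) then b else a)" using Cons.prems(1,4) Cons by auto
    then show ?thesis using u by simp
  qed
qed simp

text \<open>Each reflection changes one of the two coefficients by the recurrence sin ((k + 2)
  \<theta>) = 2 cos \<theta> sin ((k + 1) \<theta>) - sin (k \<theta>). The closed form serves
  twice: at k = m for the braid relation, and for k < m because both sines are then
  nonnegative.\<close>

lemma alt_root:
  assumes ab: "a < 4" "b < 4" "a \<noteq> b"
  defines "\<theta> \<equiv> pi / real (m a b)"
  shows "act (alt b a k) (e a) = (sin (real (Suc k) * \<theta>) / sin \<theta>) *\<^sub>R e (if even k then a else b) +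
     (sin (real k * \<theta>) / sin \<theta>) *\<^sub>R e (if even k then b else a)"
proof (induction k)
  case 0
  have "0 < \<theta>" "\<theta> < pi" using m_offdiag[OF ab] by (auto simp: \<theta>_def field_simps)
  then have "sin \<theta> \<noteq> 0" using sin_gt_zero by fastforce
  then show ?case by simp
next
  case (Suc k)
  have g: "lorentz (e a) (e b) = - cos \<theta>" "lorentz (e b) (e a) = - cos \<theta>" "lorentz (e a) (e a) = 1" "lorentz (e b) (e b) = 1"
    using ab by (simp_all add: gram \<theta>_def m_sym[of b a] m_diag)
  have rec: "sin (real (Suc (Suc k)) * \<theta>) = 2 * cos \<theta> * sin (real (Suc k) * \<theta>) - sin (real k * \<theta>)"
  proof -
    have "sin (real (Suc k) * \<theta> + \<theta>) + sin (real (Suc k) * \<theta> - \<theta>) = 2 * cos \<theta> * sin (real (Suc k) * \<theta>)"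
      by (simp add: sin_add sin_diff)
    then show ?thesis by (simp add: algebra_simps)
  qed
  have step: "hyp_reflection v (x *\<^sub>R u + y *\<^sub>R v) = x *\<^sub>R u + (2 * cos \<theta> * x - y) *\<^sub>R v"
    if "lorentz u v = - cos \<theta>" "lorentz v v = 1" for u v x y
  proof -
    have "hyp_reflection v u = u + (2 * cos \<theta>) *\<^sub>R v" "hyp_reflection v v = - v"
      using that by (simp_all add: hyp_reflection_def scaleR_2)
    then show ?thesis by (simp add: hyp_reflection_linear scaleR_add_right scaleR_diff_left mult.commute)
  qed
  show ?case
    by (cases "even k") (simp_all add: Suc.IH step g rec diff_divide_distrib del: of_nat_Suc)
qed

text \<open>The two words agree on \<open>e a\<close> and \<open>e b\<close> by
  \<open>alt_root\<close>, and both fix every vector orthogonal to these. Since the Gram determinant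
  (sin \<theta>)^2 is nonzero, every vector splits into such parts.\<close>

lemma braid:
  assumes ab: "a < 4" "b < 4" "a \<noteq> b"
  shows "act (alt a b (m a b)) = act (alt b a (m a b))"
proof
  fix x
  define M where "M = m a b"
  define \<theta> where "\<theta> = pi / real M"
  have M: "M \<ge> 2" using m_offdiag[OF ab] by (simp add: M_def)
  have th: "0 < \<theta>" "\<theta> < pi" using M by (auto simp: \<theta>_def field_simps)
  then have s: "sin \<theta> > 0" by (rule sin_gt_zero)
  have M\<theta>: "real M * \<theta> = pi" using M by (simp add: \<theta>_def)
  have g: "lorentz (e a) (e b) = - cos \<theta>" "lorentz (e b) (e a) = - cos \<theta>" "lorentz (e a) (e a) = 1" "lorentz (e b) (e b) = 1"
    using ab by (simp_all add: gram \<theta>_def M_def m_sym[of b a] m_diag)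
  \<comment> \<open>Stated for an arbitrary ordered pair because it is applied to
    \<open>a, b\<close> and to \<open>b, a\<close>.\<close>
  have key: "act (alt a b M) (e a) = act (alt b a M) (e a)"
    if ab: "a < 4" "b < 4" "a \<noteq> b" and m: "m a b = M" for a b
  proof -
    obtain k where k: "M = Suc (Suc k)" using M by (metis add_2_eq_Suc le_Suc_ex)
    have g: "lorentz (e a) (e a) = 1" using ab by (simp add: unit)
    have "real (Suc M) * \<theta> = pi + \<theta>" using M\<theta> by (simp add: algebra_simps)
    then have "act (alt b a M) (e a) = - e (if even M then a else b)"
      using alt_root[OF ab, of M] M\<theta> s unfolding m \<theta>_def[symmetric] by simp
    moreover have "act (alt a b M) (e a) = - e (if even k then a else b)"
    proof -
      have "real (Suc k) * \<theta> = pi - \<theta>" "real (Suc (Suc k)) * \<theta> = pi" using M\<theta> k by (simp_all add: algebra_simps)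
      then have "act (alt b a (Suc k)) (e a) = e (if even k then a else b)"
        using alt_root[OF ab, of "Suc k"] s unfolding m \<theta>_def[symmetric] by simp
      moreover have "hyp_reflection (e a) (e a) = (- 1) *\<^sub>R e a" using g by (simp add: hyp_reflection_def scaleR_2)
      moreover have "alt a b M = alt b a (Suc k) @ [a]" unfolding k by (rule alt_snoc)
      ultimately show ?thesis
        by (simp only: act_append act_simps comp_apply id_apply act_linear) simp
    qed
    ultimately show ?thesis using k by simp
  qed
  have ka: "act (alt a b M) (e a) = act (alt b a M) (e a)" using key[OF ab] by (simp add: M_def)
  have kb: "act (alt a b M) (e b) = act (alt b a M) (e b)" using key[of b a] ab by (simp add: M_def m_sym)
  define d where "d = 1 - (cos \<theta>)\<^sup>2"
  have d: "d \<noteq> 0" using s by (simp add: d_def sin_squared_eq[symmetric])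
  \<comment> \<open>\<open>p\<close> and \<open>q\<close> are the coefficients of the orthogonal
    projection of \<open>x\<close> to the span of \<open>e a\<close> and \<open>e b\<close>, from
    inverting the Gram matrix with determinant \<open>d\<close>.\<close>
  define p where "p = (lorentz x (e a) + cos \<theta> * lorentz x (e b)) / d"
  define q where "q = (lorentz x (e b) + cos \<theta> * lorentz x (e a)) / d"
  define y where "y = x - p *\<^sub>R e a - q *\<^sub>R e b"
  have pq: "p - q * cos \<theta> = lorentz x (e a)" "q - p * cos \<theta> = lorentz x (e b)"
  proof -
    have pd: "p * d = lorentz x (e a) + cos \<theta> * lorentz x (e b)" and qd: "q * d = lorentz x (e b) + cos \<theta> * lorentz x (e a)"
      using d by (simp_all add: p_def q_def)
    have "(p - q * cos \<theta>) * d = lorentz x (e a) * d" "(q - p * cos \<theta>) * d = lorentz x (e b) * d"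
      using pd qd d_def by algebra+
    then show "p - q * cos \<theta> = lorentz x (e a)" "q - p * cos \<theta> = lorentz x (e b)" using d by simp_all
  qed
  have y: "lorentz y (e a) = 0" "lorentz y (e b) = 0" using pq g by (simp_all add: y_def lorentz_simps)
  have fixy: "act w y = y" if "set w \<subseteq> {a, b}" for w
    using that by (induction w) (auto simp: hyp_reflection_def y)
  have "x = y + (p *\<^sub>R e a + q *\<^sub>R e b)" by (simp add: y_def)
  then have lin: "act w x = act w y + (p *\<^sub>R act w (e a) + q *\<^sub>R act w (e b))" for w by (simp add: act_linear)
  have A: "act (alt a b M) y = y" "act (alt b a M) y = y"
    by (rule fixy, use set_alt[of a b M] set_alt[of b a M] in auto)+
  show "act (alt a b (m a b)) x = act (alt b a (m a b)) x"
    unfolding M_def[symmetric] lin A ka kb ..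
qed

text \<open>The geometric half of the exchange condition (Tits): reduce to the rank two case by
  splitting off the longest factor in the dihedral group of \<open>a\<close> and the last letter \<open>b\<close>.\<close>

theorem length_increase_nonneg_comb:
  assumes "word w" "a < 4" "len (act w) \<le> len (act (w @ [a]))"
  shows "nonneg_comb (act w (e a))"
  using assms
proof (induction "len (act w)" arbitrary: w a rule: less_induct)
  case less
  note w = \<open>word w\<close> and a = \<open>a < 4\<close> and le = less.prems(3)
  show ?case
  proof (cases "len (act w)")
    case 0
    then obtain u where "length u = 0" "act u = act w" using reduced_word[OF w] by auto
    then have "act w = id" by auto
    then show ?thesis using nonneg_comb_base[OF a] by simp
  next
    case (Suc n)
    obtain r where r: "word r" "length r = Suc n" "act r = act w" using reduced_word[OF w] Suc by auto
    obtain r' b where r': "r = r' @ [b]" using r(2) by (metis length_Suc_conv_rev)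
    have b: "b < 4" and wr': "word r'" using r(1) r' by auto
    have lr': "len (act r') \<le> n" using len_le[OF wr'] r(2) r' by simp
    have "act (w @ [b]) = act (r @ [b])" by (simp only: act_append r(3))
    also have "\<dots> = act r'" using act_cancel[OF b, of r' "[]"] r' by simp
    finally have "act (w @ [b]) = act r'" .
    \<comment> \<open>Appending \<open>b\<close> shortens \<open>w\<close>, the last letter of a
      reduced word; appending \<open>a\<close> does not, by hypothesis.\<close>
    then have ab: "a \<noteq> b" using le lr' Suc by auto
    \<comment> \<open>The factorizations of \<open>w\<close> with additive lengths whose right
      factor lies in the dihedral group of \<open>a\<close> and \<open>b\<close>. A pair with
      shortest left factor \<open>v\<close> is chosen.\<close>
    define A where "A = {(v, u). word v \<and> set u \<subseteq> {a, b} \<and> act (v @ u) = act w \<and> len (act v) + length u = len (act w)}"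
    have inA: "(r', [b]) \<in> A"
      using wr' r' r(3) Suc lr' len_append[of r' "[b]"] b by (auto simp: A_def)
    obtain v u where vu: "(v, u) \<in> A" and vmin: "\<And>v' u'. (v', u') \<in> A \<Longrightarrow> len (act v) \<le> len (act v')"
    proof -
      have "\<exists>x. x \<in> A \<and> (\<forall>y. y \<in> A \<longrightarrow> len (act (fst x)) \<le> len (act (fst y)))"
        using ex_has_least_nat[of "\<lambda>x. x \<in> A" "(r', [b])" "\<lambda>x. len (act (fst x))"] inA by blast
      then obtain x where x: "x \<in> A" "\<forall>y. y \<in> A \<longrightarrow> len (act (fst x)) \<le> len (act (fst y))" by blast
      show ?thesis
      proof (rule that)
        show "(fst x, snd x) \<in> A" using x(1) by simp
        show "len (act (fst x)) \<le> len (act v')" if "(v', u') \<in> A" for v' u'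
          using x(2)[rule_format, OF that] by simp
      qed
    qed
    have v: "word v" and u: "set u \<subseteq> {a, b}" and vuw: "act (v @ u) = act w" and ln: "len (act v) + length u = len (act w)"
      using vu by (auto simp: A_def)
    have wu: "word u" using u a b by auto
    have lv: "len (act v) < len (act w)" using vmin[OF inA] lr' Suc by simp
    \<comment> \<open>Neither letter shortens the minimal \<open>v\<close>, since it could otherwise
      be moved over to \<open>u\<close>; as \<open>v\<close> is shorter than \<open>w\<close>, the
      induction hypothesis applies to it.\<close>
    have pos: "nonneg_comb (act v (e c))" if c: "c \<in> {a, b}" for c
    proof -
      have c4: "c < 4" using c a b by auto
      have "len (act v) \<le> len (act (v @ [c]))"
      proof (rule ccontr)
        assume "\<not> ?thesis"
        then have lt: "len (act (v @ [c])) < len (act v)" by simp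
        have eq: "act ((v @ [c]) @ c # u) = act w" using vuw act_cancel[OF c4, of v u] by simp
        have "len (act w) \<le> len (act (v @ [c])) + length (c # u)"
          using len_append[of "v @ [c]" "c # u"] v wu c4 eq by simp
        then have "(v @ [c], c # u) \<in> A" using lt ln v u c c4 eq by (auto simp: A_def)
        from vmin[OF this] lt show False by simp
      qed
      then show ?thesis using less.hyps[OF lv v c4] by simp
    qed
    have shorter: "length u \<le> length u'" if "set u' \<subseteq> {a, b}" "act u' = act u" for u'
    proof -
      have "act (v @ u') = act w" using vuw that by (simp add: act_append)
      moreover have "word u'" using that a b by auto
      ultimately have "len (act w) \<le> len (act v) + length u'" using len_append[OF v, of u'] by simp
      then show ?thesis using ln by simp
    qed
    \<comment> \<open>If \<open>u\<close> could be written with last letter \<open>a\<close> and the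
      same length or less, appending \<open>a\<close> would cancel it and shorten
      \<open>w\<close>.\<close>
    have not_a: False if "set u' \<subseteq> {a, b}" "act (u' @ [a]) = act u" "length u' < length u" for u'
    proof -
      have "act (w @ [a]) = act (v @ u')"
      proof -
        have 1: "act w = act v \<circ> act u" using vuw by (simp add: act_append)
        have 2: "act u = act u' \<circ> act [a]" using that(2) by (simp only: act_append)
        have 3: "act [a] \<circ> act [a] = id" using a by (auto simp: hyp_reflection_involution unit)
        show ?thesis by (simp only: act_append 1 2 3 comp_assoc comp_id)
      qed
      moreover have "word u'" using that a b by auto
      ultimately have "len (act (w @ [a])) \<le> len (act v) + length u'" using len_append[OF v, of u'] by simp
      then show False using le ln that by simp
    qed
    have alt: "u = alt b a (length u)"
    proof (rule alternating_word[OF u _ _ ab])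
      fix xs c ys show "u \<noteq> xs @ c # c # ys"
      proof
        assume eq: "u = xs @ c # c # ys"
        then have "act (xs @ ys) = act u" using act_cancel[of c xs ys] wu by simp
        then show False using shorter[of "xs @ ys"] eq u by auto
      qed
    next
      assume "u \<noteq> []"
      then obtain u' c where u': "u = u' @ [c]" by (metis rev_exhaust)
      show "last u = b"
      proof (rule ccontr)
        assume "last u \<noteq> b"
        then have "c = a" using u u' by auto
        then show False using not_a[of u'] u u' by auto
      qed
    qed
    define k where "k = length u"
    have alt': "alt b a k = u" unfolding k_def by (rule alt[symmetric])
    \<comment> \<open>A right factor of length \<open>m a b\<close> or more could be rewritten by
      the braid relation so as to end in \<open>a\<close>. Below that length both sines in
      \<open>alt_root\<close> are nonnegative.\<close>
    have km: "k < m a b"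
    proof (rule ccontr)
      assume "\<not> k < m a b"
      then obtain j where j: "k = j + m a b" by (metis add.commute le_Suc_ex not_le)
      obtain M where M: "m a b = Suc M" using m_offdiag[OF a b ab] by (cases "m a b") auto
      have split: "\<exists>p. set p \<subseteq> {a, b} \<and> length p = j \<and> alt b a (j + N) = p @ alt b a N" for N
      proof (induction j)
        case (Suc j)
        then obtain p where "set p \<subseteq> {a, b}" "length p = j" "alt b a (j + N) = p @ alt b a N" by blast
        then show ?case by (intro exI[of _ "(if even (j + N) then b else a) # p"]) auto
      qed simp
      obtain p where p: "set p \<subseteq> {a, b}" "length p = j" "alt b a (j + m a b) = p @ alt b a (m a b)"
        using split by blast
      have "act u = act ((p @ alt b a M) @ [a])"
      proof -
        have "u = p @ alt b a (m a b)" using p(3) alt' j by simp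
        then have "act u = act p \<circ> act (alt a b (m a b))" by (simp only: act_append braid[OF a b ab])
        then show ?thesis by (simp only: M alt_snoc act_append comp_assoc)
      qed
      then show False using not_a[of "p @ alt b a M"] p set_alt[of b a M] j M by (auto simp: k_def)
    qed
    define \<theta> where "\<theta> = pi / real (m a b)"
    have m0: "m a b \<ge> 2" by (rule m_offdiag[OF a b ab])
    have s: "sin \<theta> > 0" using m0 by (intro sin_gt_zero) (auto simp: \<theta>_def field_simps)
    have sk: "sin (real j * \<theta>) \<ge> 0" if "j \<le> m a b" for j
    proof (rule sin_ge_zero)
      have "real j * \<theta> \<le> real (m a b) * \<theta>" using that m0 by (intro mult_right_mono) (auto simp: \<theta>_def)
      then show "real j * \<theta> \<le> pi" using m0 by (simp add: \<theta>_def)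
    qed (use m0 in \<open>simp add: \<theta>_def\<close>)
    have "act w (e a) = act v (act (alt b a k) (e a))"
    proof -
      have "act w = act v \<circ> act u" using vuw by (simp add: act_append)
      then show ?thesis by (simp add: alt')
    qed
    also have "\<dots> = (sin (real (Suc k) * \<theta>) / sin \<theta>) *\<^sub>R act v (e (if even k then a else b)) +
        (sin (real k * \<theta>) / sin \<theta>) *\<^sub>R act v (e (if even k then b else a))"
      unfolding alt_root[OF a b ab] act_linear \<theta>_def ..
    finally show ?thesis
      using pos[of a] pos[of b] sk[of k] sk[of "Suc k"] km s
      by (auto intro!: nonneg_comb_add nonneg_comb_scale divide_nonneg_pos)
  qed
qed

text \<open>Induction on the length: prefixing a reflection that increases the length adds
  \<open>t *\<^sub>R e j\<close>. Here \<open>t \<ge> 0\<close>, because \<open>e j\<close> moved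
  back by \<open>h\<close> is a nonnegative combination of the normals and \<open>l\<close> pairs
  nonpositively with these. The last clause records that the first reflection to move
  \<open>l\<close> is the one in facet \<open>i\<close>, as the other three fix it.\<close>

theorem orbit_nonneg_comb:
  assumes w: "word w" and l: "\<And>k. k < 4 \<Longrightarrow> lorentz l (e k) \<le> 0"
    and i: "i < 4" "\<And>k. k < 4 \<Longrightarrow> k \<noteq> i \<Longrightarrow> lorentz l (e k) = 0"
  shows "\<exists>c. (\<forall>k<4. c k \<ge> 0) \<and> act w l = l + (\<Sum>k<4. c k *\<^sub>R e k) \<and> (act w l = l \<or> c i \<ge> - 2 * lorentz l (e i))"
  using w
proof (induction "len (act w)" arbitrary: w)
  case 0
  then obtain u where "length u = 0" "act u = act w" using reduced_word[OF \<open>word w\<close>] by auto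
  then have "act w = id" by auto
  then show ?case by (intro exI[of _ "\<lambda>_. 0"]) simp
next
  case (Suc n)
  obtain r where r: "word r" "length r = Suc n" "act r = act w" using reduced_word[OF \<open>word w\<close>] Suc(2) by auto
  obtain j h where jh: "r = j # h" using r(2) by (cases r) auto
  have j: "j < 4" and h: "word h" using r(1) jh by auto
  have "len (act h) \<le> n" using len_le[OF h] r(2) jh by simp
  moreover have "len (act w) \<le> len (act h) + 1"
    using len_append[of "rev h" "[j]"] h j len_rev[OF h] len_rev[of "j # h"] r jh by simp
  ultimately have lh: "len (act h) = n" using Suc(2) by simp
  from Suc(1)[OF lh[symmetric] h] obtain c where c: "\<forall>k<4. c k \<ge> 0" "act h l = l + (\<Sum>k<4. c k *\<^sub>R e k)"
    "act h l = l \<or> c i \<ge> - 2 * lorentz l (e i)" by blast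
  define t where "t = - 2 * lorentz (act h l) (e j)"
  have t0: "t \<ge> 0"
  proof -
    have "len (act (rev h)) \<le> len (act (rev h @ [j]))"
      using len_rev[OF h] len_rev[of "j # h"] lh r jh Suc(2) j h by simp
    then have "nonneg_comb (act (rev h) (e j))" using length_increase_nonneg_comb[of "rev h" j] h j by simp
    then obtain d where d: "\<forall>k<4. d k \<ge> 0" "act (rev h) (e j) = (\<Sum>k<4. d k *\<^sub>R e k)" unfolding nonneg_comb_def by blast
    have "lorentz (act h l) (e j) = lorentz (act (rev h) (act h l)) (act (rev h) (e j))"
      using act_lorentz[of "rev h"] h by simp
    also have "\<dots> = lorentz l (act (rev h) (e j))" by (simp add: act_rev[OF h])
    also have "\<dots> = (\<Sum>k<4. d k * lorentz l (e k))"
      unfolding d(2) by (simp add: eval_nat_numeral lorentz_simps)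
    also have "\<dots> \<le> 0" using d(1) l by (intro sum_nonpos) (auto simp: mult_nonneg_nonpos)
    finally show ?thesis by (simp add: t_def)
  qed
  define c' where "c' k = c k + (if k = j then t else 0)" for k
  have "act w l = act h l + t *\<^sub>R e j" 
  proof -
    have "act w = act (j # h)" using r(3) jh by simp
    then show ?thesis by (simp add: hyp_reflection_def t_def)
  qed
  also have "\<dots> = l + (\<Sum>k<4. c' k *\<^sub>R e k)"
    using j by (simp add: c(2) c'_def scaleR_add_left sum.distrib if_distrib[of "\<lambda>a. a *\<^sub>R _"] cong: if_cong)
  finally have eq: "act w l = l + (\<Sum>k<4. c' k *\<^sub>R e k)" .
  have "act w l = l \<or> c' i \<ge> - 2 * lorentz l (e i)"
  proof (cases "act h l = l")
    case True
    show ?thesis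
    proof (cases "j = i")
      case True
      then show ?thesis using c(1) i(1) \<open>act h l = l\<close> by (simp add: c'_def t_def)
    next
      case False
      then have "t = 0" using True i(2)[OF j] by (simp add: t_def)
      then show ?thesis using True \<open>act w l = act h l + t *\<^sub>R e j\<close> by simp
    qed
  next
    case False
    then show ?thesis using c(3) t0 by (auto simp: c'_def)
  qed
  then show ?case using eq c(1) t0 by (intro exI[of _ c']) (auto simp: c'_def)
qed

end

section \<open>Horoball packings of a Coxeter tetrahedron\<close>

lemma future_null_mult_pos:
  assumes "l \<in> future_null" "lorentz m m = 0" "lorentz l m < 0"
  shows "m \<in> future_null"
proof -
  have "fst m > 0"
  proof (rule ccontr)
    assume "\<not> fst m > 0"
    have "lorentz (- m) l \<le> 0"
      by (rule lorentz_future_nonpos)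
        (use assms \<open>\<not> fst m > 0\<close> in \<open>simp_all add: future_null_def lorentz_minus_left lorentz_minus_right\<close>)
    then show False using assms(3) lorentz_commute[of m l] by (simp add: lorentz_minus_left)
  qed
  then show ?thesis using assms by (simp add: future_null_def)
qed

text \<open>Equality case of Cauchy-Schwarz for the space parts, whose norms equal the time
  parts.\<close>

lemma future_null_orthogonal:
  assumes "l \<in> future_null" "m \<in> future_null" "lorentz l m = 0"
  shows "fst l *\<^sub>R m = fst m *\<^sub>R l"
proof -
  have n: "norm (snd l) = fst l" "norm (snd m) = fst m"
    using assms by (auto simp: future_null_def lorentz_def norm_eq_sqrt_inner intro!: real_sqrt_unique simp: power2_eq_square)
  then have "snd l \<bullet> snd m = norm (snd l) * norm (snd m)" using assms(3) by (simp add: lorentz_def)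
  then have "norm (snd l) *\<^sub>R snd m = norm (snd m) *\<^sub>R snd l" using norm_cauchy_schwarz_eq by blast
  then show ?thesis by (simp add: n prod_eq_iff)
qed

lemma future_null_scale: "l \<in> future_null \<Longrightarrow> a > 0 \<Longrightarrow> a *\<^sub>R l \<in> future_null"
  by (simp add: future_null_def lorentz_simps)

text \<open>The two summands of \<open>y\<close> are the components of \<open>l\<close> and
  \<open>m\<close> orthogonal to \<open>x\<close>, scaled to the same norm; \<open>y\<close> is
  orthogonal to the timelike \<open>x\<close>, so its square is nonnegative. The inequality bounds
  the overlap of two horoballs by the product of their vectors.\<close>

lemma hyp3_horosphere_product:
  assumes x: "x \<in> hyp3" and l: "l \<in> future_null" and m: "m \<in> future_null"
  shows "lorentz l m \<ge> - 2 * (lorentz x l * lorentz x m)"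
proof -
  define p where "p = lorentz x l"
  define q where "q = lorentz x m"
  have xx: "lorentz x x = - 1" "fst x > 0" using x by (auto simp: hyp3_def)
  have pq: "p < 0" "q < 0" using lorentz_future_neg[of x l] lorentz_future_neg[of x m] xx l m by (auto simp: p_def q_def future_null_def)
  define y where "y = q *\<^sub>R (l + p *\<^sub>R x) + p *\<^sub>R (m + q *\<^sub>R x)"
  have ll: "lorentz l l = 0" "lorentz m m = 0" using l m by (auto simp: future_null_def)
  have c: "lorentz l x = p" "lorentz m x = q" "lorentz x l = p" "lorentz x m = q" "lorentz m l = lorentz l m"
    by (simp_all add: p_def q_def lorentz_commute)
  have "lorentz x y = 0" by (simp add: y_def lorentz_simps xx c)
  then have "lorentz y y \<ge> 0" using lorentz_square_pos_orth[of x y] xx by simp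
  moreover have "lorentz y y = 2 * (p * q) * (lorentz l m + 2 * (p * q))"
    unfolding y_def by (simp add: lorentz_simps xx c ll) (simp add: algebra_simps)
  moreover have "2 * (p * q) > 0" using pq by (simp add: mult_neg_neg)
  ultimately have "lorentz l m + 2 * (p * q) \<ge> 0"
    by (metis zero_le_mult_iff not_le)
  then show ?thesis by (simp add: p_def q_def)
qed

lemma hyp_interior_horoball:
  assumes l: "l \<in> future_null"
  shows "hyp_interior (horoball l) = {x \<in> hyp3. lorentz x l > - 1}"
proof (intro set_eqI iffI)
  fix x assume "x \<in> {x \<in> hyp3. lorentz x l > - 1}"
  moreover have "openin (top_of_set hyp3) (hyp3 \<inter> {x. - 1 < lorentz x l})"
    by (intro openin_open_Int open_Collect_less continuous_intros)
  ultimately show "x \<in> hyp_interior (horoball l)"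
    unfolding hyp_interior_def interior_of_def horoball_def
    by (intro CollectI exI[of _ "hyp3 \<inter> {x. - 1 < lorentz x l}"]) auto
next
  fix x assume "x \<in> hyp_interior (horoball l)"
  then obtain U where U: "open U" "x \<in> U" "x \<in> hyp3" "hyp3 \<inter> U \<subseteq> horoball l"
    by (auto simp: hyp_interior_def interior_of_def openin_open)
  have "lorentz x l \<noteq> - 1"
  proof
    assume xl: "lorentz x l = - 1"
    \<comment> \<open>The geodesic from \<open>x\<close> that runs away from the centre of the
      horoball. The coefficient of \<open>l\<close> keeps it on the hyperboloid, and its product
      with \<open>l\<close> is \<open>- s\<close>, below - 1 for s > 1.\<close>
    define y where "y s = s *\<^sub>R x + ((1 - s\<^sup>2) / (2 * s)) *\<^sub>R l" for s
    have xx: "lorentz x x = - 1" "fst x > 0" using U by (auto simp: hyp3_def)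
    have ll: "lorentz l l = 0" using l by (simp add: future_null_def)
    have y1: "y 1 = x" by (simp add: y_def)
    have lim: "(y \<longlongrightarrow> y 1) (at_right 1)"
      unfolding y_def by (intro tendsto_intros) auto
    have "eventually (\<lambda>s. y s \<in> U) (at_right 1)"
      using topological_tendstoD[OF lim U(1)] U(2) y1 by simp
    moreover have "eventually (\<lambda>s. fst (y s) > 0) (at_right 1)"
      using tendsto_fst[OF lim] xx(2) by (intro order_tendstoD(1)[of _ "fst x"]) (simp_all add: y1)
    moreover have "eventually (\<lambda>s. s > (1 :: real)) (at_right 1)"
      by (simp add: eventually_at_filter)
    ultimately have "eventually (\<lambda>s. y s \<in> U \<and> fst (y s) > 0 \<and> s > 1) (at_right 1)"
      by eventually_elim auto
    then obtain s where s: "y s \<in> U" "fst (y s) > 0" "s > 1"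
      using eventually_happens'[OF trivial_limit_at_right_real] by blast
    have lx: "lorentz l x = - 1" using xl by (simp add: lorentz_commute)
    define r where "r = (1 - s\<^sup>2) / (2 * s)"
    have r: "2 * s * r = 1 - s\<^sup>2" using s by (simp add: r_def)
    have "lorentz (y s) (y s) = - s\<^sup>2 - 2 * s * r"
      unfolding y_def r_def[symmetric] by (simp add: lorentz_simps xx ll xl lx power2_eq_square algebra_simps)
    also have "\<dots> = - 1" using r by simp
    finally have "y s \<in> hyp3" using s by (simp add: hyp3_def)
    then have "lorentz (y s) l \<ge> - 1" using U(4) s by (auto simp: horoball_def)
    then show False using s by (simp add: y_def lorentz_simps xl ll)
  qed
  moreover have "x \<in> horoball l" using U by auto
  ultimately show "x \<in> {x \<in> hyp3. lorentz x l > - 1}" by (auto simp: horoball_def)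
qed

text \<open>The points of the geodesic between two ideal points; a small ratio \<open>r\<close> is
  close to \<open>l\<close>, a large one close to \<open>m\<close>. They are the explicit witnesses
  in the arguments about overlapping, distinct and protruding horoballs.\<close>

lemma geodesic_point:
  assumes l: "l \<in> future_null" and m: "m \<in> future_null" and k: "lorentz l m = - k" "k > 0" and r: "r > 0"
  obtains x c where "x \<in> hyp3" "c > 0" "c\<^sup>2 * (2 * r * k) = 1" "x = c *\<^sub>R (l + r *\<^sub>R m)"
    "lorentz x l = - (c * r * k)" "lorentz x m = - (c * k)"
proof -
  define c where "c = 1 / sqrt (2 * r * k)"
  have c: "c > 0" "c\<^sup>2 * (2 * r * k) = 1" using k r by (auto simp: c_def power_divide)
  define x where "x = c *\<^sub>R (l + r *\<^sub>R m)"
  have ml: "lorentz m l = - k" using k(1) by (simp add: lorentz_commute)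
  have n: "lorentz l l = 0" "lorentz m m = 0" "fst l > 0" "fst m > 0" using l m by (auto simp: future_null_def)
  have "lorentz x x = - (c\<^sup>2 * (2 * r * k))"
    by (simp add: x_def lorentz_simps n k ml power2_eq_square algebra_simps)
  then have "x \<in> hyp3" using c n r by (simp add: hyp3_def x_def add_pos_pos)
  then show ?thesis
    by (rule that[OF _ c x_def]) (simp_all add: x_def lorentz_simps n k ml)
qed

lemma disjoint_horoballs_if:
  assumes "l \<in> future_null" "m \<in> future_null" "lorentz l m \<le> - 2"
  shows "disjnt (hyp_interior (horoball l)) (hyp_interior (horoball m))"
  unfolding hyp_interior_horoball[OF assms(1)] hyp_interior_horoball[OF assms(2)] disjnt_iff
proof (intro allI notI)
  fix x assume "x \<in> {x \<in> hyp3. - 1 < lorentz x l} \<and> x \<in> {x \<in> hyp3. - 1 < lorentz x m}"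
  then have x: "x \<in> hyp3" "lorentz x l > - 1" "lorentz x m > - 1" by auto
  have "lorentz x l < 0" "lorentz x m < 0"
    using lorentz_future_neg[of x l] lorentz_future_neg[of x m] x assms by (auto simp: hyp3_def future_null_def)
  then have "(- lorentz x l) * (- lorentz x m) < 1 * 1" using x by (intro mult_strict_mono) auto
  then show False using hyp3_horosphere_product[OF x(1) assms(1,2)] assms(3) by simp
qed

lemma disjoint_horoballs_only_if:
  assumes l: "l \<in> future_null" and m: "m \<in> future_null" and neg: "lorentz l m < 0"
    and disj: "disjnt (hyp_interior (horoball l)) (hyp_interior (horoball m))"
  shows "lorentz l m \<le> - 2"
proof (rule ccontr)
  assume gt: "\<not> lorentz l m \<le> - 2"
  define k where "k = - lorentz l m"
  have k: "lorentz l m = - k" "k > 0" "k < 2" using neg gt by (auto simp: k_def)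
  \<comment> \<open>The ratio 1 gives the point with equal products with \<open>l\<close> and
    \<open>m\<close>; it is interior to both horoballs if \<open>lorentz l m > - 2\<close>.\<close>
  obtain x c where x: "x \<in> hyp3" "c > 0" "c\<^sup>2 * (2 * 1 * k) = 1" "lorentz x l = - (c * 1 * k)" "lorentz x m = - (c * k)"
    using geodesic_point[OF l m k(1,2) zero_less_one] by blast
  have "(c * k)\<^sup>2 = k / 2" using x(3) by (simp add: power2_eq_square field_simps)
  also have "\<dots> < 1\<^sup>2" using k by simp
  finally have "c * k < 1" using power_less_imp_less_base by fastforce
  then have "x \<in> hyp_interior (horoball l)" "x \<in> hyp_interior (horoball m)"
    using x by (auto simp: hyp_interior_horoball l m)
  then show False using disj unfolding disjnt_iff by blast
qed

text \<open>A packing demands disjointness only of distinct members, so horoballs at different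
  vertices first have to be told apart.\<close>

lemma horoball_neq:
  assumes l: "l \<in> future_null" and m: "m \<in> future_null" and neg: "lorentz l m < 0"
  shows "horoball l \<noteq> horoball m"
proof -
  define k where "k = - lorentz l m"
  have k: "lorentz l m = - k" "k > 0" using neg by (auto simp: k_def)
  \<comment> \<open>The bound by \<open>1 / k\<close> puts the point into the horoball of
    \<open>l\<close>, the bound by \<open>k / 4\<close> keeps it out of the horoball of
    \<open>m\<close>.\<close>
  define r where "r = min (1 / k) (k / 4)"
  have r: "r > 0" "r * k \<le> 1" "4 * r \<le> k"
  proof -
    show "r > 0" using k by (simp add: r_def)
    have "r * k \<le> 1 / k * k" using k by (intro mult_right_mono) (auto simp: r_def)
    then show "r * k \<le> 1" using k by simp
    have "r \<le> k / 4" by (simp add: r_def)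
    then show "4 * r \<le> k" by simp
  qed
  obtain x c where x: "x \<in> hyp3" "c > 0" "c\<^sup>2 * (2 * r * k) = 1" "lorentz x l = - (c * r * k)" "lorentz x m = - (c * k)"
    using geodesic_point[OF l m k r(1)] by blast
  have "(c * r * k)\<^sup>2 * 2 = (c\<^sup>2 * (2 * r * k)) * (r * k)" by (simp add: power2_eq_square)
  then have "(c * r * k)\<^sup>2 \<le> 1\<^sup>2" using x(3) r by simp
  then have "c * r * k \<le> 1" by (rule power2_le_imp_le) simp
  then have "x \<in> horoball l" using x by (simp add: horoball_def)
  have "(c * k)\<^sup>2 * (2 * r) = k" using x(3) by (simp add: power2_eq_square algebra_simps)
  then have "c * k > 1"
  proof -
    have "\<not> (c * k)\<^sup>2 \<le> 1"
    proof
      assume "(c * k)\<^sup>2 \<le> 1"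
      then have "(c * k)\<^sup>2 * (2 * r) \<le> 1 * (2 * r)" using r by (intro mult_right_mono) auto
      then show False using \<open>(c * k)\<^sup>2 * (2 * r) = k\<close> r by simp
    qed
    then show ?thesis using power_le_one[of "c * k" 2] x k by fastforce
  qed
  then have "x \<notin> horoball m" using x by (simp add: horoball_def)
  with \<open>x \<in> horoball l\<close> show ?thesis by auto
qed

section \<open>Reflections, and horoballs inside half-spaces\<close>

lemma hyp_reflection_hyp3:
  assumes u: "lorentz u u = 1" and x: "x \<in> hyp3"
  shows "hyp_reflection u x \<in> hyp3"
proof -
  have xx: "lorentz x x = - 1" "fst x > 0" using x by (auto simp: hyp3_def)
  have "lorentz (hyp_reflection u x) x = - 1 - 2 * (lorentz x u)\<^sup>2"
    using lorentz_commute[of u x] by (simp add: hyp_reflection_def lorentz_simps xx power2_eq_square)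
  also have "\<dots> < 0" using zero_le_power2[of "lorentz x u"] by linarith
  finally have "fst (hyp_reflection u x) > 0"
    using timelike_future_iff[of "hyp_reflection u x" x] xx by (simp add: lorentz_hyp_reflection[OF u])
  then show ?thesis by (simp add: hyp3_def lorentz_hyp_reflection[OF u] xx)
qed

lemma hyp_reflection_future_null:
  assumes u: "lorentz u u = 1" and l: "l \<in> future_null"
  shows "hyp_reflection u l \<in> future_null"
proof (cases "lorentz l u = 0")
  case True
  then show ?thesis using l by (simp add: hyp_reflection_def)
next
  case False
  have ll: "lorentz l l = 0" using l by (simp add: future_null_def)
  have "lorentz l (hyp_reflection u l) = - 2 * (lorentz l u)\<^sup>2"
    by (simp add: hyp_reflection_def lorentz_simps ll power2_eq_square)
  also have "\<dots> < 0" using False by simp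
  finally show ?thesis
    by (intro future_null_mult_pos[OF l]) (simp_all add: lorentz_hyp_reflection[OF u] ll)
qed

text \<open>A horoball stays on its side of a plane iff its interior does not meet that of its
  mirror image. With a = - lorentz l u, the product of \<open>l\<close> with its reflection
  \<open>l'\<close> is - 2 a^2, so the threshold - 2 is reached at a = 1.\<close>

lemma horoball_subset_half_space_iff:
  assumes u: "lorentz u u = 1" and l: "l \<in> future_null" and neg: "lorentz l u < 0"
  shows "horoball l \<subseteq> half_space u \<longleftrightarrow> lorentz l u \<le> - 1"
proof
  define a where "a = - lorentz l u"
  define l' where "l' = hyp_reflection u l"
  have a: "lorentz l u = - a" "a > 0" using neg by (auto simp: a_def)
  have l'_eq: "l' = l + (2 * a) *\<^sub>R u" by (simp add: l'_def hyp_reflection_def a)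
  have l': "l' \<in> future_null" unfolding l'_def by (rule hyp_reflection_future_null[OF u l])
  have ll: "lorentz l l = 0" using l by (simp add: future_null_def)
  have ll': "lorentz l l' = - (2 * a\<^sup>2)" by (simp add: l'_eq lorentz_simps ll a power2_eq_square)
  show "lorentz l u \<le> - 1" if sub: "horoball l \<subseteq> half_space u"
  proof (rule ccontr)
    assume "\<not> ?thesis"
    then have a1: "a < 1" by (simp add: a)
    have pos: "2 * a\<^sup>2 > 0" "1 / a\<^sup>2 > 0" using a(2) by simp_all
    \<comment> \<open>The ratio \<open>1 / a\<^sup>2\<close> is the one for which the point lies on
      the horosphere; for a < 1 it is beyond the plane.\<close>
    obtain x c where x: "x \<in> hyp3" "c > 0" "c\<^sup>2 * (2 * (1 / a\<^sup>2) * (2 * a\<^sup>2)) = 1" "x = c *\<^sub>R (l + (1 / a\<^sup>2) *\<^sub>R l')"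
      "lorentz x l = - (c * (1 / a\<^sup>2) * (2 * a\<^sup>2))"
      using geodesic_point[OF l l' ll' pos] by blast
    have "(2 * c)\<^sup>2 = 1\<^sup>2" using x(3) a by (simp add: power2_eq_square)
    then have c: "2 * c = 1" using x(2) by (subst (asm) power2_eq_iff_nonneg) auto
    have "lorentz x l = - 1" using x(5) c a by simp
    then have "x \<in> horoball l" using x(1) by (simp add: horoball_def)
    then have "lorentz x u \<le> 0" using sub by (auto simp: half_space_def)
    moreover have "lorentz x u = c * (1 / a - a)"
      unfolding x(4) l'_eq by (simp add: lorentz_simps a u power2_eq_square field_simps)
    moreover have "1 / a - a > 0"
    proof -
      have "a * a < 1 * 1" using a a1 by (intro mult_strict_mono) auto
      then show ?thesis using a by (simp add: field_simps)
    qed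
    ultimately show False using x(2) by (simp add: mult_le_0_iff)
  qed
  show "horoball l \<subseteq> half_space u" if le: "lorentz l u \<le> - 1"
  proof
    fix x assume "x \<in> horoball l"
    then have x: "x \<in> hyp3" "lorentz x l \<ge> - 1" by (auto simp: horoball_def)
    have "lorentz x u \<le> 0"
    proof (rule ccontr)
      assume "\<not> ?thesis"
      then have "2 * a * lorentz x u > 0" using a(2) by simp
      then have "lorentz x l' > - 1" using x by (simp add: l'_eq lorentz_simps)
      moreover have "lorentz x l < 0" "lorentz x l' < 0"
        using lorentz_future_neg[of x l] lorentz_future_neg[of x l'] x l l' by (auto simp: hyp3_def future_null_def)
      moreover from this have "(- lorentz x l) * (- lorentz x l') \<le> 1 * (- lorentz x l')"
        using x(2) by (intro mult_right_mono) auto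
      ultimately have "(- lorentz x l) * (- lorentz x l') < 1" by linarith
      moreover have "a\<^sup>2 \<ge> 1" using le a by (simp add: one_le_power)
      ultimately show False using hyp3_horosphere_product[OF x(1) l l'] ll' by simp
    qed
    then show "x \<in> half_space u" using x by (simp add: half_space_def)
  qed
qed

locale coxeter_tetrahedron = coxeter_vectors +
  assumes vertex: "i < 4 \<Longrightarrow> \<exists>w. represents_vertex e i w"
begin

text \<open>Pairing with the vertex opposite facet \<open>i\<close> isolates the coefficient of
  \<open>e i\<close>: the vertices are a dual basis up to scaling.\<close>

lemma independent_vectors:
  assumes "(\<Sum>k<4. c k *\<^sub>R e k) = 0" "i < 4"
  shows "c i = 0"
proof -
  obtain w where w: "represents_vertex e i w" using vertex[OF assms(2)] by blast
  have "0 = lorentz w (\<Sum>k<4. c k *\<^sub>R e k)" by (simp add: assms lorentz_simps)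
  also have "\<dots> = (\<Sum>k<4. c k * lorentz w (e k))" by (simp add: eval_nat_numeral lorentz_simps)
  also have "\<dots> = (\<Sum>k<4. if k = i then c i * lorentz w (e i) else 0)"
    using w by (intro sum.cong) (auto simp: represents_vertex_def)
  also have "\<dots> = c i * lorentz w (e i)" using assms(2) by simp
  finally show ?thesis using w by (simp add: represents_vertex_def)
qed

text \<open>Four independent normals span Minkowski space, so \<open>x\<close> is orthogonal to
  every vector. Its product with the time reversal \<open>(- fst x, snd x)\<close> is its Euclidean
  square.\<close>

lemma orthogonal_all_zero:
  assumes x: "\<And>k. k < 4 \<Longrightarrow> lorentz x (e k) = 0"
  shows "x = 0"
proof -
  have inj: "inj_on e {..<4}"
  proof (rule inj_onI, rule ccontr)
    fix i j assume ij: "i \<in> {..<4}" "j \<in> {..<4}" "e i = e j" "i \<noteq> j"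
    have "(\<Sum>k<4. (if k = i then 1 else if k = j then - 1 else 0 :: real) *\<^sub>R e k) = (\<Sum>k\<in>{i, j}. (if k = i then 1 else if k = j then - 1 else 0 :: real) *\<^sub>R e k)"
      using ij by (intro sum.mono_neutral_right) auto
    also have "\<dots> = 0" using ij by simp
    finally show False using independent_vectors[of "\<lambda>k. if k = i then 1 else if k = j then - 1 else 0" i] ij by simp
  qed
  have "independent (e ` {..<4})"
  proof (rule independent_if_scalars_zero)
    fix f v assume f: "(\<Sum>v\<in>e ` {..<4}. f v *\<^sub>R v) = 0" "v \<in> e ` {..<4}"
    then have "(\<Sum>k<4. f (e k) *\<^sub>R e k) = 0" by (simp add: sum.reindex[OF inj])
    then show "f v = 0" using independent_vectors[of "\<lambda>k. f (e k)"] f by auto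
  qed simp
  moreover have "card (e ` {..<4}) = dim (UNIV :: minkowski set)" by (simp add: card_image[OF inj])
  ultimately have span: "span (e ` {..<4}) = UNIV"
    using card_eq_dim[of "e ` {..<4}" UNIV] by auto
  have "lorentz x y = 0" for y
  proof -
    have "y \<in> span (e ` {..<4})" by (simp add: span)
    then show ?thesis by (induction rule: span_induct_alt) (auto simp: lorentz_simps x)
  qed
  from this[of "(- fst x, snd x)"] have "snd x \<bullet> snd x + fst x * fst x = 0" by (simp add: lorentz_def)
  then have "snd x \<bullet> snd x = 0" "fst x * fst x = 0" using inner_ge_zero[of "snd x"] zero_le_square[of "fst x"] by linarith+
  then show ?thesis by (simp add: prod_eq_iff)
qed

lemma vertex_unique:
  assumes i: "i < 4" and x: "\<And>k. k < 4 \<Longrightarrow> k \<noteq> i \<Longrightarrow> lorentz x (e k) = 0" and y: "\<And>k. k < 4 \<Longrightarrow> k \<noteq> i \<Longrightarrow> lorentz y (e k) = 0"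
    and yi: "lorentz y (e i) \<noteq> 0"
  shows "x = (lorentz x (e i) / lorentz y (e i)) *\<^sub>R y"
proof -
  have "lorentz (x - (lorentz x (e i) / lorentz y (e i)) *\<^sub>R y) (e k) = 0" if "k < 4" for k
    using x[OF that] y[OF that] yi by (cases "k = i") (auto simp: lorentz_simps)
  from orthogonal_all_zero[OF this] show ?thesis by simp
qed

section \<open>The group action on horoballs, and packings as systems of vectors\<close>

lemma act_hyp3: "word w \<Longrightarrow> x \<in> hyp3 \<Longrightarrow> act w x \<in> hyp3"
  by (induction w) (auto simp: hyp_reflection_hyp3 unit)

lemma act_future_null: "word w \<Longrightarrow> x \<in> future_null \<Longrightarrow> act w x \<in> future_null"
  by (induction w) (auto simp: hyp_reflection_future_null unit)

lemma act_horoball: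
  assumes w: "word w" shows "act w ` horoball l = horoball (act w l)"
proof
  show "act w ` horoball l \<subseteq> horoball (act w l)"
    using w by (auto simp: horoball_def act_hyp3 act_lorentz)
  show "horoball (act w l) \<subseteq> act w ` horoball l"
  proof
    fix x assume x: "x \<in> horoball (act w l)"
    have "x = act w (act (rev w) x)" by (simp add: act_rev'[OF w])
    moreover have "act (rev w) x \<in> horoball l"
      using x w act_lorentz[of "rev w" x "act w l"] by (auto simp: horoball_def act_hyp3 act_rev)
    ultimately show "x \<in> act w ` horoball l" by blast
  qed
qed

text \<open>In the case of two ideal vertices a zero product would make the null vectors
  proportional, although only one of them pairs to zero with \<open>e j\<close>.\<close>

lemma vertices_neg:
  assumes i: "i < 4" "l \<in> future_null" "represents_vertex e i l" and j: "j < 4" "j \<noteq> i" "represents_vertex e j w"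
  shows "lorentz w l < 0"
proof (cases "lorentz w w < 0")
  case True
  then show ?thesis using lorentz_future_neg[of w l] i j by (simp add: represents_vertex_def future_null_def)
next
  case False
  then have w: "w \<in> future_null" using j by (auto simp: represents_vertex_def future_null_def)
  have "lorentz w l \<le> 0" using lorentz_future_nonpos[of w l] w i by (auto simp: future_null_def)
  moreover have "lorentz w l \<noteq> 0"
  proof
    assume "lorentz w l = 0"
    then have "fst w *\<^sub>R l = fst l *\<^sub>R w" by (rule future_null_orthogonal[OF w i(2)])
    then have "lorentz (fst w *\<^sub>R l) (e j) = lorentz (fst l *\<^sub>R w) (e j)" by simp
    then have "fst l * lorentz w (e j) = 0" using i j by (simp add: lorentz_simps represents_vertex_def)
    then show False using i j by (auto simp: future_null_def represents_vertex_def)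
  qed
  ultimately show ?thesis by simp
qed

definition packing_vectors :: "(nat \<Rightarrow> minkowski) \<Rightarrow> bool" where
  "packing_vectors l \<longleftrightarrow> (\<forall>i\<in>ideal_vertices e. l i \<in> future_null \<and> represents_vertex e i (l i) \<and>
     lorentz (l i) (e i) \<le> - 1 \<and> (\<forall>j\<in>ideal_vertices e. j \<noteq> i \<longrightarrow> lorentz (l i) (l j) \<le> - 2))"

lemma packing_vectors_of_packing:
  assumes "horoball_packing e B b"
  obtains l where "packing_vectors l" "\<And>i. i \<in> ideal_vertices e \<Longrightarrow> b i = horoball (l i)"
proof -
  note A = assms[unfolded horoball_packing_def, THEN conjunct2, THEN conjunct2]
  note c3 = A[THEN conjunct1] and c4 = A[THEN conjunct2, THEN conjunct1]
    and c5 = A[THEN conjunct2, THEN conjunct2, THEN conjunct1] and c6 = A[THEN conjunct2, THEN conjunct2, THEN conjunct2]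
  have "\<forall>i\<in>ideal_vertices e. \<exists>l. l \<in> future_null \<and> represents_vertex e i l \<and> b i = horoball l"
    using c4 by blast
  from bchoice[OF this] obtain l where
    l: "\<And>i. i \<in> ideal_vertices e \<Longrightarrow> l i \<in> future_null \<and> represents_vertex e i (l i) \<and> b i = horoball (l i)"
    by blast
  have i4: "i < 4" if "i \<in> ideal_vertices e" for i using that by (simp add: ideal_vertices_def)
  have bB: "b i \<in> B" if "i \<in> ideal_vertices e" for i
  proof -
    have "b i \<in> b ` ideal_vertices e" using that by (rule imageI)
    then show ?thesis unfolding c3[symmetric] by simp
  qed
  have "lorentz (l i) (e i) \<le> - 1" if i: "i \<in> ideal_vertices e" for i
  proof -
    have "b i \<subseteq> half_space (e i)" using c6 i by (rule bspec)
    moreover have "lorentz (l i) (e i) < 0" using l[OF i] unfolding represents_vertex_def by blast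
    ultimately show ?thesis using horoball_subset_half_space_iff[OF unit[OF i4[OF i]], of "l i"] l[OF i] by simp
  qed
  moreover have "lorentz (l i) (l j) \<le> - 2" if i: "i \<in> ideal_vertices e" and j: "j \<in> ideal_vertices e" and ne: "j \<noteq> i" for i j
  proof -
    have neg: "lorentz (l i) (l j) < 0" using vertices_neg[of j "l j" i "l i"] l[OF i] l[OF j] i4[OF i] i4[OF j] ne by blast
    have "b i \<noteq> b j" using horoball_neq[OF _ _ neg] l[OF i] l[OF j] by simp
    then have "disjnt (hyp_interior (b i)) (hyp_interior (b j))"
      using pairwiseD[OF c5 bB[OF i] bB[OF j]] by blast
    then show ?thesis using disjoint_horoballs_only_if[OF _ _ neg] l[OF i] l[OF j] by simp
  qed
  ultimately have "packing_vectors l" using l unfolding packing_vectors_def by blast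
  then show ?thesis using that l by blast
qed

text \<open>By \<open>orbit_nonneg_comb\<close> the image of \<open>l i\<close> is
  \<open>l i\<close> plus a nonnegative combination of the normals, of which \<open>l j\<close> sees
  only the term of \<open>e j\<close>. For i \<noteq> j the product starts at - 2 or below and can
  only decrease. For i = j it starts at 0, and a moved image has coefficient at least 2 at
  \<open>e i\<close>. The second claim holds because points of the simplex pair nonpositively with
  all normals.\<close>

lemma orbit_separation:
  assumes l: "packing_vectors l" and i: "i \<in> ideal_vertices e" and j: "j \<in> ideal_vertices e" and w: "word w"
  shows "i = j \<and> act w (l i) = l i \<or> lorentz (act w (l i)) (l j) \<le> - 2"
    and "x \<in> hyp_simplex e \<Longrightarrow> lorentz x (act w (l i)) \<le> lorentz x (l i)"
proof -
  have i4: "i < 4" "j < 4" using i j by (simp_all add: ideal_vertices_def)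
  have li: "l i \<in> future_null" "lorentz (l i) (e i) \<le> - 1" "\<And>k. k < 4 \<Longrightarrow> k \<noteq> i \<Longrightarrow> lorentz (l i) (e k) = 0"
    using l i by (auto simp: packing_vectors_def represents_vertex_def)
  have lj: "lorentz (l j) (e j) \<le> - 1" "\<And>k. k < 4 \<Longrightarrow> k \<noteq> j \<Longrightarrow> lorentz (l j) (e k) = 0"
    using l j by (auto simp: packing_vectors_def represents_vertex_def)
  have "lorentz (l i) (e k) \<le> 0" if "k < 4" for k using li(2) li(3)[OF that] by (cases "k = i") auto
  from orbit_nonneg_comb[OF w this i4(1) li(3)] obtain c where
    c: "\<And>k. k < 4 \<Longrightarrow> c k \<ge> 0" "act w (l i) = l i + (\<Sum>k<4. c k *\<^sub>R e k)" "act w (l i) = l i \<or> c i \<ge> - 2 * lorentz (l i) (e i)"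
    by blast
  have "lorentz (l j) (act w (l i)) = lorentz (l j) (l i) + (\<Sum>k<4. c k * lorentz (l j) (e k))"
    unfolding c(2) by (simp add: eval_nat_numeral lorentz_simps)
  also have "(\<Sum>k<4. c k * lorentz (l j) (e k)) = (\<Sum>k<4. if k = j then c j * lorentz (l j) (e j) else 0)"
    using lj by (intro sum.cong) auto
  also have "\<dots> = c j * lorentz (l j) (e j)" using i4 by simp
  finally have eq: "lorentz (act w (l i)) (l j) = lorentz (l i) (l j) + c j * lorentz (l j) (e j)"
    by (simp add: lorentz_commute)
  show "i = j \<and> act w (l i) = l i \<or> lorentz (act w (l i)) (l j) \<le> - 2"
  proof (cases "i = j")
    case False
    have "lorentz (l i) (l j) \<le> - 2" using l i j False by (auto simp: packing_vectors_def)
    moreover have "c j * lorentz (l j) (e j) \<le> 0" using c(1)[OF i4(2)] lj(1) by (intro mult_nonneg_nonpos) auto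
    ultimately show ?thesis using eq by simp
  next
    case True
    have "lorentz (act w (l i)) (l j) \<le> - 2" if "c i \<ge> - 2 * lorentz (l i) (e i)"
    proof -
      have "2 \<le> c i" using that li(2) by linarith
      then have "2 * 1 \<le> c i * - lorentz (l i) (e i)" using li(2) by (intro mult_mono) auto
      moreover have "lorentz (l i) (l i) = 0" using li(1) by (simp add: future_null_def)
      ultimately show ?thesis using eq True by simp
    qed
    then show ?thesis using c(3) True by auto
  qed
  show "lorentz x (act w (l i)) \<le> lorentz x (l i)" if x: "x \<in> hyp_simplex e"
  proof -
    have "lorentz x (act w (l i)) = lorentz x (l i) + (\<Sum>k<4. c k * lorentz x (e k))"
      unfolding c(2) by (simp add: eval_nat_numeral lorentz_simps)
    moreover have "(\<Sum>k<4. c k * lorentz x (e k)) \<le> 0"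
      using x c(1) by (intro sum_nonpos mult_nonneg_nonpos) (auto simp: hyp_simplex_def half_space_def)
    ultimately show ?thesis by simp
  qed
qed

lemma packing_of_packing_vectors:
  assumes l: "packing_vectors l"
  shows "\<exists>B. horoball_packing e B (\<lambda>i. horoball (l i))"
proof
  define I where "I = ideal_vertices e"
  define B where "B = {horoball (act w (l i)) | w i. word w \<and> i \<in> I}"
  have i4: "i < 4" if "i \<in> I" for i using that by (simp add: I_def ideal_vertices_def)
  have li: "l i \<in> future_null" "represents_vertex e i (l i)" "lorentz (l i) (e i) \<le> - 1" if "i \<in> I" for i
    using l that unfolding packing_vectors_def I_def by blast+
  have sep: "disjnt (hyp_interior (horoball (act w (l i)))) (hyp_interior (horoball (act v (l j))))"
    if wv: "word w" "word v" and ij: "i \<in> I" "j \<in> I" and ne: "horoball (act w (l i)) \<noteq> horoball (act v (l j))" for w v i j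
  proof -
    have eq: "lorentz (act (rev v @ w) (l i)) (l j) = lorentz (act w (l i)) (act v (l j))"
      using act_lorentz[OF wv(2), of "act (rev v @ w) (l i)" "l j"] wv by (simp add: act_append act_rev')
    have "\<not> (i = j \<and> act (rev v @ w) (l i) = l i)"
    proof
      assume h: "i = j \<and> act (rev v @ w) (l i) = l i"
      then have "act (rev v @ w) (l i) = l i" by blast
      then have "act (rev v) (act w (l i)) = l i" by (simp add: act_append)
      moreover have "i = j" using h by blast
      ultimately show False using ne act_rev'[OF wv(2), of "act w (l i)"] by simp
    qed
    then have "lorentz (act w (l i)) (act v (l j)) \<le> - 2"
      using orbit_separation(1)[OF l ij[unfolded I_def], of "rev v @ w"] wv eq by simp blast
    then show ?thesis using wv ij li by (intro disjoint_horoballs_if act_future_null) simp_all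
  qed
  have base: "horoball (l i) \<in> B" if "i \<in> I" for i
    unfolding B_def using that by (intro CollectI exI[of _ "[]"] exI[of _ i]) simp
  have meets: "hyp_interior (horoball (l i)) \<inter> hyp_simplex e \<noteq> {}" if i: "i \<in> I" for i
  proof -
    define j :: nat where "j = (if i = 0 then 1 else 0)"
    have j: "j < 4" "j \<noteq> i" by (auto simp: j_def)
    obtain p where p: "represents_vertex e j p" using vertex[OF j(1)] by blast
    define k where "k = - lorentz p (l i)"
    have k: "lorentz p (l i) = - k" "lorentz (l i) p = - k" "k > 0"
      using vertices_neg[OF i4[OF i] li(1,2)[OF i] j p] by (auto simp: k_def lorentz_commute)
    \<comment> \<open>A vector on the ray from another vertex \<open>p\<close> towards
      \<open>l i\<close>, hence over the closed simplex. The coefficient \<open>k\<close> is large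
      enough: \<open>- lorentz X X\<close> exceeds \<open>k\<^sup>2\<close>, so after normalization
      the product with \<open>l i\<close> is above - 1.\<close>
    define X where "X = p + k *\<^sub>R l i"
    have pp: "lorentz p p \<le> 0" "fst p > 0" using p by (auto simp: represents_vertex_def)
    have l0: "lorentz (l i) (l i) = 0" "fst (l i) > 0" using li(1)[OF i] by (auto simp: future_null_def)
    define s where "s = sqrt (- lorentz X X)"
    have XX: "lorentz X X \<le> - 2 * k\<^sup>2" using pp by (simp add: X_def lorentz_simps k l0 power2_eq_square)
    then have XX0: "- lorentz X X > k\<^sup>2" using k(3) by (simp add: less_le_trans[of "k\<^sup>2" "2 * k\<^sup>2"])
    moreover from this have "- lorentz X X \<ge> 0" using zero_le_power2[of k] by linarith
    ultimately have s: "s > k" "s\<^sup>2 = - lorentz X X" unfolding s_def by (simp_all add: real_less_rsqrt)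
    define x where "x = (1 / s) *\<^sub>R X"
    have s0: "s > 0" using s k by simp
    have "lorentz X X = - (s * s)" using s(2) by (simp add: power2_eq_square)
    then have "lorentz x x = - 1" using s0 by (simp add: x_def lorentz_simps)
    moreover have "fst x > 0" using s0 pp l0 k by (simp add: x_def X_def add_pos_pos)
    ultimately have x: "x \<in> hyp3" by (simp add: hyp3_def)
    have "lorentz x (l i) = - (k / s)" by (simp add: x_def X_def lorentz_simps k l0)
    then have "lorentz x (l i) > - 1" using s s0 k by simp
    moreover have "lorentz x (e h) \<le> 0" if "h < 4" for h
    proof -
      have "lorentz p (e h) \<le> 0" "lorentz (l i) (e h) \<le> 0"
        using p li(2)[OF i] that by (cases "h = j"; cases "h = i"; force simp: represents_vertex_def)+
      then have "lorentz X (e h) \<le> 0" using k by (simp add: X_def lorentz_simps add_nonpos_nonpos mult_nonneg_nonpos)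
      then show ?thesis using s0 by (simp add: x_def lorentz_simps divide_nonpos_pos)
    qed
    ultimately show ?thesis using x by (auto simp: hyp_interior_horoball[OF li(1)[OF i]] hyp_simplex_def half_space_def)
  qed
  \<comment> \<open>A point of the simplex inside an orbit horoball is also inside the original
    \<open>horoball (l i)\<close>, by the second part of \<open>orbit_separation\<close>; the two
    interiors meet, so the horoballs coincide.\<close>
  have only: "H \<in> (\<lambda>i. horoball (l i)) ` I" if H: "H \<in> B" "hyp_interior H \<inter> hyp_simplex e \<noteq> {}" for H
  proof -
    obtain w i where wi: "word w" "i \<in> I" "H = horoball (act w (l i))" using H(1) by (auto simp: B_def)
    obtain x where x: "x \<in> hyp_interior H" "x \<in> hyp_simplex e" using H(2) by auto
    have n: "act w (l i) \<in> future_null" using act_future_null wi li by simp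
    have "x \<in> hyp3" "lorentz x (act w (l i)) > - 1" using x(1) unfolding wi(3) hyp_interior_horoball[OF n] by auto
    then have "x \<in> hyp_interior (horoball (l i))"
      using orbit_separation(2)[OF l wi(2,2)[unfolded I_def] wi(1) x(2)] by (simp add: hyp_interior_horoball[OF li(1)[OF wi(2)]])
    moreover have "disjnt (hyp_interior (horoball (act w (l i)))) (hyp_interior (horoball (act [] (l i))))" if "H \<noteq> horoball (l i)"
      by (rule sep[OF wi(1) _ wi(2,2)]) (use that wi(3) in simp_all)
    ultimately have "H = horoball (l i)"
      using x(1) unfolding disjnt_iff wi(3) act_simps id_apply by blast
    then show ?thesis using wi by blast
  qed
  show "horoball_packing e B (\<lambda>i. horoball (l i))"
    unfolding horoball_packing_def I_def[symmetric]
  proof (intro conjI ballI)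
    show "B \<subseteq> horoball ` future_null"
    proof
      fix H assume "H \<in> B"
      then obtain w i where wi: "word w" "i \<in> I" "H = horoball (act w (l i))" by (auto simp: B_def)
      then have "act w (l i) \<in> future_null" using act_future_null li(1) by blast
      then show "H \<in> horoball ` future_null" using wi(3) by blast
    qed
    show "g ` H \<in> B" if g: "g \<in> reflection_group e" and H: "H \<in> B" for g H
    proof -
      obtain v where v: "word v" "g = act v" using g by (auto simp: reflection_group_word)
      obtain w i where wi: "word w" "i \<in> I" "H = horoball (act w (l i))" using H by (auto simp: B_def)
      have "g ` H = horoball (act (v @ w) (l i))" by (simp add: v wi act_horoball act_append)
      then show ?thesis unfolding B_def using v wi by (intro CollectI exI[of _ "v @ w"] exI[of _ i]) simp
    qed
    show "{H \<in> B. hyp_interior H \<inter> hyp_simplex e \<noteq> {}} = (\<lambda>i. horoball (l i)) ` I"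
      using only base meets by blast
    show "\<exists>k\<in>future_null. represents_vertex e i k \<and> horoball (l i) = horoball k" if "i \<in> I" for i
      using li[OF that] by blast
    show "pairwise (\<lambda>H K. disjnt (hyp_interior H) (hyp_interior K)) B"
    proof (rule pairwiseI)
      fix H K assume HK: "H \<in> B" "K \<in> B" "H \<noteq> K"
      obtain w i where wi: "word w" "i \<in> I" "H = horoball (act w (l i))" using HK(1) by (auto simp: B_def)
      obtain v j where vj: "word v" "j \<in> I" "K = horoball (act v (l j))" using HK(2) by (auto simp: B_def)
      show "disjnt (hyp_interior H) (hyp_interior K)"
        unfolding wi(3) vj(3) by (rule sep[OF wi(1) vj(1) wi(2) vj(2)]) (use HK(3) wi(3) vj(3) in blast)
    qed
    show "horoball (l i) \<subseteq> half_space (e i)" if "i \<in> I" for i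
      using horoball_subset_half_space_iff[OF unit[OF i4[OF that]] li(1)[OF that]] li(3)[OF that] by simp
  qed
qed

end

section \<open>Cusps\<close>

text \<open>Shows, through the splitting into right triangles, that the part of the cusp triangle
  outside the open unit disc is null. Corners on the circle, which are ideal vertices, are
  allowed.\<close>

lemma wedge_zero_density:
  assumes d: "0 \<le> d" "d\<^sup>2 * (1 + t\<^sup>2) \<le> 1"
  shows "wedge (indicator {1..}) d t = 0"
proof -
  have "wedge (indicator {1..}) d t = (\<integral>\<^sup>+s\<in>{0..t}. (\<integral>\<^sup>+x\<in>{0<..d}. ennreal x * indicator {1..} (x\<^sup>2 * (1 + s\<^sup>2)) \<partial>lborel) \<partial>lborel)"
    by (rule wedge_slices) measurable
  also have "\<dots> = (\<integral>\<^sup>+s. (0 :: ennreal) \<partial>(lborel :: real measure))"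
  proof (rule nn_integral_cong_AE, rule eventually_mono[OF AE_lborel_singleton[of t]])
    fix s :: real assume "s \<noteq> t"
    show "(\<integral>\<^sup>+x\<in>{0<..d}. ennreal x * indicator {1..} (x\<^sup>2 * (1 + s\<^sup>2)) \<partial>lborel) * indicator {0..t} s = 0"
    proof (cases "s \<in> {0..t}")
      case True
      have z: "ennreal x * indicator {1..} (x\<^sup>2 * (1 + s\<^sup>2)) * indicator {0<..d} x = 0" for x
      proof (cases "x \<in> {0<..d}")
        case x: True
        have "x\<^sup>2 * (1 + s\<^sup>2) \<le> d\<^sup>2 * (1 + s\<^sup>2)" using x by (intro mult_right_mono power_mono) auto
        also have "s\<^sup>2 < t\<^sup>2" using True \<open>s \<noteq> t\<close> by (intro power_strict_mono) auto
        then have "d\<^sup>2 * (1 + s\<^sup>2) < d\<^sup>2 * (1 + t\<^sup>2)" using x by simp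
        finally have "x\<^sup>2 * (1 + s\<^sup>2) < 1" using d by simp
        then show ?thesis by simp
      qed simp
      show ?thesis unfolding z by simp
    qed simp
  qed
  finally show ?thesis by simp
qed

context coxeter_tetrahedron
begin

text \<open>The three angles at the vertex sum to pi, so the Gram matrix of the facets
  \<open>a, b, c\<close> is that of a Euclidean triangle. It is singular, with the sines of the
  opposite angles as kernel, and this kernel vector is the null vector of the ideal vertex; \<sigma>
  normalizes its product with \<open>e i\<close>.\<close>

lemma ideal_vertex_data:
  assumes idx: "i < 4" "a < 4" "b < 4" "c < 4" "distinct [i, a, b, c]"
    and cs: "cab\<^sup>2 + sab\<^sup>2 = 1" "cac\<^sup>2 + sac\<^sup>2 = 1" "cbc = sab * sac - cab * cac" "sbc = sab * cac + cab * sac"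
    and s: "sab > 0" "sac > 0" "sbc > 0"
    and gr: "lorentz (e a) (e b) = - cab" "lorentz (e a) (e c) = - cac" "lorentz (e b) (e c) = - cbc"
      "lorentz (e a) (e i) = - da" "lorentz (e b) (e i) = - db" "lorentz (e c) (e i) = - dc"
    and \<sigma>: "\<sigma> = sbc * da + sac * db + sab * dc" "\<sigma> > 0"
    and v: "v = (1 / \<sigma>) *\<^sub>R (sbc *\<^sub>R e a + sac *\<^sub>R e b + sab *\<^sub>R e c)"
  shows "v \<in> future_null" "represents_vertex e i v" "lorentz v (e i) = - 1"
    and "represents_vertex e i l \<Longrightarrow> l = (- lorentz l (e i)) *\<^sub>R v"
proof -
  note gr' = gr gr[unfolded lorentz_commute[of "e a" "e b"] lorentz_commute[of "e a" "e c"] lorentz_commute[of "e b" "e c"]]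
  have u: "lorentz (e a) (e a) = 1" "lorentz (e b) (e b) = 1" "lorentz (e c) (e c) = 1" using idx unit by auto
  define V where "V = sbc *\<^sub>R e a + sac *\<^sub>R e b + sab *\<^sub>R e c"
  have "lorentz V (e a) = sbc - sac * cab - sab * cac"
    using gr' u by (simp add: V_def lorentz_simps)
  then have Va: "lorentz V (e a) = 0" using cs by (simp add: algebra_simps)
  have "lorentz V (e b) = sac - sbc * cab - sab * cbc"
    using gr' u by (simp add: V_def lorentz_simps)
  also have "\<dots> = sac * (1 - (cab\<^sup>2 + sab\<^sup>2))" unfolding cs(3,4) by (simp add: algebra_simps power2_eq_square)
  finally have Vb: "lorentz V (e b) = 0" using cs by simp
  have "lorentz V (e c) = sab - sbc * cac - sac * cbc"
    using gr' u by (simp add: V_def lorentz_simps)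
  also have "\<dots> = sab * (1 - (cac\<^sup>2 + sac\<^sup>2))" unfolding cs(3,4) by (simp add: algebra_simps power2_eq_square)
  finally have Vc: "lorentz V (e c) = 0" using cs by simp
  have Vi: "lorentz V (e i) = - \<sigma>" using gr by (simp add: V_def lorentz_simps \<sigma>)
  have vV: "v = (1 / \<sigma>) *\<^sub>R V" by (simp add: v V_def)
  have vk: "lorentz v (e a) = 0" "lorentz v (e b) = 0" "lorentz v (e c) = 0" "lorentz v (e i) = - 1"
    using \<sigma>(2) by (simp_all add: vV lorentz_scale_left Va Vb Vc Vi)
  have all: "k = i \<or> k = a \<or> k = b \<or> k = c" if "k < 4" for k
    using that idx by (simp add: less_Suc_eq eval_nat_numeral) auto
  have vnull: "lorentz v v = 0"
  proof -
    have "lorentz v V = 0" unfolding V_def by (simp add: lorentz_simps vk)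
    then show ?thesis using arg_cong[OF vV, of "lorentz v"] by (simp add: lorentz_scale_right)
  qed
  have uniq: "l = (- lorentz l (e i)) *\<^sub>R v" if "represents_vertex e i l" for l
  proof -
    have "lorentz v (e k) = 0" if "k < 4" "k \<noteq> i" for k using all[OF that(1)] that(2) vk by auto
    then show ?thesis using vertex_unique[OF idx(1), of l v] that vk(4) by (auto simp: represents_vertex_def)
  qed
  then show "represents_vertex e i l \<Longrightarrow> l = (- lorentz l (e i)) *\<^sub>R v" .
  \<comment> \<open>The given vertex vector lies in the future and is a positive multiple of
    \<open>v\<close>, which settles the time orientation of \<open>v\<close>.\<close>
  obtain w where w: "represents_vertex e i w" using vertex[OF idx(1)] by blast
  have "fst w = - lorentz w (e i) * fst v" using arg_cong[OF uniq[OF w], of fst] by simp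
  then have "0 < - lorentz w (e i) * fst v" "0 < - lorentz w (e i)" using w by (auto simp: represents_vertex_def)
  then have "fst v > 0" by (rule zero_less_mult_pos)
  then show "v \<in> future_null" using vnull by (simp add: future_null_def)
  show "represents_vertex e i v" unfolding represents_vertex_def
    using vnull \<open>fst v > 0\<close> vk all by (auto simp: less_le)
  show "lorentz v (e i) = - 1" by (rule vk)
qed

lemma ideal_vertex_iff:
  assumes "i < 4" "v \<in> future_null" "represents_vertex e i v" shows "i \<in> ideal_vertices e"
  using assms by (auto simp: ideal_vertices_def)

text \<open>The simplex seen from the ideal vertex \<open>i\<close>: in upper half-space coordinates the facets
  \<open>a, b, c\<close> are vertical planes and the facet \<open>i\<close> is the unit hemisphere.\<close>

lemma cusp_volumes:
  assumes idx: "i < 4" "a < 4" "b < 4" "c < 4" "distinct [i, a, b, c]"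
    and cs: "cab\<^sup>2 + sab\<^sup>2 = 1" "cac\<^sup>2 + sac\<^sup>2 = 1" "cbc = sab * sac - cab * cac" "sbc = sab * cac + cab * sac"
    and s: "sab > 0" "sac > 0" "sbc > 0" and cnn: "cab \<ge> 0" "cac \<ge> 0" "cbc \<ge> 0"
    and gr: "lorentz (e a) (e b) = - cab" "lorentz (e a) (e c) = - cac" "lorentz (e b) (e c) = - cbc"
      "lorentz (e a) (e i) = - da" "lorentz (e b) (e i) = - db" "lorentz (e c) (e i) = - dc"
    and d: "da \<ge> 0" "db \<ge> 0" "dc \<ge> 0"
    and \<sigma>: "\<sigma> = sbc * da + sac * db + sab * dc" "\<sigma> > 0"
    and v: "v = (1 / \<sigma>) *\<^sub>R (sbc *\<^sub>R e a + sac *\<^sub>R e b + sab *\<^sub>R e c)"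
    and t: "t1 = (db + cab * da) / (sab * da)" "t2 = (dc + cac * da) / (sac * da)" "t3 = (dc + cbc * db) / (sbc * db)"
      "t4 = (da + cab * db) / (sab * db)" "t5 = (da + cac * dc) / (sac * dc)" "t6 = (db + cbc * dc) / (sbc * dc)"
    and fit: "da\<^sup>2 * (1 + t1\<^sup>2) \<le> 1" "da\<^sup>2 * (1 + t2\<^sup>2) \<le> 1" "db\<^sup>2 * (1 + t3\<^sup>2) \<le> 1"
      "db\<^sup>2 * (1 + t4\<^sup>2) \<le> 1" "dc\<^sup>2 * (1 + t5\<^sup>2) \<le> 1" "dc\<^sup>2 * (1 + t6\<^sup>2) \<le> 1"
  shows "hyp_vol (hyp_simplex e) = enn2real (wedge hyp_density da t1 + wedge hyp_density da t2 + wedge hyp_density db t3 +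
      wedge hyp_density db t4 + wedge hyp_density dc t5 + wedge hyp_density dc t6) / 2"
    and "r \<ge> 1 \<Longrightarrow> hyp_vol (horoball (r *\<^sub>R v) \<inter> hyp_simplex e) =
      (da\<^sup>2 * (t1 + t2) + db\<^sup>2 * (t3 + t4) + dc\<^sup>2 * (t5 + t6)) / (4 * r\<^sup>2)"
proof -
  note vd = ideal_vertex_data[OF idx cs s gr \<sigma> v]
  \<comment> \<open>The frame for \<open>hyp_vol_region\<close>, with \<open>e i\<close> in the role
    of its \<open>g\<close>: then \<open>f - e i = v\<close>, so infinity is the ideal vertex and
    the plane of facet \<open>i\<close> is the unit hemisphere. \<open>u\<close> and
    \<open>w\<close> arise from \<open>e a\<close> and \<open>e b\<close> by removing multiples of
    \<open>v\<close> and orthonormalizing.\<close>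
  define f where "f = e i + v"
  define u where "u = e a - da *\<^sub>R v"
  define w where "w = (1 / sab) *\<^sub>R (e b - db *\<^sub>R v + cab *\<^sub>R u)"
  have un: "lorentz (e a) (e a) = 1" "lorentz (e b) (e b) = 1" "lorentz (e i) (e i) = 1" using idx unit by auto
  have vv: "lorentz v v = 0" and fv: "fst v > 0" using vd(1) by (auto simp: future_null_def)
  have ve: "lorentz v (e a) = 0" "lorentz v (e b) = 0" "lorentz v (e i) = - 1"
    using vd(2,3) idx by (auto simp: represents_vertex_def)
  have gi: "lorentz (e b) (e a) = - cab" "lorentz (e i) (e a) = - da" "lorentz (e i) (e b) = - db"
    "lorentz (e a) v = 0" "lorentz (e b) v = 0" "lorentz (e i) v = - 1"
    using gr ve by (simp_all add: lorentz_commute[of "e b" "e a"] lorentz_commute[of "e i"] lorentz_commute[of _ v])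
  note L = lorentz_simps un vv ve gi gr(1,4,5)
  have frame: "lorentz f f = - 1" "lorentz u u = 1" "lorentz (e i) (e i) = 1" "lorentz f u = 0" "lorentz f (e i) = 0" "lorentz u (e i) = 0"
    by (simp_all add: f_def u_def L)
  have wu: "sab * lorentz u w = 0" "sab * lorentz f w = 0" "sab * lorentz w (e i) = 0"
    using s by (simp_all add: w_def f_def u_def L)
  define W where "W = e b - db *\<^sub>R v + cab *\<^sub>R u"
  have "lorentz W W = 1 - cab\<^sup>2"
    by (simp add: W_def u_def L power2_eq_square algebra_simps)
  then have "lorentz W W = sab * sab" using cs(1) by (simp add: power2_eq_square)
  moreover have "lorentz w w = (1 / sab) * ((1 / sab) * lorentz W W)"
    unfolding w_def W_def[symmetric] by (simp only: lorentz_scale_left lorentz_scale_right)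
  ultimately have ww: "lorentz w w = 1" using s by simp
  have frame': "lorentz w w = 1" "lorentz u w = 0" "lorentz f w = 0" "lorentz w (e i) = 0" using wu ww s by auto
  have fg: "f - e i = v" by (simp add: f_def)
  have ec: "sab *\<^sub>R e c = \<sigma> *\<^sub>R v - sbc *\<^sub>R e a - sac *\<^sub>R e b"
    using \<sigma>(2) by (simp add: v)
  have ea: "e a = u + da *\<^sub>R v" by (simp add: u_def)
  have eb: "e b = sab *\<^sub>R w - cab *\<^sub>R u + db *\<^sub>R v" using s by (simp add: w_def)
  have all: "k = i \<or> k = a \<or> k = b \<or> k = c" if "k < 4" for k
    using that idx by (simp add: less_Suc_eq eval_nat_numeral) auto
  \<comment> \<open>The facets through the ideal vertex become lines in the horizontal plane, at the
    distances given by the Gram matrix. The third line follows from the linear relation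
    \<open>ec\<close>.\<close>
  have coords: "lorentz x (e a) \<le> 0 \<longleftrightarrow> lorentz x u / h \<le> da"
      "lorentz x (e b) \<le> 0 \<longleftrightarrow> - cab * (lorentz x u / h) + sab * (lorentz x w / h) \<le> db"
      "lorentz x (e c) \<le> 0 \<longleftrightarrow> - cac * (lorentz x u / h) - sac * (lorentz x w / h) \<le> dc"
    if h: "h = - lorentz x v" "h > 0" for x h
  proof -
    define X Y where "X = lorentz x u / h" and "Y = lorentz x w / h"
    have XY: "lorentz x u = h * X" "lorentz x w = h * Y" using h by (simp_all add: X_def Y_def)
    have xv: "lorentz x v = - h" using h by simp
    have A: "lorentz x (e a) = h * (X - da)" unfolding ea by (simp add: lorentz_simps XY xv algebra_simps)
    have B: "lorentz x (e b) = h * (sab * Y - cab * X - db)" unfolding eb by (simp add: lorentz_simps XY xv algebra_simps)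
    have "sab * lorentz x (e c) = - \<sigma> * h - sbc * (h * (X - da)) - sac * (h * (sab * Y - cab * X - db))"
      using arg_cong[OF ec, of "lorentz x"] by (simp add: lorentz_simps xv A B)
    also have "\<dots> = sab * (h * (- cac * X - sac * Y - dc))"
      unfolding \<sigma>(1) cs(4) by (simp add: algebra_simps)
    finally have C: "lorentz x (e c) = h * (- cac * X - sac * Y - dc)" using s by simp
    have m: "h * Z \<le> 0 \<longleftrightarrow> Z \<le> 0" for Z using h(2) by (simp add: mult_le_0_iff)
    show "lorentz x (e a) \<le> 0 \<longleftrightarrow> lorentz x u / h \<le> da"
      unfolding A X_def[symmetric] m by simp
    show "lorentz x (e b) \<le> 0 \<longleftrightarrow> - cab * (lorentz x u / h) + sab * (lorentz x w / h) \<le> db"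
      unfolding B X_def[symmetric] Y_def[symmetric] m by (rule iffI; linarith)
    show "lorentz x (e c) \<le> 0 \<longleftrightarrow> - cac * (lorentz x u / h) - sac * (lorentz x w / h) \<le> dc"
      unfolding C X_def[symmetric] Y_def[symmetric] m by (rule iffI; linarith)
  qed
  \<comment> \<open>The difference of \<open>x\<close> and its frame expansion is orthogonal to the
    frame, hence to all four normals, hence zero.\<close>
  have parseval: "lorentz x x = (lorentz x u)\<^sup>2 + (lorentz x w)\<^sup>2 + (lorentz x (e i))\<^sup>2 - (lorentz x f)\<^sup>2" for x
  proof -
    define y where "y = x + lorentz x f *\<^sub>R f - lorentz x u *\<^sub>R u - lorentz x w *\<^sub>R w - lorentz x (e i) *\<^sub>R e i"
    note sym = lorentz_commute[of u f] lorentz_commute[of "e i" f] lorentz_commute[of w f] lorentz_commute[of w u] lorentz_commute[of "e i" u] lorentz_commute[of "e i" w]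
    have yo: "lorentz y f = 0" "lorentz y u = 0" "lorentz y w = 0" "lorentz y (e i) = 0"
      by (simp_all add: y_def lorentz_simps frame frame' sym)
    have yv: "lorentz y v = 0" unfolding fg[symmetric] by (simp add: lorentz_simps yo)
    have ya: "lorentz y (e a) = 0" unfolding ea by (simp add: lorentz_simps yo yv)
    have yb: "lorentz y (e b) = 0" unfolding eb by (simp add: lorentz_simps yo yv)
    have "sab * lorentz y (e c) = 0" using arg_cong[OF ec, of "lorentz y"] by (simp add: lorentz_simps yv ya yb)
    then have yc: "lorentz y (e c) = 0" using s by simp
    have "y = 0" by (rule orthogonal_all_zero) (use all ya yb yc yo(4) in auto)
    then have "x = lorentz x u *\<^sub>R u + lorentz x w *\<^sub>R w + lorentz x (e i) *\<^sub>R e i - lorentz x f *\<^sub>R f"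
      by (simp add: y_def algebra_simps)
    then have "lorentz x x = lorentz x (lorentz x u *\<^sub>R u + lorentz x w *\<^sub>R w + lorentz x (e i) *\<^sub>R e i - lorentz x f *\<^sub>R f)"
      by (rule arg_cong)
    then show ?thesis by (simp add: lorentz_simps power2_eq_square)
  qed
  \<comment> \<open>With height t = 1 / h and horizontal position \<xi> this says |\<xi>|^2 + t^2
    \<ge> 1: facet \<open>i\<close> leaves the points on or above the unit hemisphere.\<close>
  have top: "lorentz x (e i) \<le> 0 \<longleftrightarrow> h\<^sup>2 * (1 - (norm (lorentz x u / h, lorentz x w / h))\<^sup>2) \<le> 1"
    if x: "x \<in> hyp3" and h: "h = - lorentz x v" "h > 0" for x h
  proof -
    define p q where "p = - lorentz x f" and "q = lorentz x (e i)"
    have hpq: "h = p + q" using h(1) unfolding fg[symmetric] by (simp add: lorentz_simps p_def q_def)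
    have "lorentz x x = - 1" using x by (simp add: hyp3_def)
    then have "(p - q) * h = 1 + (lorentz x u)\<^sup>2 + (lorentz x w)\<^sup>2"
      using parseval[of x] unfolding hpq by (simp add: p_def q_def power2_eq_square algebra_simps)
    moreover have "h\<^sup>2 * (norm (lorentz x u / h, lorentz x w / h))\<^sup>2 = (lorentz x u)\<^sup>2 + (lorentz x w)\<^sup>2"
      using h(2) by (simp add: norm_plane power_divide field_simps)
    ultimately have "h\<^sup>2 * (1 - (norm (lorentz x u / h, lorentz x w / h))\<^sup>2) = 1 + 2 * q * h"
      unfolding right_diff_distrib by (simp add: hpq power2_eq_square algebra_simps)
    then show ?thesis using h(2) by (simp add: q_def mult_le_0_iff)
  qed
  define T where "T = {z :: real \<times> real. fst z \<le> da \<and> - cab * fst z + sab * snd z \<le> db \<and> - cac * fst z - sac * snd z \<le> dc}"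
  have T_meas [measurable]: "T \<in> sets borel"
  proof -
    have "T = {z. fst z \<le> da} \<inter> {z. - cab * fst z + sab * snd z \<le> db} \<inter> {z. - cac * fst z - sac * snd z \<le> dc}"
      by (auto simp: T_def)
    also have "\<dots> \<in> sets borel" by (intro sets.Int borel_closed closed_Collect_le continuous_intros)
    finally show ?thesis .
  qed
  have tri: "(\<integral>\<^sup>+z\<in>T. \<phi> ((norm z)\<^sup>2) \<partial>lborel) = wedge \<phi> da t1 + wedge \<phi> da t2 + wedge \<phi> db t3 + wedge \<phi> db t4 + wedge \<phi> dc t5 + wedge \<phi> dc t6"
    if "\<phi> \<in> borel_measurable borel" for \<phi>
    unfolding T_def t by (rule triangle_integral[OF that cs s cnn d])
  have mem: "x \<in> hyp_simplex e \<longleftrightarrow> (lorentz x u / h, lorentz x w / h) \<in> T \<and> h\<^sup>2 * (1 - (norm (lorentz x u / h, lorentz x w / h))\<^sup>2) \<le> 1"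
    if x: "x \<in> hyp3" and h: "h = - lorentz x v" "h > 0" for x h
  proof -
    have "x \<in> hyp_simplex e \<longleftrightarrow> lorentz x (e a) \<le> 0 \<and> lorentz x (e b) \<le> 0 \<and> lorentz x (e c) \<le> 0 \<and> lorentz x (e i) \<le> 0"
      using idx x all by (auto simp: hyp_simplex_def half_space_def)
    then show ?thesis using coords[OF h] top[OF x h] by (simp add: T_def)
  qed
  have disc: "AE z in lborel. z \<in> T \<longrightarrow> 1 - (norm z)\<^sup>2 > 0"
  proof -
    have "(\<integral>\<^sup>+z\<in>T. indicator {1..} ((norm z)\<^sup>2) \<partial>lborel) = 0"
      using tri[of "indicator {1..}"] fit d by (simp add: wedge_zero_density)
    then have "AE z in lborel. indicator {1..} ((norm z)\<^sup>2) * indicator T z = (0 :: ennreal)"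
      by (subst (asm) nn_integral_0_iff_AE) simp_all
    then show ?thesis by eventually_elim (auto simp: indicator_def split: if_splits)
  qed
  have fv': "fst (f - e i) > 0" by (simp add: fg fv)
  have "hyp_vol (hyp_simplex e) = enn2real (ennreal (1 / 2) * (\<integral>\<^sup>+z\<in>T. ennreal (1 / (1 - (norm z)\<^sup>2)) \<partial>lborel))"
  proof (rule hyp_vol_region[OF frame(1,2) frame'(1) frame(3,4) frame'(3) frame(5) frame'(2) frame(6) frame'(4) fv' hyp_simplex_borel T_meas _ disc])
    show "(\<lambda>z :: real \<times> real. 1 - (norm z)\<^sup>2) \<in> borel_measurable borel" by measurable
    show "x \<in> hyp_simplex e \<longleftrightarrow> (lorentz x u / h, lorentz x w / h) \<in> T \<and> h\<^sup>2 * (1 - (norm (lorentz x u / h, lorentz x w / h))\<^sup>2) \<le> 1"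
      if "x \<in> hyp3" "h = - lorentz x (f - e i)" "h > 0" for x h
      using mem[of x h] that unfolding fg by simp
  qed
  also have "(\<integral>\<^sup>+z\<in>T. ennreal (1 / (1 - (norm z)\<^sup>2)) \<partial>lborel) = (\<integral>\<^sup>+z\<in>T. hyp_density ((norm z)\<^sup>2) \<partial>lborel)"
    by (rule nn_integral_cong_AE, rule eventually_mono[OF disc]) (auto simp: hyp_density_def indicator_def)
  also note tri[OF hyp_density_measurable]
  finally show "hyp_vol (hyp_simplex e) = enn2real (wedge hyp_density da t1 + wedge hyp_density da t2 + wedge hyp_density db t3 +
      wedge hyp_density db t4 + wedge hyp_density dc t5 + wedge hyp_density dc t6) / 2"
    unfolding enn2real_mult by (subst (asm) enn2real_ennreal) (simp, simp only: mult.commute times_divide_eq_right mult_1_right)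
  assume r: "r \<ge> 1"
  have "hyp_vol (horoball (r *\<^sub>R v) \<inter> hyp_simplex e) = enn2real (ennreal (1 / 2) * (\<integral>\<^sup>+z\<in>T. ennreal (1 / r\<^sup>2) \<partial>lborel))"
  proof (rule hyp_vol_region[OF frame(1,2) frame'(1) frame(3,4) frame'(3) frame(5) frame'(2) frame(6) frame'(4) fv' _ T_meas])
    show "horoball (r *\<^sub>R v) \<inter> hyp_simplex e \<in> sets borel" by measurable
    show "AE z in lborel. z \<in> T \<longrightarrow> r\<^sup>2 > 0" using r by simp
    fix x h assume x: "x \<in> hyp3" and h: "h = - lorentz x (f - e i)" "h > 0"
    have hv: "h = - lorentz x v" using h by (simp add: fg)
    have "x \<in> horoball (r *\<^sub>R v) \<longleftrightarrow> h * r \<le> 1" using x hv by (auto simp: horoball_def lorentz_simps algebra_simps)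
    also have "\<dots> \<longleftrightarrow> h\<^sup>2 * r\<^sup>2 \<le> 1"
    proof -
      have "h * r \<ge> 0" using h(2) r by (intro mult_nonneg_nonneg) linarith+
      then have "h * r \<le> 1 \<longleftrightarrow> (h * r)\<^sup>2 \<le> 1" using abs_square_le_1[of "h * r"] by (simp only: abs_of_nonneg)
      then show ?thesis by (simp only: power_mult_distrib)
    qed
    finally have 1: "x \<in> horoball (r *\<^sub>R v) \<longleftrightarrow> h\<^sup>2 * r\<^sup>2 \<le> 1" .
    \<comment> \<open>The horoball is t \<ge> r; since r \<ge> 1 it lies above the hemisphere. Its
      part of the simplex is therefore the prism over the triangle with constant floor.\<close>
    have 2: "h\<^sup>2 * (1 - N\<^sup>2) \<le> 1" if "h\<^sup>2 * r\<^sup>2 \<le> 1" for N :: real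
    proof -
      have "h\<^sup>2 * (1 - N\<^sup>2) \<le> h\<^sup>2 * r\<^sup>2" using r by (intro mult_left_mono) (auto intro: order_trans[of _ 1] simp: one_le_power)
      then show ?thesis using that by simp
    qed
    show "x \<in> horoball (r *\<^sub>R v) \<inter> hyp_simplex e \<longleftrightarrow> (lorentz x u / h, lorentz x w / h) \<in> T \<and> h\<^sup>2 * r\<^sup>2 \<le> 1"
      using 1 2 mem[OF x hv h(2)] by blast
  qed simp
  also have "(\<integral>\<^sup>+z\<in>T. ennreal (1 / r\<^sup>2) \<partial>lborel) = wedge (\<lambda>_. ennreal (1 / r\<^sup>2)) da t1 + wedge (\<lambda>_. ennreal (1 / r\<^sup>2)) da t2 +
    wedge (\<lambda>_. ennreal (1 / r\<^sup>2)) db t3 + wedge (\<lambda>_. ennreal (1 / r\<^sup>2)) db t4 + wedge (\<lambda>_. ennreal (1 / r\<^sup>2)) dc t5 + wedge (\<lambda>_. ennreal (1 / r\<^sup>2)) dc t6"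
    using tri[of "\<lambda>_. ennreal (1 / r\<^sup>2)"] by simp
  also have "\<dots> = ennreal ((da\<^sup>2 * (t1 + t2) + db\<^sup>2 * (t3 + t4) + dc\<^sup>2 * (t5 + t6)) / (2 * r\<^sup>2))"
  proof -
    have tn: "t1 \<ge> 0" "t2 \<ge> 0" "t3 \<ge> 0" "t4 \<ge> 0" "t5 \<ge> 0" "t6 \<ge> 0" using d cnn s by (auto simp: t)
    have *: "wedge (\<lambda>_. ennreal (1 / r\<^sup>2)) d t = ennreal (d\<^sup>2 * t / (2 * r\<^sup>2))" if "d \<ge> 0" "t \<ge> 0" for d t
      using wedge_const[OF that, of "1 / r\<^sup>2"] by (simp add: mult.commute)
    show ?thesis using d tn by (simp add: * ennreal_plus[symmetric] add_divide_distrib distrib_left del: ennreal_plus)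
  qed
  finally have "hyp_vol (horoball (r *\<^sub>R v) \<inter> hyp_simplex e) =
    enn2real (ennreal (1 / 2) * ennreal ((da\<^sup>2 * (t1 + t2) + db\<^sup>2 * (t3 + t4) + dc\<^sup>2 * (t5 + t6)) / (2 * r\<^sup>2)))" .
  also have "\<dots> = (da\<^sup>2 * (t1 + t2) + db\<^sup>2 * (t3 + t4) + dc\<^sup>2 * (t5 + t6)) / (4 * r\<^sup>2)"
  proof -
    have "t1 \<ge> 0" "t2 \<ge> 0" "t3 \<ge> 0" "t4 \<ge> 0" "t5 \<ge> 0" "t6 \<ge> 0" using d cnn s by (auto simp: t)
    then have h1: "enn2real (ennreal ((da\<^sup>2 * (t1 + t2) + db\<^sup>2 * (t3 + t4) + dc\<^sup>2 * (t5 + t6)) / (2 * r\<^sup>2))) =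
      (da\<^sup>2 * (t1 + t2) + db\<^sup>2 * (t3 + t4) + dc\<^sup>2 * (t5 + t6)) / (2 * r\<^sup>2)" by (intro enn2real_ennreal) simp
    have h2: "enn2real (ennreal (1 / 2)) = 1 / 2" by (rule enn2real_ennreal) simp
    show ?thesis unfolding enn2real_mult h1 h2 by simp
  qed
  finally show "hyp_vol (horoball (r *\<^sub>R v) \<inter> hyp_simplex e) =
      (da\<^sup>2 * (t1 + t2) + db\<^sup>2 * (t3 + t4) + dc\<^sup>2 * (t5 + t6)) / (4 * r\<^sup>2)" .
qed

end

text \<open>By the factor 1 / 2 in \<open>hyp_vol_region\<close> this is twice the hyperbolic volume
  over a right triangle in the unit disc.\<close>

definition wedge_volume :: "real \<Rightarrow> real \<Rightarrow> real" where
  "wedge_volume d t = enn2real (wedge hyp_density d t)"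

lemma wedge_volume_zero [simp]: "wedge_volume 0 t = 0" "wedge_volume d 0 = 0"
proof -
  show "wedge_volume 0 t = 0" by (simp add: wedge_volume_def wedge_def not_le[symmetric])
  have "wedge hyp_density d 0 = (\<integral>\<^sup>+z. 0 \<partial>(lborel :: (real \<times> real) measure))"
    unfolding wedge_def
    by (rule nn_integral_cong_AE, rule eventually_mono[OF AE_plane_line[of 0 1]]) (auto simp: indicator_def zero_prod_def)
  then show "wedge_volume d 0 = 0" by (simp add: wedge_volume_def)
qed

lemma wedge_volume_values:
  assumes "q = sqrt 3" "p = sqrt 2"
  shows "wedge_volume (1 / 2) (q / 3) = lobachevsky (pi / 3) / 4" "wedge_volume (1 / 2) q = lobachevsky (pi / 3)"
    "wedge_volume (q / 2) (q / 3) = 3 / 2 * lobachevsky (pi / 3)" "wedge_volume (p / 2) 1 = lobachevsky (pi / 4)"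
proof -
  have "lobachevsky (pi / 3) > 0" using dirichlet_L_bounds(1) by (simp add: lobachevsky_third_pi_eq)
  moreover have e: "q / 3 = 1 / sqrt 3" using assms by (simp add: field_simps)
  ultimately show "wedge_volume (1 / 2) (q / 3) = lobachevsky (pi / 3) / 4" "wedge_volume (1 / 2) q = lobachevsky (pi / 3)"
    "wedge_volume (q / 2) (q / 3) = 3 / 2 * lobachevsky (pi / 3)" "wedge_volume (p / 2) 1 = lobachevsky (pi / 4)"
    using lobachevsky_quarter_pi_lower unfolding wedge_volume_def e unfolding assms wedge_values by simp_all
qed

lemma wedge_volume_lower:
  assumes "1 / 2 \<le> d" "d < 1" "t \<ge> 0" "d\<^sup>2 * (1 + t\<^sup>2) \<le> 1"
  shows "wedge_volume d t \<ge> d\<^sup>2 * t / 2 + d ^ 4 * (t + t ^ 3 / 3) / 4 + d ^ 6 * (t + 2 * t ^ 3 / 3 + t ^ 5 / 5) / 6"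
    (is "_ \<ge> ?P")
proof -
  have "ennreal ?P \<le> wedge hyp_density d t" using assms by (intro wedge_hyp_density_lower) auto
  moreover have "wedge hyp_density d t < \<infinity>" using assms by (intro wedge_hyp_density_finite) auto
  ultimately have "enn2real (ennreal ?P) \<le> wedge_volume d t"
    unfolding wedge_volume_def by (intro enn2real_mono) auto
  moreover have "?P \<ge> 0" using assms by (intro add_nonneg_nonneg divide_nonneg_nonneg mult_nonneg_nonneg) auto
  ultimately show ?thesis by simp
qed

context coxeter_tetrahedron
begin

text \<open>Vertex \<open>i\<close> is ideal; for the null vector \<open>v\<close> representing it and normalized by
  \<open>lorentz v (e i) = - 1\<close>, the horoball \<open>horoball (r *\<^sub>R v)\<close> cuts off the volume \<open>A / r\<^sup>2\<close>, and
  \<open>\<kappa> j\<close> is minus the product of \<open>v\<close> with the likewise normalized representative of vertex \<open>j\<close>.\<close>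

definition cusp :: "nat \<Rightarrow> real \<Rightarrow> (nat \<Rightarrow> real) \<Rightarrow> bool" where
  "cusp i A \<kappa> \<longleftrightarrow> i < 4 \<and> (\<exists>v. v \<in> future_null \<and> represents_vertex e i v \<and> lorentz v (e i) = - 1 \<and>
     (\<forall>r\<ge>1. hyp_vol (horoball (r *\<^sub>R v) \<inter> hyp_simplex e) = A / r\<^sup>2) \<and>
     (\<forall>j<4. \<forall>w. j \<noteq> i \<longrightarrow> represents_vertex e j w \<longrightarrow> lorentz w (e j) = - 1 \<longrightarrow> lorentz v w = - \<kappa> j))"

lemma cusp_ideal: "cusp i A \<kappa> \<Longrightarrow> i \<in> ideal_vertices e"
  unfolding cusp_def using ideal_vertex_iff by blast

text \<open>The facets \<open>a, b, c\<close> cut a horosphere at the ideal vertex \<open>i\<close> in a Euclidean triangle; with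
  the facet \<open>i\<close> as unit hemisphere, \<open>da, db, dc\<close> are the distances of its center from the sides,
  \<open>cab, sab, \<dots>\<close> the cosines and sines of the angles, and \<open>t1, \<dots>, t6\<close> the tangents of the angles
  under which the center sees the six half sides (arbitrary for a side through the center).
  All hypotheses are polynomial in the data.\<close>

lemma cusp_intro:
  assumes idx: "i < 4" "a < 4" "b < 4" "c < 4" "distinct [i, a, b, c]"
    and gr: "lorentz (e a) (e b) = - cab" "lorentz (e a) (e c) = - cac" "lorentz (e b) (e c) = - cbc"
      "lorentz (e a) (e i) = - da" "lorentz (e b) (e i) = - db" "lorentz (e c) (e i) = - dc"
    and cs: "cab * cab + sab * sab = 1" "cac * cac + sac * sac = 1" "cbc = sab * sac - cab * cac" "sbc = sab * cac + cab * sac"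
    and s: "sab > 0" "sac > 0" "sbc > 0" and cnn: "cab \<ge> 0" "cac \<ge> 0" "cbc \<ge> 0"
    and d: "da = 0 \<or> 1 / 2 \<le> da" "db = 0 \<or> 1 / 2 \<le> db" "dc = 0 \<or> 1 / 2 \<le> dc" "da < 1" "db < 1" "dc < 1"
    and k: "ka * (sbc * da + sac * db + sab * dc) = sbc" "kb * (sbc * da + sac * db + sab * dc) = sac"
      "kc * (sbc * da + sac * db + sab * dc) = sab"
    and t: "da * (t1 * (sab * da) - (db + cab * da)) = 0" "da * (t2 * (sac * da) - (dc + cac * da)) = 0"
      "db * (t3 * (sbc * db) - (dc + cbc * db)) = 0" "db * (t4 * (sab * db) - (da + cab * db)) = 0"
      "dc * (t5 * (sac * dc) - (da + cac * dc)) = 0" "dc * (t6 * (sbc * dc) - (db + cbc * dc)) = 0"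
    and f: "da * da * (1 + t1 * t1) = f1" "da * da * (1 + t2 * t2) = f2" "db * db * (1 + t3 * t3) = f3"
      "db * db * (1 + t4 * t4) = f4" "dc * dc * (1 + t5 * t5) = f5" "dc * dc * (1 + t6 * t6) = f6"
    and f1: "f1 \<le> 1" "f2 \<le> 1" "f3 \<le> 1" "f4 \<le> 1" "f5 \<le> 1" "f6 \<le> 1"
    and A: "4 * A = da * da * (t1 + t2) + db * db * (t3 + t4) + dc * dc * (t5 + t6)"
  shows "cusp i A (\<lambda>j. if j = a then ka else if j = b then kb else kc) \<and>
    hyp_vol (hyp_simplex e) = (wedge_volume da t1 + wedge_volume da t2 + wedge_volume db t3 +
      wedge_volume db t4 + wedge_volume dc t5 + wedge_volume dc t6) / 2"
proof -
  define \<sigma> where "\<sigma> = sbc * da + sac * db + sab * dc"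
  have d0: "da \<ge> 0" "db \<ge> 0" "dc \<ge> 0" using d by auto
  have "\<sigma> \<ge> 0" using s d0 by (simp add: \<sigma>_def)
  moreover have "\<sigma> \<noteq> 0" using k(1) s by (auto simp: \<sigma>_def)
  ultimately have \<sigma>0: "\<sigma> > 0" by simp
  define v where "v = (1 / \<sigma>) *\<^sub>R (sbc *\<^sub>R e a + sac *\<^sub>R e b + sab *\<^sub>R e c)"
  have cs': "cab\<^sup>2 + sab\<^sup>2 = 1" "cac\<^sup>2 + sac\<^sup>2 = 1" using cs by (simp_all add: power2_eq_square)
  have kk: "ka = sbc / \<sigma>" "kb = sac / \<sigma>" "kc = sab / \<sigma>" using k \<sigma>0 by (simp_all add: \<sigma>_def eq_divide_eq)
  \<comment> \<open>The hypotheses on the tangents are cleared of denominators. A vanishing distance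
    leaves the tangent free, which is harmless because the wedge is then empty.\<close>
  have wT: "x = 0 \<or> tt = (y + z * x) / (w * x)" if "x * (tt * (w * x) - (y + z * x)) = 0" "w > 0" for x tt y z w :: real
    using that by (auto simp: eq_divide_eq)
  note tT = wT[OF t(1) s(1)] wT[OF t(2) s(2)] wT[OF t(3) s(3)] wT[OF t(4) s(1)] wT[OF t(5) s(2)] wT[OF t(6) s(3)]
  have fit: "x\<^sup>2 * (1 + E\<^sup>2) \<le> 1" if "x * x * (1 + tt * tt) = ff" "ff \<le> 1" "x = 0 \<or> tt = E" for x tt ff E :: real
    using that by (auto simp: power2_eq_square)
  have weq: "wedge hyp_density x E = wedge hyp_density x tt" if "x = 0 \<or> tt = E" for x tt E
    using that by (auto simp: wedge_def not_le[symmetric])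
  have fin: "wedge hyp_density x tt < top"
    if "x * x * (1 + tt * tt) = ff" "ff \<le> 1" "x = 0 \<or> tt = (y + z * x) / (w * x)" "x = 0 \<or> 1 / 2 \<le> x" "x < 1" "y \<ge> 0" "z \<ge> 0" "w > 0"
    for x tt ff y z w
  proof (cases "x = 0")
    case True
    then show ?thesis by (simp add: wedge_def not_le[symmetric])
  next
    case False
    then have "tt \<ge> 0" using that by auto
    then show ?thesis using wedge_hyp_density_finite[of x tt] that False by (simp add: power2_eq_square)
  qed
  note fins = fin[OF f(1) f1(1) tT(1) d(1,4) d0(2) cnn(1) s(1)] fin[OF f(2) f1(2) tT(2) d(1,4) d0(3) cnn(2) s(2)]
    fin[OF f(3) f1(3) tT(3) d(2,5) d0(3) cnn(3) s(3)] fin[OF f(4) f1(4) tT(4) d(2,5) d0(1) cnn(1) s(1)]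
    fin[OF f(5) f1(5) tT(5) d(3,6) d0(1) cnn(2) s(2)] fin[OF f(6) f1(6) tT(6) d(3,6) d0(2) cnn(3) s(3)]
  note vd = ideal_vertex_data[OF idx cs' cs(3,4) s gr \<sigma>_def \<sigma>0 v_def]
  note cv = cusp_volumes[OF idx cs' cs(3,4) s cnn gr d0 \<sigma>_def \<sigma>0 v_def refl refl refl refl refl refl
    fit[OF f(1) f1(1) tT(1)] fit[OF f(2) f1(2) tT(2)] fit[OF f(3) f1(3) tT(3)] fit[OF f(4) f1(4) tT(4)] fit[OF f(5) f1(5) tT(5)] fit[OF f(6) f1(6) tT(6)]]
  have V: "hyp_vol (hyp_simplex e) = (wedge_volume da t1 + wedge_volume da t2 + wedge_volume db t3 +
      wedge_volume db t4 + wedge_volume dc t5 + wedge_volume dc t6) / 2"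
    unfolding cv(1) weq[OF tT(1)] weq[OF tT(2)] weq[OF tT(3)] weq[OF tT(4)] weq[OF tT(5)] weq[OF tT(6)] wedge_volume_def
    using fins by (simp add: enn2real_plus)
  have sq: "x\<^sup>2 * (E + E') = x * x * (tt + tt')" if "x = 0 \<or> tt = E" "x = 0 \<or> tt' = E'" for x tt tt' E E' :: real
    using that by (auto simp: power2_eq_square)
  have vol: "hyp_vol (horoball (r *\<^sub>R v) \<inter> hyp_simplex e) = A / r\<^sup>2" if "r \<ge> 1" for r
    unfolding cv(2)[OF that] sq[OF tT(1,2)] sq[OF tT(3,4)] sq[OF tT(5,6)] A[symmetric] by simp
  have all: "j = i \<or> j = a \<or> j = b \<or> j = c" if "j < 4" for j
    using that idx by (simp add: less_Suc_eq eval_nat_numeral) auto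
  have prod: "lorentz v w = - (if j = a then ka else if j = b then kb else kc)"
    if j: "j < 4" "j \<noteq> i" and w: "represents_vertex e j w" "lorentz w (e j) = - 1" for j w
  proof -
    have w0: "lorentz (e k) w = (if k = j then - 1 else 0)" if "k < 4" for k
      using w that by (auto simp: represents_vertex_def lorentz_commute[of "e k"])
    have "lorentz v w = (1 / \<sigma>) * (sbc * lorentz (e a) w + sac * lorentz (e b) w + sab * lorentz (e c) w)"
      by (simp add: v_def lorentz_add_left lorentz_scale_left)
    then show ?thesis
      unfolding w0[OF idx(2)] w0[OF idx(3)] w0[OF idx(4)] kk using all[OF j(1)] j(2) idx(5) by auto
  qed
  have "cusp i A (\<lambda>j. if j = a then ka else if j = b then kb else kc)"
    unfolding cusp_def using idx(1) vd(1-3) vol prod by blast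
  with V show ?thesis by blast
qed

text \<open>\<delta> is the Gram determinant of the facets \<open>a, b, c\<close>. The adjugate
  matrix provides the coefficients \<open>X\<close>, \<open>Y\<close>, \<open>Z\<close> that make
  \<open>w\<close> orthogonal to them, so the vertex is a multiple of \<open>w\<close>; its square
  is \<delta> times its product with \<open>e i\<close>, hence nonzero.\<close>

lemma not_ideal:
  assumes idx: "i < 4" "a < 4" "b < 4" "c < 4" "distinct [i, a, b, c]"
    and gr: "lorentz (e a) (e b) = - x" "lorentz (e a) (e c) = - y" "lorentz (e b) (e c) = - z"
    and det: "1 - x * x - y * y - z * z - 2 * x * y * z = \<delta>" "\<delta> \<noteq> 0"
  shows "i \<notin> ideal_vertices e"
proof
  assume "i \<in> ideal_vertices e"
  then obtain l where l: "l \<in> future_null" "represents_vertex e i l" by (auto simp: ideal_vertices_def)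
  have u: "lorentz (e a) (e a) = 1" "lorentz (e b) (e b) = 1" "lorentz (e c) (e c) = 1" using idx unit by auto
  have gs: "lorentz (e b) (e a) = - x" "lorentz (e c) (e a) = - y" "lorentz (e c) (e b) = - z"
    using gr by (simp_all add: lorentz_commute[of "e b" "e a"] lorentz_commute[of "e c"])
  define da db dc where "da = - lorentz (e i) (e a)" and "db = - lorentz (e i) (e b)" and "dc = - lorentz (e i) (e c)"
  define X where "X = da * (1 - z * z) + db * (x + y * z) + dc * (y + x * z)"
  define Y where "Y = da * (x + y * z) + db * (1 - y * y) + dc * (z + x * y)"
  define Z where "Z = da * (y + x * z) + db * (z + x * y) + dc * (1 - x * x)"
  define w where "w = \<delta> *\<^sub>R e i + X *\<^sub>R e a + Y *\<^sub>R e b + Z *\<^sub>R e c"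
  have wa: "lorentz w (e a) = - \<delta> * da + X - Y * x - Z * y" "lorentz w (e b) = - \<delta> * db - X * x + Y - Z * z"
    "lorentz w (e c) = - \<delta> * dc - X * y - Y * z + Z"
    by (simp_all add: w_def lorentz_simps u gr gs da_def db_def dc_def)
  have w0: "lorentz w (e a) = 0" "lorentz w (e b) = 0" "lorentz w (e c) = 0"
    unfolding wa X_def Y_def Z_def det(1)[symmetric] by algebra+
  have all: "k = i \<or> k = a \<or> k = b \<or> k = c" if "k < 4" for k
    using that idx by (simp add: less_Suc_eq eval_nat_numeral) auto
  have wk: "lorentz w (e k) = 0" if "k < 4" "k \<noteq> i" for k using all[OF that(1)] that(2) w0 by auto
  have "lorentz w (e i) \<noteq> 0"
  proof
    assume "lorentz w (e i) = 0"
    then have "lorentz w (e k) = 0" if "k < 4" for k using wk that by (cases "k = i") auto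
    then have "w = 0" by (rule orthogonal_all_zero)
    obtain v where v: "represents_vertex e i v" using vertex[OF idx(1)] by blast
    then have "lorentz v (e a) = 0" "lorentz v (e b) = 0" "lorentz v (e c) = 0" using idx by (auto simp: represents_vertex_def)
    then have "lorentz v w = \<delta> * lorentz v (e i)" by (simp add: w_def lorentz_simps)
    then show False using \<open>w = 0\<close> det(2) v by (simp add: represents_vertex_def lorentz_simps)
  qed
  moreover from this have "l = (lorentz l (e i) / lorentz w (e i)) *\<^sub>R w"
    using l(2) by (intro vertex_unique[OF idx(1) _ wk]) (auto simp: represents_vertex_def)
  ultimately obtain \<mu> where \<mu>: "l = \<mu> *\<^sub>R w" "lorentz w (e i) \<noteq> 0" by blast
  have "\<mu> \<noteq> 0" using \<mu>(1) l(1) by (auto simp: future_null_def)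
  have "lorentz l l = \<mu> * (\<mu> * lorentz w w)" by (simp add: \<mu>(1) lorentz_simps)
  moreover have "lorentz w w = \<delta> * lorentz w (e i)"
    using arg_cong[OF w_def, of "lorentz w"] by (simp add: lorentz_simps w0)
  ultimately show False using l(1) \<open>\<mu> \<noteq> 0\<close> \<mu>(2) det(2) by (simp add: future_null_def)
qed

text \<open>Separates geometry from optimization: \<open>opt\<close> is the upper bound and
  \<open>sw\<close> a feasible point attaining it, both in terms of the squared reciprocals of the
  scales. The bound (\<kappa> i j)^2 / 4 is the condition r i * r j * \<kappa> i j \<ge> 2 after
  squaring. The supremum is a maximum.\<close>

theorem delta_opt_eq:
  assumes I: "ideal_vertices e = I" and cusp: "\<And>i. i \<in> I \<Longrightarrow> cusp i (A i) (\<kappa> i)"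
    and V: "hyp_vol (hyp_simplex e) = V" "V > 0"
    and opt: "\<And>s. (\<And>i. i \<in> I \<Longrightarrow> 0 < s i \<and> s i \<le> 1) \<Longrightarrow>
       (\<And>i j. i \<in> I \<Longrightarrow> j \<in> I \<Longrightarrow> i \<noteq> j \<Longrightarrow> s i * s j \<le> (\<kappa> i j)\<^sup>2 / 4) \<Longrightarrow> (\<Sum>i\<in>I. A i * s i) \<le> H"
    and \<kappa>: "\<And>i j. i \<in> I \<Longrightarrow> j \<in> I \<Longrightarrow> i \<noteq> j \<Longrightarrow> \<kappa> i j > 0"
    and sw: "\<And>i. i \<in> I \<Longrightarrow> 0 < sw i \<and> sw i \<le> 1"
      "\<And>i j. i \<in> I \<Longrightarrow> j \<in> I \<Longrightarrow> i \<noteq> j \<Longrightarrow> sw i * sw j \<le> (\<kappa> i j)\<^sup>2 / 4" "(\<Sum>i\<in>I. A i * sw i) = H"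
  shows "delta_opt e = H / V"
proof -
  obtain v where v: "\<And>i. i \<in> I \<Longrightarrow> v i \<in> future_null" "\<And>i. i \<in> I \<Longrightarrow> represents_vertex e i (v i)"
    "\<And>i. i \<in> I \<Longrightarrow> lorentz (v i) (e i) = - 1"
    "\<And>i r. i \<in> I \<Longrightarrow> r \<ge> 1 \<Longrightarrow> hyp_vol (horoball (r *\<^sub>R v i) \<inter> hyp_simplex e) = A i / r\<^sup>2"
    "\<And>i j w. i \<in> I \<Longrightarrow> j < 4 \<Longrightarrow> j \<noteq> i \<Longrightarrow> represents_vertex e j w \<Longrightarrow> lorentz w (e j) = - 1 \<Longrightarrow> lorentz (v i) w = - \<kappa> i j"
  proof -
    have "\<forall>i\<in>I. \<exists>v. v \<in> future_null \<and> represents_vertex e i v \<and> lorentz v (e i) = - 1 \<and>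
     (\<forall>r\<ge>1. hyp_vol (horoball (r *\<^sub>R v) \<inter> hyp_simplex e) = A i / r\<^sup>2) \<and>
     (\<forall>j<4. \<forall>w. j \<noteq> i \<longrightarrow> represents_vertex e j w \<longrightarrow> lorentz w (e j) = - 1 \<longrightarrow> lorentz v w = - \<kappa> i j)"
      using cusp unfolding cusp_def by blast
    from bchoice[OF this] show ?thesis using that by blast
  qed
  have i4: "i < 4" if "i \<in> I" for i using that I by (auto simp: ideal_vertices_def)
  have prod: "lorentz (v i) (v j) = - \<kappa> i j" if "i \<in> I" "j \<in> I" "i \<noteq> j" for i j
    using v(5)[OF that(1) i4[OF that(2)] _ v(2)[OF that(2)] v(3)[OF that(2)]] that(3) by simp
  have dens: "packing_density e (\<lambda>i. horoball (r i *\<^sub>R v i)) = (\<Sum>i\<in>I. A i * (1 / (r i)\<^sup>2)) / V" if "\<And>i. i \<in> I \<Longrightarrow> r i \<ge> 1" for r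
    unfolding packing_density_def I V(1) using v(4) that by simp
  have sq: "r * r' * k \<ge> 2 \<longleftrightarrow> (1 / r\<^sup>2) * (1 / r'\<^sup>2) \<le> k\<^sup>2 / 4" if "r \<ge> 1" "r' \<ge> 1" "k > 0" for r r' k :: real
  proof -
    have p: "r * r' > 0" using that by simp
    have "r * r' * k \<ge> 2 \<longleftrightarrow> 2\<^sup>2 \<le> (r * r' * k)\<^sup>2"
    proof -
      have "r * r' * k \<ge> 0" using that(3) by (intro mult_nonneg_nonneg[OF less_imp_le[OF p]]) simp
      then show ?thesis using abs_le_square_iff[of 2 "r * r' * k"] by (simp only: abs_of_nonneg abs_numeral)
    qed
    also have "\<dots> \<longleftrightarrow> 1 / (r * r')\<^sup>2 \<le> k\<^sup>2 / 4"
    proof -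
      have "1 / (r * r')\<^sup>2 \<le> k\<^sup>2 / 4 \<longleftrightarrow> 1 \<le> k\<^sup>2 / 4 * (r * r')\<^sup>2" by (rule pos_divide_le_eq[OF zero_less_power[OF p]])
      moreover have "(r * r' * k)\<^sup>2 = 4 * (k\<^sup>2 / 4 * (r * r')\<^sup>2)" by (simp add: power_mult_distrib)
      ultimately show ?thesis by simp
    qed
    finally show ?thesis by (simp add: power_mult_distrib)
  qed
  let ?S = "{packing_density e b | B b. horoball_packing e B b}"
  have upper: "x \<le> H / V" if x: "x \<in> ?S" for x
  proof -
    obtain B b where b: "x = packing_density e b" "horoball_packing e B b" using x by blast
    obtain l where l: "packing_vectors l" "\<And>i. i \<in> ideal_vertices e \<Longrightarrow> b i = horoball (l i)"
      using packing_vectors_of_packing[OF b(2)] by blast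
    define r where "r i = - lorentz (l i) (e i)" for i
    have lr: "l i = r i *\<^sub>R v i" "r i \<ge> 1" if i: "i \<in> I" for i
    proof -
      have li: "represents_vertex e i (l i)" "lorentz (l i) (e i) \<le> - 1"
        using l(1)[unfolded packing_vectors_def I, THEN bspec, OF i] by simp_all
      then show "r i \<ge> 1" by (simp add: r_def)
      have "l i = (lorentz (l i) (e i) / lorentz (v i) (e i)) *\<^sub>R v i"
        using li(1) v(2,3)[OF i] by (intro vertex_unique[OF i4[OF i]]) (auto simp: represents_vertex_def)
      then show "l i = r i *\<^sub>R v i" by (simp add: r_def v(3)[OF i])
    qed
    have "packing_density e b = packing_density e (\<lambda>i. horoball (r i *\<^sub>R v i))"
      unfolding packing_density_def I
    proof (intro arg_cong2[where f = "(/)"] sum.cong refl)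
      fix i assume i: "i \<in> I"
      then have "b i = horoball (l i)" using l(2) I by blast
      then show "hyp_vol (b i \<inter> hyp_simplex e) = hyp_vol (horoball (r i *\<^sub>R v i) \<inter> hyp_simplex e)"
        by (simp only: lr(1)[OF i])
    qed
    also have "\<dots> = (\<Sum>i\<in>I. A i * (1 / (r i)\<^sup>2)) / V" by (rule dens) (rule lr(2))
    also have "\<dots> \<le> H / V"
    proof (rule divide_right_mono[OF opt])
      show "0 < 1 / (r i)\<^sup>2 \<and> 1 / (r i)\<^sup>2 \<le> 1" if "i \<in> I" for i using lr(2)[OF that] by (simp add: one_le_power)
      show "1 / (r i)\<^sup>2 * (1 / (r j)\<^sup>2) \<le> (\<kappa> i j)\<^sup>2 / 4" if ij: "i \<in> I" "j \<in> I" "i \<noteq> j" for i j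
      proof -
        have "\<forall>j\<in>I. j \<noteq> i \<longrightarrow> lorentz (l i) (l j) \<le> - 2"
          using l(1)[unfolded packing_vectors_def I, THEN bspec, OF ij(1)] by (elim conjE) assumption
        from this[THEN bspec, OF ij(2), THEN mp, OF ij(3)[symmetric]] have "lorentz (l i) (l j) \<le> - 2" .
        then have "r j * (r i * - \<kappa> i j) \<le> - 2"
          unfolding lr(1)[OF ij(1)] lr(1)[OF ij(2)] lorentz_scale_left lorentz_scale_right prod[OF ij] .
        then have "r i * r j * \<kappa> i j \<ge> 2" by (simp only: mult_ac mult_minus_right neg_le_iff_le)
        then show ?thesis by (rule sq[OF lr(2)[OF ij(1)] lr(2)[OF ij(2)] \<kappa>[OF ij], THEN iffD1])
      qed
    qed (use V in simp)
    finally show ?thesis using b by simp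
  qed
  have "H / V \<in> ?S"
  proof -
    define r where "r i = 1 / sqrt (sw i)" for i
    have r1: "r i \<ge> 1" "1 / (r i)\<^sup>2 = sw i" if "i \<in> I" for i
      using sw(1)[OF that] by (simp_all add: r_def power_divide)
    have "packing_vectors (\<lambda>i. r i *\<^sub>R v i)"
      unfolding packing_vectors_def I
    proof (intro ballI conjI impI)
      fix i assume i: "i \<in> I"
      have r0: "r i > 0" using r1[OF i] by simp
      show "r i *\<^sub>R v i \<in> future_null" using future_null_scale[OF v(1)[OF i] r0] .
      show "represents_vertex e i (r i *\<^sub>R v i)"
        using v(2)[OF i] r0 by (simp add: represents_vertex_def lorentz_simps mult_nonneg_nonpos mult_pos_neg)
      show "lorentz (r i *\<^sub>R v i) (e i) \<le> - 1" using v(3)[OF i] r1[OF i] by (simp add: lorentz_simps)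
      fix j assume j: "j \<in> I" "j \<noteq> i"
      have ij: "i \<noteq> j" using j(2) by blast
      have "r i * r j * \<kappa> i j \<ge> 2"
        using sw(2)[OF i j(1) ij] unfolding r1(2)[OF i, symmetric] r1(2)[OF j(1), symmetric]
        by (rule sq[OF r1(1)[OF i] r1(1)[OF j(1)] \<kappa>[OF i j(1) ij], THEN iffD2])
      then show "lorentz (r i *\<^sub>R v i) (r j *\<^sub>R v j) \<le> - 2"
        unfolding lorentz_scale_left lorentz_scale_right prod[OF i j(1) ij]
        by (simp only: mult_ac mult_minus_right neg_le_iff_le)
    qed
    from packing_of_packing_vectors[OF this] obtain B where "horoball_packing e B (\<lambda>i. horoball (r i *\<^sub>R v i))" by blast
    moreover have "packing_density e (\<lambda>i. horoball (r i *\<^sub>R v i)) = H / V"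
    proof -
      have "packing_density e (\<lambda>i. horoball (r i *\<^sub>R v i)) = (\<Sum>i\<in>I. A i * (1 / (r i)\<^sup>2)) / V"
        by (rule dens) (rule r1(1))
      also have "(\<Sum>i\<in>I. A i * (1 / (r i)\<^sup>2)) = (\<Sum>i\<in>I. A i * sw i)"
        by (intro sum.cong refl) (simp only: r1(2))
      finally show ?thesis unfolding sw(3) .
    qed
    ultimately show ?thesis by (intro CollectI exI conjI) (rule sym)
  qed
  from cSup_eq_maximum[OF this upper] show ?thesis unfolding delta_opt_def .
qed

end

context coxeter_tetrahedron
begin

section \<open>Optimal horoball sizes for one to four cusps\<close>

corollary delta_opt_one_cusp:
  assumes "ideal_vertices e = {i}" "cusp i A \<kappa>" "hyp_vol (hyp_simplex e) = V" "V > 0" "A \<ge> 0"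
  shows "delta_opt e = A / V"
  using assms(2,5) by (intro delta_opt_eq[OF assms(1) _ assms(3,4), of "\<lambda>_. A" "\<lambda>_. \<kappa>" A "\<lambda>_. 1"])
    (auto intro: mult_left_le)

corollary delta_opt_three_cusps:
  assumes I: "ideal_vertices e = {i, j, k}" "distinct [i, j, k]"
    and c: "cusp i Ai \<kappa>i" "cusp j Aj \<kappa>j" "cusp k Ak \<kappa>k" and V: "hyp_vol (hyp_simplex e) = V" "V > 0"
    and \<kappa>: "\<kappa>i j = ka" "\<kappa>j i = ka" "\<kappa>i k = kb" "\<kappa>k i = kb" "\<kappa>j k = kc" "\<kappa>k j = kc"
    and pos: "ka > 0" "kb > 0" "kc > 0" and sq: "ka * ka = 4 * a" "kb * kb = 4 * b" "kc * kc = 4 * c"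
    and opt: "\<And>x y z. 0 < x \<Longrightarrow> 0 < y \<Longrightarrow> 0 < z \<Longrightarrow> x \<le> 1 \<Longrightarrow> y \<le> 1 \<Longrightarrow> z \<le> 1 \<Longrightarrow>
       x * y \<le> a \<Longrightarrow> x * z \<le> b \<Longrightarrow> y * z \<le> c \<Longrightarrow> Ai * x + Aj * y + Ak * z \<le> H"
    and w: "0 < x" "0 < y" "0 < z" "x \<le> 1" "y \<le> 1" "z \<le> 1" "x * y \<le> a" "x * z \<le> b" "y * z \<le> c"
      "Ai * x + Aj * y + Ak * z = H"
  shows "delta_opt e = H / V"
proof (rule delta_opt_eq[OF I(1), where A = "\<lambda>n. if n = i then Ai else if n = j then Aj else Ak"
      and \<kappa> = "\<lambda>n. if n = i then \<kappa>i else if n = j then \<kappa>j else \<kappa>k"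
      and sw = "\<lambda>n. if n = i then x else if n = j then y else z"])
  have sym: "y * x \<le> a" "z * x \<le> b" "z * y \<le> c" using w by (simp_all add: mult.commute)
  fix s :: "nat \<Rightarrow> real"
  assume s: "\<And>n. n \<in> {i, j, k} \<Longrightarrow> 0 < s n \<and> s n \<le> 1"
    "\<And>n n'. n \<in> {i, j, k} \<Longrightarrow> n' \<in> {i, j, k} \<Longrightarrow> n \<noteq> n' \<Longrightarrow>
       s n * s n' \<le> ((if n = i then \<kappa>i else if n = j then \<kappa>j else \<kappa>k) n')\<^sup>2 / 4"
  have "Ai * s i + Aj * s j + Ak * s k \<le> H"
    using s(1)[of i] s(1)[of j] s(1)[of k] s(2)[of i j] s(2)[of i k] s(2)[of j k] I(2) \<kappa> sq[folded power2_eq_square] by (intro opt) simp_all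
  then show "(\<Sum>n\<in>{i, j, k}. (if n = i then Ai else if n = j then Aj else Ak) * s n) \<le> H"
    using I(2) by (simp add: add.assoc)
next
  have sym: "y * x \<le> a" "z * x \<le> b" "z * y \<le> c" using w by (simp_all add: mult.commute)
  show "(if n = i then x else if n = j then y else z) * (if n' = i then x else if n' = j then y else z)
     \<le> ((if n = i then \<kappa>i else if n = j then \<kappa>j else \<kappa>k) n')\<^sup>2 / 4"
    if "n \<in> {i, j, k}" "n' \<in> {i, j, k}" "n \<noteq> n'" for n n'
    using that w sym \<kappa> sq[folded power2_eq_square] I(2) by auto
qed (use I(2) c V \<kappa> pos w in \<open>auto simp: add.assoc\<close>)

text \<open>One horoball has full size and the other the largest size compatible with it: (1 - s) (1
  - t) \<ge> 0 and s t \<le> a give s + t \<le> 1 + a.\<close>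

corollary delta_opt_two_cusps:
  assumes I: "ideal_vertices e = {i, j}" "i \<noteq> j"
    and c: "cusp i A \<kappa>i" "cusp j A \<kappa>j" and V: "hyp_vol (hyp_simplex e) = V" "V > 0"
    and \<kappa>: "\<kappa>i j = k" "\<kappa>j i = k" and pos: "k > 0" and sq: "k * k = 4 * a" and a: "0 < a" "a \<le> 1" "A \<ge> 0"
  shows "delta_opt e = A * (1 + a) / V"
proof (rule delta_opt_eq[OF I(1), where A = "\<lambda>n. A" and \<kappa> = "\<lambda>n. if n = i then \<kappa>i else \<kappa>j"
      and sw = "\<lambda>n. if n = i then 1 else a"])
  fix s :: "nat \<Rightarrow> real"
  assume s: "\<And>n. n \<in> {i, j} \<Longrightarrow> 0 < s n \<and> s n \<le> 1"
    "\<And>n n'. n \<in> {i, j} \<Longrightarrow> n' \<in> {i, j} \<Longrightarrow> n \<noteq> n' \<Longrightarrow> s n * s n' \<le> ((if n = i then \<kappa>i else \<kappa>j) n')\<^sup>2 / 4"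
  have "0 \<le> (1 - s i) * (1 - s j)" using s(1)[of i] s(1)[of j] by simp
  moreover have "s i * s j \<le> a" using s(2)[of i j] I(2) \<kappa> sq[folded power2_eq_square] by simp
  ultimately have "s i + s j \<le> 1 + a" by (simp add: algebra_simps)
  then have "A * (s i + s j) \<le> A * (1 + a)" using a(3) by (rule mult_left_mono)
  then show "(\<Sum>n\<in>{i, j}. A * s n) \<le> A * (1 + a)"
    using I(2) by (simp add: distrib_left)
qed (use I(2) c V \<kappa> pos a sq[folded power2_eq_square] in \<open>auto simp: distrib_left\<close>)

text \<open>Covers diagrams with enough symmetry that disjoint pairs of vertices have equal
  products. The optimum is attained with vertex 0 at full size; the conditions k01 * k02 \<le> k03
  and its permutations make the other three sizes compatible with each other.\<close>

corollary delta_opt_four_cusps: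
  assumes I: "ideal_vertices e = {0, 1, 2, 3}"
    and c: "cusp 0 A \<kappa>0" "cusp 1 A \<kappa>1" "cusp 2 A \<kappa>2" "cusp 3 A \<kappa>3" and V: "hyp_vol (hyp_simplex e) = V" "V > 0"
    and \<kappa>: "\<kappa>0 1 = ra" "\<kappa>1 0 = ra" "\<kappa>0 2 = rb" "\<kappa>2 0 = rb" "\<kappa>0 3 = rc" "\<kappa>3 0 = rc"
      "\<kappa>1 2 = rc" "\<kappa>2 1 = rc" "\<kappa>1 3 = rb" "\<kappa>3 1 = rb" "\<kappa>2 3 = ra" "\<kappa>3 2 = ra"
    and pos: "ra > 0" "rb > 0" "rc > 0" and sq: "ra * ra = 4 * k01" "rb * rb = 4 * k02" "rc * rc = 4 * k03"
    and k: "0 < k01" "k01 \<le> 1" "0 < k02" "k02 \<le> 1" "0 < k03" "k03 \<le> 1" "k01 * k02 \<le> k03" "k01 * k03 \<le> k02" "k02 * k03 \<le> k01"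
    and opt: "\<And>x y z u. 0 < x \<Longrightarrow> 0 < y \<Longrightarrow> 0 < z \<Longrightarrow> 0 < u \<Longrightarrow> x \<le> 1 \<Longrightarrow> y \<le> 1 \<Longrightarrow> z \<le> 1 \<Longrightarrow> u \<le> 1 \<Longrightarrow>
       x * y \<le> k01 \<Longrightarrow> x * z \<le> k02 \<Longrightarrow> x * u \<le> k03 \<Longrightarrow> y * z \<le> k03 \<Longrightarrow> y * u \<le> k02 \<Longrightarrow> z * u \<le> k01 \<Longrightarrow>
       x + y + z + u \<le> 1 + k01 + k02 + k03" and A: "A \<ge> 0"
  shows "delta_opt e = A * (1 + k01 + k02 + k03) / V"
proof (rule delta_opt_eq[OF I, where A = "\<lambda>n. A"
      and \<kappa> = "\<lambda>n. if n = 0 then \<kappa>0 else if n = 1 then \<kappa>1 else if n = 2 then \<kappa>2 else \<kappa>3"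
      and sw = "\<lambda>n. if n = 0 then 1 else if n = 1 then k01 else if n = 2 then k02 else k03"])
  let ?\<kappa> = "\<lambda>n. if n = 0 then \<kappa>0 else if n = 1 then \<kappa>1 else if n = 2 then \<kappa>2 else \<kappa>3"
  fix s :: "nat \<Rightarrow> real"
  assume s: "\<And>n. n \<in> {0, 1, 2, 3} \<Longrightarrow> 0 < s n \<and> s n \<le> 1"
    "\<And>n n'. n \<in> {0, 1, 2, 3} \<Longrightarrow> n' \<in> {0, 1, 2, 3} \<Longrightarrow> n \<noteq> n' \<Longrightarrow> s n * s n' \<le> (?\<kappa> n n')\<^sup>2 / 4"
  have "s 0 + s 1 + s 2 + s 3 \<le> 1 + k01 + k02 + k03"
    using s(1)[of 0] s(1)[of 1] s(1)[of 2] s(1)[of 3] s(2)[of 0 1] s(2)[of 0 2] s(2)[of 0 3] s(2)[of 1 2] s(2)[of 1 3] s(2)[of 2 3] \<kappa> sq[folded power2_eq_square]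
    by (intro opt) simp_all
  then have "A * (s 0 + s 1 + s 2 + s 3) \<le> A * (1 + k01 + k02 + k03)" using A by (rule mult_left_mono)
  then show "(\<Sum>n\<in>{0, 1, 2, 3}. A * s n) \<le> A * (1 + k01 + k02 + k03)" by (simp add: distrib_left add.assoc)
next
  have sym: "k02 * k01 \<le> k03" "k03 * k01 \<le> k02" "k03 * k02 \<le> k01" using k by (simp_all add: mult.commute)
  show "(if n = 0 then 1 else if n = 1 then k01 else if n = 2 then k02 else k03) *
     (if n' = 0 then 1 else if n' = 1 then k01 else if n' = 2 then k02 else k03)
     \<le> ((if n = 0 then \<kappa>0 else if n = 1 then \<kappa>1 else if n = 2 then \<kappa>2 else \<kappa>3) n')\<^sup>2 / 4"
    if "n \<in> {0, 1, 2, 3}" "n' \<in> {0, 1, 2, 3}" "n \<noteq> n'" for n n' :: nat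
    using that k sym \<kappa> sq[folded power2_eq_square] by auto
  show "(if n = 0 then \<kappa>0 else if n = 1 then \<kappa>1 else if n = 2 then \<kappa>2 else \<kappa>3) n' > 0"
    if "n \<in> {0, 1, 2, 3}" "n' \<in> {0, 1, 2, 3}" "n \<noteq> n'" for n n' :: nat
    using that \<kappa> pos by auto
qed (use c V k in \<open>auto simp: distrib_left\<close>)

lemma ideal_vertices_eqI:
  assumes "\<And>i. i \<in> S \<Longrightarrow> i \<in> ideal_vertices e" "\<And>i. i \<in> {0, 1, 2, 3} - S \<Longrightarrow> i \<notin> ideal_vertices e"
  shows "ideal_vertices e = S"
proof -
  have "i \<in> {0, 1, 2, 3}" if "i \<in> ideal_vertices e" for i
    using that by (auto simp: ideal_vertices_def)
  then show ?thesis using assms by blast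
qed

end

lemma find_Some_in_set: "find P xs = Some x \<Longrightarrow> x \<in> set xs"
  by (induction xs) (auto split: if_splits)

lemma coxeter_simplex_tetrahedron:
  assumes "coxeter_simplex D e" "\<forall>(a, b, k)\<in>set D. 2 \<le> k"
  shows "coxeter_tetrahedron e (coxeter_matrix D)"
proof
  fix i j :: nat
  show "coxeter_matrix D i j = coxeter_matrix D j i" by (simp add: coxeter_matrix_def insert_commute)
  show "lorentz (e i) (e j) = - cos (pi / real (coxeter_matrix D i j))" if "i < 4" "j < 4"
    using assms(1) that by (simp add: coxeter_simplex_def)
  show "coxeter_matrix D i i = 1" by (simp add: coxeter_matrix_def)
  show "2 \<le> coxeter_matrix D i j" if "i \<noteq> j"
  proof (cases "find (\<lambda>(a, b, k). {a, b} = {i, j}) D")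
    case None then show ?thesis using that by (simp add: coxeter_matrix_def)
  next
    case (Some x)
    then have "x \<in> set D" by (rule find_Some_in_set)
    then show ?thesis using Some that assms(2) by (auto simp: coxeter_matrix_def split: prod.split)
  qed
  show "\<exists>w. represents_vertex e i w" if "i < 4" using assms(1) that by (simp add: coxeter_simplex_def)
qed

section \<open>Numerical estimates\<close>

text \<open>The convex function w + \<theta> / w takes the value 1 + \<theta> at both ends w =
  \<theta> and w = 1.\<close>

lemma sum_le_of_dominant:
  fixes w r \<theta> :: real
  assumes "\<theta> \<le> w" "w \<le> 1" "w > 0" "w * r \<le> \<theta>"
  shows "w + r \<le> 1 + \<theta>"
proof -
  have "0 \<le> (1 - w) * (w - \<theta>)" using assms by simp
  then have "w * (w + r) \<le> w * (1 + \<theta>)" using assms(4) by (simp add: algebra_simps)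
  then show ?thesis using assms(3) by simp
qed

lemma sum_le_of_prod_le:
  fixes s t \<theta> :: real
  assumes "s \<le> \<theta>" "t \<le> \<theta>" "\<theta> > 0" "s * t \<le> \<theta> * k"
  shows "s + t \<le> \<theta> + k"
proof -
  have "0 \<le> (\<theta> - s) * (\<theta> - t)" using assms by simp
  then have "\<theta> * (s + t) \<le> \<theta> * (\<theta> + k)" using assms(4) by (simp add: algebra_simps)
  then show ?thesis using assms(3) by simp
qed

text \<open>With the threshold \<theta> = k1 + k2 + k3, a variable that reaches \<theta> dominates:
  its product with the sum of the others is at most \<theta>, and \<open>sum_le_of_dominant\<close>
  applies. The case where all four stay below \<theta> depends on the numbers and is passed on as
  \<open>small\<close>.\<close>

lemma sum_four_le:
  fixes x y z u :: real
  assumes pos: "0 < x" "0 < y" "0 < z" "0 < u" and le: "x \<le> 1" "y \<le> 1" "z \<le> 1" "u \<le> 1"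
    and pr: "x * y \<le> k1" "x * z \<le> k2" "x * u \<le> k3" "y * z \<le> k3" "y * u \<le> k2" "z * u \<le> k1"
    and small: "x < k1 + k2 + k3 \<Longrightarrow> y < k1 + k2 + k3 \<Longrightarrow> z < k1 + k2 + k3 \<Longrightarrow> u < k1 + k2 + k3 \<Longrightarrow>
      x + y + z + u \<le> 1 + k1 + k2 + k3"
  shows "x + y + z + u \<le> 1 + k1 + k2 + k3"
proof -
  have rp: "y * x \<le> k1" "z * x \<le> k2" "u * x \<le> k3" "z * y \<le> k3" "u * y \<le> k2" "u * z \<le> k1"
    using pr by (simp_all add: mult.commute)
  consider "k1 + k2 + k3 \<le> x" | "k1 + k2 + k3 \<le> y" | "k1 + k2 + k3 \<le> z" | "k1 + k2 + k3 \<le> u"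
    | "x < k1 + k2 + k3" "y < k1 + k2 + k3" "z < k1 + k2 + k3" "u < k1 + k2 + k3" by linarith
  then show ?thesis
  proof cases
    case 1
    then show ?thesis using sum_le_of_dominant[of "k1 + k2 + k3" x "y + z + u"] pos le pr by (simp add: distrib_left)
  next
    case 2
    then show ?thesis using sum_le_of_dominant[of "k1 + k2 + k3" y "x + z + u"] pos le pr rp by (simp add: distrib_left)
  next
    case 3
    then show ?thesis using sum_le_of_dominant[of "k1 + k2 + k3" z "x + y + u"] pos le pr rp by (simp add: distrib_left)
  next
    case 4
    then show ?thesis using sum_le_of_dominant[of "k1 + k2 + k3" u "x + y + z"] pos le rp by (simp add: distrib_left)
  next
    case 5
    then show ?thesis by (rule small)
  qed
qed

text \<open>Same argument with threshold \<open>a + c * b\<close>. The third variable has its own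
  weight \<open>c\<close>, so the case where it alone reaches the threshold is passed on as
  \<open>third\<close>.\<close>

lemma sum_three_le:
  fixes x y z c :: real
  assumes pos: "0 < x" "0 < y" "0 < z" and le: "x \<le> 1" "y \<le> 1" "z \<le> 1" and c: "c \<ge> 0"
    and pr: "x * y \<le> a" "x * z \<le> b" "y * z \<le> b"
    and third: "a + c * b \<le> z \<Longrightarrow> x < a + c * b \<Longrightarrow> y < a + c * b \<Longrightarrow> x + y + c * z \<le> 1 + (a + c * b)"
    and small: "x < a + c * b \<Longrightarrow> y < a + c * b \<Longrightarrow> z < a + c * b \<Longrightarrow> x + y + c * z \<le> 1 + (a + c * b)"
  shows "x + y + c * z \<le> 1 + (a + c * b)"
proof -
  have rp: "y * x \<le> a" "c * (x * z) \<le> c * b" "c * (y * z) \<le> c * b"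
    using pr c by (simp_all add: mult.commute[of y x] mult_left_mono)
  consider "a + c * b \<le> x" | "a + c * b \<le> y" | "x < a + c * b" "y < a + c * b" by linarith
  then show ?thesis
  proof cases
    case 1
    then show ?thesis using sum_le_of_dominant[of "a + c * b" x "y + c * z"] pos le pr rp
      by (simp add: distrib_left mult.left_commute)
  next
    case 2
    then show ?thesis using sum_le_of_dominant[of "a + c * b" y "x + c * z"] pos le pr rp
      by (simp add: distrib_left mult.left_commute)
  next
    case 3
    then show ?thesis using third small by linarith
  qed
qed

section \<open>Comparison with the simplicial density\<close>

lemma lobachevsky_third_pi_pos: "lobachevsky (pi / 3) > 0"
  using dirichlet_L_bounds(1) by (simp add: lobachevsky_third_pi_eq)

lemma simplicial_density3_eq: "simplicial_density3 = 2 / (3 * dirichlet_L chi_minus3 2)"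
  by (simp add: simplicial_density3_def lobachevsky_third_pi_eq inverse_eq_divide)

lemma density_less:
  assumes "3 * (dirichlet_L chi_minus3 2 * H) < W" "W > 0"
  shows "H / (W / 2) < simplicial_density3"
  unfolding simplicial_density3_eq using assms dirichlet_L_bounds(1) by (simp add: field_simps)

text \<open>\<open>W\<close> is twice the volume, and 237 / 100 is 3 times the upper bound 79 / 100
  of the L-value.\<close>

lemma density_less_rational:
  assumes "237 * H \<le> 100 * W" "H > 0"
  shows "H / (W / 2) < simplicial_density3"
proof (rule density_less)
  have "dirichlet_L chi_minus3 2 * H < 79 / 100 * H"
    using dirichlet_L_bounds(2) assms(2) by (rule mult_strict_right_mono)
  then show "3 * (dirichlet_L chi_minus3 2 * H) < W" using assms(1) by simp
qed (use assms in simp)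

text \<open>Since \<open>W\<close> is twice the volume, the quotient is sqrt 3 / 6 divided by the
  Lobachevsky value, and sqrt 3 / 6 = 1 / (2 sqrt 3).\<close>

lemma density_eq:
  assumes "W = x * lobachevsky (pi / 3)" "H = x * (sqrt 3 / 12)" "x > 0"
  shows "H / (W / 2) = simplicial_density3"
  unfolding assms(1,2) simplicial_density3_def
  using lobachevsky_third_pi_pos assms(3) by (simp add: field_simps)

text \<open>From sin 2x = sin 3x at x = pi / 5 after cancelling sin x.\<close>

lemma cos_fifth_pi: "cos (pi / 5) * cos (pi / 5) = cos (pi / 5) / 2 + 1 / 4"
proof -
  let ?x = "pi / 5"
  have s: "sin ?x > 0" by (intro sin_gt_zero) simp_all
  have "2 * sin ?x * cos ?x = sin (2 * ?x)" by (rule sin_double[symmetric])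
  also have "\<dots> = sin (pi - 2 * ?x)" by (rule sin_pi_minus[symmetric])
  also have "pi - 2 * ?x = 2 * ?x + ?x" by simp
  also have "sin (2 * ?x + ?x) = sin ?x * (4 * (cos ?x)\<^sup>2 - 1)"
    unfolding sin_add sin_double cos_double_cos by (simp add: power2_eq_square algebra_simps)
  finally have "sin ?x * (2 * cos ?x) = sin ?x * (4 * (cos ?x)\<^sup>2 - 1)" by (simp add: mult_ac)
  then have "2 * cos ?x = 4 * (cos ?x)\<^sup>2 - 1" using s mult_cancel_left[of "sin ?x"] by simp
  then show ?thesis by (simp add: power2_eq_square)
qed

lemma square_bounds:
  fixes x :: real
  assumes "x * x = c" "a * a < c" "c < b * b" "x \<ge> 0" "b \<ge> 0"
  shows "a < x" "x < b"
proof -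
  show "x < b" using power2_less_imp_less[of x b] assms by (simp add: power2_eq_square)
  show "a < x" using power2_less_imp_less[of a x] assms by (simp add: power2_eq_square)
qed

text \<open>The three-term bound in terms of the squares \<open>D\<close> and \<open>T\<close>, so
  that for explicit data each premise follows by rewriting with \<open>powers\<close> or from
  \<open>bounds\<close>.\<close>

lemma wedge_volume_ge:
  assumes "d * d = D" "t * t = T" "D * (1 + T) = f" "f \<le> 1" "1 / 2 \<le> d" "d < 1" "t \<ge> 0"
    and "D * t / 2 + D * D * (t + t * T / 3) / 4 + D * D * D * (t + 2 * t * T / 3 + t * T * T / 5) / 6 = P"
  shows "P \<le> wedge_volume d t"
proof -
  have "d\<^sup>2 = D" "t\<^sup>2 = T" using assms by (simp_all add: power2_eq_square)
  moreover from this have "d ^ 4 = D * D" "d ^ 6 = D * D * D" "t ^ 3 = t * T" "t ^ 5 = t * T * T"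
    by (auto simp: power2_eq_square eval_nat_numeral)
  ultimately show ?thesis using wedge_volume_lower[of d t] assms by (simp add: mult.assoc)
qed

section \<open>The noncompact simplex groups\<close>

context
  fixes q p g :: real
  assumes q: "q = sqrt 3" and p: "p = sqrt 2" and g: "g = cos (pi / 5)"
begin

text \<open>The radicals stay opaque atoms. These rules reduce the polynomials that occur to linear
  combinations of 1, q, p, p q, g and g q, and \<open>bounds\<close> encloses just these monomials,
  which leaves linear arithmetic.\<close>

lemma squares: "q * q = 3" "p * p = 2" "g * g = g / 2 + 1 / 4"
  by (simp_all add: q p g cos_fifth_pi)

lemma square_left: "q * (q * x) = 3 * x" "p * (p * x) = 2 * x" "g * (g * x) = (g / 2 + 1 / 4) * x"
  by (simp_all only: mult.assoc[symmetric] squares)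

lemmas powers = squares square_left

lemma bounds: "1732 / 1000 < q" "q < 17321 / 10000" "14142 / 10000 < p" "p < 141422 / 100000"
  "24494 / 10000 < p * q" "p * q < 24495 / 10000" "809 / 1000 < g" "g < 8091 / 10000"
  "1401 / 1000 < g * q" "g * q < 1402 / 1000"
proof -
  have pos: "q \<ge> 0" "p \<ge> 0" "g > 0" by (auto simp: q p g intro!: cos_gt_zero)
  show 1: "1732 / 1000 < q" "q < 17321 / 10000"
    using square_bounds[of q 3 "1732 / 1000" "17321 / 10000"] squares(1) pos by simp_all
  show 2: "14142 / 10000 < p" "p < 141422 / 100000"
    using square_bounds[of p 2 "14142 / 10000" "141422 / 100000"] squares(2) pos by simp_all
  have "(p * q) * (p * q) = (p * p) * (q * q)" by (simp only: mult_ac)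
  then have "(p * q) * (p * q) = 6" unfolding squares by simp
  then show "24494 / 10000 < p * q" "p * q < 24495 / 10000"
    using square_bounds[of "p * q" 6 "24494 / 10000" "24495 / 10000"] pos by simp_all
  have "(g - 1 / 4) * (g - 1 / 4) = 5 / 16" using squares(3) by (simp add: algebra_simps)
  moreover have "g - 1 / 4 \<ge> 0"
    using cos_monotone_0_pi_le[of "pi / 5" "pi / 3"] by (simp add: g cos_60)
  ultimately have "559 / 1000 < g - 1 / 4" "g - 1 / 4 < 5591 / 10000"
    using square_bounds[of "g - 1 / 4" "5 / 16" "559 / 1000" "5591 / 10000"] by simp_all
  then show 3: "809 / 1000 < g" "g < 8091 / 10000" by simp_all
  have "809 / 1000 * (1732 / 1000) < g * q" using 1 3 by (intro mult_strict_mono) auto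
  then show "1401 / 1000 < g * q" by simp
  have "g * q < 8091 / 10000 * (17321 / 10000)" using 1 3 pos by (intro mult_strict_mono) auto
  then show "g * q < 1402 / 1000" by simp
qed

lemmas wedge_volumes = wedge_volume_values[OF q p]
lemmas cos_values = cos_30 cos_45 cos_60 q p g
lemmas diagram_defs = path_diagram_def star_diagram_def cycle_diagram_def tailed_triangle_diagram_def

section \<open>Groups commensurable with [3,3,6]\<close>

lemma density_V_bar:
  assumes "coxeter_simplex (diagram V_bar) e"
  shows "delta_opt e = simplicial_density3"
proof -
  interpret coxeter_tetrahedron e "coxeter_matrix (diagram V_bar)"
    by (rule coxeter_simplex_tetrahedron[OF assms]) (simp add: diagram_defs)
  have gr: "lorentz (e 0) (e 1) = - (1 / 2)" "lorentz (e 0) (e 2) = - 0" "lorentz (e 0) (e 3) = - 0" "lorentz (e 1) (e 0) = - (1 / 2)"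
    "lorentz (e 1) (e 2) = - (1 / 2)" "lorentz (e 1) (e 3) = - 0" "lorentz (e 2) (e 0) = - 0" "lorentz (e 2) (e 1) = - (1 / 2)"
    "lorentz (e 2) (e 3) = - (q / 2)" "lorentz (e 3) (e 0) = - 0" "lorentz (e 3) (e 1) = - 0" "lorentz (e 3) (e 2) = - (q / 2)"
    by (simp_all add: gram coxeter_matrix_def diagram_defs doubleton_eq_iff cos_values)
  \<comment> \<open>One application of \<open>cusp_intro\<close> yields both the cusp and the
    volume. Its last arguments are, on nondegenerate wedges, the squared distances of the triangle
    corners from the centre of the hemisphere; the value 1 marks a further ideal vertex. Wedges of
    distance 0 get tangent 0.\<close>
  have first: "cusp 0 (q / 48) (\<lambda>j. if j = 2 then 4 else if j = 1 then 2 else 2 * q) \<and>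
    hyp_vol (hyp_simplex e) = (wedge_volume 0 0 + wedge_volume 0 0 + wedge_volume (1 / 2) 0 + wedge_volume (1 / 2) (q / 3) + wedge_volume 0 0 + wedge_volume 0 0) / 2"
    by (rule cusp_intro[of 0 2 1 3 "1 / 2" "q / 2" "0" _ _ _ "q / 2" "1 / 2" "1" _ _ _ _ _ _ _ _ _ "0" "0" "1 / 4" "1 / 3" "0" "0"]; (fact gr | (simp add: algebra_simps powers; fail) | (simp add: field_simps powers; fail) | (use bounds in linarith)))
  note c0 = first[THEN conjunct1]
  have n1: "1 \<notin> ideal_vertices e"
    by (rule not_ideal[of 1 0 2 3 "0" "0" "q / 2" "1 / 4"]; (fact gr | (simp add: algebra_simps powers; fail) | (simp add: field_simps powers; fail) | (use bounds in linarith)))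
  have n2: "2 \<notin> ideal_vertices e"
    by (rule not_ideal[of 2 0 1 3 "1 / 2" "0" "0" "3 / 4"]; (fact gr | (simp add: algebra_simps powers; fail) | (simp add: field_simps powers; fail) | (use bounds in linarith)))
  have n3: "3 \<notin> ideal_vertices e"
    by (rule not_ideal[of 3 0 1 2 "1 / 2" "0" "1 / 2" "1 / 2"]; (fact gr | (simp add: algebra_simps powers; fail) | (simp add: field_simps powers; fail) | (use bounds in linarith)))
  define W where "W = wedge_volume (1 / 2) (q / 3)"
  have V: "hyp_vol (hyp_simplex e) = W / 2" using first by (simp add: W_def)
  have W: "W = 1 / 4 * lobachevsky (pi / 3)" by (simp add: W_def wedge_volumes)
  have W0: "W > 0" using lobachevsky_third_pi_pos by (simp add: W)
  have I: "ideal_vertices e = {0}"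
    by (rule ideal_vertices_eqI) (use cusp_ideal[OF c0] n1 n2 n3 in auto)
  have "delta_opt e = (q / 48) / (W / 2)"
    by (rule delta_opt_one_cusp[OF I c0 V half_gt_zero[OF W0]]) (use bounds in linarith)
  also have "\<dots> = simplicial_density3" by (rule density_eq[OF W]) (simp_all add: q)
  finally show ?thesis .
qed

lemma density_Y_bar:
  assumes "coxeter_simplex (diagram Y_bar) e"
  shows "delta_opt e = simplicial_density3"
proof -
  interpret coxeter_tetrahedron e "coxeter_matrix (diagram Y_bar)"
    by (rule coxeter_simplex_tetrahedron[OF assms]) (simp add: diagram_defs)
  have gr: "lorentz (e 0) (e 1) = - (1 / 2)" "lorentz (e 0) (e 2) = - 0" "lorentz (e 0) (e 3) = - 0" "lorentz (e 1) (e 0) = - (1 / 2)"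
    "lorentz (e 1) (e 2) = - (q / 2)" "lorentz (e 1) (e 3) = - 0" "lorentz (e 2) (e 0) = - 0" "lorentz (e 2) (e 1) = - (q / 2)"
    "lorentz (e 2) (e 3) = - (1 / 2)" "lorentz (e 3) (e 0) = - 0" "lorentz (e 3) (e 1) = - 0" "lorentz (e 3) (e 2) = - (1 / 2)"
    by (simp_all add: gram coxeter_matrix_def diagram_defs doubleton_eq_iff cos_values)
  have first: "cusp 0 (q / 16) (\<lambda>j. if j = 2 then 4 * q / 3 else if j = 3 then 2 * q / 3 else 2) \<and>
    hyp_vol (hyp_simplex e) = (wedge_volume 0 0 + wedge_volume 0 0 + wedge_volume 0 0 + wedge_volume 0 0 + wedge_volume (1 / 2) q + wedge_volume (1 / 2) 0) / 2"
    by (rule cusp_intro[of 0 2 3 1 "1 / 2" "q / 2" "0" _ _ _ "q / 2" "1 / 2" "1" _ _ _ _ _ _ _ _ _ "0" "0" "0" "0" "1" "1 / 4"]; (fact gr | (simp add: algebra_simps powers; fail) | (simp add: field_simps powers; fail) | (use bounds in linarith)))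
  note c0 = first[THEN conjunct1]
  have n1: "1 \<notin> ideal_vertices e"
    by (rule not_ideal[of 1 0 2 3 "0" "0" "1 / 2" "3 / 4"]; (fact gr | (simp add: algebra_simps powers; fail) | (simp add: field_simps powers; fail) | (use bounds in linarith)))
  have n2: "2 \<notin> ideal_vertices e"
    by (rule not_ideal[of 2 0 1 3 "1 / 2" "0" "0" "3 / 4"]; (fact gr | (simp add: algebra_simps powers; fail) | (simp add: field_simps powers; fail) | (use bounds in linarith)))
  have c3: "cusp 3 (q / 16) (\<lambda>j. if j = 1 then 4 * q / 3 else if j = 0 then 2 * q / 3 else 2)"
    by (rule cusp_intro[of 3 1 0 2 "1 / 2" "q / 2" "0" "0" "0" "1 / 2" "q / 2" "1 / 2" "1" "4 * q / 3" "2 * q / 3" "2" "0" "0" "0" "0" "q" "0" "0" "0" "0" "0" "1" "1 / 4", THEN conjunct1]; (fact gr | (simp add: algebra_simps powers; fail) | (simp add: field_simps powers; fail) | (use bounds in linarith)))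
  define W where "W = wedge_volume (1 / 2) q"
  have V: "hyp_vol (hyp_simplex e) = W / 2" using first by (simp add: W_def)
  have W: "W = 1 * lobachevsky (pi / 3)" by (simp add: W_def wedge_volumes)
  have W0: "W > 0" using lobachevsky_third_pi_pos by (simp add: W)
  have I: "ideal_vertices e = {0, 3}"
    by (rule ideal_vertices_eqI) (use cusp_ideal[OF c0] cusp_ideal[OF c3] n1 n2 in auto)
  have "delta_opt e = (q / 16) * (1 + (1 / 3)) / (W / 2)"
    by (rule delta_opt_two_cusps[OF I _ c0 c3 V half_gt_zero[OF W0], where k = "2 * q / 3"]; (fact gr | (simp add: algebra_simps powers; fail) | (simp add: field_simps powers; fail) | (use bounds in linarith)))
  moreover have "(q / 16) * (1 + (1 / 3)) = (q / 12 :: real)" by ((simp; fail) | (simp add: field_simps powers; fail))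
  ultimately have "delta_opt e = (q / 12) / (W / 2)" by (simp only:)
  also have "\<dots> = simplicial_density3" by (rule density_eq[OF W]) (simp_all add: q)
  finally show ?thesis .
qed

lemma density_Z_bar:
  assumes "coxeter_simplex (diagram Z_bar) e"
  shows "delta_opt e = simplicial_density3"
proof -
  interpret coxeter_tetrahedron e "coxeter_matrix (diagram Z_bar)"
    by (rule coxeter_simplex_tetrahedron[OF assms]) (simp add: diagram_defs)
  have gr: "lorentz (e 0) (e 1) = - (q / 2)" "lorentz (e 0) (e 2) = - 0" "lorentz (e 0) (e 3) = - 0" "lorentz (e 1) (e 0) = - (q / 2)"
    "lorentz (e 1) (e 2) = - (1 / 2)" "lorentz (e 1) (e 3) = - 0" "lorentz (e 2) (e 0) = - 0" "lorentz (e 2) (e 1) = - (1 / 2)"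
    "lorentz (e 2) (e 3) = - (q / 2)" "lorentz (e 3) (e 0) = - 0" "lorentz (e 3) (e 1) = - 0" "lorentz (e 3) (e 2) = - (q / 2)"
    by (simp_all add: gram coxeter_matrix_def diagram_defs doubleton_eq_iff cos_values)
  have first: "cusp 0 (q / 16) (\<lambda>j. if j = 2 then 4 * q / 3 else if j = 1 then 2 * q / 3 else 2) \<and>
    hyp_vol (hyp_simplex e) = (wedge_volume 0 0 + wedge_volume 0 0 + wedge_volume (q / 2) 0 + wedge_volume (q / 2) (q / 3) + wedge_volume 0 0 + wedge_volume 0 0) / 2"
    by (rule cusp_intro[of 0 2 1 3 "1 / 2" "q / 2" "0" _ _ _ "q / 2" "1 / 2" "1" _ _ _ _ _ _ _ _ _ "0" "0" "3 / 4" "1" "0" "0"]; (fact gr | (simp add: algebra_simps powers; fail) | (simp add: field_simps powers; fail) | (use bounds in linarith)))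
  note c0 = first[THEN conjunct1]
  have n1: "1 \<notin> ideal_vertices e"
    by (rule not_ideal[of 1 0 2 3 "0" "0" "q / 2" "1 / 4"]; (fact gr | (simp add: algebra_simps powers; fail) | (simp add: field_simps powers; fail) | (use bounds in linarith)))
  have n2: "2 \<notin> ideal_vertices e"
    by (rule not_ideal[of 2 0 1 3 "q / 2" "0" "0" "1 / 4"]; (fact gr | (simp add: algebra_simps powers; fail) | (simp add: field_simps powers; fail) | (use bounds in linarith)))
  have c3: "cusp 3 (q / 16) (\<lambda>j. if j = 1 then 4 * q / 3 else if j = 2 then 2 * q / 3 else 2)"
    by (rule cusp_intro[of 3 1 2 0 "1 / 2" "q / 2" "0" "0" "q / 2" "0" "q / 2" "1 / 2" "1" "4 * q / 3" "2 * q / 3" "2" "0" "0" "0" "q / 3" "0" "0" "0" "0" "3 / 4" "1" "0" "0", THEN conjunct1]; (fact gr | (simp add: algebra_simps powers; fail) | (simp add: field_simps powers; fail) | (use bounds in linarith)))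
  define W where "W = wedge_volume (q / 2) (q / 3)"
  have V: "hyp_vol (hyp_simplex e) = W / 2" using first by (simp add: W_def)
  have W: "W = 3 / 2 * lobachevsky (pi / 3)" by (simp add: W_def wedge_volumes)
  have W0: "W > 0" using lobachevsky_third_pi_pos by (simp add: W)
  have I: "ideal_vertices e = {0, 3}"
    by (rule ideal_vertices_eqI) (use cusp_ideal[OF c0] cusp_ideal[OF c3] n1 n2 in auto)
  \<comment> \<open>Here \<kappa> = 2: the two horoballs of full size already touch, so both are
    taken at full size.\<close>
  have "delta_opt e = (q / 16) * (1 + 1) / (W / 2)"
    by (rule delta_opt_two_cusps[OF I _ c0 c3 V half_gt_zero[OF W0], where k = "2"]; (fact gr | (simp add: algebra_simps powers; fail) | (simp add: field_simps powers; fail) | (use bounds in linarith)))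
  moreover have "(q / 16) * (1 + 1) = (q / 8 :: real)" by ((simp; fail) | (simp add: field_simps powers; fail))
  ultimately have "delta_opt e = (q / 8) / (W / 2)" by (simp only:)
  also have "\<dots> = simplicial_density3" by (rule density_eq[OF W]) (simp_all add: q)
  finally show ?thesis .
qed

lemma density_BV_bar:
  assumes "coxeter_simplex (diagram BV_bar) e"
  shows "delta_opt e < simplicial_density3"
proof -
  interpret coxeter_tetrahedron e "coxeter_matrix (diagram BV_bar)"
    by (rule coxeter_simplex_tetrahedron[OF assms]) (simp add: diagram_defs)
  have gr: "lorentz (e 0) (e 1) = - (p / 2)" "lorentz (e 0) (e 2) = - 0" "lorentz (e 0) (e 3) = - 0" "lorentz (e 1) (e 0) = - (p / 2)"
    "lorentz (e 1) (e 2) = - (1 / 2)" "lorentz (e 1) (e 3) = - 0" "lorentz (e 2) (e 0) = - 0" "lorentz (e 2) (e 1) = - (1 / 2)"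
    "lorentz (e 2) (e 3) = - (q / 2)" "lorentz (e 3) (e 0) = - 0" "lorentz (e 3) (e 1) = - 0" "lorentz (e 3) (e 2) = - (q / 2)"
    by (simp_all add: gram coxeter_matrix_def diagram_defs doubleton_eq_iff cos_values)
  have first: "cusp 0 (q / 24) (\<lambda>j. if j = 2 then 2 * p else if j = 1 then p else p * q) \<and>
    hyp_vol (hyp_simplex e) = (wedge_volume 0 0 + wedge_volume 0 0 + wedge_volume (p / 2) 0 + wedge_volume (p / 2) (q / 3) + wedge_volume 0 0 + wedge_volume 0 0) / 2"
    by (rule cusp_intro[of 0 2 1 3 "1 / 2" "q / 2" "0" _ _ _ "q / 2" "1 / 2" "1" _ _ _ _ _ _ _ _ _ "0" "0" "1 / 2" "2 / 3" "0" "0"]; (fact gr | (simp add: algebra_simps powers; fail) | (simp add: field_simps powers; fail) | (use bounds in linarith)))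
  note c0 = first[THEN conjunct1]
  have n1: "1 \<notin> ideal_vertices e"
    by (rule not_ideal[of 1 0 2 3 "0" "0" "q / 2" "1 / 4"]; (fact gr | (simp add: algebra_simps powers; fail) | (simp add: field_simps powers; fail) | (use bounds in linarith)))
  have n2: "2 \<notin> ideal_vertices e"
    by (rule not_ideal[of 2 0 1 3 "p / 2" "0" "0" "1 / 2"]; (fact gr | (simp add: algebra_simps powers; fail) | (simp add: field_simps powers; fail) | (use bounds in linarith)))
  have n3: "3 \<notin> ideal_vertices e"
    by (rule not_ideal[of 3 0 1 2 "p / 2" "0" "1 / 2" "1 / 4"]; (fact gr | (simp add: algebra_simps powers; fail) | (simp add: field_simps powers; fail) | (use bounds in linarith)))
  define W where "W = wedge_volume (p / 2) (q / 3)"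
  have V: "hyp_vol (hyp_simplex e) = W / 2" using first by (simp add: W_def)
  \<comment> \<open>The three-term bound at d^2 = 1 / 2 and t^2 = 1 / 3; the constants in the other
    groups arise in the same way.\<close>
  have w0: "373 * q / 3240 \<le> wedge_volume (p / 2) (q / 3)"
    by (rule wedge_volume_ge[of _ "1 / 2" _ "1 / 3" "2 / 3"]; (fact gr | (simp add: algebra_simps powers; fail) | (simp add: field_simps powers; fail) | (use bounds in linarith)))
  have W0: "W > 0" using w0 bounds unfolding W_def by linarith
  have I: "ideal_vertices e = {0}"
    by (rule ideal_vertices_eqI) (use cusp_ideal[OF c0] n1 n2 n3 in auto)
  have "delta_opt e = (q / 24) / (W / 2)"
    by (rule delta_opt_one_cusp[OF I c0 V half_gt_zero[OF W0]]) (use bounds in linarith)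
  also have "\<dots> < simplicial_density3"
  proof (rule density_less_rational)
    show "237 * (q / 24) \<le> 100 * W" using w0 bounds unfolding W_def distrib_left by linarith
    show "(q / 24 :: real) > 0" using bounds by linarith
  qed
  finally show ?thesis .
qed

lemma density_P_bar:
  assumes "coxeter_simplex (diagram P_bar) e"
  shows "delta_opt e = simplicial_density3"
proof -
  interpret coxeter_tetrahedron e "coxeter_matrix (diagram P_bar)"
    by (rule coxeter_simplex_tetrahedron[OF assms]) (simp add: diagram_defs)
  have gr: "lorentz (e 0) (e 1) = - (1 / 2)" "lorentz (e 0) (e 2) = - (1 / 2)" "lorentz (e 0) (e 3) = - (1 / 2)" "lorentz (e 1) (e 0) = - (1 / 2)"
    "lorentz (e 1) (e 2) = - (1 / 2)" "lorentz (e 1) (e 3) = - 0" "lorentz (e 2) (e 0) = - (1 / 2)" "lorentz (e 2) (e 1) = - (1 / 2)"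
    "lorentz (e 2) (e 3) = - 0" "lorentz (e 3) (e 0) = - (1 / 2)" "lorentz (e 3) (e 1) = - 0" "lorentz (e 3) (e 2) = - 0"
    by (simp_all add: gram coxeter_matrix_def diagram_defs doubleton_eq_iff cos_values)
  have n0: "0 \<notin> ideal_vertices e"
    by (rule not_ideal[of 0 1 2 3 "1 / 2" "0" "0" "3 / 4"]; (fact gr | (simp add: algebra_simps powers; fail) | (simp add: field_simps powers; fail) | (use bounds in linarith)))
  have n1: "1 \<notin> ideal_vertices e"
    by (rule not_ideal[of 1 0 2 3 "1 / 2" "1 / 2" "0" "1 / 2"]; (fact gr | (simp add: algebra_simps powers; fail) | (simp add: field_simps powers; fail) | (use bounds in linarith)))
  have n2: "2 \<notin> ideal_vertices e"
    by (rule not_ideal[of 2 0 1 3 "1 / 2" "1 / 2" "0" "1 / 2"]; (fact gr | (simp add: algebra_simps powers; fail) | (simp add: field_simps powers; fail) | (use bounds in linarith)))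
  have first: "cusp 3 (q / 24) (\<lambda>j. if j = 0 then 2 else if j = 1 then 2 else 2) \<and>
    hyp_vol (hyp_simplex e) = (wedge_volume (1 / 2) (q / 3) + wedge_volume (1 / 2) (q / 3) + wedge_volume 0 0 + wedge_volume 0 0 + wedge_volume 0 0 + wedge_volume 0 0) / 2"
    by (rule cusp_intro[of 3 0 1 2 "1 / 2" "1 / 2" "1 / 2" _ _ _ "q / 2" "q / 2" "q / 2" _ _ _ _ _ _ _ _ _ "1 / 3" "1 / 3" "0" "0" "0" "0"]; (fact gr | (simp add: algebra_simps powers; fail) | (simp add: field_simps powers; fail) | (use bounds in linarith)))
  note c3 = first[THEN conjunct1]
  define W where "W = wedge_volume (1 / 2) (q / 3) + wedge_volume (1 / 2) (q / 3)"
  have V: "hyp_vol (hyp_simplex e) = W / 2" using first by (simp add: W_def)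
  have W: "W = 1 / 2 * lobachevsky (pi / 3)" by (simp add: W_def wedge_volumes)
  have W0: "W > 0" using lobachevsky_third_pi_pos by (simp add: W)
  have I: "ideal_vertices e = {3}"
    by (rule ideal_vertices_eqI) (use cusp_ideal[OF c3] n0 n1 n2 in auto)
  have "delta_opt e = (q / 24) / (W / 2)"
    by (rule delta_opt_one_cusp[OF I c3 V half_gt_zero[OF W0]]) (use bounds in linarith)
  also have "\<dots> = simplicial_density3" by (rule density_eq[OF W]) (simp_all add: q)
  finally show ?thesis .
qed

lemma density_BP_bar:
  assumes "coxeter_simplex (diagram BP_bar) e"
  shows "delta_opt e < simplicial_density3"
proof -
  interpret coxeter_tetrahedron e "coxeter_matrix (diagram BP_bar)"
    by (rule coxeter_simplex_tetrahedron[OF assms]) (simp add: diagram_defs)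
  have gr: "lorentz (e 0) (e 1) = - (1 / 2)" "lorentz (e 0) (e 2) = - (1 / 2)" "lorentz (e 0) (e 3) = - (p / 2)" "lorentz (e 1) (e 0) = - (1 / 2)"
    "lorentz (e 1) (e 2) = - (1 / 2)" "lorentz (e 1) (e 3) = - 0" "lorentz (e 2) (e 0) = - (1 / 2)" "lorentz (e 2) (e 1) = - (1 / 2)"
    "lorentz (e 2) (e 3) = - 0" "lorentz (e 3) (e 0) = - (p / 2)" "lorentz (e 3) (e 1) = - 0" "lorentz (e 3) (e 2) = - 0"
    by (simp_all add: gram coxeter_matrix_def diagram_defs doubleton_eq_iff cos_values)
  have n0: "0 \<notin> ideal_vertices e"
    by (rule not_ideal[of 0 1 2 3 "1 / 2" "0" "0" "3 / 4"]; (fact gr | (simp add: algebra_simps powers; fail) | (simp add: field_simps powers; fail) | (use bounds in linarith)))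
  have n1: "1 \<notin> ideal_vertices e"
    by (rule not_ideal[of 1 0 2 3 "1 / 2" "p / 2" "0" "1 / 4"]; (fact gr | (simp add: algebra_simps powers; fail) | (simp add: field_simps powers; fail) | (use bounds in linarith)))
  have n2: "2 \<notin> ideal_vertices e"
    by (rule not_ideal[of 2 0 1 3 "1 / 2" "p / 2" "0" "1 / 4"]; (fact gr | (simp add: algebra_simps powers; fail) | (simp add: field_simps powers; fail) | (use bounds in linarith)))
  have first: "cusp 3 (q / 12) (\<lambda>j. if j = 0 then p else if j = 1 then p else p) \<and>
    hyp_vol (hyp_simplex e) = (wedge_volume (p / 2) (q / 3) + wedge_volume (p / 2) (q / 3) + wedge_volume 0 0 + wedge_volume 0 0 + wedge_volume 0 0 + wedge_volume 0 0) / 2"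
    by (rule cusp_intro[of 3 0 1 2 "1 / 2" "1 / 2" "1 / 2" _ _ _ "q / 2" "q / 2" "q / 2" _ _ _ _ _ _ _ _ _ "2 / 3" "2 / 3" "0" "0" "0" "0"]; (fact gr | (simp add: algebra_simps powers; fail) | (simp add: field_simps powers; fail) | (use bounds in linarith)))
  note c3 = first[THEN conjunct1]
  define W where "W = wedge_volume (p / 2) (q / 3) + wedge_volume (p / 2) (q / 3)"
  have V: "hyp_vol (hyp_simplex e) = W / 2" using first by (simp add: W_def)
  have w0: "373 * q / 3240 \<le> wedge_volume (p / 2) (q / 3)"
    by (rule wedge_volume_ge[of _ "1 / 2" _ "1 / 3" "2 / 3"]; (fact gr | (simp add: algebra_simps powers; fail) | (simp add: field_simps powers; fail) | (use bounds in linarith)))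
  have W0: "W > 0" using w0 bounds unfolding W_def by linarith
  have I: "ideal_vertices e = {3}"
    by (rule ideal_vertices_eqI) (use cusp_ideal[OF c3] n0 n1 n2 in auto)
  have "delta_opt e = (q / 12) / (W / 2)"
    by (rule delta_opt_one_cusp[OF I c3 V half_gt_zero[OF W0]]) (use bounds in linarith)
  also have "\<dots> < simplicial_density3"
  proof (rule density_less_rational)
    show "237 * (q / 12) \<le> 100 * W" using w0 bounds unfolding W_def distrib_left by linarith
    show "(q / 12 :: real) > 0" using bounds by linarith
  qed
  finally show ?thesis .
qed

lemma density_VP_bar:
  assumes "coxeter_simplex (diagram VP_bar) e"
  shows "delta_opt e = simplicial_density3"
proof -
  interpret coxeter_tetrahedron e "coxeter_matrix (diagram VP_bar)"
    by (rule coxeter_simplex_tetrahedron[OF assms]) (simp add: diagram_defs)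
  have gr: "lorentz (e 0) (e 1) = - (1 / 2)" "lorentz (e 0) (e 2) = - (1 / 2)" "lorentz (e 0) (e 3) = - (q / 2)" "lorentz (e 1) (e 0) = - (1 / 2)"
    "lorentz (e 1) (e 2) = - (1 / 2)" "lorentz (e 1) (e 3) = - 0" "lorentz (e 2) (e 0) = - (1 / 2)" "lorentz (e 2) (e 1) = - (1 / 2)"
    "lorentz (e 2) (e 3) = - 0" "lorentz (e 3) (e 0) = - (q / 2)" "lorentz (e 3) (e 1) = - 0" "lorentz (e 3) (e 2) = - 0"
    by (simp_all add: gram coxeter_matrix_def diagram_defs doubleton_eq_iff cos_values)
  have n0: "0 \<notin> ideal_vertices e"
    by (rule not_ideal[of 0 1 2 3 "1 / 2" "0" "0" "3 / 4"]; (fact gr | (simp add: algebra_simps powers; fail) | (simp add: field_simps powers; fail) | (use bounds in linarith)))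
  have first: "cusp 1 (3 * q / 16) (\<lambda>j. if j = 0 then 4 / 3 else if j = 2 then 2 / 3 else 2 * q / 3) \<and>
    hyp_vol (hyp_simplex e) = (wedge_volume (1 / 2) q + wedge_volume (1 / 2) q + wedge_volume (1 / 2) 0 + wedge_volume (1 / 2) q + wedge_volume 0 0 + wedge_volume 0 0) / 2"
    by (rule cusp_intro[of 1 0 2 3 "1 / 2" "q / 2" "0" _ _ _ "q / 2" "1 / 2" "1" _ _ _ _ _ _ _ _ _ "1" "1" "1 / 4" "1" "0" "0"]; (fact gr | (simp add: algebra_simps powers; fail) | (simp add: field_simps powers; fail) | (use bounds in linarith)))
  note c1 = first[THEN conjunct1]
  have c2: "cusp 2 (3 * q / 16) (\<lambda>j. if j = 0 then 4 / 3 else if j = 1 then 2 / 3 else 2 * q / 3)"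
    by (rule cusp_intro[of 2 0 1 3 "1 / 2" "q / 2" "0" "1 / 2" "1 / 2" "0" "q / 2" "1 / 2" "1" "4 / 3" "2 / 3" "2 * q / 3" "q" "q" "0" "q" "0" "0" "1" "1" "1 / 4" "1" "0" "0", THEN conjunct1]; (fact gr | (simp add: algebra_simps powers; fail) | (simp add: field_simps powers; fail) | (use bounds in linarith)))
  have c3: "cusp 3 (q / 8) (\<lambda>j. if j = 0 then 2 * q / 3 else if j = 1 then 2 * q / 3 else 2 * q / 3)"
    by (rule cusp_intro[of 3 0 1 2 "1 / 2" "1 / 2" "1 / 2" "q / 2" "0" "0" "q / 2" "q / 2" "q / 2" "2 * q / 3" "2 * q / 3" "2 * q / 3" "q / 3" "q / 3" "0" "0" "0" "0" "1" "1" "0" "0" "0" "0", THEN conjunct1]; (fact gr | (simp add: algebra_simps powers; fail) | (simp add: field_simps powers; fail) | (use bounds in linarith)))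
  define W where "W = wedge_volume (1 / 2) q + wedge_volume (1 / 2) q + wedge_volume (1 / 2) q"
  have V: "hyp_vol (hyp_simplex e) = W / 2" using first by (simp add: W_def)
  have W: "W = 3 * lobachevsky (pi / 3)" by (simp add: W_def wedge_volumes)
  have W0: "W > 0" using lobachevsky_third_pi_pos by (simp add: W)
  have I: "ideal_vertices e = {1, 2, 3}"
    by (rule ideal_vertices_eqI) (use cusp_ideal[OF c1] cusp_ideal[OF c2] cusp_ideal[OF c3] n0 in auto)
  have "delta_opt e = (q / 4) / (W / 2)"
  proof (rule delta_opt_three_cusps[OF I _ c1 c2 c3 V half_gt_zero[OF W0], where ka = "2 / 3" and kb = "2 * q / 3" and kc = "2 * q / 3"
      and a = "1 / 9" and b = "1 / 3" and c = "1 / 3" and x = "1" and y = "(1 / 9)" and z = "(1 / 3)"])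
    fix x y z :: real
    assume h: "0 < x" "0 < y" "0 < z" "x \<le> 1" "y \<le> 1" "z \<le> 1" "x * y \<le> 1 / 9" "x * z \<le> 1 / 3" "y * z \<le> 1 / 3"
    \<comment> \<open>The weights are 3 : 3 : 2, so the threshold is 1 / 9 + 2 / 9 = 1 / 3. If x and
      y are below it, the sum is at most 1 / 3 + 1 / 3 + 2 / 3 = 4 / 3 for every z.\<close>
    have "x + y + 2 / 3 * z \<le> 1 + (1 / 9 + 2 / 3 * (1 / 3))"
      by (rule sum_three_le[OF h(1-6) _ h(7-9)]) (use h in linarith)+
    then have "3 * q / 16 * (x + y + 2 / 3 * z) \<le> 3 * q / 16 * (1 + (1 / 9 + 2 / 3 * (1 / 3)))"
      using bounds by (intro mult_left_mono) linarith+
    moreover have "3 * q / 16 * x + 3 * q / 16 * y + q / 8 * z = 3 * q / 16 * (x + y + 2 / 3 * z)" by (simp add: field_simps)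
    ultimately show "3 * q / 16 * x + 3 * q / 16 * y + q / 8 * z \<le> q / 4" by simp
  qed (fact gr | (simp add: algebra_simps powers; fail) | (simp add: field_simps powers; fail) | (use bounds in linarith))+
  also have "\<dots> = simplicial_density3" by (rule density_eq[OF W]) (simp_all add: q)
  finally show ?thesis .
qed

lemma density_PP_hat:
  assumes "coxeter_simplex (diagram PP_hat) e"
  shows "delta_opt e = simplicial_density3"
proof -
  interpret coxeter_tetrahedron e "coxeter_matrix (diagram PP_hat)"
    by (rule coxeter_simplex_tetrahedron[OF assms]) (simp add: diagram_defs)
  have gr: "lorentz (e 0) (e 1) = - (1 / 2)" "lorentz (e 0) (e 2) = - (1 / 2)" "lorentz (e 0) (e 3) = - (1 / 2)" "lorentz (e 1) (e 0) = - (1 / 2)"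
    "lorentz (e 1) (e 2) = - (1 / 2)" "lorentz (e 1) (e 3) = - (1 / 2)" "lorentz (e 2) (e 0) = - (1 / 2)" "lorentz (e 2) (e 1) = - (1 / 2)"
    "lorentz (e 2) (e 3) = - (1 / 2)" "lorentz (e 3) (e 0) = - (1 / 2)" "lorentz (e 3) (e 1) = - (1 / 2)" "lorentz (e 3) (e 2) = - (1 / 2)"
    by (simp_all add: gram coxeter_matrix_def diagram_defs doubleton_eq_iff cos_values)
  have first: "cusp 0 (3 * q / 8) (\<lambda>j. if j = 1 then 2 / 3 else if j = 2 then 2 / 3 else 2 / 3) \<and>
    hyp_vol (hyp_simplex e) = (wedge_volume (1 / 2) q + wedge_volume (1 / 2) q + wedge_volume (1 / 2) q + wedge_volume (1 / 2) q + wedge_volume (1 / 2) q + wedge_volume (1 / 2) q) / 2"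
    by (rule cusp_intro[of 0 1 2 3 "1 / 2" "1 / 2" "1 / 2" _ _ _ "q / 2" "q / 2" "q / 2" _ _ _ _ _ _ _ _ _ "1" "1" "1" "1" "1" "1"]; (fact gr | (simp add: algebra_simps powers; fail) | (simp add: field_simps powers; fail) | (use bounds in linarith)))
  note c0 = first[THEN conjunct1]
  have c1: "cusp 1 (3 * q / 8) (\<lambda>j. if j = 0 then 2 / 3 else if j = 2 then 2 / 3 else 2 / 3)"
    by (rule cusp_intro[of 1 0 2 3 "1 / 2" "1 / 2" "1 / 2" "1 / 2" "1 / 2" "1 / 2" "q / 2" "q / 2" "q / 2" "2 / 3" "2 / 3" "2 / 3" "q" "q" "q" "q" "q" "q" "1" "1" "1" "1" "1" "1", THEN conjunct1]; (fact gr | (simp add: algebra_simps powers; fail) | (simp add: field_simps powers; fail) | (use bounds in linarith)))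
  have c2: "cusp 2 (3 * q / 8) (\<lambda>j. if j = 0 then 2 / 3 else if j = 1 then 2 / 3 else 2 / 3)"
    by (rule cusp_intro[of 2 0 1 3 "1 / 2" "1 / 2" "1 / 2" "1 / 2" "1 / 2" "1 / 2" "q / 2" "q / 2" "q / 2" "2 / 3" "2 / 3" "2 / 3" "q" "q" "q" "q" "q" "q" "1" "1" "1" "1" "1" "1", THEN conjunct1]; (fact gr | (simp add: algebra_simps powers; fail) | (simp add: field_simps powers; fail) | (use bounds in linarith)))
  have c3: "cusp 3 (3 * q / 8) (\<lambda>j. if j = 0 then 2 / 3 else if j = 1 then 2 / 3 else 2 / 3)"
    by (rule cusp_intro[of 3 0 1 2 "1 / 2" "1 / 2" "1 / 2" "1 / 2" "1 / 2" "1 / 2" "q / 2" "q / 2" "q / 2" "2 / 3" "2 / 3" "2 / 3" "q" "q" "q" "q" "q" "q" "1" "1" "1" "1" "1" "1", THEN conjunct1]; (fact gr | (simp add: algebra_simps powers; fail) | (simp add: field_simps powers; fail) | (use bounds in linarith)))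
  define W where "W = wedge_volume (1 / 2) q + wedge_volume (1 / 2) q + wedge_volume (1 / 2) q + wedge_volume (1 / 2) q + wedge_volume (1 / 2) q + wedge_volume (1 / 2) q"
  have V: "hyp_vol (hyp_simplex e) = W / 2" using first by (simp add: W_def)
  have W: "W = 6 * lobachevsky (pi / 3)" by (simp add: W_def wedge_volumes)
  have W0: "W > 0" using lobachevsky_third_pi_pos by (simp add: W)
  have I: "ideal_vertices e = {0, 1, 2, 3}"
    by (rule ideal_vertices_eqI) (use cusp_ideal[OF c0] cusp_ideal[OF c1] cusp_ideal[OF c2] cusp_ideal[OF c3]  in auto)
  have "delta_opt e = (3 * q / 8) * (1 + (1 / 9) + (1 / 9) + (1 / 9)) / (W / 2)"
  proof (rule delta_opt_four_cusps[OF I c0 c1 c2 c3 V half_gt_zero[OF W0], where ra = "2 / 3" and rb = "2 / 3" and rc = "2 / 3"])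
    fix x y z u :: real
    assume h: "0 < x" "0 < y" "0 < z" "0 < u" "x \<le> 1" "y \<le> 1" "z \<le> 1" "u \<le> 1"
      "x * y \<le> 1 / 9" "x * z \<le> 1 / 9" "x * u \<le> 1 / 9" "y * z \<le> 1 / 9" "y * u \<le> 1 / 9" "z * u \<le> 1 / 9"
    show "x + y + z + u \<le> 1 + (1 / 9) + (1 / 9) + (1 / 9)"
      \<comment> \<open>The threshold is 1 / 3, and four variables below it add up to less than the
        claimed 4 / 3.\<close>
      by (rule sum_four_le[OF h]) simp
  qed (fact gr | (simp add: algebra_simps powers; fail) | (simp add: field_simps powers; fail) | (use bounds in linarith))+
  moreover have "(3 * q / 8) * (1 + (1 / 9) + (1 / 9) + (1 / 9)) = (q / 2 :: real)" by ((simp; fail) | (simp add: field_simps powers; fail))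
  ultimately have "delta_opt e = (q / 2) / (W / 2)" by (simp only:)
  also have "\<dots> = simplicial_density3" by (rule density_eq[OF W]) (simp_all add: q)
  finally show ?thesis .
qed

lemma density_DV_bar:
  assumes "coxeter_simplex (diagram DV_bar) e"
  shows "delta_opt e = simplicial_density3"
proof -
  interpret coxeter_tetrahedron e "coxeter_matrix (diagram DV_bar)"
    by (rule coxeter_simplex_tetrahedron[OF assms]) (simp add: diagram_defs)
  have gr: "lorentz (e 0) (e 1) = - (q / 2)" "lorentz (e 0) (e 2) = - (1 / 2)" "lorentz (e 0) (e 3) = - (1 / 2)" "lorentz (e 1) (e 0) = - (q / 2)"
    "lorentz (e 1) (e 2) = - 0" "lorentz (e 1) (e 3) = - 0" "lorentz (e 2) (e 0) = - (1 / 2)" "lorentz (e 2) (e 1) = - 0"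
    "lorentz (e 2) (e 3) = - 0" "lorentz (e 3) (e 0) = - (1 / 2)" "lorentz (e 3) (e 1) = - 0" "lorentz (e 3) (e 2) = - 0"
    by (simp_all add: gram coxeter_matrix_def diagram_defs doubleton_eq_iff cos_values)
  have n0: "0 \<notin> ideal_vertices e"
    by (rule not_ideal[of 0 1 2 3 "0" "0" "0" "1"]; (fact gr | (simp add: algebra_simps powers; fail) | (simp add: field_simps powers; fail) | (use bounds in linarith)))
  have n1: "1 \<notin> ideal_vertices e"
    by (rule not_ideal[of 1 0 2 3 "1 / 2" "1 / 2" "0" "1 / 2"]; (fact gr | (simp add: algebra_simps powers; fail) | (simp add: field_simps powers; fail) | (use bounds in linarith)))
  have first: "cusp 2 (q / 12) (\<lambda>j. if j = 0 then 2 else if j = 3 then 1 else q) \<and>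
    hyp_vol (hyp_simplex e) = (wedge_volume (1 / 2) (q / 3) + wedge_volume (1 / 2) q + wedge_volume 0 0 + wedge_volume 0 0 + wedge_volume 0 0 + wedge_volume 0 0) / 2"
    by (rule cusp_intro[of 2 0 3 1 "1 / 2" "q / 2" "0" _ _ _ "q / 2" "1 / 2" "1" _ _ _ _ _ _ _ _ _ "1 / 3" "1" "0" "0" "0" "0"]; (fact gr | (simp add: algebra_simps powers; fail) | (simp add: field_simps powers; fail) | (use bounds in linarith)))
  note c2 = first[THEN conjunct1]
  have c3: "cusp 3 (q / 12) (\<lambda>j. if j = 0 then 2 else if j = 2 then 1 else q)"
    by (rule cusp_intro[of 3 0 2 1 "1 / 2" "q / 2" "0" "1 / 2" "0" "0" "q / 2" "1 / 2" "1" "2" "1" "q" "q / 3" "q" "0" "0" "0" "0" "1 / 3" "1" "0" "0" "0" "0", THEN conjunct1]; (fact gr | (simp add: algebra_simps powers; fail) | (simp add: field_simps powers; fail) | (use bounds in linarith)))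
  define W where "W = wedge_volume (1 / 2) (q / 3) + wedge_volume (1 / 2) q"
  have V: "hyp_vol (hyp_simplex e) = W / 2" using first by (simp add: W_def)
  have W: "W = 5 / 4 * lobachevsky (pi / 3)" by (simp add: W_def wedge_volumes)
  have W0: "W > 0" using lobachevsky_third_pi_pos by (simp add: W)
  have I: "ideal_vertices e = {2, 3}"
    by (rule ideal_vertices_eqI) (use cusp_ideal[OF c2] cusp_ideal[OF c3] n0 n1 in auto)
  have "delta_opt e = (q / 12) * (1 + (1 / 4)) / (W / 2)"
    by (rule delta_opt_two_cusps[OF I _ c2 c3 V half_gt_zero[OF W0], where k = "1"]; (fact gr | (simp add: algebra_simps powers; fail) | (simp add: field_simps powers; fail) | (use bounds in linarith)))
  moreover have "(q / 12) * (1 + (1 / 4)) = (5 * q / 48 :: real)" by ((simp; fail) | (simp add: field_simps powers; fail))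
  ultimately have "delta_opt e = (5 * q / 48) / (W / 2)" by (simp only:)
  also have "\<dots> = simplicial_density3" by (rule density_eq[OF W]) (simp_all add: q)
  finally show ?thesis .
qed

lemma density_DP_bar:
  assumes "coxeter_simplex (diagram DP_bar) e"
  shows "delta_opt e = simplicial_density3"
proof -
  interpret coxeter_tetrahedron e "coxeter_matrix (diagram DP_bar)"
    by (rule coxeter_simplex_tetrahedron[OF assms]) (simp add: diagram_defs)
  have gr: "lorentz (e 0) (e 1) = - (1 / 2)" "lorentz (e 0) (e 2) = - (1 / 2)" "lorentz (e 0) (e 3) = - (1 / 2)" "lorentz (e 1) (e 0) = - (1 / 2)"
    "lorentz (e 1) (e 2) = - (1 / 2)" "lorentz (e 1) (e 3) = - (1 / 2)" "lorentz (e 2) (e 0) = - (1 / 2)" "lorentz (e 2) (e 1) = - (1 / 2)"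
    "lorentz (e 2) (e 3) = - 0" "lorentz (e 3) (e 0) = - (1 / 2)" "lorentz (e 3) (e 1) = - (1 / 2)" "lorentz (e 3) (e 2) = - 0"
    by (simp_all add: gram coxeter_matrix_def diagram_defs doubleton_eq_iff cos_values)
  have n0: "0 \<notin> ideal_vertices e"
    by (rule not_ideal[of 0 1 2 3 "1 / 2" "1 / 2" "0" "1 / 2"]; (fact gr | (simp add: algebra_simps powers; fail) | (simp add: field_simps powers; fail) | (use bounds in linarith)))
  have n1: "1 \<notin> ideal_vertices e"
    by (rule not_ideal[of 1 0 2 3 "1 / 2" "1 / 2" "0" "1 / 2"]; (fact gr | (simp add: algebra_simps powers; fail) | (simp add: field_simps powers; fail) | (use bounds in linarith)))
  have first: "cusp 2 (q / 6) (\<lambda>j. if j = 0 then 1 else if j = 1 then 1 else 1) \<and>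
    hyp_vol (hyp_simplex e) = (wedge_volume (1 / 2) q + wedge_volume (1 / 2) (q / 3) + wedge_volume (1 / 2) (q / 3) + wedge_volume (1 / 2) q + wedge_volume 0 0 + wedge_volume 0 0) / 2"
    by (rule cusp_intro[of 2 0 1 3 "1 / 2" "1 / 2" "1 / 2" _ _ _ "q / 2" "q / 2" "q / 2" _ _ _ _ _ _ _ _ _ "1" "1 / 3" "1 / 3" "1" "0" "0"]; (fact gr | (simp add: algebra_simps powers; fail) | (simp add: field_simps powers; fail) | (use bounds in linarith)))
  note c2 = first[THEN conjunct1]
  have c3: "cusp 3 (q / 6) (\<lambda>j. if j = 0 then 1 else if j = 1 then 1 else 1)"
    by (rule cusp_intro[of 3 0 1 2 "1 / 2" "1 / 2" "1 / 2" "1 / 2" "1 / 2" "0" "q / 2" "q / 2" "q / 2" "1" "1" "1" "q" "q / 3" "q / 3" "q" "0" "0" "1" "1 / 3" "1 / 3" "1" "0" "0", THEN conjunct1]; (fact gr | (simp add: algebra_simps powers; fail) | (simp add: field_simps powers; fail) | (use bounds in linarith)))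
  define W where "W = wedge_volume (1 / 2) q + wedge_volume (1 / 2) (q / 3) + wedge_volume (1 / 2) (q / 3) + wedge_volume (1 / 2) q"
  have V: "hyp_vol (hyp_simplex e) = W / 2" using first by (simp add: W_def)
  have W: "W = 5 / 2 * lobachevsky (pi / 3)" by (simp add: W_def wedge_volumes)
  have W0: "W > 0" using lobachevsky_third_pi_pos by (simp add: W)
  have I: "ideal_vertices e = {2, 3}"
    by (rule ideal_vertices_eqI) (use cusp_ideal[OF c2] cusp_ideal[OF c3] n0 n1 in auto)
  have "delta_opt e = (q / 6) * (1 + (1 / 4)) / (W / 2)"
    by (rule delta_opt_two_cusps[OF I _ c2 c3 V half_gt_zero[OF W0], where k = "1"]; (fact gr | (simp add: algebra_simps powers; fail) | (simp add: field_simps powers; fail) | (use bounds in linarith)))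
  moreover have "(q / 6) * (1 + (1 / 4)) = (5 * q / 24 :: real)" by ((simp; fail) | (simp add: field_simps powers; fail))
  ultimately have "delta_opt e = (5 * q / 24) / (W / 2)" by (simp only:)
  also have "\<dots> = simplicial_density3" by (rule density_eq[OF W]) (simp_all add: q)
  finally show ?thesis .
qed

lemma density_VV_hat:
  assumes "coxeter_simplex (diagram VV_hat) e"
  shows "delta_opt e = simplicial_density3"
proof -
  interpret coxeter_tetrahedron e "coxeter_matrix (diagram VV_hat)"
    by (rule coxeter_simplex_tetrahedron[OF assms]) (simp add: diagram_defs)
  have gr: "lorentz (e 0) (e 1) = - (1 / 2)" "lorentz (e 0) (e 2) = - 0" "lorentz (e 0) (e 3) = - (q / 2)" "lorentz (e 1) (e 0) = - (1 / 2)"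
    "lorentz (e 1) (e 2) = - (q / 2)" "lorentz (e 1) (e 3) = - 0" "lorentz (e 2) (e 0) = - 0" "lorentz (e 2) (e 1) = - (q / 2)"
    "lorentz (e 2) (e 3) = - (1 / 2)" "lorentz (e 3) (e 0) = - (q / 2)" "lorentz (e 3) (e 1) = - 0" "lorentz (e 3) (e 2) = - (1 / 2)"
    by (simp_all add: gram coxeter_matrix_def diagram_defs doubleton_eq_iff cos_values)
  have first: "cusp 0 (q / 4) (\<lambda>j. if j = 2 then 2 * q / 3 else if j = 3 then q / 3 else 1) \<and>
    hyp_vol (hyp_simplex e) = (wedge_volume 0 0 + wedge_volume 0 0 + wedge_volume (q / 2) (q / 3) + wedge_volume (q / 2) (q / 3) + wedge_volume (1 / 2) q + wedge_volume (1 / 2) q) / 2"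
    by (rule cusp_intro[of 0 2 3 1 "1 / 2" "q / 2" "0" _ _ _ "q / 2" "1 / 2" "1" _ _ _ _ _ _ _ _ _ "0" "0" "1" "1" "1" "1"]; (fact gr | (simp add: algebra_simps powers; fail) | (simp add: field_simps powers; fail) | (use bounds in linarith)))
  note c0 = first[THEN conjunct1]
  have c1: "cusp 1 (q / 4) (\<lambda>j. if j = 3 then 2 * q / 3 else if j = 2 then q / 3 else 1)"
    by (rule cusp_intro[of 1 3 2 0 "1 / 2" "q / 2" "0" "0" "q / 2" "1 / 2" "q / 2" "1 / 2" "1" "2 * q / 3" "q / 3" "1" "0" "0" "q / 3" "q / 3" "q" "q" "0" "0" "1" "1" "1" "1", THEN conjunct1]; (fact gr | (simp add: algebra_simps powers; fail) | (simp add: field_simps powers; fail) | (use bounds in linarith)))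
  have c2: "cusp 2 (q / 4) (\<lambda>j. if j = 0 then 2 * q / 3 else if j = 1 then q / 3 else 1)"
    by (rule cusp_intro[of 2 0 1 3 "1 / 2" "q / 2" "0" "0" "q / 2" "1 / 2" "q / 2" "1 / 2" "1" "2 * q / 3" "q / 3" "1" "0" "0" "q / 3" "q / 3" "q" "q" "0" "0" "1" "1" "1" "1", THEN conjunct1]; (fact gr | (simp add: algebra_simps powers; fail) | (simp add: field_simps powers; fail) | (use bounds in linarith)))
  have c3: "cusp 3 (q / 4) (\<lambda>j. if j = 1 then 2 * q / 3 else if j = 0 then q / 3 else 1)"
    by (rule cusp_intro[of 3 1 0 2 "1 / 2" "q / 2" "0" "0" "q / 2" "1 / 2" "q / 2" "1 / 2" "1" "2 * q / 3" "q / 3" "1" "0" "0" "q / 3" "q / 3" "q" "q" "0" "0" "1" "1" "1" "1", THEN conjunct1]; (fact gr | (simp add: algebra_simps powers; fail) | (simp add: field_simps powers; fail) | (use bounds in linarith)))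
  define W where "W = wedge_volume (q / 2) (q / 3) + wedge_volume (q / 2) (q / 3) + wedge_volume (1 / 2) q + wedge_volume (1 / 2) q"
  have V: "hyp_vol (hyp_simplex e) = W / 2" using first by (simp add: W_def)
  have W: "W = 5 * lobachevsky (pi / 3)" by (simp add: W_def wedge_volumes)
  have W0: "W > 0" using lobachevsky_third_pi_pos by (simp add: W)
  have I: "ideal_vertices e = {0, 1, 2, 3}"
    by (rule ideal_vertices_eqI) (use cusp_ideal[OF c0] cusp_ideal[OF c1] cusp_ideal[OF c2] cusp_ideal[OF c3]  in auto)
  have "delta_opt e = (q / 4) * (1 + (1 / 4) + (1 / 3) + (1 / 12)) / (W / 2)"
  proof (rule delta_opt_four_cusps[OF I c0 c1 c2 c3 V half_gt_zero[OF W0], where ra = "1" and rb = "2 * q / 3" and rc = "q / 3"])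
    fix x y z u :: real
    assume h: "0 < x" "0 < y" "0 < z" "0 < u" "x \<le> 1" "y \<le> 1" "z \<le> 1" "u \<le> 1"
      "x * y \<le> 1 / 4" "x * z \<le> 1 / 3" "x * u \<le> 1 / 12" "y * z \<le> 1 / 12" "y * u \<le> 1 / 3" "z * u \<le> 1 / 4"
    show "x + y + z + u \<le> 1 + (1 / 4) + (1 / 3) + (1 / 12)"
    proof (rule sum_four_le[OF h])
      assume "x < 1 / 4 + 1 / 3 + 1 / 12" "y < 1 / 4 + 1 / 3 + 1 / 12" "z < 1 / 4 + 1 / 3 + 1 / 12" "u < 1 / 4 + 1 / 3 + 1 / 12"
      then show "x + y + z + u \<le> 1 + 1 / 4 + 1 / 3 + 1 / 12"
        \<comment> \<open>The threshold is 2 / 3. The pairs with the smallest product bound 1 / 12 =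
          2 / 3 * 1 / 8 have sums at most 2 / 3 + 1 / 8, in total 19 / 12, which is less than 5 /
          3.\<close>
        using sum_le_of_prod_le[of x "2 / 3" u "1 / 8"] sum_le_of_prod_le[of y "2 / 3" z "1 / 8"] h by simp
    qed
  qed (fact gr | (simp add: algebra_simps powers; fail) | (simp add: field_simps powers; fail) | (use bounds in linarith))+
  moreover have "(q / 4) * (1 + (1 / 4) + (1 / 3) + (1 / 12)) = (5 * q / 12 :: real)" by ((simp; fail) | (simp add: field_simps powers; fail))
  ultimately have "delta_opt e = (5 * q / 12) / (W / 2)" by (simp only:)
  also have "\<dots> = simplicial_density3" by (rule density_eq[OF W]) (simp_all add: q)
  finally show ?thesis .
qed

section \<open>Groups commensurable with [3,4,4]\<close>

lemma density_R_bar: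
  assumes "coxeter_simplex (diagram R_bar) e"
  shows "delta_opt e < simplicial_density3"
proof -
  interpret coxeter_tetrahedron e "coxeter_matrix (diagram R_bar)"
    by (rule coxeter_simplex_tetrahedron[OF assms]) (simp add: diagram_defs)
  have gr: "lorentz (e 0) (e 1) = - (1 / 2)" "lorentz (e 0) (e 2) = - 0" "lorentz (e 0) (e 3) = - 0" "lorentz (e 1) (e 0) = - (1 / 2)"
    "lorentz (e 1) (e 2) = - (p / 2)" "lorentz (e 1) (e 3) = - 0" "lorentz (e 2) (e 0) = - 0" "lorentz (e 2) (e 1) = - (p / 2)"
    "lorentz (e 2) (e 3) = - (p / 2)" "lorentz (e 3) (e 0) = - 0" "lorentz (e 3) (e 1) = - 0" "lorentz (e 3) (e 2) = - (p / 2)"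
    by (simp_all add: gram coxeter_matrix_def diagram_defs doubleton_eq_iff cos_values)
  have first: "cusp 0 (1 / 16) (\<lambda>j. if j = 2 then 2 * p else if j = 1 then 2 else 2) \<and>
    hyp_vol (hyp_simplex e) = (wedge_volume 0 0 + wedge_volume 0 0 + wedge_volume (1 / 2) 0 + wedge_volume (1 / 2) 1 + wedge_volume 0 0 + wedge_volume 0 0) / 2"
    by (rule cusp_intro[of 0 2 1 3 "p / 2" "p / 2" "0" _ _ _ "p / 2" "p / 2" "1" _ _ _ _ _ _ _ _ _ "0" "0" "1 / 4" "1 / 2" "0" "0"]; (fact gr | (simp add: algebra_simps powers; fail) | (simp add: field_simps powers; fail) | (use bounds in linarith)))
  note c0 = first[THEN conjunct1]
  have n1: "1 \<notin> ideal_vertices e"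
    by (rule not_ideal[of 1 0 2 3 "0" "0" "p / 2" "1 / 2"]; (fact gr | (simp add: algebra_simps powers; fail) | (simp add: field_simps powers; fail) | (use bounds in linarith)))
  have n2: "2 \<notin> ideal_vertices e"
    by (rule not_ideal[of 2 0 1 3 "1 / 2" "0" "0" "3 / 4"]; (fact gr | (simp add: algebra_simps powers; fail) | (simp add: field_simps powers; fail) | (use bounds in linarith)))
  have n3: "3 \<notin> ideal_vertices e"
    by (rule not_ideal[of 3 0 1 2 "1 / 2" "0" "p / 2" "1 / 4"]; (fact gr | (simp add: algebra_simps powers; fail) | (simp add: field_simps powers; fail) | (use bounds in linarith)))
  define W where "W = wedge_volume (1 / 2) 1"
  have V: "hyp_vol (hyp_simplex e) = W / 2" using first by (simp add: W_def)
  have w0: "217 / 1440 \<le> wedge_volume (1 / 2) 1"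
    by (rule wedge_volume_ge[of _ "1 / 4" _ "1" "1 / 2"]; (fact gr | (simp add: algebra_simps powers; fail) | (simp add: field_simps powers; fail) | (use bounds in linarith)))
  have W0: "W > 0" using w0 bounds unfolding W_def by linarith
  have I: "ideal_vertices e = {0}"
    by (rule ideal_vertices_eqI) (use cusp_ideal[OF c0] n1 n2 n3 in auto)
  have "delta_opt e = (1 / 16) / (W / 2)"
    by (rule delta_opt_one_cusp[OF I c0 V half_gt_zero[OF W0]]) (use bounds in linarith)
  also have "\<dots> < simplicial_density3"
  proof (rule density_less_rational)
    show "237 * (1 / 16) \<le> 100 * W" using w0 bounds unfolding W_def distrib_left by linarith
    show "(1 / 16 :: real) > 0" using bounds by linarith
  qed
  finally show ?thesis .
qed

lemma density_O_bar:
  assumes "coxeter_simplex (diagram O_bar) e"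
  shows "delta_opt e < simplicial_density3"
proof -
  interpret coxeter_tetrahedron e "coxeter_matrix (diagram O_bar)"
    by (rule coxeter_simplex_tetrahedron[OF assms]) (simp add: diagram_defs)
  have gr: "lorentz (e 0) (e 1) = - (1 / 2)" "lorentz (e 0) (e 2) = - (p / 2)" "lorentz (e 0) (e 3) = - (p / 2)" "lorentz (e 1) (e 0) = - (1 / 2)"
    "lorentz (e 1) (e 2) = - 0" "lorentz (e 1) (e 3) = - 0" "lorentz (e 2) (e 0) = - (p / 2)" "lorentz (e 2) (e 1) = - 0"
    "lorentz (e 2) (e 3) = - 0" "lorentz (e 3) (e 0) = - (p / 2)" "lorentz (e 3) (e 1) = - 0" "lorentz (e 3) (e 2) = - 0"
    by (simp_all add: gram coxeter_matrix_def diagram_defs doubleton_eq_iff cos_values)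
  have n0: "0 \<notin> ideal_vertices e"
    by (rule not_ideal[of 0 1 2 3 "0" "0" "0" "1"]; (fact gr | (simp add: algebra_simps powers; fail) | (simp add: field_simps powers; fail) | (use bounds in linarith)))
  have first: "cusp 1 (1 / 8) (\<lambda>j. if j = 0 then 2 else if j = 2 then p else p) \<and>
    hyp_vol (hyp_simplex e) = (wedge_volume (1 / 2) 1 + wedge_volume (1 / 2) 1 + wedge_volume 0 0 + wedge_volume 0 0 + wedge_volume 0 0 + wedge_volume 0 0) / 2"
    by (rule cusp_intro[of 1 0 2 3 "p / 2" "p / 2" "0" _ _ _ "p / 2" "p / 2" "1" _ _ _ _ _ _ _ _ _ "1 / 2" "1 / 2" "0" "0" "0" "0"]; (fact gr | (simp add: algebra_simps powers; fail) | (simp add: field_simps powers; fail) | (use bounds in linarith)))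
  note c1 = first[THEN conjunct1]
  have n2: "2 \<notin> ideal_vertices e"
    by (rule not_ideal[of 2 0 1 3 "1 / 2" "p / 2" "0" "1 / 4"]; (fact gr | (simp add: algebra_simps powers; fail) | (simp add: field_simps powers; fail) | (use bounds in linarith)))
  have n3: "3 \<notin> ideal_vertices e"
    by (rule not_ideal[of 3 0 1 2 "1 / 2" "p / 2" "0" "1 / 4"]; (fact gr | (simp add: algebra_simps powers; fail) | (simp add: field_simps powers; fail) | (use bounds in linarith)))
  define W where "W = wedge_volume (1 / 2) 1 + wedge_volume (1 / 2) 1"
  have V: "hyp_vol (hyp_simplex e) = W / 2" using first by (simp add: W_def)
  have w0: "217 / 1440 \<le> wedge_volume (1 / 2) 1"
    by (rule wedge_volume_ge[of _ "1 / 4" _ "1" "1 / 2"]; (fact gr | (simp add: algebra_simps powers; fail) | (simp add: field_simps powers; fail) | (use bounds in linarith)))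
  have W0: "W > 0" using w0 bounds unfolding W_def by linarith
  have I: "ideal_vertices e = {1}"
    by (rule ideal_vertices_eqI) (use cusp_ideal[OF c1] n0 n2 n3 in auto)
  have "delta_opt e = (1 / 8) / (W / 2)"
    by (rule delta_opt_one_cusp[OF I c1 V half_gt_zero[OF W0]]) (use bounds in linarith)
  also have "\<dots> < simplicial_density3"
  proof (rule density_less_rational)
    show "237 * (1 / 8) \<le> 100 * W" using w0 bounds unfolding W_def distrib_left by linarith
    show "(1 / 8 :: real) > 0" using bounds by linarith
  qed
  finally show ?thesis .
qed

lemma density_BR_hat:
  assumes "coxeter_simplex (diagram BR_hat) e"
  shows "delta_opt e < simplicial_density3"
proof -
  interpret coxeter_tetrahedron e "coxeter_matrix (diagram BR_hat)"
    by (rule coxeter_simplex_tetrahedron[OF assms]) (simp add: diagram_defs)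
  have gr: "lorentz (e 0) (e 1) = - (1 / 2)" "lorentz (e 0) (e 2) = - 0" "lorentz (e 0) (e 3) = - (p / 2)" "lorentz (e 1) (e 0) = - (1 / 2)"
    "lorentz (e 1) (e 2) = - (1 / 2)" "lorentz (e 1) (e 3) = - 0" "lorentz (e 2) (e 0) = - 0" "lorentz (e 2) (e 1) = - (1 / 2)"
    "lorentz (e 2) (e 3) = - (p / 2)" "lorentz (e 3) (e 0) = - (p / 2)" "lorentz (e 3) (e 1) = - 0" "lorentz (e 3) (e 2) = - (p / 2)"
    by (simp_all add: gram coxeter_matrix_def diagram_defs doubleton_eq_iff cos_values)
  have n0: "0 \<notin> ideal_vertices e"
    by (rule not_ideal[of 0 1 2 3 "1 / 2" "0" "p / 2" "1 / 4"]; (fact gr | (simp add: algebra_simps powers; fail) | (simp add: field_simps powers; fail) | (use bounds in linarith)))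
  have first: "cusp 1 (1 / 4) (\<lambda>j. if j = 3 then p else if j = 0 then 1 else 1) \<and>
    hyp_vol (hyp_simplex e) = (wedge_volume 0 0 + wedge_volume 0 0 + wedge_volume (1 / 2) 1 + wedge_volume (1 / 2) 1 + wedge_volume (1 / 2) 1 + wedge_volume (1 / 2) 1) / 2"
    by (rule cusp_intro[of 1 3 0 2 "p / 2" "p / 2" "0" _ _ _ "p / 2" "p / 2" "1" _ _ _ _ _ _ _ _ _ "0" "0" "1 / 2" "1 / 2" "1 / 2" "1 / 2"]; (fact gr | (simp add: algebra_simps powers; fail) | (simp add: field_simps powers; fail) | (use bounds in linarith)))
  note c1 = first[THEN conjunct1]
  have n2: "2 \<notin> ideal_vertices e"
    by (rule not_ideal[of 2 0 1 3 "1 / 2" "p / 2" "0" "1 / 4"]; (fact gr | (simp add: algebra_simps powers; fail) | (simp add: field_simps powers; fail) | (use bounds in linarith)))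
  have n3: "3 \<notin> ideal_vertices e"
    by (rule not_ideal[of 3 0 1 2 "1 / 2" "0" "1 / 2" "1 / 2"]; (fact gr | (simp add: algebra_simps powers; fail) | (simp add: field_simps powers; fail) | (use bounds in linarith)))
  define W where "W = wedge_volume (1 / 2) 1 + wedge_volume (1 / 2) 1 + wedge_volume (1 / 2) 1 + wedge_volume (1 / 2) 1"
  have V: "hyp_vol (hyp_simplex e) = W / 2" using first by (simp add: W_def)
  have w0: "217 / 1440 \<le> wedge_volume (1 / 2) 1"
    by (rule wedge_volume_ge[of _ "1 / 4" _ "1" "1 / 2"]; (fact gr | (simp add: algebra_simps powers; fail) | (simp add: field_simps powers; fail) | (use bounds in linarith)))
  have W0: "W > 0" using w0 bounds unfolding W_def by linarith
  have I: "ideal_vertices e = {1}"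
    by (rule ideal_vertices_eqI) (use cusp_ideal[OF c1] n0 n2 n3 in auto)
  have "delta_opt e = (1 / 4) / (W / 2)"
    by (rule delta_opt_one_cusp[OF I c1 V half_gt_zero[OF W0]]) (use bounds in linarith)
  also have "\<dots> < simplicial_density3"
  proof (rule density_less_rational)
    show "237 * (1 / 4) \<le> 100 * W" using w0 bounds unfolding W_def distrib_left by linarith
    show "(1 / 4 :: real) > 0" using bounds by linarith
  qed
  finally show ?thesis .
qed

lemma density_N_bar:
  assumes "coxeter_simplex (diagram N_bar) e"
  shows "delta_opt e < simplicial_density3"
proof -
  interpret coxeter_tetrahedron e "coxeter_matrix (diagram N_bar)"
    by (rule coxeter_simplex_tetrahedron[OF assms]) (simp add: diagram_defs)
  have gr: "lorentz (e 0) (e 1) = - (p / 2)" "lorentz (e 0) (e 2) = - 0" "lorentz (e 0) (e 3) = - 0" "lorentz (e 1) (e 0) = - (p / 2)"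
    "lorentz (e 1) (e 2) = - (p / 2)" "lorentz (e 1) (e 3) = - 0" "lorentz (e 2) (e 0) = - 0" "lorentz (e 2) (e 1) = - (p / 2)"
    "lorentz (e 2) (e 3) = - (p / 2)" "lorentz (e 3) (e 0) = - 0" "lorentz (e 3) (e 1) = - 0" "lorentz (e 3) (e 2) = - (p / 2)"
    by (simp_all add: gram coxeter_matrix_def diagram_defs doubleton_eq_iff cos_values)
  have first: "cusp 0 (1 / 8) (\<lambda>j. if j = 2 then 2 else if j = 1 then p else p) \<and>
    hyp_vol (hyp_simplex e) = (wedge_volume 0 0 + wedge_volume 0 0 + wedge_volume (p / 2) 0 + wedge_volume (p / 2) 1 + wedge_volume 0 0 + wedge_volume 0 0) / 2"
    by (rule cusp_intro[of 0 2 1 3 "p / 2" "p / 2" "0" _ _ _ "p / 2" "p / 2" "1" _ _ _ _ _ _ _ _ _ "0" "0" "1 / 2" "1" "0" "0"]; (fact gr | (simp add: algebra_simps powers; fail) | (simp add: field_simps powers; fail) | (use bounds in linarith)))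
  note c0 = first[THEN conjunct1]
  have n1: "1 \<notin> ideal_vertices e"
    by (rule not_ideal[of 1 0 2 3 "0" "0" "p / 2" "1 / 2"]; (fact gr | (simp add: algebra_simps powers; fail) | (simp add: field_simps powers; fail) | (use bounds in linarith)))
  have n2: "2 \<notin> ideal_vertices e"
    by (rule not_ideal[of 2 0 1 3 "p / 2" "0" "0" "1 / 2"]; (fact gr | (simp add: algebra_simps powers; fail) | (simp add: field_simps powers; fail) | (use bounds in linarith)))
  have c3: "cusp 3 (1 / 8) (\<lambda>j. if j = 1 then 2 else if j = 0 then p else p)"
    by (rule cusp_intro[of 3 1 0 2 "p / 2" "p / 2" "0" "0" "0" "p / 2" "p / 2" "p / 2" "1" "2" "p" "p" "0" "0" "0" "0" "1" "0" "0" "0" "0" "0" "1" "1 / 2", THEN conjunct1]; (fact gr | (simp add: algebra_simps powers; fail) | (simp add: field_simps powers; fail) | (use bounds in linarith)))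
  define W where "W = wedge_volume (p / 2) 1"
  have V: "hyp_vol (hyp_simplex e) = W / 2" using first by (simp add: W_def)
  \<comment> \<open>This wedge ends in an ideal vertex, where the truncated series gives only about
    0.37. Its value is half of Catalan's constant.\<close>
  have wp: "9 / 20 < wedge_volume (p / 2) 1" using lobachevsky_quarter_pi_lower by (simp add: wedge_volumes)
  have W0: "W > 0" using  wp bounds unfolding W_def by linarith
  have I: "ideal_vertices e = {0, 3}"
    by (rule ideal_vertices_eqI) (use cusp_ideal[OF c0] cusp_ideal[OF c3] n1 n2 in auto)
  have "delta_opt e = (1 / 8) * (1 + (1 / 2)) / (W / 2)"
    by (rule delta_opt_two_cusps[OF I _ c0 c3 V half_gt_zero[OF W0], where k = "p"]; (fact gr | (simp add: algebra_simps powers; fail) | (simp add: field_simps powers; fail) | (use bounds in linarith)))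
  moreover have "(1 / 8) * (1 + (1 / 2)) = (3 / 16 :: real)" by ((simp; fail) | (simp add: field_simps powers; fail))
  ultimately have "delta_opt e = (3 / 16) / (W / 2)" by (simp only:)
  also have "\<dots> < simplicial_density3"
  proof (rule density_less_rational)
    show "237 * (3 / 16) \<le> 100 * W" using  wp bounds unfolding W_def distrib_left by linarith
    show "(3 / 16 :: real) > 0" using bounds by linarith
  qed
  finally show ?thesis .
qed

lemma density_M_bar:
  assumes "coxeter_simplex (diagram M_bar) e"
  shows "delta_opt e < simplicial_density3"
proof -
  interpret coxeter_tetrahedron e "coxeter_matrix (diagram M_bar)"
    by (rule coxeter_simplex_tetrahedron[OF assms]) (simp add: diagram_defs)
  have gr: "lorentz (e 0) (e 1) = - (p / 2)" "lorentz (e 0) (e 2) = - (p / 2)" "lorentz (e 0) (e 3) = - (p / 2)" "lorentz (e 1) (e 0) = - (p / 2)"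
    "lorentz (e 1) (e 2) = - 0" "lorentz (e 1) (e 3) = - 0" "lorentz (e 2) (e 0) = - (p / 2)" "lorentz (e 2) (e 1) = - 0"
    "lorentz (e 2) (e 3) = - 0" "lorentz (e 3) (e 0) = - (p / 2)" "lorentz (e 3) (e 1) = - 0" "lorentz (e 3) (e 2) = - 0"
    by (simp_all add: gram coxeter_matrix_def diagram_defs doubleton_eq_iff cos_values)
  have n0: "0 \<notin> ideal_vertices e"
    by (rule not_ideal[of 0 1 2 3 "0" "0" "0" "1"]; (fact gr | (simp add: algebra_simps powers; fail) | (simp add: field_simps powers; fail) | (use bounds in linarith)))
  have first: "cusp 1 (1 / 4) (\<lambda>j. if j = 0 then p else if j = 2 then 1 else 1) \<and>
    hyp_vol (hyp_simplex e) = (wedge_volume (p / 2) 1 + wedge_volume (p / 2) 1 + wedge_volume 0 0 + wedge_volume 0 0 + wedge_volume 0 0 + wedge_volume 0 0) / 2"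
    by (rule cusp_intro[of 1 0 2 3 "p / 2" "p / 2" "0" _ _ _ "p / 2" "p / 2" "1" _ _ _ _ _ _ _ _ _ "1" "1" "0" "0" "0" "0"]; (fact gr | (simp add: algebra_simps powers; fail) | (simp add: field_simps powers; fail) | (use bounds in linarith)))
  note c1 = first[THEN conjunct1]
  have c2: "cusp 2 (1 / 4) (\<lambda>j. if j = 0 then p else if j = 1 then 1 else 1)"
    by (rule cusp_intro[of 2 0 1 3 "p / 2" "p / 2" "0" "p / 2" "0" "0" "p / 2" "p / 2" "1" "p" "1" "1" "1" "1" "0" "0" "0" "0" "1" "1" "0" "0" "0" "0", THEN conjunct1]; (fact gr | (simp add: algebra_simps powers; fail) | (simp add: field_simps powers; fail) | (use bounds in linarith)))
  have c3: "cusp 3 (1 / 4) (\<lambda>j. if j = 0 then p else if j = 1 then 1 else 1)"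
    by (rule cusp_intro[of 3 0 1 2 "p / 2" "p / 2" "0" "p / 2" "0" "0" "p / 2" "p / 2" "1" "p" "1" "1" "1" "1" "0" "0" "0" "0" "1" "1" "0" "0" "0" "0", THEN conjunct1]; (fact gr | (simp add: algebra_simps powers; fail) | (simp add: field_simps powers; fail) | (use bounds in linarith)))
  define W where "W = wedge_volume (p / 2) 1 + wedge_volume (p / 2) 1"
  have V: "hyp_vol (hyp_simplex e) = W / 2" using first by (simp add: W_def)
  have wp: "9 / 20 < wedge_volume (p / 2) 1" using lobachevsky_quarter_pi_lower by (simp add: wedge_volumes)
  have W0: "W > 0" using  wp bounds unfolding W_def by linarith
  have I: "ideal_vertices e = {1, 2, 3}"
    by (rule ideal_vertices_eqI) (use cusp_ideal[OF c1] cusp_ideal[OF c2] cusp_ideal[OF c3] n0 in auto)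
  have "delta_opt e = (3 / 8) / (W / 2)"
  proof (rule delta_opt_three_cusps[OF I _ c1 c2 c3 V half_gt_zero[OF W0], where ka = "1" and kb = "1" and kc = "1"
      and a = "1 / 4" and b = "1 / 4" and c = "1 / 4" and x = "1" and y = "(1 / 4)" and z = "(1 / 4)"])
    fix x y z :: real
    assume h: "0 < x" "0 < y" "0 < z" "x \<le> 1" "y \<le> 1" "z \<le> 1" "x * y \<le> 1 / 4" "x * z \<le> 1 / 4" "y * z \<le> 1 / 4"
    have "x + y + 1 * z \<le> 1 + (1 / 4 + 1 * (1 / 4))"
    proof (rule sum_three_le[OF h(1-6) _ h(7-9)])
      \<comment> \<open>All weights are equal here, so the third variable can play the dominant part
        as well.\<close>
      assume "1 / 4 + 1 * (1 / 4) \<le> z"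
      then show "x + y + 1 * z \<le> 1 + (1 / 4 + 1 * (1 / 4))"
        using sum_le_of_dominant[of "1 / 2" z "x + y"] h by (simp add: distrib_left mult.commute[of z])
    qed simp_all
    then show "1 / 4 * x + 1 / 4 * y + 1 / 4 * z \<le> 3 / 8" by simp
  qed (fact gr | (simp add: algebra_simps powers; fail) | (simp add: field_simps powers; fail) | (use bounds in linarith))+
  also have "\<dots> < simplicial_density3"
  proof (rule density_less_rational)
    show "237 * (3 / 8) \<le> 100 * W" using  wp bounds unfolding W_def distrib_left by linarith
    show "(3 / 8 :: real) > 0" using bounds by linarith
  qed
  finally show ?thesis .
qed

lemma density_RR_hat:
  assumes "coxeter_simplex (diagram RR_hat) e"
  shows "delta_opt e < simplicial_density3"
proof -
  interpret coxeter_tetrahedron e "coxeter_matrix (diagram RR_hat)"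
    by (rule coxeter_simplex_tetrahedron[OF assms]) (simp add: diagram_defs)
  have gr: "lorentz (e 0) (e 1) = - (p / 2)" "lorentz (e 0) (e 2) = - 0" "lorentz (e 0) (e 3) = - (p / 2)" "lorentz (e 1) (e 0) = - (p / 2)"
    "lorentz (e 1) (e 2) = - (p / 2)" "lorentz (e 1) (e 3) = - 0" "lorentz (e 2) (e 0) = - 0" "lorentz (e 2) (e 1) = - (p / 2)"
    "lorentz (e 2) (e 3) = - (p / 2)" "lorentz (e 3) (e 0) = - (p / 2)" "lorentz (e 3) (e 1) = - 0" "lorentz (e 3) (e 2) = - (p / 2)"
    by (simp_all add: gram coxeter_matrix_def diagram_defs doubleton_eq_iff cos_values)
  have first: "cusp 0 (1 / 2) (\<lambda>j. if j = 2 then 1 else if j = 1 then p / 2 else p / 2) \<and>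
    hyp_vol (hyp_simplex e) = (wedge_volume 0 0 + wedge_volume 0 0 + wedge_volume (p / 2) 1 + wedge_volume (p / 2) 1 + wedge_volume (p / 2) 1 + wedge_volume (p / 2) 1) / 2"
    by (rule cusp_intro[of 0 2 1 3 "p / 2" "p / 2" "0" _ _ _ "p / 2" "p / 2" "1" _ _ _ _ _ _ _ _ _ "0" "0" "1" "1" "1" "1"]; (fact gr | (simp add: algebra_simps powers; fail) | (simp add: field_simps powers; fail) | (use bounds in linarith)))
  note c0 = first[THEN conjunct1]
  have c1: "cusp 1 (1 / 2) (\<lambda>j. if j = 3 then 1 else if j = 0 then p / 2 else p / 2)"
    by (rule cusp_intro[of 1 3 0 2 "p / 2" "p / 2" "0" "0" "p / 2" "p / 2" "p / 2" "p / 2" "1" "1" "p / 2" "p / 2" "0" "0" "1" "1" "1" "1" "0" "0" "1" "1" "1" "1", THEN conjunct1]; (fact gr | (simp add: algebra_simps powers; fail) | (simp add: field_simps powers; fail) | (use bounds in linarith)))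
  have c2: "cusp 2 (1 / 2) (\<lambda>j. if j = 0 then 1 else if j = 1 then p / 2 else p / 2)"
    by (rule cusp_intro[of 2 0 1 3 "p / 2" "p / 2" "0" "0" "p / 2" "p / 2" "p / 2" "p / 2" "1" "1" "p / 2" "p / 2" "0" "0" "1" "1" "1" "1" "0" "0" "1" "1" "1" "1", THEN conjunct1]; (fact gr | (simp add: algebra_simps powers; fail) | (simp add: field_simps powers; fail) | (use bounds in linarith)))
  have c3: "cusp 3 (1 / 2) (\<lambda>j. if j = 1 then 1 else if j = 0 then p / 2 else p / 2)"
    by (rule cusp_intro[of 3 1 0 2 "p / 2" "p / 2" "0" "0" "p / 2" "p / 2" "p / 2" "p / 2" "1" "1" "p / 2" "p / 2" "0" "0" "1" "1" "1" "1" "0" "0" "1" "1" "1" "1", THEN conjunct1]; (fact gr | (simp add: algebra_simps powers; fail) | (simp add: field_simps powers; fail) | (use bounds in linarith)))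
  define W where "W = wedge_volume (p / 2) 1 + wedge_volume (p / 2) 1 + wedge_volume (p / 2) 1 + wedge_volume (p / 2) 1"
  have V: "hyp_vol (hyp_simplex e) = W / 2" using first by (simp add: W_def)
  have wp: "9 / 20 < wedge_volume (p / 2) 1" using lobachevsky_quarter_pi_lower by (simp add: wedge_volumes)
  have W0: "W > 0" using  wp bounds unfolding W_def by linarith
  have I: "ideal_vertices e = {0, 1, 2, 3}"
    by (rule ideal_vertices_eqI) (use cusp_ideal[OF c0] cusp_ideal[OF c1] cusp_ideal[OF c2] cusp_ideal[OF c3]  in auto)
  have "delta_opt e = (1 / 2) * (1 + (1 / 8) + (1 / 4) + (1 / 8)) / (W / 2)"
  proof (rule delta_opt_four_cusps[OF I c0 c1 c2 c3 V half_gt_zero[OF W0], where ra = "p / 2" and rb = "1" and rc = "p / 2"])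
    fix x y z u :: real
    assume h: "0 < x" "0 < y" "0 < z" "0 < u" "x \<le> 1" "y \<le> 1" "z \<le> 1" "u \<le> 1"
      "x * y \<le> 1 / 8" "x * z \<le> 1 / 4" "x * u \<le> 1 / 8" "y * z \<le> 1 / 8" "y * u \<le> 1 / 4" "z * u \<le> 1 / 8"
    show "x + y + z + u \<le> 1 + (1 / 8) + (1 / 4) + (1 / 8)"
    proof (rule sum_four_le[OF h])
      assume "x < 1 / 8 + 1 / 4 + 1 / 8" "y < 1 / 8 + 1 / 4 + 1 / 8" "z < 1 / 8 + 1 / 4 + 1 / 8" "u < 1 / 8 + 1 / 4 + 1 / 8"
      then show "x + y + z + u \<le> 1 + 1 / 8 + 1 / 4 + 1 / 8"
        \<comment> \<open>The threshold is 1 / 2, and 1 / 8 = 1 / 2 * 1 / 4 bounds each of two pairs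
          by 3 / 4; together they give 3 / 2, exactly the claim.\<close>
        using sum_le_of_prod_le[of x "1 / 2" y "1 / 4"] sum_le_of_prod_le[of z "1 / 2" u "1 / 4"] h by simp
    qed
  qed (fact gr | (simp add: algebra_simps powers; fail) | (simp add: field_simps powers; fail) | (use bounds in linarith))+
  moreover have "(1 / 2) * (1 + (1 / 8) + (1 / 4) + (1 / 8)) = (3 / 4 :: real)" by ((simp; fail) | (simp add: field_simps powers; fail))
  ultimately have "delta_opt e = (3 / 4) / (W / 2)" by (simp only:)
  also have "\<dots> < simplicial_density3"
  proof (rule density_less_rational)
    show "237 * (3 / 4) \<le> 100 * W" using  wp bounds unfolding W_def distrib_left by linarith
    show "(3 / 4 :: real) > 0" using bounds by linarith
  qed
  finally show ?thesis .
qed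

section \<open>Nonarithmetic groups\<close>

lemma density_HV_bar:
  assumes "coxeter_simplex (diagram HV_bar) e"
  shows "delta_opt e < simplicial_density3"
proof -
  interpret coxeter_tetrahedron e "coxeter_matrix (diagram HV_bar)"
    by (rule coxeter_simplex_tetrahedron[OF assms]) (simp add: diagram_defs)
  have gr: "lorentz (e 0) (e 1) = - g" "lorentz (e 0) (e 2) = - 0" "lorentz (e 0) (e 3) = - 0" "lorentz (e 1) (e 0) = - g"
    "lorentz (e 1) (e 2) = - (1 / 2)" "lorentz (e 1) (e 3) = - 0" "lorentz (e 2) (e 0) = - 0" "lorentz (e 2) (e 1) = - (1 / 2)"
    "lorentz (e 2) (e 3) = - (q / 2)" "lorentz (e 3) (e 0) = - 0" "lorentz (e 3) (e 1) = - 0" "lorentz (e 3) (e 2) = - (q / 2)"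
    by (simp_all add: gram coxeter_matrix_def diagram_defs doubleton_eq_iff cos_values)
  have first: "cusp 0 (q / 48 + g * q / 24) (\<lambda>j. if j = 2 then - (4) + 8 * g else if j = 1 then - (2) + 4 * g else - (2 * q) + 4 * (g * q)) \<and>
    hyp_vol (hyp_simplex e) = (wedge_volume 0 0 + wedge_volume 0 0 + wedge_volume g 0 + wedge_volume g (q / 3) + wedge_volume 0 0 + wedge_volume 0 0) / 2"
    by (rule cusp_intro[of 0 2 1 3 "1 / 2" "q / 2" "0" _ _ _ "q / 2" "1 / 2" "1" _ _ _ _ _ _ _ _ _ "0" "0" "1 / 4 + g / 2" "1 / 3 + 2 * g / 3" "0" "0"]; (fact gr | (simp add: algebra_simps powers; fail) | (simp add: field_simps powers; fail) | (use bounds in linarith)))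
  note c0 = first[THEN conjunct1]
  have n1: "1 \<notin> ideal_vertices e"
    by (rule not_ideal[of 1 0 2 3 "0" "0" "q / 2" "1 / 4"]; (fact gr | (simp add: algebra_simps powers; fail) | (simp add: field_simps powers; fail) | (use bounds in linarith)))
  have n2: "2 \<notin> ideal_vertices e"
    by (rule not_ideal[of 2 0 1 3 "g" "0" "0" "3 / 4 - g / 2"]; (fact gr | (simp add: algebra_simps powers; fail) | (simp add: field_simps powers; fail) | (use bounds in linarith)))
  have n3: "3 \<notin> ideal_vertices e"
    by (rule not_ideal[of 3 0 1 2 "g" "0" "1 / 2" "1 / 2 - g / 2"]; (fact gr | (simp add: algebra_simps powers; fail) | (simp add: field_simps powers; fail) | (use bounds in linarith)))
  define W where "W = wedge_volume g (q / 3)"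
  have V: "hyp_vol (hyp_simplex e) = W / 2" using first by (simp add: W_def)
  have w0: "19 * q / 324 + 877 * (g * q) / 6480 \<le> wedge_volume g (q / 3)"
    by (rule wedge_volume_ge[of _ "1 / 4 + g / 2" _ "1 / 3" "1 / 3 + 2 * g / 3"]; (fact gr | (simp add: algebra_simps powers; fail) | (simp add: field_simps powers; fail) | (use bounds in linarith)))
  have W0: "W > 0" using w0 bounds unfolding W_def by linarith
  have I: "ideal_vertices e = {0}"
    by (rule ideal_vertices_eqI) (use cusp_ideal[OF c0] n1 n2 n3 in auto)
  have "delta_opt e = (q / 48 + g * q / 24) / (W / 2)"
    by (rule delta_opt_one_cusp[OF I c0 V half_gt_zero[OF W0]]) (use bounds in linarith)
  also have "\<dots> < simplicial_density3"
  proof (rule density_less_rational)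
    show "237 * (q / 48 + g * q / 24) \<le> 100 * W" using w0 bounds unfolding W_def distrib_left by linarith
    show "(q / 48 + g * q / 24 :: real) > 0" using bounds by linarith
  qed
  finally show ?thesis .
qed

lemma density_HP_bar:
  assumes "coxeter_simplex (diagram HP_bar) e"
  shows "delta_opt e < simplicial_density3"
proof -
  interpret coxeter_tetrahedron e "coxeter_matrix (diagram HP_bar)"
    by (rule coxeter_simplex_tetrahedron[OF assms]) (simp add: diagram_defs)
  have gr: "lorentz (e 0) (e 1) = - (1 / 2)" "lorentz (e 0) (e 2) = - (1 / 2)" "lorentz (e 0) (e 3) = - g" "lorentz (e 1) (e 0) = - (1 / 2)"
    "lorentz (e 1) (e 2) = - (1 / 2)" "lorentz (e 1) (e 3) = - 0" "lorentz (e 2) (e 0) = - (1 / 2)" "lorentz (e 2) (e 1) = - (1 / 2)"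
    "lorentz (e 2) (e 3) = - 0" "lorentz (e 3) (e 0) = - g" "lorentz (e 3) (e 1) = - 0" "lorentz (e 3) (e 2) = - 0"
    by (simp_all add: gram coxeter_matrix_def diagram_defs doubleton_eq_iff cos_values)
  have n0: "0 \<notin> ideal_vertices e"
    by (rule not_ideal[of 0 1 2 3 "1 / 2" "0" "0" "3 / 4"]; (fact gr | (simp add: algebra_simps powers; fail) | (simp add: field_simps powers; fail) | (use bounds in linarith)))
  have n1: "1 \<notin> ideal_vertices e"
    by (rule not_ideal[of 1 0 2 3 "1 / 2" "g" "0" "1 / 2 - g / 2"]; (fact gr | (simp add: algebra_simps powers; fail) | (simp add: field_simps powers; fail) | (use bounds in linarith)))
  have n2: "2 \<notin> ideal_vertices e"
    by (rule not_ideal[of 2 0 1 3 "1 / 2" "g" "0" "1 / 2 - g / 2"]; (fact gr | (simp add: algebra_simps powers; fail) | (simp add: field_simps powers; fail) | (use bounds in linarith)))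
  have first: "cusp 3 (q / 24 + g * q / 12) (\<lambda>j. if j = 0 then - (2) + 4 * g else if j = 1 then - (2) + 4 * g else - (2) + 4 * g) \<and>
    hyp_vol (hyp_simplex e) = (wedge_volume g (q / 3) + wedge_volume g (q / 3) + wedge_volume 0 0 + wedge_volume 0 0 + wedge_volume 0 0 + wedge_volume 0 0) / 2"
    by (rule cusp_intro[of 3 0 1 2 "1 / 2" "1 / 2" "1 / 2" _ _ _ "q / 2" "q / 2" "q / 2" _ _ _ _ _ _ _ _ _ "1 / 3 + 2 * g / 3" "1 / 3 + 2 * g / 3" "0" "0" "0" "0"]; (fact gr | (simp add: algebra_simps powers; fail) | (simp add: field_simps powers; fail) | (use bounds in linarith)))
  note c3 = first[THEN conjunct1]
  define W where "W = wedge_volume g (q / 3) + wedge_volume g (q / 3)"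
  have V: "hyp_vol (hyp_simplex e) = W / 2" using first by (simp add: W_def)
  have w0: "19 * q / 324 + 877 * (g * q) / 6480 \<le> wedge_volume g (q / 3)"
    by (rule wedge_volume_ge[of _ "1 / 4 + g / 2" _ "1 / 3" "1 / 3 + 2 * g / 3"]; (fact gr | (simp add: algebra_simps powers; fail) | (simp add: field_simps powers; fail) | (use bounds in linarith)))
  have W0: "W > 0" using w0 bounds unfolding W_def by linarith
  have I: "ideal_vertices e = {3}"
    by (rule ideal_vertices_eqI) (use cusp_ideal[OF c3] n0 n1 n2 in auto)
  have "delta_opt e = (q / 24 + g * q / 12) / (W / 2)"
    by (rule delta_opt_one_cusp[OF I c3 V half_gt_zero[OF W0]]) (use bounds in linarith)
  also have "\<dots> < simplicial_density3"
  proof (rule density_less_rational)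
    show "237 * (q / 24 + g * q / 12) \<le> 100 * W" using w0 bounds unfolding W_def distrib_left by linarith
    show "(q / 24 + g * q / 12 :: real) > 0" using bounds by linarith
  qed
  finally show ?thesis .
qed

lemma density_AV_hat:
  assumes "coxeter_simplex (diagram AV_hat) e"
  shows "delta_opt e < simplicial_density3"
proof -
  interpret coxeter_tetrahedron e "coxeter_matrix (diagram AV_hat)"
    by (rule coxeter_simplex_tetrahedron[OF assms]) (simp add: diagram_defs)
  have gr: "lorentz (e 0) (e 1) = - (1 / 2)" "lorentz (e 0) (e 2) = - 0" "lorentz (e 0) (e 3) = - (q / 2)" "lorentz (e 1) (e 0) = - (1 / 2)"
    "lorentz (e 1) (e 2) = - (1 / 2)" "lorentz (e 1) (e 3) = - 0" "lorentz (e 2) (e 0) = - 0" "lorentz (e 2) (e 1) = - (1 / 2)"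
    "lorentz (e 2) (e 3) = - (1 / 2)" "lorentz (e 3) (e 0) = - (q / 2)" "lorentz (e 3) (e 1) = - 0" "lorentz (e 3) (e 2) = - (1 / 2)"
    by (simp_all add: gram coxeter_matrix_def diagram_defs doubleton_eq_iff cos_values)
  have n0: "0 \<notin> ideal_vertices e"
    by (rule not_ideal[of 0 1 2 3 "1 / 2" "0" "1 / 2" "1 / 2"]; (fact gr | (simp add: algebra_simps powers; fail) | (simp add: field_simps powers; fail) | (use bounds in linarith)))
  have first: "cusp 1 (1 / 8 + q / 12) (\<lambda>j. if j = 3 then - (2) + 2 * q else if j = 2 then - (1) + q else 3 - q) \<and>
    hyp_vol (hyp_simplex e) = (wedge_volume 0 0 + wedge_volume 0 0 + wedge_volume (1 / 2) 1 + wedge_volume (1 / 2) (q / 3) + wedge_volume (1 / 2) q + wedge_volume (1 / 2) 1) / 2"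
    by (rule cusp_intro[of 1 3 2 0 "1 / 2" "q / 2" "0" _ _ _ "q / 2" "1 / 2" "1" _ _ _ _ _ _ _ _ _ "0" "0" "1 / 2" "1 / 3" "1" "1 / 2"]; (fact gr | (simp add: algebra_simps powers; fail) | (simp add: field_simps powers; fail) | (use bounds in linarith)))
  note c1 = first[THEN conjunct1]
  have c2: "cusp 2 (1 / 8 + q / 12) (\<lambda>j. if j = 0 then - (2) + 2 * q else if j = 1 then - (1) + q else 3 - q)"
    by (rule cusp_intro[of 2 0 1 3 "1 / 2" "q / 2" "0" "0" "1 / 2" "1 / 2" "q / 2" "1 / 2" "1" "- (2) + 2 * q" "- (1) + q" "3 - q" "0" "0" "1" "q / 3" "q" "1" "0" "0" "1 / 2" "1 / 3" "1" "1 / 2", THEN conjunct1]; (fact gr | (simp add: algebra_simps powers; fail) | (simp add: field_simps powers; fail) | (use bounds in linarith)))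
  have n3: "3 \<notin> ideal_vertices e"
    by (rule not_ideal[of 3 0 1 2 "1 / 2" "0" "1 / 2" "1 / 2"]; (fact gr | (simp add: algebra_simps powers; fail) | (simp add: field_simps powers; fail) | (use bounds in linarith)))
  define W where "W = wedge_volume (1 / 2) 1 + wedge_volume (1 / 2) (q / 3) + wedge_volume (1 / 2) q + wedge_volume (1 / 2) 1"
  have V: "hyp_vol (hyp_simplex e) = W / 2" using first by (simp add: W_def)
  have w0: "217 / 1440 \<le> wedge_volume (1 / 2) 1"
    by (rule wedge_volume_ge[of _ "1 / 4" _ "1" "1 / 2"]; (fact gr | (simp add: algebra_simps powers; fail) | (simp add: field_simps powers; fail) | (use bounds in linarith)))
  have wl: "wedge_volume (1 / 2) (q / 3) = lobachevsky (pi / 3) / 4" "wedge_volume (1 / 2) q = lobachevsky (pi / 3)"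
    by (simp_all add: wedge_volumes)
  have W0: "W > 0" using w0 wl lobachevsky_third_pi_pos bounds unfolding W_def by linarith
  have I: "ideal_vertices e = {1, 2}"
    by (rule ideal_vertices_eqI) (use cusp_ideal[OF c1] cusp_ideal[OF c2] n0 n3 in auto)
  have "delta_opt e = (1 / 8 + q / 12) * (1 + (1 - q / 2)) / (W / 2)"
    by (rule delta_opt_two_cusps[OF I _ c1 c2 V half_gt_zero[OF W0], where k = "- (1) + q"]; (fact gr | (simp add: algebra_simps powers; fail) | (simp add: field_simps powers; fail) | (use bounds in linarith)))
  moreover have "(1 / 8 + q / 12) * (1 + (1 - q / 2)) = (1 / 8 + 5 * q / 48 :: real)" by ((simp; fail) | (simp add: field_simps powers; fail))
  ultimately have "delta_opt e = (1 / 8 + 5 * q / 48) / (W / 2)" by (simp only:)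
  also have "\<dots> < simplicial_density3"
  proof (rule density_less)
    \<comment> \<open>The exact wedges contribute 5 / 4 of the Lobachevsky value to
      \<open>W\<close>, and this equals 3 times the L-value times 5 q / 48. These terms cancel,
      leaving 3 / 8 of the L-value against the two estimated wedges.\<close>
    have "dirichlet_L chi_minus3 2 * (3 / 8) \<le> 79 / 100 * (3 / 8)"
      using dirichlet_L_bounds bounds by (intro mult_right_mono) linarith+
    also have "\<dots> < W - 5 / 4 * lobachevsky (pi / 3)" using w0 wl bounds unfolding W_def distrib_left right_diff_distrib by linarith
    finally show "3 * (dirichlet_L chi_minus3 2 * (1 / 8 + 5 * q / 48)) < W" by (simp add: lobachevsky_third_pi_eq q algebra_simps)
  qed (use W0 in simp)
  finally show ?thesis .
qed

lemma density_BV_hat: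
  assumes "coxeter_simplex (diagram BV_hat) e"
  shows "delta_opt e < simplicial_density3"
proof -
  interpret coxeter_tetrahedron e "coxeter_matrix (diagram BV_hat)"
    by (rule coxeter_simplex_tetrahedron[OF assms]) (simp add: diagram_defs)
  have gr: "lorentz (e 0) (e 1) = - (1 / 2)" "lorentz (e 0) (e 2) = - 0" "lorentz (e 0) (e 3) = - (q / 2)" "lorentz (e 1) (e 0) = - (1 / 2)"
    "lorentz (e 1) (e 2) = - (p / 2)" "lorentz (e 1) (e 3) = - 0" "lorentz (e 2) (e 0) = - 0" "lorentz (e 2) (e 1) = - (p / 2)"
    "lorentz (e 2) (e 3) = - (1 / 2)" "lorentz (e 3) (e 0) = - (q / 2)" "lorentz (e 3) (e 1) = - 0" "lorentz (e 3) (e 2) = - (1 / 2)"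
    by (simp_all add: gram coxeter_matrix_def diagram_defs doubleton_eq_iff cos_values)
  have n0: "0 \<notin> ideal_vertices e"
    by (rule not_ideal[of 0 1 2 3 "p / 2" "0" "1 / 2" "1 / 4"]; (fact gr | (simp add: algebra_simps powers; fail) | (simp add: field_simps powers; fail) | (use bounds in linarith)))
  have first: "cusp 1 (5 * q / 48 + p / 8) (\<lambda>j. if j = 3 then 4 * q - 4 * p else if j = 2 then 2 * q - 2 * p else 6 - 2 * (p * q)) \<and>
    hyp_vol (hyp_simplex e) = (wedge_volume 0 0 + wedge_volume 0 0 + wedge_volume (p / 2) (p / 2) + wedge_volume (p / 2) (q / 3) + wedge_volume (1 / 2) q + wedge_volume (1 / 2) p) / 2"
    by (rule cusp_intro[of 1 3 2 0 "1 / 2" "q / 2" "0" _ _ _ "q / 2" "1 / 2" "1" _ _ _ _ _ _ _ _ _ "0" "0" "3 / 4" "2 / 3" "1" "3 / 4"]; (fact gr | (simp add: algebra_simps powers; fail) | (simp add: field_simps powers; fail) | (use bounds in linarith)))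
  note c1 = first[THEN conjunct1]
  have c2: "cusp 2 (5 * q / 48 + p / 8) (\<lambda>j. if j = 0 then 4 * q - 4 * p else if j = 1 then 2 * q - 2 * p else 6 - 2 * (p * q))"
    by (rule cusp_intro[of 2 0 1 3 "1 / 2" "q / 2" "0" "0" "p / 2" "1 / 2" "q / 2" "1 / 2" "1" "4 * q - 4 * p" "2 * q - 2 * p" "6 - 2 * (p * q)" "0" "0" "p / 2" "q / 3" "q" "p" "0" "0" "3 / 4" "2 / 3" "1" "3 / 4", THEN conjunct1]; (fact gr | (simp add: algebra_simps powers; fail) | (simp add: field_simps powers; fail) | (use bounds in linarith)))
  have n3: "3 \<notin> ideal_vertices e"
    by (rule not_ideal[of 3 0 1 2 "1 / 2" "0" "p / 2" "1 / 4"]; (fact gr | (simp add: algebra_simps powers; fail) | (simp add: field_simps powers; fail) | (use bounds in linarith)))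
  define W where "W = wedge_volume (p / 2) (p / 2) + wedge_volume (p / 2) (q / 3) + wedge_volume (1 / 2) q + wedge_volume (1 / 2) p"
  have V: "hyp_vol (hyp_simplex e) = W / 2" using first by (simp add: W_def)
  have w0: "1013 * p / 5760 \<le> wedge_volume (p / 2) (p / 2)"
    by (rule wedge_volume_ge[of _ "1 / 2" _ "1 / 2" "3 / 4"]; (fact gr | (simp add: algebra_simps powers; fail) | (simp add: field_simps powers; fail) | (use bounds in linarith)))
  have w1: "373 * q / 3240 \<le> wedge_volume (p / 2) (q / 3)"
    by (rule wedge_volume_ge[of _ "1 / 2" _ "1 / 3" "2 / 3"]; (fact gr | (simp add: algebra_simps powers; fail) | (simp add: field_simps powers; fail) | (use bounds in linarith)))
  have w2: "27 * q / 160 \<le> wedge_volume (1 / 2) q"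
    by (rule wedge_volume_ge[of _ "1 / 4" _ "3" "1"]; (fact gr | (simp add: algebra_simps powers; fail) | (simp add: field_simps powers; fail) | (use bounds in linarith)))
  have w3: "917 * p / 5760 \<le> wedge_volume (1 / 2) p"
    by (rule wedge_volume_ge[of _ "1 / 4" _ "2" "3 / 4"]; (fact gr | (simp add: algebra_simps powers; fail) | (simp add: field_simps powers; fail) | (use bounds in linarith)))
  have W0: "W > 0" using w0 w1 w2 w3 bounds unfolding W_def by linarith
  have I: "ideal_vertices e = {1, 2}"
    by (rule ideal_vertices_eqI) (use cusp_ideal[OF c1] cusp_ideal[OF c2] n0 n3 in auto)
  have "delta_opt e = (5 * q / 48 + p / 8) * (1 + (5 - 2 * (p * q))) / (W / 2)"
    by (rule delta_opt_two_cusps[OF I _ c1 c2 V half_gt_zero[OF W0], where k = "2 * q - 2 * p"]; (fact gr | (simp add: algebra_simps powers; fail) | (simp add: field_simps powers; fail) | (use bounds in linarith)))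
  moreover have "(5 * q / 48 + p / 8) * (1 + (5 - 2 * (p * q))) = (q / 8 + p / 8 :: real)" by ((simp; fail) | (simp add: field_simps powers; fail))
  ultimately have "delta_opt e = (q / 8 + p / 8) / (W / 2)" by (simp only:)
  also have "\<dots> < simplicial_density3"
  proof (rule density_less_rational)
    show "237 * (q / 8 + p / 8) \<le> 100 * W" using w0 w1 w2 w3 bounds unfolding W_def distrib_left by linarith
    show "(q / 8 + p / 8 :: real) > 0" using bounds by linarith
  qed
  finally show ?thesis .
qed

lemma density_HV_hat:
  assumes "coxeter_simplex (diagram HV_hat) e"
  shows "delta_opt e < simplicial_density3"
proof -
  interpret coxeter_tetrahedron e "coxeter_matrix (diagram HV_hat)"
    by (rule coxeter_simplex_tetrahedron[OF assms]) (simp add: diagram_defs)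
  have gr: "lorentz (e 0) (e 1) = - (1 / 2)" "lorentz (e 0) (e 2) = - 0" "lorentz (e 0) (e 3) = - (q / 2)" "lorentz (e 1) (e 0) = - (1 / 2)"
    "lorentz (e 1) (e 2) = - g" "lorentz (e 1) (e 3) = - 0" "lorentz (e 2) (e 0) = - 0" "lorentz (e 2) (e 1) = - g"
    "lorentz (e 2) (e 3) = - (1 / 2)" "lorentz (e 3) (e 0) = - (q / 2)" "lorentz (e 3) (e 1) = - 0" "lorentz (e 3) (e 2) = - (1 / 2)"
    by (simp_all add: gram coxeter_matrix_def diagram_defs doubleton_eq_iff cos_values)
  have n0: "0 \<notin> ideal_vertices e"
    by (rule not_ideal[of 0 1 2 3 "g" "0" "1 / 2" "1 / 2 - g / 2"]; (fact gr | (simp add: algebra_simps powers; fail) | (simp add: field_simps powers; fail) | (use bounds in linarith)))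
  have first: "cusp 1 (q / 12 + g / 4 + g * q / 24) (\<lambda>j. if j = 3 then - (4) + 4 * q - 16 * g + 8 * (g * q) else if j = 2 then - (2) + 2 * q - 8 * g + 4 * (g * q) else 6 - 2 * q + 12 * g - 8 * (g * q)) \<and>
    hyp_vol (hyp_simplex e) = (wedge_volume 0 0 + wedge_volume 0 0 + wedge_volume g (- (1) + 2 * g) + wedge_volume g (q / 3) + wedge_volume (1 / 2) q + wedge_volume (1 / 2) (2 * g)) / 2"
    by (rule cusp_intro[of 1 3 2 0 "1 / 2" "q / 2" "0" _ _ _ "q / 2" "1 / 2" "1" _ _ _ _ _ _ _ _ _ "0" "0" "1 / 2 + g / 2" "1 / 3 + 2 * g / 3" "1" "1 / 2 + g / 2"]; (fact gr | (simp add: algebra_simps powers; fail) | (simp add: field_simps powers; fail) | (use bounds in linarith)))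
  note c1 = first[THEN conjunct1]
  have c2: "cusp 2 (q / 12 + g / 4 + g * q / 24) (\<lambda>j. if j = 0 then - (4) + 4 * q - 16 * g + 8 * (g * q) else if j = 1 then - (2) + 2 * q - 8 * g + 4 * (g * q) else 6 - 2 * q + 12 * g - 8 * (g * q))"
    by (rule cusp_intro[of 2 0 1 3 "1 / 2" "q / 2" "0" "0" "g" "1 / 2" "q / 2" "1 / 2" "1" "- (4) + 4 * q - 16 * g + 8 * (g * q)" "- (2) + 2 * q - 8 * g + 4 * (g * q)" "6 - 2 * q + 12 * g - 8 * (g * q)" "0" "0" "- (1) + 2 * g" "q / 3" "q" "2 * g" "0" "0" "1 / 2 + g / 2" "1 / 3 + 2 * g / 3" "1" "1 / 2 + g / 2", THEN conjunct1]; (fact gr | (simp add: algebra_simps powers; fail) | (simp add: field_simps powers; fail) | (use bounds in linarith)))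
  have n3: "3 \<notin> ideal_vertices e"
    by (rule not_ideal[of 3 0 1 2 "1 / 2" "0" "g" "1 / 2 - g / 2"]; (fact gr | (simp add: algebra_simps powers; fail) | (simp add: field_simps powers; fail) | (use bounds in linarith)))
  define W where "W = wedge_volume g (- (1) + 2 * g) + wedge_volume g (q / 3) + wedge_volume (1 / 2) q + wedge_volume (1 / 2) (2 * g)"
  have V: "hyp_vol (hyp_simplex e) = W / 2" using first by (simp add: W_def)
  \<comment> \<open>\<open>2 * g\<close> is the golden ratio and \<open>- (1) + 2 * g\<close> its
    inverse, the quotient of the distances 1 / 2 and g.\<close>
  have w0: "29 / 1152 + 257 * g / 720 \<le> wedge_volume g (- (1) + 2 * g)"
    by (rule wedge_volume_ge[of _ "1 / 4 + g / 2" _ "2 - 2 * g" "1 / 2 + g / 2"]; (fact gr | (simp add: algebra_simps powers; fail) | (simp add: field_simps powers; fail) | (use bounds in linarith)))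
  have w1: "19 * q / 324 + 877 * (g * q) / 6480 \<le> wedge_volume g (q / 3)"
    by (rule wedge_volume_ge[of _ "1 / 4 + g / 2" _ "1 / 3" "1 / 3 + 2 * g / 3"]; (fact gr | (simp add: algebra_simps powers; fail) | (simp add: field_simps powers; fail) | (use bounds in linarith)))
  have w2: "27 * q / 160 \<le> wedge_volume (1 / 2) q"
    by (rule wedge_volume_ge[of _ "1 / 4" _ "3" "1"]; (fact gr | (simp add: algebra_simps powers; fail) | (simp add: field_simps powers; fail) | (use bounds in linarith)))
  have w3: "49 / 5760 + 23 * g / 72 \<le> wedge_volume (1 / 2) (2 * g)"
    by (rule wedge_volume_ge[of _ "1 / 4" _ "1 + 2 * g" "1 / 2 + g / 2"]; (fact gr | (simp add: algebra_simps powers; fail) | (simp add: field_simps powers; fail) | (use bounds in linarith)))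
  have W0: "W > 0" using w0 w1 w2 w3 bounds unfolding W_def by linarith
  have I: "ideal_vertices e = {1, 2}"
    by (rule ideal_vertices_eqI) (use cusp_ideal[OF c1] cusp_ideal[OF c2] n0 n3 in auto)
  have "delta_opt e = (q / 12 + g / 4 + g * q / 24) * (1 + (11 - 6 * q + 34 * g - 20 * (g * q))) / (W / 2)"
    by (rule delta_opt_two_cusps[OF I _ c1 c2 V half_gt_zero[OF W0], where k = "- (2) + 2 * q - 8 * g + 4 * (g * q)"]; (fact gr | (simp add: algebra_simps powers; fail) | (simp add: field_simps powers; fail) | (use bounds in linarith)))
  moreover have "(q / 12 + g / 4 + g * q / 24) * (1 + (11 - 6 * q + 34 * g - 20 * (g * q))) = (5 * q / 48 + g / 4 + g * q / 24 :: real)" by ((simp; fail) | (simp add: field_simps powers; fail))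
  ultimately have "delta_opt e = (5 * q / 48 + g / 4 + g * q / 24) / (W / 2)" by (simp only:)
  also have "\<dots> < simplicial_density3"
  proof (rule density_less_rational)
    show "237 * (5 * q / 48 + g / 4 + g * q / 24) \<le> 100 * W" using w0 w1 w2 w3 bounds unfolding W_def distrib_left by linarith
    show "(5 * q / 48 + g / 4 + g * q / 24 :: real) > 0" using bounds by linarith
  qed
  finally show ?thesis .
qed

lemma density_CR_hat:
  assumes "coxeter_simplex (diagram CR_hat) e"
  shows "delta_opt e < simplicial_density3"
proof -
  interpret coxeter_tetrahedron e "coxeter_matrix (diagram CR_hat)"
    by (rule coxeter_simplex_tetrahedron[OF assms]) (simp add: diagram_defs)
  have gr: "lorentz (e 0) (e 1) = - (1 / 2)" "lorentz (e 0) (e 2) = - 0" "lorentz (e 0) (e 3) = - (p / 2)" "lorentz (e 1) (e 0) = - (1 / 2)"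
    "lorentz (e 1) (e 2) = - (p / 2)" "lorentz (e 1) (e 3) = - 0" "lorentz (e 2) (e 0) = - 0" "lorentz (e 2) (e 1) = - (p / 2)"
    "lorentz (e 2) (e 3) = - (p / 2)" "lorentz (e 3) (e 0) = - (p / 2)" "lorentz (e 3) (e 1) = - 0" "lorentz (e 3) (e 2) = - (p / 2)"
    by (simp_all add: gram coxeter_matrix_def diagram_defs doubleton_eq_iff cos_values)
  have first: "cusp 0 (3 / 16 + p / 8) (\<lambda>j. if j = 2 then 4 - 2 * p else if j = 1 then - (2) + 2 * p else - (2) + 2 * p) \<and>
    hyp_vol (hyp_simplex e) = (wedge_volume 0 0 + wedge_volume 0 0 + wedge_volume (1 / 2) p + wedge_volume (1 / 2) 1 + wedge_volume (p / 2) 1 + wedge_volume (p / 2) (p / 2)) / 2"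
    by (rule cusp_intro[of 0 2 1 3 "p / 2" "p / 2" "0" _ _ _ "p / 2" "p / 2" "1" _ _ _ _ _ _ _ _ _ "0" "0" "3 / 4" "1 / 2" "1" "3 / 4"]; (fact gr | (simp add: algebra_simps powers; fail) | (simp add: field_simps powers; fail) | (use bounds in linarith)))
  note c0 = first[THEN conjunct1]
  have c1: "cusp 1 (3 / 16 + p / 8) (\<lambda>j. if j = 3 then 4 - 2 * p else if j = 0 then - (2) + 2 * p else - (2) + 2 * p)"
    by (rule cusp_intro[of 1 3 0 2 "p / 2" "p / 2" "0" "0" "1 / 2" "p / 2" "p / 2" "p / 2" "1" "4 - 2 * p" "- (2) + 2 * p" "- (2) + 2 * p" "0" "0" "p" "1" "1" "p / 2" "0" "0" "3 / 4" "1 / 2" "1" "3 / 4", THEN conjunct1]; (fact gr | (simp add: algebra_simps powers; fail) | (simp add: field_simps powers; fail) | (use bounds in linarith)))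
  have n2: "2 \<notin> ideal_vertices e"
    by (rule not_ideal[of 2 0 1 3 "1 / 2" "p / 2" "0" "1 / 4"]; (fact gr | (simp add: algebra_simps powers; fail) | (simp add: field_simps powers; fail) | (use bounds in linarith)))
  have n3: "3 \<notin> ideal_vertices e"
    by (rule not_ideal[of 3 0 1 2 "1 / 2" "0" "p / 2" "1 / 4"]; (fact gr | (simp add: algebra_simps powers; fail) | (simp add: field_simps powers; fail) | (use bounds in linarith)))
  define W where "W = wedge_volume (1 / 2) p + wedge_volume (1 / 2) 1 + wedge_volume (p / 2) 1 + wedge_volume (p / 2) (p / 2)"
  have V: "hyp_vol (hyp_simplex e) = W / 2" using first by (simp add: W_def)
  have w0: "917 * p / 5760 \<le> wedge_volume (1 / 2) p"
    by (rule wedge_volume_ge[of _ "1 / 4" _ "2" "3 / 4"]; (fact gr | (simp add: algebra_simps powers; fail) | (simp add: field_simps powers; fail) | (use bounds in linarith)))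
  have w1: "217 / 1440 \<le> wedge_volume (1 / 2) 1"
    by (rule wedge_volume_ge[of _ "1 / 4" _ "1" "1 / 2"]; (fact gr | (simp add: algebra_simps powers; fail) | (simp add: field_simps powers; fail) | (use bounds in linarith)))
  have w2: "1013 * p / 5760 \<le> wedge_volume (p / 2) (p / 2)"
    by (rule wedge_volume_ge[of _ "1 / 2" _ "1 / 2" "3 / 4"]; (fact gr | (simp add: algebra_simps powers; fail) | (simp add: field_simps powers; fail) | (use bounds in linarith)))
  have wp: "9 / 20 < wedge_volume (p / 2) 1" using lobachevsky_quarter_pi_lower by (simp add: wedge_volumes)
  have W0: "W > 0" using w0 w1 w2 wp bounds unfolding W_def by linarith
  have I: "ideal_vertices e = {0, 1}"
    by (rule ideal_vertices_eqI) (use cusp_ideal[OF c0] cusp_ideal[OF c1] n2 n3 in auto)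
  have "delta_opt e = (3 / 16 + p / 8) * (1 + (3 - 2 * p)) / (W / 2)"
    by (rule delta_opt_two_cusps[OF I _ c0 c1 V half_gt_zero[OF W0], where k = "- (2) + 2 * p"]; (fact gr | (simp add: algebra_simps powers; fail) | (simp add: field_simps powers; fail) | (use bounds in linarith)))
  moreover have "(3 / 16 + p / 8) * (1 + (3 - 2 * p)) = (1 / 4 + p / 8 :: real)" by ((simp; fail) | (simp add: field_simps powers; fail))
  ultimately have "delta_opt e = (1 / 4 + p / 8) / (W / 2)" by (simp only:)
  also have "\<dots> < simplicial_density3"
  proof (rule density_less_rational)
    show "237 * (1 / 4 + p / 8) \<le> 100 * W" using w0 w1 w2 wp bounds unfolding W_def distrib_left by linarith
    show "(1 / 4 + p / 8 :: real) > 0" using bounds by linarith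
  qed
  finally show ?thesis .
qed

end

section \<open>The maximum over all groups\<close>

theorem corollary1:
  fixes F :: "simplex_group \<Rightarrow> nat \<Rightarrow> minkowski"
  assumes "\<And>\<Gamma>. coxeter_simplex (diagram \<Gamma>) (F \<Gamma>)"
  shows "Max (range (\<lambda>\<Gamma>. delta_opt (F \<Gamma>))) = simplicial_density3
    \<and> simplicial_density3 = sqrt 3 / 2 * inverse gieseking
    \<and> sqrt 3 / 2 * inverse gieseking = 2 / 3 * inverse (dirichlet_L chi_minus3 2)
    \<and> {\<Gamma>. delta_opt (F \<Gamma>) = simplicial_density3} \<subseteq> commensurability_class_336
    \<and> (\<exists>A \<subseteq> {\<Gamma>. delta_opt (F \<Gamma>) = simplicial_density3}. card A = 8)"
proof (intro conjI)
  have eq: "delta_opt (F V_bar) = simplicial_density3" "delta_opt (F Y_bar) = simplicial_density3"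
    "delta_opt (F Z_bar) = simplicial_density3" "delta_opt (F P_bar) = simplicial_density3"
    "delta_opt (F VP_bar) = simplicial_density3" "delta_opt (F PP_hat) = simplicial_density3"
    "delta_opt (F DV_bar) = simplicial_density3" "delta_opt (F DP_bar) = simplicial_density3"
    "delta_opt (F VV_hat) = simplicial_density3"
    \<comment> \<open>The three \<open>refl\<close> instantiate \<open>q\<close>, \<open>p\<close>
      and \<open>g\<close> with the constants that they stand for.\<close>
    by (fact density_V_bar[OF refl refl refl assms] density_Y_bar[OF refl refl refl assms] density_Z_bar[OF refl refl refl assms]
      density_P_bar[OF refl refl refl assms] density_VP_bar[OF refl refl refl assms] density_PP_hat[OF refl refl refl assms]
      density_DV_bar[OF refl refl refl assms] density_DP_bar[OF refl refl refl assms] density_VV_hat[OF refl refl refl assms])+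
  have lt: "delta_opt (F BV_bar) < simplicial_density3" "delta_opt (F BP_bar) < simplicial_density3"
    "delta_opt (F R_bar) < simplicial_density3" "delta_opt (F O_bar) < simplicial_density3"
    "delta_opt (F BR_hat) < simplicial_density3" "delta_opt (F N_bar) < simplicial_density3"
    "delta_opt (F M_bar) < simplicial_density3" "delta_opt (F RR_hat) < simplicial_density3"
    "delta_opt (F HV_bar) < simplicial_density3" "delta_opt (F HP_bar) < simplicial_density3"
    "delta_opt (F AV_hat) < simplicial_density3" "delta_opt (F BV_hat) < simplicial_density3"
    "delta_opt (F HV_hat) < simplicial_density3" "delta_opt (F CR_hat) < simplicial_density3"
    by (fact density_BV_bar[OF refl refl refl assms] density_BP_bar[OF refl refl refl assms] density_R_bar[OF refl refl refl assms]
      density_O_bar[OF refl refl refl assms] density_BR_hat[OF refl refl refl assms] density_N_bar[OF refl refl refl assms]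
      density_M_bar[OF refl refl refl assms] density_RR_hat[OF refl refl refl assms] density_HV_bar[OF refl refl refl assms]
      density_HP_bar[OF refl refl refl assms] density_AV_hat[OF refl refl refl assms] density_BV_hat[OF refl refl refl assms]
      density_HV_hat[OF refl refl refl assms] density_CR_hat[OF refl refl refl assms])+
  have le: "delta_opt (F \<Gamma>) \<le> simplicial_density3" for \<Gamma>
    by (cases \<Gamma>) (simp_all add: eq less_imp_le[OF lt(1)] less_imp_le[OF lt(2)] less_imp_le[OF lt(3)] less_imp_le[OF lt(4)] less_imp_le[OF lt(5)] less_imp_le[OF lt(6)] less_imp_le[OF lt(7)] less_imp_le[OF lt(8)] less_imp_le[OF lt(9)] less_imp_le[OF lt(10)] less_imp_le[OF lt(11)] less_imp_le[OF lt(12)] less_imp_le[OF lt(13)] less_imp_le[OF lt(14)])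
  have "(UNIV :: simplex_group set) = set [V_bar, Y_bar, Z_bar, BV_bar, P_bar, BP_bar, VP_bar, PP_hat, DV_bar, DP_bar, VV_hat, R_bar, O_bar, BR_hat, N_bar, M_bar, RR_hat, HV_bar, HP_bar, AV_hat, BV_hat, HV_hat, CR_hat]"
  proof (intro set_eqI)
    show "\<Gamma> \<in> UNIV \<longleftrightarrow> \<Gamma> \<in> set [V_bar, Y_bar, Z_bar, BV_bar, P_bar, BP_bar, VP_bar, PP_hat, DV_bar, DP_bar, VV_hat, R_bar, O_bar, BR_hat, N_bar, M_bar, RR_hat, HV_bar, HP_bar, AV_hat, BV_hat, HV_hat, CR_hat]" for \<Gamma>
      by (cases \<Gamma>) simp_all
  qed
  then have "finite (UNIV :: simplex_group set)" by (metis finite_set)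
  then have "finite (range (\<lambda>\<Gamma>. delta_opt (F \<Gamma>)))" by (rule finite_imageI)
  then show "Max (range (\<lambda>\<Gamma>. delta_opt (F \<Gamma>))) = simplicial_density3"
  proof (rule Max_eqI)
    show "simplicial_density3 \<in> range (\<lambda>\<Gamma>. delta_opt (F \<Gamma>))" by (rule range_eqI) (rule eq(1)[symmetric])
  qed (use le in blast)
  have G: "sqrt 3 / 2 * inverse gieseking = 2 / 3 * inverse (dirichlet_L chi_minus3 2)"
    using dirichlet_L_bounds(1) by (simp add: gieseking_def lobachevsky_third_pi_eq inverse_eq_divide field_simps)
  then show "sqrt 3 / 2 * inverse gieseking = 2 / 3 * inverse (dirichlet_L chi_minus3 2)" .
  show "simplicial_density3 = sqrt 3 / 2 * inverse gieseking"
    unfolding G simplicial_density3_eq by (simp add: inverse_eq_divide)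
  show "{\<Gamma>. delta_opt (F \<Gamma>) = simplicial_density3} \<subseteq> commensurability_class_336"
  proof
    fix \<Gamma> assume "\<Gamma> \<in> {\<Gamma>. delta_opt (F \<Gamma>) = simplicial_density3}"
    then show "\<Gamma> \<in> commensurability_class_336"
      using lt by (cases \<Gamma>) (simp_all add: commensurability_class_336_def)
  qed
  show "\<exists>A \<subseteq> {\<Gamma>. delta_opt (F \<Gamma>) = simplicial_density3}. card A = 8"
    \<comment> \<open>Nine groups attain the density; \<open>DV_bar\<close> is left out to obtain a
      set of eight.\<close>
    by (rule exI[of _ "{V_bar, Y_bar, Z_bar, P_bar, VP_bar, PP_hat, DP_bar, VV_hat}"]) (simp add: eq)
qed

end
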